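(* Let $n\ge 4$. The $\mathbb{Z}[\delta]$-algebra $\mathbb{D}\widehat{TL}(D_n)$ has cell datum $(\Lambda,M,C,* )$, where $\Lambda$, $M$, $C$, $*$ are the explicit poset, family of finite sets of half-diagrams, map, and top-bottom inversion map described in the context; that is, $\mathbb{D}\widehat{TL}(D_n)$ together with this datum is a cellular algebra over $\mathbb{Z}[\delta]$.
   Context: **Decorated diagrams.** The standard $n$-box is a rectangle with nodes $1,\dots,n$ (left to right) on the north (top) face and $1',\dots,n'$ on the south (bottom) face. A concrete pseudo $n$-diagram is a finite collection of disjoint planar curves (edges) in the box such that every node is the endpoint of exactly one edge (meeting the box transversely), and all other edges are closed curves (loops) disjoint from the box. An edge is propagating if it joins a north node to a south node; other edges are non-propagating. Let $\mathbf{a}(d)$ be the number of non-propagating edges in the north face and $\mathbf{p}(d)$ the number of propagating edges, so $2\mathbf{a}(d)+\mathbf{p}(d)=n$. Edges may carry finitely many decorations $\bullet$ (decorations adjacent along an edge may be conjoined into one block), subject to: if $\mathbf{a}(d)=0$ then all edges are undecorated; and all decorated edges can be simultaneously deformed so as to take the decorations to the left wall of the box without crossing any other edges. Such diagrams up to isotopy (through diagrams of the same kind) are called L-decorated pseudo $n$-diagrams; they are a basis of the associative $\mathbb{Z}[\delta]$-algebra $\mathcal{P}_n^L(\bullet)$, where $d'd$ is obtained by stacking $d'$ on top of $d$ (node $i'$ of $d'$ identified with node $i$ of $d$). Let $\widehat{\mathcal{P}}_n^L(\bullet)$ be the quotient by the local relations: an undecorated loop is removed and replaced by the factor $\delta$;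 two adjacent decorations on an edge cancel; a decorated edge loses its decoration in the presence of a (different) loop carrying one decoration. **The algebras.** For $1\le i\le n-1$, $d_i$ is the undecorated diagram with edges $\{i,i+1\}$, $\{i',(i+1)'\}$ and vertical edges $\{j,j'\}$ for $j\ne i,i+1$; $d_{\overline{1}}$ is $d_1$ with one decoration on each of its two non-propagating edges. These are the simple diagrams. $\mathbb{D}TL(D_n)$ is the unital $\mathbb{Z}[\delta]$-subalgebra of $\widehat{\mathcal{P}}_n^L(\bullet)$ generated by $d_{\overline{1}},d_1,\dots,d_{n-1}$. $\mathbb{D}\widehat{TL}(D_n)$ is the quotient of $\mathbb{D}TL(D_n)$ by the additional relation that a decorated loop equals $0$ (any diagram containing a decorated loop is $0$). **Type II diagrams.** A $D$-admissible diagram of type II is an L-decorated diagram to which none of the local relations defining $\widehat{\mathcal{P}}_n^L(\bullet)$ apply, namely: an undecorated loop is removed and replaced by the factor $\delta$; two adjacent decorations on an edge cancel; a decorated edge loses its decoration in the presence of a (different) loop carrying one decoration (so each edge carries at most one decoration), containing no loops, and with an even total number of decorations. Such diagrams lie in $\mathbb{D}TL(D_n)$ and are identified with their images in $\mathbb{D}\widehat{TL}(D_n)$. **Half-diagrams.** For $d$ of type II, remove all propagating edges; the upper half is the half-diagram $\overline{d}$, and the lower half, inverted in a horizontal line, is the half-diagram $\underline{d}$. For a half-diagram $h$, $\mathbf{a}(h)$ is its number of (non-propagating) edges and $\mathbf{p}(h)=n-2\mathbf{a}(h)$. For half-diagrams $h_1,h_2$ with $\mathbf{p}(h_1)=\mathbf{p}(h_2)$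 (and, if this number is $0$, with numbers of decorations of the same parity), $h_1\circ h_2$ is the type II diagram with upper half $h_1$ and lower half $h_2$ (inverted), obtained by inserting the non-crossing propagating edges; if there are propagating edges, the leftmost is decorated exactly when needed to make the total number of decorations even, and the others are undecorated. **The datum.** $\Lambda=\{1,3,5,\dots,n\}$ if $n$ is odd and $\Lambda=\{0^+,0^-,2,4,\dots,n\}$ if $n$ is even, with $i<j$ iff $|i|<|j|$, where $|i|=i$ for natural numbers and $|0^+|=|0^-|=0$. $M(\lambda)$ is the set of half-diagrams $h$ arising from $D$-admissible diagrams of type II with $\mathbf{p}(h)=|\lambda|$, where in addition half-diagrams with no propagating edges belong to $M(0^+)$ if they have an even number of decorations and to $M(0^-)$ if they have an odd number. $C(h_1,h_2)=h_1\circ h_2$ for $h_1,h_2\in M(\lambda)$. The map $*$ is the $\mathbb{Z}[\delta]$-linear map given by top-bottom inversion of type II diagrams. **Cellular algebra.** A cellular algebra over a commutative ring $R$ with identity is an associative unital $R$-algebra $A$ with a cell datum $(\Lambda,M,C,* )$ such that: (1) $\Lambda$ is a poset, each $M(\lambda)$ is a finite set, and $C:\coprod_{\lambda\in\Lambda}(M(\lambda)\times M(\lambda))\to A$ is injective with image an $R$-basis of $A$; (2) writing $C(S,T)=C^\lambda_{S,T}$ for $S,T\in M(\lambda)$, $*$ is an $R$-linear involutory anti-automorphism of $A$ with $(C^\lambda_{S,T})^*=C^\lambda_{T,S}$; (3) for $\lambda\in\Lambda$, $S,T\in M(\lambda)$ and $a\in A$, $aC^\lambda_{S,T}\equiv\sum_{S'\in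 M(\lambda)}r_a(S',S)C^\lambda_{S',T} \mod A(<\lambda)$, where $r_a(S',S)\in R$ is independent of $T$ and $A(<\lambda)$ is the $R$-submodule generated by $\{C^\mu_{S'',T''}:\mu<\lambda,\ S'',T''\in M(\mu)\}$. *)

theory Defs
  imports
    "HOL-Computational_Algebra.Polynomial"
    "HOL-Library.Poly_Mapping"
    "HOL-Library.Multiset"
    "HOL-Library.Disjoint_Sets"
    "HOL-Library.FuncSet"
    "HOL-Algebra.QuotRing"
    "HOL-Algebra.Subrings"
    "HOL-Algebra.Algebraic_Closure_Type"
begin

section \<open>Cellular algebras\<close>

text \<open>The library locale \<open>algebra\<close> demands commutativity of the algebra; here only
  associativity and a unit are wanted.\<close>

locale unital_algebra = module R A + A?: ring A
  for R (structure) and A (structure) +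
  assumes smult_mult_left:
      "\<lbrakk>c \<in> carrier R; x \<in> carrier A; y \<in> carrier A\<rbrakk> \<Longrightarrow>
        (c \<odot>\<^bsub>A\<^esub> x) \<otimes>\<^bsub>A\<^esub> y = c \<odot>\<^bsub>A\<^esub> (x \<otimes>\<^bsub>A\<^esub> y)"
    and smult_mult_right:
      "\<lbrakk>c \<in> carrier R; x \<in> carrier A; y \<in> carrier A\<rbrakk> \<Longrightarrow>
        x \<otimes>\<^bsub>A\<^esub> (c \<odot>\<^bsub>A\<^esub> y) = c \<odot>\<^bsub>A\<^esub> (x \<otimes>\<^bsub>A\<^esub> y)"

definition gen_submodule :: "('r, 'e) ring_scheme \<Rightarrow> ('r, 'a, 'm) module_scheme \<Rightarrow> 'a set \<Rightarrow> 'a set"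
  where "gen_submodule R A S = \<Inter>{H. submodule H R A \<and> S \<subseteq> H}"

definition lin_indep :: "('r, 'e) ring_scheme \<Rightarrow> ('r, 'a, 'm) module_scheme \<Rightarrow> 'a set \<Rightarrow> bool"
  where "lin_indep R A B \<longleftrightarrow>
    (\<forall>F c. finite F \<and> F \<subseteq> B \<and> c \<in> F \<rightarrow> carrier R \<and>
        (\<Oplus>\<^bsub>A\<^esub>b\<in>F. c b \<odot>\<^bsub>A\<^esub> b) = \<zero>\<^bsub>A\<^esub>
      \<longrightarrow> (\<forall>b\<in>F. c b = \<zero>\<^bsub>R\<^esub>))"

definition module_basis :: "('r, 'e) ring_scheme \<Rightarrow> ('r, 'a, 'm) module_scheme \<Rightarrow> 'a set \<Rightarrow> bool"
  where "module_basis R A B \<longleftrightarrow>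
    B \<subseteq> carrier A \<and> lin_indep R A B \<and> gen_submodule R A B = carrier A"

definition linear_endo ::
  "('r, 'e) ring_scheme \<Rightarrow> ('r, 'a, 'm) module_scheme \<Rightarrow> ('a \<Rightarrow> 'a) \<Rightarrow> bool"
  where "linear_endo R A f \<longleftrightarrow>
    f \<in> carrier A \<rightarrow> carrier A \<and>
    (\<forall>x\<in>carrier A. \<forall>y\<in>carrier A. f (x \<oplus>\<^bsub>A\<^esub> y) = f x \<oplus>\<^bsub>A\<^esub> f y) \<and>
    (\<forall>c\<in>carrier R. \<forall>x\<in>carrier A. f (c \<odot>\<^bsub>A\<^esub> x) = c \<odot>\<^bsub>A\<^esub> f x)"

text \<open>The poset is a carrier set \<open>\<Lambda>\<close> with a reflexive order relation \<open>le\<close>;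
  \<open>C l S T\<close> is only relevant for \<open>l \<in> \<Lambda>\<close> and \<open>S, T \<in> M l\<close>.\<close>

locale cellular_algebra = unital_algebra R A
  for R :: "('r, 'e) ring_scheme" (structure) and A :: "('r, 'a, 'x) module_scheme" (structure) +
  fixes \<Lambda> :: "'l set" and le :: "('l \<times> 'l) set" and M :: "'l \<Rightarrow> 'm set"
    and C :: "'l \<Rightarrow> 'm \<Rightarrow> 'm \<Rightarrow> 'a" and star :: "'a \<Rightarrow> 'a"
  assumes poset: "partial_order_on \<Lambda> le"
    and finite_M: "l \<in> \<Lambda> \<Longrightarrow> finite (M l)"
    and C_inj: "inj_on (\<lambda>(l, S, T). C l S T) (SIGMA l:\<Lambda>. M l \<times> M l)"
    and C_basis: "module_basis R A ((\<lambda>(l, S, T). C l S T) ` (SIGMA l:\<Lambda>. M l \<times> M l))"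
    and star_linear: "linear_endo R A star"
    and star_involutory: "x \<in> carrier A \<Longrightarrow> star (star x) = x"
    and star_mult: "\<lbrakk>x \<in> carrier A; y \<in> carrier A\<rbrakk> \<Longrightarrow>
      star (x \<otimes>\<^bsub>A\<^esub> y) = star y \<otimes>\<^bsub>A\<^esub> star x"
    and star_C: "\<lbrakk>l \<in> \<Lambda>; S \<in> M l; T \<in> M l\<rbrakk> \<Longrightarrow> star (C l S T) = C l T S"
    and left_mult: "\<lbrakk>l \<in> \<Lambda>; a \<in> carrier A\<rbrakk> \<Longrightarrow>
      \<exists>r \<in> M l \<rightarrow> M l \<rightarrow> carrier R. \<forall>S\<in>M l. \<forall>T\<in>M l.
        a \<otimes>\<^bsub>A\<^esub> C l S T \<ominus>\<^bsub>A\<^esub> (\<Oplus>\<^bsub>A\<^esub>S'\<in>M l. r S' S \<odot>\<^bsub>A\<^esub> C l S' T)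
          \<in> gen_submodule R A
              {C k S'' T'' | k S'' T''. k \<in> \<Lambda> \<and> (k, l) \<in> le \<and> k \<noteq> l \<and> S'' \<in> M k \<and> T'' \<in> M k}"

definition gen_subalgebra :: "('r, 'e) ring_scheme \<Rightarrow> ('r, 'a, 'm) module_scheme \<Rightarrow> 'a set \<Rightarrow> 'a set"
  where "gen_subalgebra R A S = \<Inter>{H. subring H A \<and> submodule H R A \<and> S \<subseteq> H}"

text \<open>The library quotient ring, with the scalar action \<open>c \<odot> (I + x) = I + c \<odot> x\<close>.\<close>

definition quot_algebra :: "('r, 'a, 'm) module_scheme \<Rightarrow> 'a set \<Rightarrow> ('r, 'a set) module"
  where "quot_algebra A I =
    ring.extend (A Quot I) (module.fields (\<lambda>c K. \<Union>x\<in>K. I +>\<^bsub>A\<^esub> (c \<odot>\<^bsub>A\<^esub> x)))"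


section \<open>L-decorated pseudo diagrams\<close>

text \<open>
  \<open>North i\<close> is the node \<open>i\<close> and \<open>South i\<close> is the node \<open>i'\<close>. An isotopy class of diagrams is
  recorded by the pairs of nodes joined by an edge, the number of decorations on each such edge,
  and the multiset of the numbers of decorations on the loops.

  Decorations slide freely along their edge, so only their number matters, and all decorations
  of an edge are mutually adjacent. A decorated loop necessarily lies in the region next to the
  left wall, so its position carries no information. The position of an undecorated loop is not
  recorded: it has no influence on stacking, and diagrams that differ only in such positions
  become equal as soon as undecorated loops are replaced by \<open>\<delta>\<close>.
\<close>

datatype node = North nat | South nat

datatype diag =
  Diag (edges: "node set set") (dec: "node set \<Rightarrow> nat") (loops: "nat multiset")

definition nodes :: "nat \<Rightarrow> node set"
  where "nodes n = North ` {1..n} \<union> South ` {1..n}"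

text \<open>Cutting the boundary of the box open at the left wall puts the nodes in the linear order
  \<open>1, \<dots>, n, n', \<dots>, 1'\<close>. Edges become arcs over a line, with the left wall at infinity.\<close>

fun pos :: "nat \<Rightarrow> node \<Rightarrow> nat" where
  "pos n (North i) = i"
| "pos n (South i) = 2 * n + 1 - i"

definition noncrossing :: "nat \<Rightarrow> node set set \<Rightarrow> bool"
  where "noncrossing n E \<longleftrightarrow>
    (\<forall>e\<in>E. \<forall>f\<in>E. \<forall>a\<in>e. \<forall>b\<in>e. \<forall>c\<in>f. \<forall>d\<in>f.
      \<not> (pos n a < pos n c \<and> pos n c < pos n b \<and> pos n b < pos n d))"

text \<open>An edge can be deformed to touch the left wall without crossing other edges iff no other
  edge separates it from the left wall, i.e. iff it is an outermost arc. Any family of such edges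
  and of loops next to the left wall can be deformed simultaneously.\<close>

definition left_exposed :: "nat \<Rightarrow> node set set \<Rightarrow> node set \<Rightarrow> bool"
  where "left_exposed n E e \<longleftrightarrow>
    \<not> (\<exists>f\<in>E. \<exists>c\<in>f. \<exists>d\<in>f. \<forall>x\<in>e. pos n c < pos n x \<and> pos n x < pos n d)"

definition cups :: "diag \<Rightarrow> node set set"
  where "cups d = {e \<in> edges d. e \<subseteq> range North}"

definition diagrams :: "nat \<Rightarrow> diag set"
  where "diagrams n = {d.
    partition_on (nodes n) (edges d) \<and> (\<forall>e\<in>edges d. card e = 2) \<and>
    noncrossing n (edges d) \<and>
    (\<forall>e. e \<notin> edges d \<longrightarrow> dec d e = 0) \<and>
    (\<forall>e\<in>edges d. dec d e > 0 \<longrightarrow> left_exposed n (edges d) e) \<and>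
    (card (cups d) = 0 \<longrightarrow> (\<forall>e\<in>edges d. dec d e = 0) \<and> (\<forall>k\<in>#loops d. k = 0))}"

definition total_dec :: "diag \<Rightarrow> nat"
  where "total_dec d = (\<Sum>e\<in>edges d. dec d e) + sum_mset (loops d)"


subsection \<open>Stacking\<close>

text \<open>In the product of \<open>d'\<close> (on top) and \<open>d\<close>, the edges of the two diagrams
  are the pieces (\<open>Inl\<close> from \<open>d'\<close>, \<open>Inr\<close> from \<open>d\<close>), glued at the identified middle nodes.
  The connected components of pieces are the edges and the new loops of the product; a component
  is a loop iff it has no end on the outer faces.\<close>

type_synonym piece = "node set + node set"

fun middle :: "piece \<Rightarrow> nat set" where
  "middle (Inl e) = South -` e"
| "middle (Inr f) = North -` f"

fun outer :: "piece \<Rightarrow> node set" where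
  "outer (Inl e) = e \<inter> range North"
| "outer (Inr f) = f \<inter> range South"

fun piece_dec :: "diag \<Rightarrow> diag \<Rightarrow> piece \<Rightarrow> nat" where
  "piece_dec d' d (Inl e) = dec d' e"
| "piece_dec d' d (Inr f) = dec d f"

definition glue :: "diag \<Rightarrow> diag \<Rightarrow> (piece \<times> piece) set"
  where "glue d' d = {(p, q). p \<in> edges d' <+> edges d \<and> q \<in> edges d' <+> edges d \<and>
    middle p \<inter> middle q \<noteq> {}}"

definition chains :: "diag \<Rightarrow> diag \<Rightarrow> piece set set"
  where "chains d' d = (edges d' <+> edges d) // (glue d' d)\<^sup>*"

definition ends :: "piece set \<Rightarrow> node set"
  where "ends K = \<Union>(outer ` K)"

definition stack :: "diag \<Rightarrow> diag \<Rightarrow> diag"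
  where "stack d' d = (let w = (\<lambda>K. \<Sum>p\<in>K. piece_dec d' d p) in
    Diag
      {ends K | K. K \<in> chains d' d \<and> ends K \<noteq> {}}
      (\<lambda>e. if e = {} then 0 else \<Sum>K\<in>{K \<in> chains d' d. ends K = e}. w K)
      (loops d' + loops d + image_mset w (mset_set {K \<in> chains d' d. ends K = {}})))"

definition id_diag :: "nat \<Rightarrow> diag"
  where "id_diag n = Diag {{North i, South i} | i. i \<in> {1..n}} (\<lambda>_. 0) {#}"

fun flip_node :: "node \<Rightarrow> node" where
  "flip_node (North i) = South i"
| "flip_node (South i) = North i"

definition flip :: "diag \<Rightarrow> diag"
  where "flip d = Diag ((`) flip_node ` edges d) (\<lambda>e. dec d (flip_node ` e)) (loops d)"


section \<open>The algebras\<close>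

abbreviation \<delta> :: "int poly"
  where "\<delta> \<equiv> [:0, 1:]"

abbreviation Z\<delta> :: "int poly ring"
  where "Z\<delta> \<equiv> ring_of_type_algebra"

definition PL :: "nat \<Rightarrow> (int poly, diag \<Rightarrow>\<^sub>0 int poly) module"
  where "PL n = \<lparr>
    carrier = {x. Poly_Mapping.keys x \<subseteq> diagrams n},
    monoid.mult = (\<lambda>x y. \<Sum>a\<in>Poly_Mapping.keys x. \<Sum>b\<in>Poly_Mapping.keys y.
      Poly_Mapping.single (stack a b) (Poly_Mapping.lookup x a * Poly_Mapping.lookup y b)),
    one = Poly_Mapping.single (id_diag n) 1,
    zero = 0,
    add = (+),
    module.smult = (\<lambda>c. Poly_Mapping.map ((*) c))\<rparr>"

text \<open>\<open>local_step d c d'\<close>: a local relation applies to \<open>d\<close> and rewrites it to \<open>c\<close> times \<open>d'\<close>.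
  Relations that concern an edge occur twice, for an edge between nodes and for a loop.\<close>

inductive local_step :: "diag \<Rightarrow> int poly \<Rightarrow> diag \<Rightarrow> bool" where
  remove_loop: "local_step (Diag E w (add_mset 0 L)) \<delta> (Diag E w L)"
| cancel_edge: "\<lbrakk>e \<in> E; w e = k + 2\<rbrakk> \<Longrightarrow>
    local_step (Diag E w L) 1 (Diag E (w(e := k)) L)"
| cancel_loop: "local_step (Diag E w (add_mset (k + 2) L)) 1 (Diag E w (add_mset k L))"
| absorb_edge: "\<lbrakk>e \<in> E; w e = k + 1; 1 \<in># L\<rbrakk> \<Longrightarrow>
    local_step (Diag E w L) 1 (Diag E (w(e := k)) L)"
| absorb_loop: "1 \<in># L \<Longrightarrow>
    local_step (Diag E w (add_mset (k + 1) L)) 1 (Diag E w (add_mset k L))"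

definition local_ideal :: "nat \<Rightarrow> (diag \<Rightarrow>\<^sub>0 int poly) set"
  where "local_ideal n = Idl\<^bsub>PL n\<^esub>
    {Poly_Mapping.single d 1 - Poly_Mapping.single d' c | d c d'. d \<in> diagrams n \<and> local_step d c d'}"

definition PL_hat :: "nat \<Rightarrow> (int poly, (diag \<Rightarrow>\<^sub>0 int poly) set) module"
  where "PL_hat n = quot_algebra (PL n) (local_ideal n)"

definition PL_hat_diag :: "nat \<Rightarrow> diag \<Rightarrow> (diag \<Rightarrow>\<^sub>0 int poly) set"
  where "PL_hat_diag n d = local_ideal n +>\<^bsub>PL n\<^esub> Poly_Mapping.single d 1"

definition simple_edges :: "nat \<Rightarrow> nat \<Rightarrow> node set set"
  where "simple_edges n i =
    {{North i, North (i + 1)}, {South i, South (i + 1)}} \<union>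
    {{North j, South j} | j. j \<in> {1..n} - {i, i + 1}}"

definition simple :: "nat \<Rightarrow> nat \<Rightarrow> diag"
  where "simple n i = Diag (simple_edges n i) (\<lambda>_. 0) {#}"

definition simple_bar :: "nat \<Rightarrow> diag"
  where "simple_bar n = Diag (simple_edges n 1)
    (\<lambda>e. if e = {North 1, North 2} \<or> e = {South 1, South 2} then 1 else 0) {#}"

definition DTL :: "nat \<Rightarrow> (int poly, (diag \<Rightarrow>\<^sub>0 int poly) set) module"
  where "DTL n = (PL_hat n)\<lparr>carrier :=
    gen_subalgebra Z\<delta> (PL_hat n)
      (PL_hat_diag n ` insert (simple_bar n) (simple n ` {1..n - 1}))\<rparr>"

text \<open>A decorated loop is a loop with exactly one decoration, since two decorations on a loop
  cancel.\<close>

definition decorated_loop_ideal :: "nat \<Rightarrow> (diag \<Rightarrow>\<^sub>0 int poly) set set"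
  where "decorated_loop_ideal n = Idl\<^bsub>DTL n\<^esub>
    {PL_hat_diag n d | d. d \<in> diagrams n \<and> 1 \<in># loops d \<and> PL_hat_diag n d \<in> carrier (DTL n)}"

definition DTL_hat :: "nat \<Rightarrow> (int poly, (diag \<Rightarrow>\<^sub>0 int poly) set set) module"
  where "DTL_hat n = quot_algebra (DTL n) (decorated_loop_ideal n)"

definition DTL_hat_diag :: "nat \<Rightarrow> diag \<Rightarrow> (diag \<Rightarrow>\<^sub>0 int poly) set set"
  where "DTL_hat_diag n d = decorated_loop_ideal n +>\<^bsub>DTL n\<^esub> PL_hat_diag n d"


section \<open>The cell datum\<close>

definition type_II :: "nat \<Rightarrow> diag set"
  where "type_II n = {d \<in> diagrams n.
    (\<nexists>c d'. local_step d c d') \<and> loops d = {#} \<and> even (total_dec d)}"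

text \<open>A half-diagram has nodes \<open>1, \<dots>, n\<close>; it consists of its edges and the numbers of decorations
  on them.\<close>

datatype half = Half (hedges: "nat set set") (hdec: "nat set \<Rightarrow> nat")

definition upper :: "diag \<Rightarrow> half"
  where "upper d = Half {e. North ` e \<in> edges d} (\<lambda>e. dec d (North ` e))"

definition lower :: "diag \<Rightarrow> half"
  where "lower d = Half {e. South ` e \<in> edges d} (\<lambda>e. dec d (South ` e))"

definition half_total :: "half \<Rightarrow> nat"
  where "half_total h = (\<Sum>e\<in>hedges h. hdec h e)"

definition half_prop :: "nat \<Rightarrow> half \<Rightarrow> nat"
  where "half_prop n h = n - 2 * card (hedges h)"

definition free_nodes :: "nat \<Rightarrow> half \<Rightarrow> nat list"
  where "free_nodes n h = sorted_list_of_set ({1..n} - \<Union>(hedges h))"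

text \<open>The propagating edges of \<open>h1 \<circ> h2\<close>, from left to right.\<close>

definition prop_edges :: "nat \<Rightarrow> half \<Rightarrow> half \<Rightarrow> node set list"
  where "prop_edges n h1 h2 =
    map2 (\<lambda>i j. {North i, South j}) (free_nodes n h1) (free_nodes n h2)"

definition circ :: "nat \<Rightarrow> half \<Rightarrow> half \<Rightarrow> diag"
  where "circ n h1 h2 = Diag
    ((`) North ` hedges h1 \<union> (`) South ` hedges h2 \<union> set (prop_edges n h1 h2))
    (\<lambda>e. if e \<in> (`) North ` hedges h1 then hdec h1 (North -` e)
         else if e \<in> (`) South ` hedges h2 then hdec h2 (South -` e)
         else if prop_edges n h1 h2 \<noteq> [] \<and> e = hd (prop_edges n h1 h2)
           then (half_total h1 + half_total h2) mod 2
         else 0)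
    {#}"

text \<open>\<open>Thru k\<close> is the natural number \<open>k\<close> as an element of \<open>\<Lambda>\<close>; \<open>Zero_plus\<close> and \<open>Zero_minus\<close>
  are \<open>0\<^sup>+\<close> and \<open>0\<^sup>-\<close>.\<close>

datatype label = Thru nat | Zero_plus | Zero_minus

fun label_abs :: "label \<Rightarrow> nat" where
  "label_abs (Thru k) = k"
| "label_abs Zero_plus = 0"
| "label_abs Zero_minus = 0"

definition cell_labels :: "nat \<Rightarrow> label set"
  where "cell_labels n =
    (if odd n then {Thru k | k. odd k \<and> k \<le> n}
     else {Zero_plus, Zero_minus} \<union> {Thru k | k. even k \<and> 2 \<le> k \<and> k \<le> n})"

definition cell_order :: "nat \<Rightarrow> (label \<times> label) set"
  where "cell_order n = {(i, j). i \<in> cell_labels n \<and> j \<in> cell_labels n \<and>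
    (i = j \<or> label_abs i < label_abs j)}"

definition half_diagrams :: "nat \<Rightarrow> half set"
  where "half_diagrams n = upper ` type_II n \<union> lower ` type_II n"

definition cell_halves :: "nat \<Rightarrow> label \<Rightarrow> half set"
  where "cell_halves n l = {h \<in> half_diagrams n. half_prop n h = label_abs l \<and>
    (l = Zero_plus \<longrightarrow> even (half_total h)) \<and> (l = Zero_minus \<longrightarrow> odd (half_total h))}"

definition cell_map :: "nat \<Rightarrow> label \<Rightarrow> half \<Rightarrow> half \<Rightarrow> (diag \<Rightarrow>\<^sub>0 int poly) set set"
  where "cell_map n l h1 h2 = DTL_hat_diag n (circ n h1 h2)"

definition inversion :: "nat \<Rightarrow> (diag \<Rightarrow>\<^sub>0 int poly) set set \<Rightarrow> (diag \<Rightarrow>\<^sub>0 int poly) set set"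
  where "inversion n = (THE f. f \<in> extensional (carrier (DTL_hat n)) \<and>
    linear_endo Z\<delta> (DTL_hat n) f \<and>
    (\<forall>d\<in>type_II n. f (DTL_hat_diag n d) = DTL_hat_diag n (flip d)))"

end

theory Submission
  imports Defs
begin

text \<open>
Stacking diagrams means gluing arcs at the middle vertices. Eliminating these vertices one at a time gives
the same result in every order, hence associativity, and each elimination preserves planarity and the
exposure of decorations to the left wall.

The linear map \<open>red\<close> sends a diagram to \<open>\<delta>\<^sup>k\<close> times its type II normal form, or to \<open>0\<close> if it has a
decorated loop. It kills the local relations and the decorated loops and is compatible with products, so
the type II diagrams stay linearly independent in the quotient. They span the algebra of the simple diagrams
because multiplication by simple diagrams moves a short cup to the right end; after the same has been done
at the bottom, the cup and the cap can be split off and induction on \<open>n\<close> applies.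

A product has at most as many propagating edges as each of its factors, and its lower half is that of the lower
factor when that factor keeps all its propagating edges. This is the triangularity required of a cellular algebra.
\<close>

text \<open>Gluing one pair of ends keeps a picture planar only if the two ends are neighbours along
  the boundary cut open at the left wall. Therefore an identity diagram is put between the two
  factors, which doubles every middle node, and the columns are contracted starting at the left
  wall: removing one column makes the next pair neighbours. The same induction shows that no
  component of a product has more than two ends, so no separate argument about paths is needed.

  Confluence of the local relations is never discussed. The kernel of \<open>red\<close> is a
  two-sided ideal containing these relations, and \<open>red\<close> fixes type II diagrams; linear
  independence follows from this alone.

  Evenness of the number of decorations is what allows an undecorated cup and cap to be cut off: if
  no cup remains, at most the leftmost strand is decorated, hence by parity none.

  The lower half T has to drop out of the coefficients of a product with S \<circ> T. This rests on
  Z[\<delta>] having no zero divisors: T is exchanged for T' at the cost of a power of \<delta>,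
  which is cancelled.\<close>

section \<open>Nets\<close>

text \<open>An entry is a connected piece: the vertices at which it can still be glued and its
  number of decorations. Entries without vertices are loops. Multisets are needed because equal
  loops may occur several times.\<close>

type_synonym 'v net = "('v set \<times> nat) multiset"

text \<open>The guard keeps a vertex that no piece meets from creating an empty entry, which would
  count as a loop.\<close>

definition elim :: "'v \<Rightarrow> 'v net \<Rightarrow> 'v net"
  where "elim v N = (let T = {#p \<in># N. v \<in> fst p#} in
    if T = {#} then N
    else add_mset (\<Union>(fst ` set_mset T) - {v}, \<Sum>\<^sub># (image_mset snd T)) {#p \<in># N. v \<notin> fst p#})"

abbreviation elims :: "'v list \<Rightarrow> 'v net \<Rightarrow> 'v net"
  where "elims \<equiv> fold elim"

definition verts :: "'v net \<Rightarrow> 'v set"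
  where "verts N = \<Union>(fst ` set_mset N)"

lemma verts_simps [simp]:
  "verts {#} = {}" "verts (add_mset p N) = fst p \<union> verts N" "verts (A + B) = verts A \<union> verts B"
  by (auto simp: verts_def)

lemma elim_untouched: "v \<notin> verts N \<Longrightarrow> elim v N = N"
  by (auto simp: elim_def verts_def Let_def filter_mset_eq_mempty_iff)

text \<open>Together with \<open>net_split\<close> this replaces the filters in \<open>elim\<close>
  by a decomposition of the net, the form in which explicit eliminations are computed below.\<close>

lemma elim_touched:
  assumes "T \<noteq> {#}" "\<forall>p\<in>#T. v \<in> fst p" "v \<notin> verts N"
  shows "elim v (T + N) = add_mset (verts T - {v}, \<Sum>\<^sub># (image_mset snd T)) N"
proof -
  have "{#p \<in># T. v \<in> fst p#} = T" "{#p \<in># T. v \<notin> fst p#} = {#}"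
    using assms(2) by (auto simp: filter_mset_eq_conv filter_mset_eq_mempty_iff)
  moreover have "{#p \<in># N. v \<in> fst p#} = {#}" "{#p \<in># N. v \<notin> fst p#} = N"
    using assms(3) by (auto simp: verts_def filter_mset_eq_conv filter_mset_eq_mempty_iff)
  ultimately show ?thesis using assms(1) by (auto simp: elim_def Let_def verts_def)
qed

lemma net_split:
  obtains T N' where "N = T + N'" "\<forall>p\<in>#T. v \<in> fst p" "v \<notin> verts N'"
proof
  show "N = {#p \<in># N. v \<in> fst p#} + {#p \<in># N. v \<notin> fst p#}" by (rule multiset_partition)
qed (auto simp: verts_def)

lemma elim_add:
  assumes "v \<notin> verts A \<or> v \<notin> verts B"
  shows "elim v (A + B) = elim v A + elim v B"
proof -
  have *: "elim v (A + B) = elim v A + B" if "v \<notin> verts B" for A B :: "'a net"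
  proof -
    obtain T N' where 1: "A = T + N'" "\<forall>p\<in>#T. v \<in> fst p" "v \<notin> verts N'"
      by (rule net_split)
    show ?thesis
    proof (cases "T = {#}")
      case True
      then show ?thesis using 1 that by (simp add: elim_untouched)
    next
      case False
      then show ?thesis using 1 that elim_touched[OF False 1(2), of "N' + B"] elim_touched[OF False 1(2,3)]
        by (simp add: add.assoc)
    qed
  qed
  from assms show ?thesis
  proof
    assume "v \<notin> verts B" then show ?thesis using * by (simp add: elim_untouched)
  next
    assume "v \<notin> verts A" then show ?thesis using *[of A B] by (simp add: elim_untouched add.commute)
  qed
qed

lemma verts_elim: "verts (elim v N) = verts N - {v}"
proof -
  obtain T N' where 1: "N = T + N'" "\<forall>p\<in>#T. v \<in> fst p" "v \<notin> verts N'"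
    by (rule net_split)
  show ?thesis
  proof (cases "T = {#}")
    case True
    then show ?thesis using 1 by (simp add: elim_untouched)
  next
    case False
    then show ?thesis using 1 elim_touched[OF False 1(2,3)] by auto
  qed
qed

text \<open>Sort the pieces into those through both vertices (\<open>A\<close>), only through
  \<open>u\<close> (\<open>B\<close>), only through \<open>v\<close> (\<open>C\<close>) and through
  neither (\<open>D\<close>). If \<open>A\<close> is empty, the two eliminations act on different
  pieces; otherwise both orders fuse \<open>A + B + C\<close> into a single piece.\<close>

lemma elim_commute: "elim u (elim v N) = elim v (elim u N)"
proof (cases "u = v")
  case False
  obtain T R where 1: "N = T + R" "\<forall>p\<in>#T. u \<in> fst p" "u \<notin> verts R"
    by (rule net_split)
  obtain A B where 2: "T = A + B" "\<forall>p\<in>#A. v \<in> fst p" "v \<notin> verts B"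
    by (rule net_split)
  obtain C D where 3: "R = C + D" "\<forall>p\<in>#C. v \<in> fst p" "v \<notin> verts D"
    by (rule net_split)
  have N: "N = (A + B + C) + D" using 1 2 3 by simp
  have D: "u \<notin> verts D" "v \<notin> verts D" "u \<notin> verts C" using 1 3 by auto
  have *: "elim u (elim v M) = elim v (elim u M)" if M: "M = A + B + C" for M
  proof (cases "A = {#}")
    case True
    have "u \<notin> verts C \<and> v \<notin> verts B" using D 2 by auto
    then show ?thesis using M True by (simp add: elim_add elim_untouched verts_elim False)
  next
    case nA: False
    have A: "\<forall>p\<in>#A. u \<in> fst p" "\<forall>p\<in>#B. u \<in> fst p" using 1 2 by auto
    obtain p where p: "p \<in># A" using nA by (rule multiset_nonemptyE)
    have "u \<in> fst p" "v \<in> fst p" using p A 2 by auto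
    then have uv: "u \<in> verts A" "v \<in> verts A" using p by (auto simp: verts_def)
    have "elim v ((A + C) + B) = add_mset (verts (A+C) - {v}, \<Sum>\<^sub># (image_mset snd (A+C))) B"
      using elim_touched[of "A + C" v B] nA 2 3 by auto
    moreover have "elim u ((A + B) + C) = add_mset (verts (A+B) - {u}, \<Sum>\<^sub># (image_mset snd (A+B))) C"
      using elim_touched[of "A + B" u C] nA A D by auto
    moreover have "elim u (add_mset (verts (A+C) - {v}, \<Sum>\<^sub># (image_mset snd (A+C))) B)
      = {#(verts (A+B+C) - {u,v}, \<Sum>\<^sub># (image_mset snd (A+B+C)))#}"
      using elim_touched[of "add_mset (verts (A+C) - {v}, \<Sum>\<^sub># (image_mset snd (A+C))) B" u "{#}"] A uv False 2
      by (auto simp: ac_simps)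
    moreover have "elim v (add_mset (verts (A+B) - {u}, \<Sum>\<^sub># (image_mset snd (A+B))) C)
      = {#(verts (A+B+C) - {u,v}, \<Sum>\<^sub># (image_mset snd (A+B+C)))#}"
      using elim_touched[of "add_mset (verts (A+B) - {u}, \<Sum>\<^sub># (image_mset snd (A+B))) C" v "{#}"] A uv False 3 D
      by (auto simp: ac_simps)
    ultimately show ?thesis unfolding M by (simp add: ac_simps)
  qed
  show ?thesis unfolding N using D *[OF refl] by (simp add: elim_add elim_untouched verts_elim)
qed simp

lemma elims_perm:
  assumes "mset xs = mset ys"
  shows "elims xs N = elims ys N"
proof -
  have "elim x \<circ> elim y = elim y \<circ> elim x" for x y :: 'a
    by (rule ext) (simp add: elim_commute)
  then show ?thesis using fold_multiset_equiv[OF _ assms, of elim] by simp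
qed

lemma elims_untouched: "set xs \<inter> verts N = {} \<Longrightarrow> elims xs N = N"
  by (induction xs arbitrary: N) (auto simp: elim_untouched)

lemma verts_elims: "verts (elims xs N) = verts N - set xs"
  by (induction xs arbitrary: N) (auto simp: verts_elim)

lemma elims_add: "set xs \<inter> verts A \<inter> verts B = {} \<Longrightarrow> elims xs (A + B) = elims xs A + elims xs B"
proof (induction xs arbitrary: A B)
  case (Cons x xs)
  then have "x \<notin> verts A \<or> x \<notin> verts B" by auto
  then have "elims (x # xs) (A + B) = elims xs (elim x A + elim x B)" by (simp add: elim_add)
  also have "\<dots> = elims xs (elim x A) + elims xs (elim x B)"
    using Cons.prems by (intro Cons.IH) (auto simp: verts_elim)
  finally show ?case by simp
qed simp

lemma elims_add_untouched: "set xs \<inter> verts B = {} \<Longrightarrow> elims xs (A + B) = elims xs A + B"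
  by (subst elims_add) (auto simp: elims_untouched)

lemma elims_sum:
  assumes "finite I" "\<And>i j. i \<in> I \<Longrightarrow> j \<in> I \<Longrightarrow> i \<noteq> j \<Longrightarrow> set xs \<inter> verts (A i) \<inter> verts (A j) = {}"
  shows "elims xs (\<Sum>i\<in>I. A i) = (\<Sum>i\<in>I. elims xs (A i))"
  using assms
proof (induction I rule: finite_induct)
  case empty
  then show ?case by (simp add: elims_untouched)
next
  case (insert i I)
  have v: "verts (\<Sum>i\<in>I. A i) = (\<Union>i\<in>I. verts (A i))"
    using insert(1) by (induction I rule: finite_induct) auto
  have "elims xs (A i + (\<Sum>i\<in>I. A i)) = elims xs (A i) + elims xs (\<Sum>i\<in>I. A i)"
    using insert by (intro elims_add) (auto simp: v)
  then show ?case using insert by auto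
qed

lemma elims_filter: "elims xs N = elims (filter (\<lambda>x. x \<in> verts N) xs) N"
proof (induction xs arbitrary: N)
  case (Cons x xs)
  have "elims (filter (\<lambda>y. y \<in> verts (elim x N)) xs) (elim x N) = elims (filter (\<lambda>y. y \<in> verts N) xs) (elim x N)"
  proof -
    have "elims (filter (\<lambda>y. y \<in> verts (elim x N)) ys) M = elims (filter (\<lambda>y. y \<in> verts N) ys) M"
      if "x \<notin> verts M" for ys M
      using that by (induction ys arbitrary: M) (auto simp: verts_elim elim_untouched)
    then show ?thesis by (simp add: verts_elim)
  qed
  then show ?case using Cons[of "elim x N"] by (auto simp: elim_untouched)
qed simp

text \<open>Vertices absent from the net do not matter, so a whole row may be replaced by the few of
  its vertices that occur, in any order.\<close>

lemma elims_cong: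
  assumes "distinct xs" "distinct ys" "set xs \<inter> verts N = set ys \<inter> verts N"
  shows "elims xs N = elims ys N"
proof -
  let ?f = "filter (\<lambda>x. x \<in> verts N)"
  have "set (?f zs) = set zs \<inter> verts N" for zs by auto
  then have "set (?f xs) = set (?f ys)" using assms(3) by (simp only:)
  then have "mset (?f xs) = mset (?f ys)"
    using set_eq_iff_mset_eq_distinct[OF distinct_filter[OF assms(1)] distinct_filter[OF assms(2)]] by (rule iffD1[rotated])
  then have "elims (?f xs) N = elims (?f ys) N" by (rule elims_perm)
  then show ?thesis by (rule trans[OF trans[OF elims_filter] elims_filter[symmetric]])
qed

text \<open>Gluing never loses decorations; this is the source of the additivity of
  \<open>total_dec\<close> under stacking.\<close>

lemma sum_elim: "\<Sum>\<^sub># (image_mset snd (elim v N)) = \<Sum>\<^sub># (image_mset snd N)"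
proof -
  obtain T N' where 1: "N = T + N'" "\<forall>p\<in>#T. v \<in> fst p" "v \<notin> verts N'"
    by (rule net_split)
  show ?thesis
  proof (cases "T = {#}")
    case True
    then show ?thesis unfolding 1(1) using elim_untouched[OF 1(3)] by simp
  next
    case False
    show ?thesis unfolding 1(1) elim_touched[OF False 1(2,3)] by simp
  qed
qed

lemma sum_elims: "\<Sum>\<^sub># (image_mset snd (elims xs N)) = \<Sum>\<^sub># (image_mset snd N)"
  by (induction xs arbitrary: N) (auto simp: sum_elim)

section \<open>Classes of the gluing relation and their agreement with elimination\<close>

section \<open>Classes of pieces\<close>

text \<open>A version of \<open>glue\<close> in which gluing happens only at vertices of
  \<open>M\<close>, so that \<open>M\<close> can grow by one vertex at a time.\<close>

definition links :: "'p set \<Rightarrow> ('p \<Rightarrow> 'v set) \<Rightarrow> 'v set \<Rightarrow> ('p \<times> 'p) set"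
  where "links P pts M = {(p, q). p \<in> P \<and> q \<in> P \<and> pts p \<inter> pts q \<inter> M \<noteq> {}}"

lemma rtrancl_class_eq:
  assumes "sym S" "(x, y) \<in> S\<^sup>*"
  shows "S\<^sup>* `` {x} = S\<^sup>* `` {y}"
proof -
  have "(y, x) \<in> S\<^sup>*" using assms by (meson sym_rtrancl symD)
  then show ?thesis using assms(2) rtrancl_trans[of x y S] rtrancl_trans[of y x S] by blast
qed

text \<open>The part of a path between its first entry into \<open>B\<close> and its last exit from
  \<open>B\<close> can be replaced by a single jump inside \<open>B\<close>.\<close>

lemma rtrancl_insert_square:
  assumes "sym S"
  shows "(S \<union> B \<times> B)\<^sup>* = S\<^sup>* \<union> S\<^sup>* O (B \<times> B) O S\<^sup>*"
proof -
  let ?X = "S\<^sup>* \<union> S\<^sup>* O (B \<times> B) O S\<^sup>*"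
  have "(x, y) \<in> ?X" if "(x, y) \<in> (S \<union> B \<times> B)\<^sup>*" for x y
    using that
  proof (induction rule: rtrancl_induct)
    case (step y z)
    consider "(x, y) \<in> S\<^sup>*" | b c where "(x, b) \<in> S\<^sup>*" "b \<in> B" "c \<in> B" "(c, y) \<in> S\<^sup>*"
      using step.IH by blast
    then show ?case
    proof cases
      case 1
      show ?thesis using step.hyps(2)
      proof
        assume "(y, z) \<in> S"
        then have "(x, z) \<in> S\<^sup>*" using 1 by (rule rtrancl_into_rtrancl[rotated])
        then show ?thesis by blast
      next
        assume "(y, z) \<in> B \<times> B"
        then have "(x, z) \<in> S\<^sup>* O (B \<times> B) O S\<^sup>*"
          using 1 relcompI[OF 1, of z "(B \<times> B) O S\<^sup>*"] relcompI[of y z "B \<times> B" z "S\<^sup>*"] by simp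
        then show ?thesis by blast
      qed
    next
      case 2
      show ?thesis using step.hyps(2)
      proof
        assume "(y, z) \<in> S"
        then have "(c, z) \<in> S\<^sup>*" using 2(4) by (rule rtrancl_into_rtrancl[rotated])
        then show ?thesis using 2 by blast
      next
        assume "(y, z) \<in> B \<times> B"
        then have "z \<in> B" by blast
        then have "(x, z) \<in> S\<^sup>* O (B \<times> B) O S\<^sup>*"
          using relcompI[OF 2(1), of z "(B \<times> B) O S\<^sup>*"] relcompI[of b z "B \<times> B" z "S\<^sup>*"] 2(2) by simp
        then show ?thesis by blast
      qed
    qed
  qed simp
  moreover have "?X \<subseteq> (S \<union> B \<times> B)\<^sup>*"
  proof -
    have 1: "S\<^sup>* \<subseteq> (S \<union> B \<times> B)\<^sup>*" by (rule rtrancl_mono) simp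
    have 2: "B \<times> B \<subseteq> (S \<union> B \<times> B)\<^sup>*" by (meson Un_upper2 r_into_rtrancl subset_iff)
    have "S\<^sup>* O (B \<times> B) O S\<^sup>* \<subseteq> (S \<union> B \<times> B)\<^sup>* O (S \<union> B \<times> B)\<^sup>* O (S \<union> B \<times> B)\<^sup>*"
      by (intro relcomp_mono 1 2)
    then show ?thesis using 1 by simp
  qed
  ultimately show ?thesis by (intro equalityI) (rule subrelI, assumption)
qed

definition comps :: "'p set \<Rightarrow> ('p \<Rightarrow> 'v set) \<Rightarrow> 'v set \<Rightarrow> 'p set set"
  where "comps P pts M = P // (links P pts M)\<^sup>*"

lemma sym_links: "sym (links P pts M)"
  by (auto simp: sym_def links_def)

lemma links_rtrancl_closed: "(p, q) \<in> (links P pts M)\<^sup>* \<Longrightarrow> p \<in> P \<Longrightarrow> q \<in> P"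
  by (induction rule: rtrancl_induct) (auto simp: links_def)

lemma comps_partition: "partition_on P (comps P pts M)"
proof -
  let ?R = "(links P pts M)\<^sup>*"
  have "\<Union>(comps P pts M) = P"
    by (auto simp: comps_def quotient_def dest: links_rtrancl_closed)
  moreover have "K = K'" if KK: "K \<in> comps P pts M" "K' \<in> comps P pts M" "K \<inter> K' \<noteq> {}" for K K'
  proof -
    obtain p where p: "K = ?R `` {p}" using KK(1) unfolding comps_def by (rule quotientE)
    obtain q where q: "K' = ?R `` {q}" using KK(2) unfolding comps_def by (rule quotientE)
    obtain r where "r \<in> K" "r \<in> K'" using KK(3) by auto
    then have "?R `` {p} = ?R `` {r}" "?R `` {q} = ?R `` {r}"
      using rtrancl_class_eq[OF sym_links, of p r P pts M] rtrancl_class_eq[OF sym_links, of q r P pts M]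
      by (simp_all add: p q)
    then show ?thesis by (simp add: p q)
  qed
  moreover have "{} \<notin> comps P pts M" by (auto simp: comps_def quotient_def)
  ultimately show ?thesis by (auto simp: partition_on_def disjoint_def)
qed

text \<open>Gluing at \<open>v\<close> relates all pieces through \<open>v\<close> to each other, so
  exactly the classes meeting \<open>v\<close> merge.\<close>

lemma comps_insert:
  fixes M :: "'v set"
  assumes "\<exists>p\<in>P. v \<in> pts p"
  defines "T \<equiv> {K \<in> comps P pts M. v \<in> \<Union>(pts ` K)}"
  shows "comps P pts (insert v M) = insert (\<Union>T) (comps P pts M - T)"
proof -
  define S where "S = links P pts M"
  define B where "B = {p\<in>P. v \<in> pts p}"
  have S: "sym S" by (simp add: S_def sym_links)
  have l: "links P pts (insert v M) = S \<union> B \<times> B" by (auto simp: links_def S_def B_def)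
  have T: "T = (\<lambda>p. S\<^sup>* `` {p}) ` B"
  proof -
    have "S\<^sup>* `` {p} \<in> T" if "p \<in> B" for p
      using that by (auto simp: T_def comps_def quotient_def B_def S_def)
    moreover have "K \<in> (\<lambda>p. S\<^sup>* `` {p}) ` B" if K: "K \<in> T" for K
    proof -
      obtain p q where *: "K = S\<^sup>* `` {p}" "p \<in> P" "(p, q) \<in> S\<^sup>*" "v \<in> pts q"
        using K by (auto simp: T_def comps_def quotient_def S_def)
      then have "q \<in> B" using links_rtrancl_closed[of p q P pts M] by (auto simp: B_def S_def)
      then show ?thesis using rtrancl_class_eq[OF S *(3)] *(1) by auto
    qed
    ultimately show ?thesis by auto
  qed
  have UT: "\<Union>T = S\<^sup>* `` B" by (auto simp: T)
  have cl: "(S \<union> B \<times> B)\<^sup>* `` {p} = (if p \<in> \<Union>T then \<Union>T else S\<^sup>* `` {p})" for p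
  proof (cases "p \<in> \<Union>T")
    case True
    then obtain b where b: "b \<in> B" "(b, p) \<in> S\<^sup>*" by (auto simp: UT)
    then have pb: "(p, b) \<in> S\<^sup>*" using symD[OF sym_rtrancl[OF S]] by blast
    have "S\<^sup>* `` {p} = S\<^sup>* `` {b}" using rtrancl_class_eq[OF S b(2)] by simp
    moreover have "S\<^sup>* `` {b} \<subseteq> \<Union>T" using b(1) by (auto simp: UT)
    moreover have "(S\<^sup>* O (B \<times> B) O S\<^sup>*) `` {p} = \<Union>T" using pb b(1) unfolding UT by blast
    moreover have "(S \<union> B \<times> B)\<^sup>* `` {p} = S\<^sup>* `` {p} \<union> (S\<^sup>* O (B \<times> B) O S\<^sup>*) `` {p}"
      unfolding rtrancl_insert_square[OF S] by blast
    ultimately show ?thesis using True by auto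
  next
    case False
    have "\<not> (\<exists>b\<in>B. (p, b) \<in> S\<^sup>*)"
    proof
      assume "\<exists>b\<in>B. (p, b) \<in> S\<^sup>*"
      then obtain b where "b \<in> B" "(b, p) \<in> S\<^sup>*" using symD[OF sym_rtrancl[OF S]] by blast
      then show False using False unfolding UT by blast
    qed
    then have "(S\<^sup>* O (B \<times> B) O S\<^sup>*) `` {p} = {}" by blast
    moreover have "(S \<union> B \<times> B)\<^sup>* `` {p} = S\<^sup>* `` {p} \<union> (S\<^sup>* O (B \<times> B) O S\<^sup>*) `` {p}"
      unfolding rtrancl_insert_square[OF S] by blast
    ultimately show ?thesis using False by simp
  qed
  have sub: "\<Union>T \<subseteq> P" using comps_partition[of P pts M] by (auto simp: T_def partition_on_def)
  have ne: "\<Union>T \<noteq> {}" using assms(1) by (auto simp: UT B_def)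
  have "comps P pts (insert v M) = (\<lambda>p. (S \<union> B \<times> B)\<^sup>* `` {p}) ` P"
    by (auto simp: comps_def l quotient_def)
  also have "\<dots> = (\<lambda>p. if p \<in> \<Union>T then \<Union>T else S\<^sup>* `` {p}) ` (\<Union>T \<union> (P - \<Union>T))"
    using sub by (simp only: cl Un_Diff_cancel Un_absorb1)
  also have "\<dots> = insert (\<Union>T) ((\<lambda>p. S\<^sup>* `` {p}) ` (P - \<Union>T))"
    unfolding image_Un using ne by (intro arg_cong2[where f="(\<union>)", of _ "{\<Union>T}", simplified]) (simp_all add: image_constant_conv)
  also have "(\<lambda>p. S\<^sup>* `` {p}) ` (P - \<Union>T) = comps P pts M - T"
  proof -
    have "S\<^sup>* `` {p} \<in> T \<longleftrightarrow> p \<in> \<Union>T" if "p \<in> P" for p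
    proof
      assume "p \<in> \<Union>T"
      then obtain K where K: "K \<in> T" "p \<in> K" by auto
      then obtain b where "K = S\<^sup>* `` {b}" by (auto simp: T)
      then show "S\<^sup>* `` {p} \<in> T" using K rtrancl_class_eq[OF S, of b p] by auto
    qed auto
    then show ?thesis by (auto simp: comps_def quotient_def S_def)
  qed
  finally show ?thesis .
qed

lemma comps_insert_none:
  assumes "\<not> (\<exists>p\<in>P. v \<in> pts p)"
  shows "comps P pts (insert v M) = comps P pts M"
proof -
  have "links P pts (insert v M) = links P pts M" using assms by (auto simp: links_def)
  then show ?thesis by (simp add: comps_def)
qed

lemma comps_empty: "comps P pts {} = (\<lambda>p. {p}) ` P"
  by (auto simp: comps_def links_def quotient_def)

lemma finite_comps: "finite P \<Longrightarrow> finite (comps P pts M)"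
  using comps_partition finite_elements by metis

text \<open>The bridge from the transitive closure in \<open>stack\<close> to elimination: by
  \<open>comps_insert\<close>, admitting one more vertex merges classes in the same way as
  \<open>elim\<close> merges entries.\<close>

lemma comps_elims:
  assumes "finite P" "distinct xs"
  shows "image_mset (\<lambda>K. (\<Union>(pts ` K) - set xs, sum wt K)) (mset_set (comps P pts (set xs)))
    = elims xs (image_mset (\<lambda>p. (pts p, wt p)) (mset_set P))"
  using assms(2)
proof (induction xs rule: rev_induct)
  case Nil
  have "image_mset (\<lambda>K. (\<Union>(pts ` K), sum wt K)) (mset_set ((\<lambda>p. {p}) ` P))
     = image_mset (\<lambda>K. (\<Union>(pts ` K), sum wt K)) (image_mset (\<lambda>p. {p}) (mset_set P))"
    by (subst image_mset_mset_set) (auto simp: inj_on_def)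
  then show ?case by (simp add: comps_empty multiset.map_comp o_def)
next
  case (snoc v xs)
  let ?C = "comps P pts (set xs)"
  let ?f = "\<lambda>xs K. (\<Union>(pts ` K) - set xs, sum wt K)"
  define T where "T = {K \<in> ?C. v \<in> \<Union>(pts ` K)}"
  have v: "v \<notin> set xs" using snoc by auto
  have fC: "finite ?C" using assms finite_comps by auto
  then have fT: "finite T" by (auto simp: T_def)
  have part: "partition_on P ?C" by (rule comps_partition)
  have IH: "elims xs (image_mset (\<lambda>p. (pts p, wt p)) (mset_set P)) = image_mset (?f xs) (mset_set ?C)"
    using snoc by auto
  have same: "image_mset (?f (xs @ [v])) (mset_set (?C - T)) = image_mset (?f xs) (mset_set (?C - T))"
    using fC by (intro image_mset_cong) (auto simp: T_def)
  have R: "v \<notin> verts (image_mset (?f xs) (mset_set (?C - T)))"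
    using fC by (auto simp: verts_def T_def)
  show ?case
  proof (cases "\<exists>p\<in>P. v \<in> pts p")
    case False
    then have "T = {}" using part by (auto simp: T_def partition_on_def)
    then show ?thesis using same R False IH by (simp add: comps_insert_none elim_untouched)
  next
    case True
    have cl: "comps P pts (set (xs @ [v])) = insert (\<Union>T) (?C - T)"
      using comps_insert[OF True, of "set xs"] by (simp add: T_def)
    have neT: "T \<noteq> {}" using True part by (auto simp: T_def partition_on_def)
    \<comment> \<open>A class in \<open>T\<close> is nonempty and contained in the union of
      \<open>T\<close>, so this union cannot be a class disjoint from it. Hence
      \<open>insert\<close> really adds an element to the multiset.\<close>
    have notin: "\<Union>T \<notin> ?C - T"
    proof
      assume a: "\<Union>T \<in> ?C - T"
      obtain K where K: "K \<in> T" using neT by auto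
      then have KC: "K \<in> ?C" by (simp add: T_def)
      then have "K \<noteq> {}" using part unfolding partition_on_def by blast
      then have "K \<inter> \<Union>T \<noteq> {}" using K by blast
      moreover have "\<And>A B. A \<in> ?C \<Longrightarrow> B \<in> ?C \<Longrightarrow> A \<inter> B \<noteq> {} \<Longrightarrow> A = B"
        using part unfolding partition_on_def disjoint_def by blast
      ultimately have "K = \<Union>T" using a KC by blast
      then show False using a K by blast
    qed
    have "T \<union> (?C - T) = ?C" by (auto simp: T_def)
    then have "mset_set ?C = mset_set T + mset_set (?C - T)"
      using fC fT mset_set_Union[of T "?C - T"] by auto
    then have "elim v (image_mset (?f xs) (mset_set ?C))
       = elim v (image_mset (?f xs) (mset_set T) + image_mset (?f xs) (mset_set (?C - T)))" by simp
    also have "\<dots> = add_mset (verts (image_mset (?f xs) (mset_set T)) - {v},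
          \<Sum>\<^sub># (image_mset snd (image_mset (?f xs) (mset_set T)))) (image_mset (?f xs) (mset_set (?C - T)))"
      using fT neT R v by (intro elim_touched) (auto simp: T_def mset_set_empty_iff)
    also have "verts (image_mset (?f xs) (mset_set T)) - {v} = \<Union>(pts ` \<Union>T) - set (xs @ [v])"
      using fT by (auto simp: verts_def)
    also have "\<Sum>\<^sub># (image_mset snd (image_mset (?f xs) (mset_set T))) = sum wt (\<Union>T)"
    proof -
      have "sum wt (\<Union>T) = (\<Sum>K\<in>T. sum wt K)"
        using part finite_subset[OF _ assms(1)] by (subst sum.Union_disjoint)
         (auto simp: T_def partition_on_def disjoint_def)
      then show ?thesis by (simp add: multiset.map_comp o_def sum_unfold_sum_mset)
    qed
    finally show ?thesis using IH same fC notin cl by (simp add: mset_set.insert)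
  qed
qed

section \<open>Nets of diagrams, and stacking as elimination of the middle row\<close>

section \<open>Diagrams as nets\<close>

declare upt_Suc [simp del]

text \<open>The part of membership in \<open>diagrams\<close> that gluing alone needs: planarity,
  exposure and the condition on cups are left out.\<close>

definition matching :: "nat \<Rightarrow> diag \<Rightarrow> bool"
  where "matching n d \<longleftrightarrow> partition_on (nodes n) (edges d) \<and> (\<forall>e\<in>edges d. card e = 2) \<and>
    (\<forall>e. e \<notin> edges d \<longrightarrow> dec d e = 0)"

fun vtx :: "nat \<Rightarrow> nat \<Rightarrow> node \<Rightarrow> nat \<times> nat" where
  "vtx r s (North i) = (r, i)"
| "vtx r s (South i) = (s, i)"

definition edge_net :: "nat \<Rightarrow> nat \<Rightarrow> diag \<Rightarrow> (nat \<times> nat) net"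
  where "edge_net r s d = image_mset (\<lambda>e. (vtx r s ` e, dec d e)) (mset_set (edges d))"

definition loop_net :: "nat multiset \<Rightarrow> 'v net"
  where "loop_net L = image_mset (\<lambda>k. ({}, k)) L"

text \<open>Vertices are pairs (row, index); a diagram occupies two rows.\<close>

definition net :: "nat \<Rightarrow> nat \<Rightarrow> diag \<Rightarrow> (nat \<times> nat) net"
  where "net r s d = edge_net r s d + loop_net (loops d)"

abbreviation row :: "nat \<Rightarrow> nat \<Rightarrow> (nat \<times> nat) list"
  where "row s n \<equiv> map (Pair s) [1..<Suc n]"

lemma set_row: "set (row s n) = {s} \<times> {1..n}"
  by auto

lemma distinct_row: "distinct (row s n)"
  by (simp add: distinct_map inj_on_def)

lemma finite_nodes [simp]: "finite (nodes n)"
  by (simp add: nodes_def)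

lemma matchingD:
  assumes "matching n d"
  shows "finite (edges d)" "{} \<notin> edges d" "\<And>e. e \<notin> edges d \<Longrightarrow> dec d e = 0"
    "\<And>e. e \<in> edges d \<Longrightarrow> e \<subseteq> nodes n" "\<And>e. e \<in> edges d \<Longrightarrow> card e = 2" "\<Union>(edges d) = nodes n"
    "\<And>e f. e \<in> edges d \<Longrightarrow> f \<in> edges d \<Longrightarrow> e \<inter> f \<noteq> {} \<Longrightarrow> e = f"
proof -
  have p: "partition_on (nodes n) (edges d)" using assms by (simp add: matching_def)
  show "finite (edges d)" by (rule finite_elements[OF finite_nodes p])
  show "{} \<notin> edges d" "\<Union>(edges d) = nodes n"  "\<And>e. e \<in> edges d \<Longrightarrow> e \<subseteq> nodes n"
    using p by (auto simp: partition_on_def)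
  show "\<And>e f. e \<in> edges d \<Longrightarrow> f \<in> edges d \<Longrightarrow> e \<inter> f \<noteq> {} \<Longrightarrow> e = f"
    using p unfolding partition_on_def disjoint_def by blast
qed (use assms in \<open>auto simp: matching_def\<close>)

lemma vtx_mem:
  assumes "r \<noteq> s"
  shows "(r, j) \<in> vtx r s ` e \<longleftrightarrow> North j \<in> e" "(s, j) \<in> vtx r s ` e \<longleftrightarrow> South j \<in> e"
    "u \<noteq> r \<Longrightarrow> u \<noteq> s \<Longrightarrow> (u, j) \<notin> vtx r s ` e"
proof -
  have *: "vtx r s x = (r, j) \<longleftrightarrow> x = North j" "vtx r s x = (s, j) \<longleftrightarrow> x = South j" for x
    using assms by (cases x; auto)+
  show "(r, j) \<in> vtx r s ` e \<longleftrightarrow> North j \<in> e" "(s, j) \<in> vtx r s ` e \<longleftrightarrow> South j \<in> e"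
    unfolding image_iff using * by metis+
  show "u \<noteq> r \<Longrightarrow> u \<noteq> s \<Longrightarrow> (u, j) \<notin> vtx r s ` e"
    by (rule notI) (auto elim: vtx.elims[OF sym])
qed

lemma vtx_mem_iff:
  "r \<noteq> s \<Longrightarrow> (u, j) \<in> vtx r s ` e \<longleftrightarrow> u = r \<and> North j \<in> e \<or> u = s \<and> South j \<in> e"
  using vtx_mem[of r s] by metis

lemma inj_vtx: "r \<noteq> s \<Longrightarrow> inj (vtx r s)"
proof (rule injI)
  fix x y assume "r \<noteq> s" "vtx r s x = vtx r s y"
  then show "x = y" by (cases x; cases y) auto
qed

lemma verts_loop_net [simp]: "verts (loop_net L) = {}"
  by (auto simp: verts_def loop_net_def)

lemma verts_edge_net: "finite (edges d) \<Longrightarrow> verts (edge_net r s d) = vtx r s ` \<Union>(edges d)"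
  by (auto simp: verts_def edge_net_def)

lemma vtx_nodes: "vtx r s ` nodes n = {r, s} \<times> {1..n}"
  by (force simp: nodes_def image_Un image_image)

lemma verts_net: "matching n d \<Longrightarrow> verts (net r s d) = {r, s} \<times> {1..n}"
  by (simp add: net_def verts_edge_net matchingD vtx_nodes)

text \<open>An outer node lies in only one piece, so components with a common end share a piece and
  coincide. Hence the sum over components in \<open>stack\<close> has a single term for each
  edge.\<close>

lemma ends_stack_inj:
  assumes "matching n a" "matching n b"
  shows "inj_on ends {K \<in> chains a b. ends K \<noteq> {}}"
proof (rule inj_onI)
  fix K K' assume K: "K \<in> {K \<in> chains a b. ends K \<noteq> {}}" "K' \<in> {K \<in> chains a b. ends K \<noteq> {}}" "ends K = ends K'"
  let ?P = "edges a <+> edges b"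
  have dis: "p = q" if "p \<in> ?P" "q \<in> ?P" "outer p \<inter> outer q \<noteq> {}" for p q
  proof (cases p; cases q)
    fix e e' assume "p = Inl e" "q = Inl e'"
    then show ?thesis using that matchingD(7)[OF assms(1), of e e'] by auto
  next
    fix e e' assume "p = Inr e" "q = Inr e'"
    then show ?thesis using that matchingD(7)[OF assms(2), of e e'] by auto
  qed (use that in auto)
  have ch: "chains a b = comps ?P (\<lambda>p. middle p) UNIV"
    by (simp add: chains_def comps_def glue_def links_def)
  have part: "partition_on ?P (chains a b)" unfolding ch by (rule comps_partition)
  obtain x where "x \<in> ends K" "x \<in> ends K'" using K by auto
  then obtain p q where "p \<in> K" "q \<in> K'" "x \<in> outer p" "x \<in> outer q" by (auto simp: ends_def)
  moreover have "p \<in> ?P" "q \<in> ?P" using part K \<open>p \<in> K\<close> \<open>q \<in> K'\<close> by (auto simp: partition_on_def)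
  ultimately have "K \<inter> K' \<noteq> {}" using dis by blast
  then show "K = K'" using part K unfolding partition_on_def disjoint_def by blast
qed

text \<open>Most facts about products are proved through this equation. The first diagram occupies
  rows \<open>r\<close>, \<open>s\<close>, the second rows \<open>s\<close>, \<open>t\<close>, and
  \<open>comps_elims\<close> turns the components of \<open>stack\<close> into the result of
  eliminating row \<open>s\<close>. Loops of the factors touch no row and are carried along.\<close>

lemma net_stack:
  assumes a: "matching n a" and b: "matching n b" and rst: "r \<noteq> s" "s \<noteq> t" "r \<noteq> t"
  shows "net r t (stack a b) = elims (row s n) (net r s a + net s t b)"
proof -
  define P where "P = edges a <+> edges b"
  define pts where "pts = (\<lambda>p. case p of Inl e \<Rightarrow> vtx r s ` e | Inr f \<Rightarrow> vtx s t ` f)"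
  define M where "M = set (row s n)"
  define wt where "wt = piece_dec a b"
  define C where "C = chains a b"
  define w where "w = (\<lambda>K. \<Sum>p\<in>K. wt p)"
  have finP: "finite P" using a b matchingD(1) by (auto simp: P_def)
  have mid: "(s, j) \<in> pts p \<longleftrightarrow> j \<in> middle p" for j p
    using rst by (cases p) (auto simp: pts_def vtx_mem)
  have midn: "middle p \<subseteq> {1..n}" if "p \<in> P" for p
    using that matchingD(4)[OF a] matchingD(4)[OF b] by (cases p) (force simp: P_def nodes_def)+
  have "links P pts M = glue a b"
  proof -
    have "pts p \<inter> pts q \<inter> M \<noteq> {} \<longleftrightarrow> middle p \<inter> middle q \<noteq> {}" if "p \<in> P" "q \<in> P" for p q
    proof
      assume "pts p \<inter> pts q \<inter> M \<noteq> {}"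
      then obtain j where "(s, j) \<in> pts p" "(s, j) \<in> pts q" by (auto simp: M_def)
      then show "middle p \<inter> middle q \<noteq> {}" by (auto simp: mid)
    next
      assume "middle p \<inter> middle q \<noteq> {}"
      then obtain j where "j \<in> middle p" "j \<in> middle q" by auto
      moreover then have "j \<in> {1..n}" using midn[OF that(1)] by blast
      ultimately have "(s, j) \<in> pts p \<inter> pts q \<inter> M" by (auto simp: mid M_def)
      then show "pts p \<inter> pts q \<inter> M \<noteq> {}" by auto
    qed
    then show ?thesis by (auto simp: links_def glue_def P_def)
  qed
  then have C: "C = comps P pts M" by (simp add: C_def chains_def comps_def P_def)
  have finC: "finite C" by (simp add: C finite_comps finP)
  have part: "partition_on P C" unfolding C by (rule comps_partition)
  have endsK: "\<Union>(pts ` K) - M = vtx r t ` ends K" if "K \<in> C" for K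
  proof -
    have "pts p - M = vtx r t ` outer p" if "p \<in> P" for p
    proof (cases p)
      case (Inl e)
      have m: "\<And>j. South j \<in> e \<Longrightarrow> j \<in> {1..n}" using midn[OF that] by (auto simp: Inl)
      have "x \<in> vtx r s ` e - M \<longleftrightarrow> x \<in> vtx r t ` (e \<inter> range North)" for x
        unfolding M_def set_row using m by (cases x) (auto simp: vtx_mem_iff rst rst[symmetric])
      then have "vtx r s ` e - M = vtx r t ` (e \<inter> range North)" by blast
      then show ?thesis by (simp add: Inl pts_def)
    next
      case (Inr e)
      have m: "\<And>j. North j \<in> e \<Longrightarrow> j \<in> {1..n}" using midn[OF that] by (auto simp: Inr)
      have "x \<in> vtx s t ` e - M \<longleftrightarrow> x \<in> vtx r t ` (e \<inter> range South)" for x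
        unfolding M_def set_row using m by (cases x) (auto simp: vtx_mem_iff rst rst[symmetric])
      then have "vtx s t ` e - M = vtx r t ` (e \<inter> range South)" by blast
      then show ?thesis by (simp add: Inr pts_def)
    qed
    moreover have "K \<subseteq> P" using that part by (auto simp: partition_on_def)
    ultimately have "(\<Union>p\<in>K. pts p - M) = (\<Union>p\<in>K. vtx r t ` outer p)" by (intro SUP_cong) auto
    then show ?thesis by (auto simp: ends_def image_UN)
  qed
  \<comment> \<open>Components with ends become edges of the product, components without ends become
    loops.\<close>
  let ?A = "{K \<in> C. ends K \<noteq> {}}" and ?B = "{K \<in> C. ends K = {}}"
  have inj: "inj_on ends ?A" using ends_stack_inj[OF a b] by (simp add: C_def)
  have st: "stack a b = Diag (ends ` ?A) (\<lambda>e. if e = {} then 0 else \<Sum>K\<in>{K \<in> C. ends K = e}. w K)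
      (loops a + loops b + image_mset w (mset_set ?B))"
    by (auto simp: stack_def Let_def C_def w_def wt_def image_def)
  have decs: "dec (stack a b) (ends K) = w K" if "K \<in> ?A" for K
  proof -
    have "{K' \<in> C. ends K' = ends K} = {K}" using that inj by (auto simp: inj_on_def)
    then show ?thesis using that by (simp add: st)
  qed
  have "edge_net r t (stack a b) = image_mset (\<lambda>e. (vtx r t ` e, dec (stack a b) e)) (mset_set (ends ` ?A))"
    by (simp add: edge_net_def st)
  also have "mset_set (ends ` ?A) = image_mset ends (mset_set ?A)"
    using inj by (simp add: image_mset_mset_set)
  also have "image_mset (\<lambda>e. (vtx r t ` e, dec (stack a b) e)) \<dots> = image_mset (\<lambda>K. (vtx r t ` ends K, w K)) (mset_set ?A)"
    unfolding multiset.map_comp using finC decs by (intro image_mset_cong) simp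
  finally have 1: "edge_net r t (stack a b) = image_mset (\<lambda>K. (vtx r t ` ends K, w K)) (mset_set ?A)" .
  have 2: "loop_net (loops (stack a b)) = loop_net (loops a) + loop_net (loops b)
      + image_mset (\<lambda>K. (vtx r t ` ends K, w K)) (mset_set ?B)"
    using finC by (auto simp: st loop_net_def multiset.map_comp o_def intro!: image_mset_cong)
  have "mset_set C = mset_set ?A + mset_set ?B"
  proof -
    have "?A \<union> ?B = C" "?A \<inter> ?B = {}" by auto
    then show ?thesis using finC mset_set_Union[of ?A ?B] by simp
  qed
  then have "net r t (stack a b) = image_mset (\<lambda>K. (vtx r t ` ends K, w K)) (mset_set C)
       + loop_net (loops a) + loop_net (loops b)"
    by (simp add: net_def 1 2)
  also have "image_mset (\<lambda>K. (vtx r t ` ends K, w K)) (mset_set C)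
      = image_mset (\<lambda>K. (\<Union>(pts ` K) - set (row s n), sum wt K)) (mset_set (comps P pts (set (row s n))))"
    unfolding C[symmetric, unfolded M_def] w_def
    by (rule image_mset_cong) (use finC endsK in \<open>simp add: M_def\<close>)
  also have "\<dots> = elims (row s n) (image_mset (\<lambda>p. (pts p, wt p)) (mset_set P))"
    by (rule comps_elims[OF finP distinct_row])
  also have "image_mset (\<lambda>p. (pts p, wt p)) (mset_set P) = edge_net r s a + edge_net s t b"
  proof -
    have "mset_set P = mset_set (Inl ` edges a) + mset_set (Inr ` edges b)"
      using matchingD(1)[OF a] matchingD(1)[OF b] unfolding P_def Plus_def by (intro mset_set_Union) auto
    also have "\<dots> = image_mset Inl (mset_set (edges a)) + image_mset Inr (mset_set (edges b))"
      by (simp add: image_mset_mset_set)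
    finally show ?thesis by (simp add: multiset.map_comp o_def pts_def wt_def edge_net_def)
  qed
  also have "elims (row s n) (edge_net r s a + edge_net s t b) + loop_net (loops a) + loop_net (loops b)
     = elims (row s n) (net r s a + net s t b)"
  proof -
    have "net r s a + net s t b = (edge_net r s a + edge_net s t b) + (loop_net (loops a) + loop_net (loops b))"
      by (simp add: net_def)
    moreover have "set (row s n) \<inter> verts (loop_net (loops a) + loop_net (loops b)) = {}" by simp
    note elims_add_untouched[OF this, of "edge_net r s a + edge_net s t b"]
    ultimately show ?thesis by (simp only: add.assoc)
  qed
  finally show ?thesis .
qed

text \<open>Holds for every product of diagrams with finitely many edges, before anything is known
  about its nodes, and suffices for \<open>net_inj\<close>.\<close>

definition proper :: "diag \<Rightarrow> bool"
  where "proper d \<longleftrightarrow> finite (edges d) \<and> {} \<notin> edges d \<and> (\<forall>e. e \<notin> edges d \<longrightarrow> dec d e = 0)"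

lemma matching_proper: "matching n d \<Longrightarrow> proper d"
  using matchingD by (simp add: proper_def)

lemma proper_stack:
  assumes "finite (edges a)" "finite (edges b)"
  shows "proper (stack a b)"
proof -
  have "chains a b = comps (edges a <+> edges b) middle UNIV"
    by (simp add: chains_def comps_def glue_def links_def)
  then have "finite (chains a b)" using assms finite_comps by (metis finite_Plus)
  moreover have "edges (stack a b) = ends ` {K \<in> chains a b. ends K \<noteq> {}}"
    by (auto simp: stack_def Let_def)
  moreover have "dec (stack a b) e = 0" if "e \<notin> edges (stack a b)" for e
  proof -
    have "{K \<in> chains a b. ends K = e} = {}" if "e \<noteq> {}" using that \<open>e \<notin> _\<close> by (auto simp: stack_def Let_def)
    then show ?thesis
      by (cases "e = {}") (simp_all only: stack_def Let_def diag.sel if_True if_False sum.empty simp_thms)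
  qed
  ultimately show ?thesis by (auto simp: proper_def)
qed

text \<open>Edges are the entries with vertices, loops those without, and \<open>vtx\<close> is
  injective, so a diagram can be read off its net. Equations between products are proved by
  comparing nets.\<close>

lemma net_inj:
  assumes "proper a" "proper b" "net r s a = net r s b" "r \<noteq> s"
  shows "a = b"
proof -
  have A: "edge_net r s d = {#p \<in># net r s d. fst p \<noteq> {}#}" "loop_net (loops d) = {#p \<in># net r s d. fst p = {}#}"
    if "proper d" for d
  proof -
    have e: "\<forall>p\<in>#edge_net r s d. fst p \<noteq> {}" using that by (auto simp: edge_net_def proper_def)
    have l: "\<forall>p\<in>#loop_net (loops d). fst p = {}" by (auto simp: loop_net_def)
    have 1: "{#p \<in># M. P p#} = M" if "\<forall>p\<in>#M. P p" for M and P :: "(nat \<times> nat) set \<times> nat \<Rightarrow> bool"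
      using that by (simp add: filter_mset_eq_conv)
    have 2: "{#p \<in># M. P p#} = {#}" if "\<forall>p\<in>#M. \<not> P p" for M and P :: "(nat \<times> nat) set \<times> nat \<Rightarrow> bool"
      using that by simp
    show "edge_net r s d = {#p \<in># net r s d. fst p \<noteq> {}#}"
      unfolding net_def filter_union_mset 1[OF e] by (subst 2) (use l in auto)
    show "loop_net (loops d) = {#p \<in># net r s d. fst p = {}#}"
      unfolding net_def filter_union_mset 1[OF l] by (subst 2) (use e in auto)
  qed
  have e: "edge_net r s a = edge_net r s b" and l: "loop_net (loops a) = (loop_net (loops b) :: (nat\<times>nat) net)"
    using A[OF assms(1)] A[OF assms(2)] assms(3) by auto
  have loops: "loops a = loops b"
  proof -
    have "image_mset snd (loop_net L :: (nat \<times> nat) net) = L" for L by (simp add: loop_net_def multiset.map_comp o_def)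
    then show ?thesis using l by metis
  qed
  have sub: "e \<in> edges d' \<and> dec d e = dec d' e"
    if that': "proper d" "proper d'" "edge_net r s d = edge_net r s d'" "e \<in> edges d" for d d' e
  proof -
    have "(vtx r s ` e, dec d e) \<in># edge_net r s d" using that'(1,4) by (auto simp: edge_net_def proper_def)
    then have "(vtx r s ` e, dec d e) \<in># edge_net r s d'" by (simp only: that'(3))
    then obtain e' where "e' \<in> edges d'" "vtx r s ` e = vtx r s ` e'" "dec d e = dec d' e'"
      using that'(2) by (auto simp: edge_net_def proper_def)
    then show ?thesis using inj_vtx[OF assms(4)] by (metis inj_image_eq_iff)
  qed
  have edges: "edges a = edges b" using sub[of a b] sub[of b a] e assms by auto
  have "dec a = dec b"
  proof
    fix x show "dec a x = dec b x"
      using sub[of a b x] assms e edges by (cases "x \<in> edges a") (auto simp: proper_def)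
  qed
  then show ?thesis using loops edges by (metis diag.expand)
qed

section \<open>Identity, inversion and the total number of decorations\<close>

section \<open>Units, inversion\<close>

text \<open>The size of the filtered multiset counts with multiplicity, so two equal entries through
  \<open>v\<close> are excluded as well.\<close>

definition once :: "'v \<Rightarrow> 'v net \<Rightarrow> bool"
  where "once v N \<longleftrightarrow> size {#p \<in># N. v \<in> fst p#} = 1"

lemma once_iff: "once v N \<longleftrightarrow> (\<exists>U w N'. N = add_mset (U, w) N' \<and> v \<in> U \<and> v \<notin> verts N')"
proof
  assume "once v N"
  then obtain p where p: "{#p \<in># N. v \<in> fst p#} = {#p#}" using size_1_singleton_mset unfolding once_def by blast
  have "N = {#p \<in># N. v \<in> fst p#} + {#p \<in># N. v \<notin> fst p#}" by (rule multiset_partition)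
  moreover have "v \<notin> verts {#p \<in># N. v \<notin> fst p#}" by (auto simp: verts_def)
  moreover have "v \<in> fst p" using p by (metis (mono_tags, lifting) filter_mset_eq_conv union_single_eq_member add_mset_add_single empty_neutral(1))
  ultimately show "\<exists>U w N'. N = add_mset (U, w) N' \<and> v \<in> U \<and> v \<notin> verts N'"
    unfolding p by (metis add_mset_add_single prod.collapse union_commute)
next
  assume "\<exists>U w N'. N = add_mset (U, w) N' \<and> v \<in> U \<and> v \<notin> verts N'"
  then obtain U w N' where *: "N = add_mset (U, w) N'" "v \<in> U" "v \<notin> verts N'" by auto
  then have "{#p \<in># N'. v \<in> fst p#} = {#}" by (auto simp: verts_def)
  then show "once v N" using * by (simp add: once_def)
qed

definition relabel :: "('v \<Rightarrow> 'u) \<Rightarrow> 'v net \<Rightarrow> 'u net"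
  where "relabel f N = image_mset (\<lambda>(U, w). (f ` U, w)) N"

lemma relabel_simps [simp]:
  "relabel f {#} = {#}" "relabel f (add_mset (U, w) N) = add_mset (f ` U, w) (relabel f N)"
  "relabel f (A + B) = relabel f A + relabel f B"
  by (auto simp: relabel_def)

lemma relabel_relabel: "relabel g (relabel f N) = relabel (g \<circ> f) N"
  by (simp add: relabel_def multiset.map_comp o_def case_prod_unfold image_image)

lemma relabel_cong: "(\<And>x. x \<in> verts N \<Longrightarrow> f x = g x) \<Longrightarrow> relabel f N = relabel g N"
  unfolding relabel_def
  by (intro image_mset_cong) (force simp: verts_def intro!: image_cong)

lemma relabel_id: "(\<And>x. x \<in> verts N \<Longrightarrow> f x = x) \<Longrightarrow> relabel f N = N"
  using relabel_cong[of N f id] by (auto simp: relabel_def)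

definition verticals :: "nat \<Rightarrow> nat \<Rightarrow> nat list \<Rightarrow> (nat \<times> nat) net"
  where "verticals r s js = mset (map (\<lambda>j. ({(r, j), (s, j)}, 0)) js)"

lemma verticals_simps [simp]:
  "verticals r s [] = {#}" "verticals r s (j # js) = add_mset ({(r, j), (s, j)}, 0) (verticals r s js)"
  by (auto simp: verticals_def)

lemma verts_verticals: "verts (verticals r s js) = {r, s} \<times> set js"
  by (induction js) auto

definition move :: "nat \<Rightarrow> nat \<Rightarrow> nat set \<Rightarrow> nat \<times> nat \<Rightarrow> nat \<times> nat"
  where "move r s J x = (if fst x = s \<and> snd x \<in> J then (r, snd x) else x)"

text \<open>Eliminating the lower end of an undecorated vertical strand only renames the vertex to
  which it is glued. The new names must be free in \<open>D\<close>, lest the renaming identify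
  vertices.\<close>

lemma elims_verticals:
  assumes "distinct js" "r \<noteq> s"
    "\<And>j. j \<in> set js \<Longrightarrow> once (s, j) D" "\<And>j. j \<in> set js \<Longrightarrow> (r, j) \<notin> verts D"
  shows "elims (map (Pair s) js) (verticals r s js + D) = relabel (move r s (set js)) D"
  using assms(1,3,4)
proof (induction js arbitrary: D)
  case Nil
  then show ?case by (simp add: relabel_id move_def)
next
  case (Cons j js)
  obtain U w D' where D: "D = add_mset (U, w) D'" "(s, j) \<in> U" "(s, j) \<notin> verts D'"
    using Cons.prems(2)[of j] by (auto simp: once_iff)
  have j: "j \<notin> set js" using Cons by simp
  have rD: "(r, j) \<notin> verts D" using Cons by simp
  let ?m = "move r s {j}"
  have U': "?m ` U = insert (r, j) (U - {(s, j)})"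
    using D(2) assms(2) by (force simp: move_def image_iff)
  have "relabel ?m D' = D'" using D(3) by (intro relabel_id) (auto simp: move_def)
  then have D1: "relabel ?m D = add_mset (insert (r, j) (U - {(s, j)}), w) D'"
    by (simp add: D(1) U')
  have "elim (s, j) (verticals r s (j # js) + D)
     = elim (s, j) ({#({(r, j), (s, j)}, 0), (U, w)#} + (verticals r s js + D'))"
    by (simp add: D add_mset_commute)
  also have "\<dots> = add_mset (insert (r, j) (U - {(s, j)}), w) (verticals r s js + D')"
    using j D by (subst elim_touched) (auto simp: verts_verticals insert_Diff_if assms(2))
  also have "\<dots> = verticals r s js + relabel ?m D" by (simp add: D1)
  finally have "elims (map (Pair s) (j # js)) (verticals r s (j # js) + D)
     = elims (map (Pair s) js) (verticals r s js + relabel ?m D)" by simp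
  also have "\<dots> = relabel (move r s (set js)) (relabel ?m D)"
  proof (rule Cons.IH)
    show "distinct js" using Cons by simp
    fix i assume i: "i \<in> set js"
    have "once (s, i) D" using i Cons by simp
    then have "size (filter_mset (\<lambda>p. (s, i) \<in> fst p) D) = 1" by (simp add: once_def)
    moreover have "i \<noteq> j" using i j by auto
    ultimately show "once (s, i) (relabel ?m D)" unfolding D1 using D by (auto simp: once_def assms(2) split: if_splits)
    show "(r, i) \<notin> verts (relabel ?m D)" using i \<open>i \<noteq> j\<close> Cons.prems(3)[of i] D D1 by auto
  qed
  also have "\<dots> = relabel (move r s (set (j # js))) D"
    unfolding relabel_relabel using assms(2) by (intro relabel_cong) (auto simp: move_def)
  finally show ?case .
qed

lemma once_net:
  assumes "matching n d" "r \<noteq> s" "v \<in> {r, s} \<times> {1..n}"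
  shows "once v (net r s d)"
proof -
  obtain x where x: "x \<in> nodes n" "v = vtx r s x" using assms(3) vtx_nodes[of r s n] by blast
  have v: "v \<in> vtx r s ` e \<longleftrightarrow> x \<in> e" for e
    using inj_vtx[OF assms(2)] by (simp add: x(2) inj_image_mem_iff)
  obtain e where e: "e \<in> edges d" "x \<in> e" using x(1) matchingD(6)[OF assms(1)] by auto
  have "{f \<in> edges d. x \<in> f} = {e}" using e matchingD(7)[OF assms(1), of e] by blast
  moreover have "{#p \<in># net r s d. v \<in> fst p#} = {#p \<in># edge_net r s d. v \<in> fst p#}"
    by (auto simp: net_def loop_net_def)
  moreover have "size {#p \<in># edge_net r s d. v \<in> fst p#} = size {#e \<in># mset_set (edges d). x \<in> e#}"
    by (simp add: edge_net_def filter_mset_image_mset v o_def)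
  ultimately show ?thesis by (simp add: once_def matchingD(1)[OF assms(1)])
qed

lemma mset_upt: "mset_set {1..n} = mset [1..<Suc n]"
proof -
  have "mset_set (set [1..<Suc n]) = mset [1..<Suc n]" by (rule mset_set_set) simp
  then show ?thesis by (simp add: atLeastLessThanSuc_atLeastAtMost)
qed

lemma edge_net_id: "edge_net r s (id_diag n) = verticals r s [1..<Suc n]"
proof -
  have e: "edges (id_diag n) = (\<lambda>i. {North i, South i}) ` {1..n}" by (auto simp: id_diag_def)
  moreover have "inj_on (\<lambda>i. {North i, South i}) {1..n}" by (auto simp: inj_on_def doubleton_eq_iff)
  ultimately have "mset_set (edges (id_diag n)) = image_mset (\<lambda>i. {North i, South i}) (mset_set {1..n})"
    using image_mset_mset_set[of "\<lambda>i. {North i, South i}" "{1..n}"] by (simp add: e)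
  then have "edge_net r s (id_diag n) = image_mset (\<lambda>i. ({(r, i), (s, i)}, 0)) (mset_set {1..n})"
    by (simp add: edge_net_def multiset.map_comp o_def id_diag_def)
  then show ?thesis unfolding mset_upt verticals_def by simp
qed

lemma net_id: "net r s (id_diag n) = verticals r s [1..<Suc n]"
  by (simp add: net_def edge_net_id) (simp add: loop_net_def id_diag_def)

lemma matching_id: "matching n (id_diag n)"
proof -
  have "edges (id_diag n) = (\<lambda>i. {North i, South i}) ` {1..n}" by (auto simp: id_diag_def)
  then have "partition_on (nodes n) (edges (id_diag n))"
    by (auto simp: partition_on_def disjoint_def nodes_def)
  then show ?thesis by (auto simp: matching_def id_diag_def)
qed

lemma move_vtx: "x \<in> nodes n \<Longrightarrow> s \<noteq> t \<Longrightarrow> move r s {1..n} (vtx s t x) = vtx r t x"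
  by (cases x) (auto simp: move_def nodes_def)

lemma relabel_net:
  assumes "matching n d" "\<And>x. x \<in> nodes n \<Longrightarrow> f (vtx s t x) = vtx r u x"
  shows "relabel f (net s t d) = net r u d"
proof -
  have "relabel f (edge_net s t d) = edge_net r u d"
    unfolding relabel_def edge_net_def multiset.map_comp
  proof (rule image_mset_cong)
    fix e assume "e \<in># mset_set (edges d)"
    then have "e \<subseteq> nodes n" using matchingD[OF assms(1)] by auto
    then show "((\<lambda>(U, w). (f ` U, w)) \<circ> (\<lambda>e. (vtx s t ` e, dec d e))) e = (vtx r u ` e, dec d e)"
      using assms(2) by (force simp: image_image intro: image_cong)
  qed
  moreover have "relabel f (loop_net L) = loop_net L" for L by (simp add: relabel_def loop_net_def multiset.map_comp o_def)
  ultimately show ?thesis by (simp add: net_def)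
qed

lemma elims_id:
  assumes "matching n d" "r \<noteq> s" "s \<noteq> t" "r \<noteq> t"
  shows "elims (row s n) (net r s (id_diag n) + net s t d) = net r t d"
proof -
  have "elims (row s n) (net r s (id_diag n) + net s t d) = relabel (move r s (set [1..<Suc n])) (net s t d)"
    unfolding net_id using assms by (intro elims_verticals) (auto simp: verts_net intro!: once_net)
  also have "\<dots> = net r t d"
    using assms(1,3) move_vtx[of _ n s t r] unfolding set_upt atLeastLessThanSuc_atLeastAtMost
    by (intro relabel_net)
  finally show ?thesis .
qed

lemma stack_id_left: "matching n d \<Longrightarrow> stack (id_diag n) d = d"
  using elims_id[of n d 0 1 2] net_stack[OF matching_id, of n d 0 1 2]
    matchingD(1)[OF matching_id, of n] matchingD(1)[of n d]
  by (intro net_inj[of _ _ 0 2]) (auto simp: matching_proper proper_stack)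

lemma flip_node_flip [simp]: "flip_node (flip_node x) = x"
  by (cases x) auto

lemma inj_flip_node: "inj flip_node"
  by (metis flip_node_flip injI)

lemma image_flip_flip [simp]: "flip_node ` flip_node ` e = e"
  by (simp add: image_image)

lemma flip_nodes: "flip_node ` nodes n = nodes n"
  by (auto simp: nodes_def image_Un image_image)

lemma edges_flip: "e \<in> edges (flip d) \<longleftrightarrow> flip_node ` e \<in> edges d"
  by (auto simp: flip_def image_iff) (metis image_flip_flip)

lemma dec_flip [simp]: "dec (flip d) e = dec d (flip_node ` e)"
  and loops_flip [simp]: "loops (flip d) = loops d"
  by (simp_all add: flip_def)

lemma flip_flip [simp]: "flip (flip d) = d"
  by (simp add: flip_def image_image)

lemma matching_flip: "matching n d \<Longrightarrow> matching n (flip d)"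
proof -
  assume d: "matching n d"
  note d = matchingD[OF d]
  have e: "edges (flip d) = (`) flip_node ` edges d" by (simp add: flip_def)
  have "\<Union>(edges (flip d)) = nodes n" unfolding e by (metis d(6) flip_nodes image_Union)
  moreover have "disjoint (edges (flip d))"
  proof (rule disjointI)
    fix f g assume "f \<in> edges (flip d)" "g \<in> edges (flip d)" "f \<noteq> g"
    then obtain f' g' where "f = flip_node ` f'" "g = flip_node ` g'" "f' \<in> edges d" "g' \<in> edges d" "f' \<noteq> g'"
      by (auto simp: e)
    moreover then have "f' \<inter> g' = {}" using d(7) by blast
    ultimately show "f \<inter> g = {}" by (metis image_Int image_empty inj_flip_node)
  qed
  moreover have "card (flip_node ` f) = card f" for f by (metis card_image inj_flip_node inj_on_subset top_greatest)
  ultimately show ?thesis using d(2,3,5)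
    by (auto simp: matching_def partition_on_def edges_flip) (metis image_flip_flip)+
qed

lemma vtx_flip: "vtx r s ` flip_node ` e = vtx s r ` e"
proof -
  have "vtx r s (flip_node x) = vtx s r x" for x by (cases x) auto
  then show ?thesis by (simp add: image_image)
qed

lemma net_flip: "net r s (flip d) = net s r d"
proof -
  have "inj_on ((`) flip_node) (edges d)" by (metis image_flip_flip inj_onI)
  then have "edge_net r s (flip d) = edge_net s r d"
    by (simp add: edge_net_def flip_def image_mset_mset_set[symmetric] multiset.map_comp o_def vtx_flip)
  then show ?thesis by (simp add: net_def)
qed

lemma finite_edges_flip: "finite (edges d) \<Longrightarrow> finite (edges (flip d))"
  by (simp add: flip_def)

lemma proper_flip: "proper d \<Longrightarrow> proper (flip d)"
  unfolding proper_def by (simp add: finite_edges_flip edges_flip)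

text \<open>By \<open>net_flip\<close> inversion only exchanges the two rows of a net, so both sides
  eliminate the same row from the same net.\<close>

lemma flip_stack:
  assumes "matching n a" "matching n b"
  shows "flip (stack a b) = stack (flip b) (flip a)"
proof (rule net_inj[of _ _ 0 2])
  show "net 0 2 (flip (stack a b)) = net 0 2 (stack (flip b) (flip a))"
  proof -
    have "net 0 2 (stack (flip b) (flip a)) = elims (row 1 n) (net 0 1 (flip b) + net 1 2 (flip a))"
      using assms by (intro net_stack matching_flip) auto
    moreover have "net 2 0 (stack a b) = elims (row 1 n) (net 2 1 a + net 1 0 b)"
      using assms by (intro net_stack) auto
    ultimately show ?thesis by (simp only: net_flip add.commute)
  qed
  show "proper (stack (flip b) (flip a))"
    using assms matchingD(1) finite_edges_flip by (intro proper_stack) blast+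
  show "proper (flip (stack a b))"
    using assms matchingD(1) by (intro proper_flip proper_stack) blast+
qed simp

lemma flip_id [simp]: "flip (id_diag n) = id_diag n"
proof -
  have "edges (id_diag n) = (\<lambda>i. {North i, South i}) ` {1..n}" by (auto simp: id_diag_def)
  then show ?thesis by (simp add: flip_def image_image insert_commute) (simp add: id_diag_def)
qed

lemma stack_id_right: "matching n d \<Longrightarrow> stack d (id_diag n) = d"
  using flip_stack[OF matching_id matching_flip, of n d] stack_id_left[of n "flip d"]
  by (simp add: matching_flip)

lemma total_dec_net: "total_dec d = \<Sum>\<^sub># (image_mset snd (net r s d))"
  by (simp add: total_dec_def net_def edge_net_def loop_net_def multiset.map_comp o_def sum_unfold_sum_mset)

lemma total_dec_stack: "matching n a \<Longrightarrow> matching n b \<Longrightarrow> total_dec (stack a b) = total_dec a + total_dec b"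
proof -
  assume "matching n a" "matching n b"
  then have "net 0 2 (stack a b) = elims (row 1 n) (net 0 1 a + net 1 2 b)" by (rule net_stack) auto
  then show ?thesis
    unfolding total_dec_net[of "stack a b" 0 2] total_dec_net[of a 0 1] total_dec_net[of b 1 2]
    by (simp only: sum_elims image_mset_union sum_mset.union)
qed

section \<open>Planarity and exposure to the left wall under stacking\<close>

section \<open>Diagrams are closed under stacking\<close>

text \<open>Written as an exclusive or, so that crossings can be added modulo 2 in
  \<open>not_crosses_join\<close>.\<close>

definition crosses :: "nat \<Rightarrow> nat \<Rightarrow> nat \<Rightarrow> nat \<Rightarrow> bool"
  where "crosses a b c d \<longleftrightarrow> (min a b < c \<and> c < max a b) \<noteq> (min a b < d \<and> d < max a b)"

text \<open>The invariant of elimination, for nets drawn as arcs over a line with positions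
  \<open>P\<close>. It contains \<open>noncrossing\<close> and \<open>left_exposed\<close>, and also
  that every piece has either no end or two ends.\<close>

definition planar :: "('v \<Rightarrow> nat) \<Rightarrow> 'v net \<Rightarrow> bool"
  where "planar P N \<longleftrightarrow> inj_on P (verts N) \<and> (\<forall>v\<in>verts N. once v N) \<and>
    (\<forall>p\<in>#N. fst p = {} \<or> card (fst p) = 2) \<and>
    (\<forall>p\<in>#N. \<forall>q\<in>#N. \<forall>a\<in>fst p. \<forall>b\<in>fst p. \<forall>c\<in>fst q. \<forall>d\<in>fst q.
      {a, b} \<inter> {c, d} = {} \<longrightarrow> \<not> crosses (P a) (P b) (P c) (P d)) \<and>
    (\<forall>p\<in>#N. \<forall>q\<in>#N. \<forall>c\<in>fst q. \<forall>d\<in>fst q. fst p \<noteq> {} \<and> snd p > 0 \<longrightarrow>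
      \<not> (\<forall>x\<in>fst p. P c < P x \<and> P x < P d))"

lemma once_add_mset: "once v (add_mset p N) \<longleftrightarrow> (if v \<in> fst p then v \<notin> verts N else once v N)"
  by (auto simp: once_def verts_def)

text \<open>A point outside the gap from \<open>x\<close> to \<open>y\<close> lies under the joined
  arc \<open>a\<close>-\<open>b\<close> iff it lies under exactly one of the arcs
  \<open>x\<close>-\<open>a\<close> and \<open>y\<close>-\<open>b\<close>. So crossings with
  \<open>c\<close>-\<open>d\<close> add modulo 2.\<close>

lemma not_crosses_join:
  assumes "x < y" "\<And>z. z \<in> {a, b, c, d} \<Longrightarrow> z < x \<or> y < z" "\<not> crosses x a c d" "\<not> crosses y b c d"
    "a \<noteq> c" "a \<noteq> d" "b \<noteq> c" "b \<noteq> d"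
  shows "\<not> crosses a b c d"
proof -
  have between: "(min a b < z \<and> z < max a b) \<longleftrightarrow> ((min x a < z \<and> z < max x a) \<noteq> (min y b < z \<and> z < max y b))"
    if "z < x \<or> y < z" "z \<noteq> a" "z \<noteq> b" for z
    using that assms(1) assms(2)[of a] assms(2)[of b]
    by (cases "x \<le> a"; cases "y \<le> b"; cases "a \<le> b") (auto simp: min_def max_def)
  show ?thesis
    using between[of c] between[of d] assms(2)[of c] assms(2)[of d] assms(3-8) unfolding crosses_def by auto
qed

lemma crosses_commute: "a \<noteq> c \<Longrightarrow> a \<noteq> d \<Longrightarrow> b \<noteq> c \<Longrightarrow> b \<noteq> d \<Longrightarrow> crosses a b c d = crosses c d a b"
  by (cases "a \<le> b"; cases "c \<le> d") (auto simp: crosses_def min_def max_def)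

text \<open>Here \<open>s\<close> and \<open>t\<close> are the ends of a decorated arc. If the
  joined arc covered \<open>s\<close>, one of the two old arcs would cover \<open>s\<close>, and
  since it does not cross \<open>s\<close>-\<open>t\<close> it would cover \<open>t\<close> as
  well.\<close>

lemma not_covers_join:
  fixes a b s t x y :: nat
  assumes "x < y" "s < x \<or> y < s" "t < x \<or> y < t" "\<not> crosses x a s t" "\<not> crosses y b s t"
    "\<not> (x < s \<and> s < a \<and> x < t \<and> t < a)" "\<not> (a < s \<and> s < x \<and> a < t \<and> t < x)"
    "\<not> (y < s \<and> s < b \<and> y < t \<and> t < b)" "\<not> (b < s \<and> s < y \<and> b < t \<and> t < y)"
  shows "\<not> (a < s \<and> s < b \<and> a < t \<and> t < b)" "\<not> (b < s \<and> s < a \<and> b < t \<and> t < a)"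
proof -
  have within: "p < s \<and> s < q \<longrightarrow> p < t \<and> t < q" "p < t \<and> t < q \<longrightarrow> p < s \<and> s < q"
    if "\<not> crosses p q s t \<or> \<not> crosses q p s t" for p q
    using that by (auto simp: crosses_def min_def max_def)
  note xa = within[of a x] within[of x a] and yb = within[of b y] within[of y b]
  show "\<not> (a < s \<and> s < b \<and> a < t \<and> t < b)"
  proof
    assume *: "a < s \<and> s < b \<and> a < t \<and> t < b"
    show False
    proof (cases "s < x")
      case True
      then show False using * xa(1) assms(4,7) by simp
    next
      case False
      then have "y < s" using assms(2) by simp
      then show False using * yb(3) assms(5,8) by simp
    qed
  qed
  show "\<not> (b < s \<and> s < a \<and> b < t \<and> t < a)"
  proof
    assume *: "b < s \<and> s < a \<and> b < t \<and> t < a"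
    show False
    proof (cases "s < x")
      case True
      then have "s < y" using assms(1) by simp
      then show False using * yb(1) assms(5,9) by simp
    next
      case False
      then have "x < s" using assms(1,2) by simp
      then show False using * xa(3) assms(4,6) by simp
    qed
  qed
qed

lemma planar_subset:
  assumes "planar P (add_mset p N)"
  shows "planar P N"
proof -
  have "once v N" if "v \<in> verts N" for v
    using assms that unfolding planar_def by (auto simp: once_add_mset split: if_splits)
  then show ?thesis using assms unfolding planar_def by (auto intro: inj_on_subset)
qed

lemma planar_add_empty: "planar P N \<Longrightarrow> planar P (add_mset ({}, w) N)"
  unfolding planar_def by (auto simp: once_add_mset)

text \<open>Joining two neighbours by an undecorated piece either closes an arc to a loop or fuses
  the arcs at \<open>x\<close> and \<open>y\<close>. No vertex lies between \<open>x\<close> and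
  \<open>y\<close>, so nothing can cross the new connection.\<close>

lemma planar_contract:
  assumes pl: "planar P N" and xy: "x \<in> verts N" "y \<in> verts N" "P x < P y"
    and adj: "\<And>z. z \<in> verts N \<Longrightarrow> P z \<le> P x \<or> P y \<le> P z"
  shows "planar P (elims [x, y] (add_mset ({x, y}, 0) N))"
proof -
  have inj: "inj_on P (verts N)" and once: "\<And>v. v \<in> verts N \<Longrightarrow> once v N"
    and card: "\<And>p. p \<in># N \<Longrightarrow> fst p = {} \<or> card (fst p) = 2"
    and nc: "\<And>p q a b c d. p \<in># N \<Longrightarrow> q \<in># N \<Longrightarrow> a \<in> fst p \<Longrightarrow> b \<in> fst p \<Longrightarrow> c \<in> fst q \<Longrightarrow> d \<in> fst q
      \<Longrightarrow> {a, b} \<inter> {c, d} = {} \<Longrightarrow> \<not> crosses (P a) (P b) (P c) (P d)"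
    and ex: "\<And>p q c d. p \<in># N \<Longrightarrow> q \<in># N \<Longrightarrow> c \<in> fst q \<Longrightarrow> d \<in> fst q \<Longrightarrow> fst p \<noteq> {} \<Longrightarrow> snd p > 0
      \<Longrightarrow> \<not> (\<forall>x\<in>fst p. P c < P x \<and> P x < P d)"
    using pl unfolding planar_def by blast+
  have neq: "x \<noteq> y" using xy by auto
  obtain A w N1 where N1: "N = add_mset (A, w) N1" "x \<in> A" "x \<notin> verts N1"
    using once[OF xy(1)] by (auto simp: once_iff)
  have "card A = 2" using card[of "(A, w)"] N1 by auto
  then obtain a where A: "A = {x, a}" "a \<noteq> x" using N1(2) by (auto simp: card_2_iff)
  have onceN1: "once v N1 \<and> v \<notin> A" if "v \<in> verts N1" for v
    using once[of v] that N1 by (auto simp: once_add_mset split: if_splits)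
  show ?thesis
  proof (cases "a = y")
    \<comment> \<open>The arc starting at \<open>x\<close> ends at \<open>y\<close> and closes up to
      a loop.\<close>
    case True
    then have y: "y \<notin> verts N1" using onceN1 A by auto
    have "elim x (add_mset ({x, y}, 0) N) = add_mset ({y}, w) N1"
      using elim_touched[of "{#({x, y}, 0), (A, w)#}" x N1] N1 A True neq by (auto simp: add_mset_commute insert_Diff_if)
    moreover have "elim y (add_mset ({y}, w) N1) = add_mset ({}, w) N1"
      using elim_touched[of "{#({y}, w)#}" y N1] y by auto
    moreover have "planar P N1" using planar_subset[of P "(A, w)" N1] pl N1(1) by simp
    ultimately show ?thesis using planar_add_empty[of P N1 w] by simp
  next
    case False
    then have "y \<in> verts N1" using xy N1 A neq by auto
    then obtain B u N2 where N2: "N1 = add_mset (B, u) N2" "y \<in> B" "y \<notin> verts N2"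
      using onceN1[of y] by (auto simp: once_iff)
    have "card B = 2" using card[of "(B, u)"] N1 N2 by auto
    then obtain b where B: "B = {y, b}" "b \<noteq> y" using N2(2) by (auto simp: card_2_iff)
    have onceN2: "once v N2 \<and> v \<notin> A \<and> v \<notin> B" if "v \<in> verts N2" for v
      using onceN1[of v] that N2 by (auto simp: once_add_mset split: if_splits)
    have ab: "a \<noteq> b" "x \<noteq> b" using onceN1[of b] N2 B A N1 by auto
    have NN: "N = add_mset ({x, a}, w) (add_mset ({y, b}, u) N2)" using N1 N2 A B by simp
    have "elim x (add_mset ({x, y}, 0) N) = add_mset ({y, a}, w) (add_mset ({y, b}, u) N2)"
      using elim_touched[of "{#({x, y}, 0), (A, w)#}" x N1] N1 N2 A B False neq
      by (auto simp: add_mset_commute insert_Diff_if insert_commute)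
    moreover have "elim y (add_mset ({y, a}, w) (add_mset ({y, b}, u) N2)) = add_mset ({a, b}, w + u) N2"
      using elim_touched[of "{#({y, a}, w), ({y, b}, u)#}" y N2] N2 A B False neq
      by (auto simp: add_mset_commute insert_Diff_if insert_commute)
    ultimately have res: "elims [x, y] (add_mset ({x, y}, 0) N) = add_mset ({a, b}, w + u) N2" by simp
    have vN: "verts N = {x, a, y, b} \<union> verts N2" by (auto simp: NN)
    have disj: "a \<notin> verts N2" "b \<notin> verts N2" "x \<notin> verts N2" "y \<notin> verts N2"
      using onceN2 A B by auto
    have adj': "P z < P x \<or> P y < P z" if "z \<in> verts N" "z \<noteq> x" "z \<noteq> y" for z
      using adj[OF that(1)] inj_onD[OF inj _ that(1), of x] inj_onD[OF inj _ that(1), of y] xy that by force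
    have aN: "a \<in> verts N" "b \<in> verts N" and N2N: "verts N2 \<subseteq> verts N" by (auto simp: vN)
    have inj': "P s \<noteq> P t" if "s \<in> verts N" "t \<in> verts N" "s \<noteq> t" for s t
      using inj that by (auto dest: inj_onD)
    have cd: "\<not> crosses (P x) (P a) (P c) (P d)" "\<not> crosses (P y) (P b) (P c) (P d)" "\<not> crosses (P a) (P b) (P c) (P d)"
      if q: "q \<in># N2" "c \<in> fst q" "d \<in> fst q" for q c d
    proof -
      have v: "c \<in> verts N2" "d \<in> verts N2" using q by (auto simp: verts_def)
      have ne: "c \<notin> {a, b, x, y}" "d \<notin> {a, b, x, y}" using disj v by auto
      show 1: "\<not> crosses (P x) (P a) (P c) (P d)" using nc[of "({x, a}, w)" q x a c d] q ne by (auto simp: NN)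
      show 2: "\<not> crosses (P y) (P b) (P c) (P d)" using nc[of "({y, b}, u)" q y b c d] q ne by (auto simp: NN)
      show "\<not> crosses (P a) (P b) (P c) (P d)"
        using adj' aN v N2N ne A B False ab inj' by (intro not_crosses_join[OF xy(3) _ 1 2]) auto
    qed
    have dist: "P s \<noteq> P t" if "s \<in> {a, b, x, y}" "q \<in># N2" "t \<in> fst q" for s t q
    proof -
      have "t \<in> verts N2" using that by (auto simp: verts_def)
      then show ?thesis using that disj aN xy N2N by (intro inj') auto
    qed
    have side: "P c < P x \<or> P y < P c" if "q \<in># N2" "c \<in> fst q" for q c
    proof -
      have "c \<in> verts N2" using that by (auto simp: verts_def)
      then show ?thesis using adj'[of c] disj N2N by auto
    qed
    have "planar P (add_mset ({a, b}, w + u) N2)"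
      unfolding planar_def
    proof (intro conjI)
      show "inj_on P (verts (add_mset ({a, b}, w + u) N2))"
        using vN by (intro inj_on_subset[OF inj]) auto
      show "\<forall>v\<in>verts (add_mset ({a, b}, w + u) N2). once v (add_mset ({a, b}, w + u) N2)"
        using onceN2 disj by (auto simp: once_add_mset)
      show "\<forall>p\<in>#add_mset ({a, b}, w + u) N2. fst p = {} \<or> card (fst p) = 2"
        using card ab by (auto simp: NN)
      show "\<forall>p\<in>#add_mset ({a, b}, w + u) N2. \<forall>q\<in>#add_mset ({a, b}, w + u) N2. \<forall>s\<in>fst p. \<forall>t\<in>fst p. \<forall>c\<in>fst q. \<forall>d\<in>fst q.
         {s, t} \<inter> {c, d} = {} \<longrightarrow> \<not> crosses (P s) (P t) (P c) (P d)"
      proof (intro ballI impI)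
        fix p q s t c d
        assume p: "p \<in># add_mset ({a, b}, w + u) N2" "s \<in> fst p" "t \<in> fst p"
          and q: "q \<in># add_mset ({a, b}, w + u) N2" "c \<in> fst q" "d \<in> fst q" and st: "{s, t} \<inter> {c, d} = {}"
        have triv: "\<not> crosses (P s) (P t) (P c) (P c)" "\<not> crosses (P s) (P s) (P c) (P d)" for s t c d
          by (auto simp: crosses_def)
        have sym: "crosses (P a) (P b) (P c) (P d) = crosses (P b) (P a) (P c) (P d)"
          "crosses (P c) (P d) (P a) (P b) = crosses (P c) (P d) (P b) (P a)" for a b c d
          by (auto simp: crosses_def min.commute max.commute)
        consider "p = ({a, b}, w + u)" "q = ({a, b}, w + u)" | "p = ({a, b}, w + u)" "q \<in># N2"
          | "p \<in># N2" "q = ({a, b}, w + u)" | "p \<in># N2" "q \<in># N2" using p q by auto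
        then show "\<not> crosses (P s) (P t) (P c) (P d)"
        proof cases
          case 1
          then show ?thesis using p q st triv by auto
        next
          case 2
          then show ?thesis using p q cd[of q c d] triv sym(1)[of a b c d] by auto
        next
          case 3
          have "\<not> crosses (P s) (P t) (P a) (P b)"
            using crosses_commute[of "P a" "P s" "P t" "P b"] dist 3 p cd(3)[of p s t] by auto
          then show ?thesis using 3 q triv sym(2)[of s t a b] by auto
        next
          case 4
          then show ?thesis using nc[of p q s t c d] p q st by (auto simp: NN)
        qed
      qed
      show "\<forall>p\<in>#add_mset ({a, b}, w + u) N2. \<forall>q\<in>#add_mset ({a, b}, w + u) N2. \<forall>c\<in>fst q. \<forall>d\<in>fst q.
         fst p \<noteq> {} \<and> snd p > 0 \<longrightarrow> \<not> (\<forall>x\<in>fst p. P c < P x \<and> P x < P d)"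
      proof (intro ballI impI notI)
        fix p q c d
        assume p: "p \<in># add_mset ({a, b}, w + u) N2" "fst p \<noteq> {} \<and> snd p > 0"
          and q: "q \<in># add_mset ({a, b}, w + u) N2" "c \<in> fst q" "d \<in> fst q"
          and cov: "\<forall>x\<in>fst p. P c < P x \<and> P x < P d"
        show False
        proof (cases "p \<in># N2")
          case False
          then have p': "p = ({a, b}, w + u)" using p by auto
          then have q2: "q \<in># N2" using q cov by auto
          have c: "P c < P a" "P a < P d" "P c < P b" "P b < P d" using cov p' by auto
          \<comment> \<open>An arc that covers \<open>a\<close> and does not cross
            \<open>x\<close>-\<open>a\<close> covers \<open>x\<close> too. So the old arc was
            already covered and carried no decoration; the same holds for
            \<open>y\<close>-\<open>b\<close>.\<close>
          have "P c < P x \<and> P x < P d"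
            using cd(1)[OF q2 q(2,3)] crosses_commute[of "P x" "P c" "P d" "P a"] dist[OF _ q2 q(2)] dist[OF _ q2 q(3)] c
            by (auto simp: crosses_def min_def max_def split: if_splits)
          then have "w = 0" using ex[of "({x, a}, w)" q c d] q q2 c by (auto simp: NN)
          moreover have "P c < P y \<and> P y < P d"
            using cd(2)[OF q2 q(2,3)] crosses_commute[of "P y" "P c" "P d" "P b"] dist[OF _ q2 q(2)] dist[OF _ q2 q(3)] c
            by (auto simp: crosses_def min_def max_def split: if_splits)
          then have "u = 0" using ex[of "({y, b}, u)" q c d] q q2 c by (auto simp: NN)
          ultimately show False using p p' by simp
        next
          case True
          show False
          proof (cases "q \<in># N2")
            case True
            then show False using ex[of p q c d] p q cov \<open>p \<in># N2\<close> by (auto simp: NN)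
          next
            case False
            then have q': "q = ({a, b}, w + u)" using q by auto
            obtain s where s: "s \<in> fst p" using p by auto
            have "card (fst p) = 2" using card[of p] p True by (auto simp: NN)
            then obtain s1 t1 where "fst p = {s1, t1}" unfolding card_2_iff by blast
            then have "fst p = {s, if s = s1 then t1 else s1}" using s by auto
            then obtain t where t: "fst p = {s, t}" by blast
            have c1: "P c < P s" "P s < P d" "P c < P t" "P t < P d" using cov t by auto
            have "\<not> crosses (P x) (P a) (P s) (P t)" "\<not> crosses (P y) (P b) (P s) (P t)"
              using cd[OF True, of s t] t by auto
            moreover have "\<not> (P x < P s \<and> P s < P a \<and> P x < P t \<and> P t < P a)" "\<not> (P a < P s \<and> P s < P x \<and> P a < P t \<and> P t < P x)"
              using ex[of p "({x, a}, w)" x a] ex[of p "({x, a}, w)" a x] p True t by (auto simp: NN)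
            moreover have "\<not> (P y < P s \<and> P s < P b \<and> P y < P t \<and> P t < P b)" "\<not> (P b < P s \<and> P s < P y \<and> P b < P t \<and> P t < P y)"
              using ex[of p "({y, b}, u)" y b] ex[of p "({y, b}, u)" b y] p True t by (auto simp: NN)
            moreover have "P s < P x \<or> P y < P s" "P t < P x \<or> P y < P t" using side[OF True] t by auto
            ultimately have "\<not> (P a < P s \<and> P s < P b \<and> P a < P t \<and> P t < P b)"
              "\<not> (P b < P s \<and> P s < P a \<and> P b < P t \<and> P t < P a)"
              using not_covers_join[OF xy(3)] by blast+
            moreover have "(c = a \<and> d = b) \<or> (c = b \<and> d = a)" using q q' c1 by auto
            ultimately show False using c1 by blast
          qed
        qed
      qed
    qed
    then show ?thesis by (simp only: res)
  qed
qed

text \<open>Rows 0 and 1 belong to the upper diagram, rows 2 and 3 to the lower one. Positions in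
  row 1 count down from 2n and those in row 2 count up from 2n + 1, so the two copies of the first
  middle node are neighbours, and those of the next node once these are gone. On rows 0 and 3 the
  order is that of \<open>pos\<close>.\<close>

definition posn :: "nat \<Rightarrow> nat \<times> nat \<Rightarrow> nat"
  where "posn n = (\<lambda>(r, i). if r = 0 then i else if r = 1 then 2 * n + 1 - i
    else if r = 2 then 2 * n + i else 4 * n + 1 - i)"

text \<open>Columns up to \<open>k\<close> have been contracted already, hence the vertices of rows
  1 and 2 in column k + 1 are neighbours and \<open>planar_contract\<close> applies.\<close>

lemma planar_pairs:
  assumes "k \<le> n" "planar (posn n) N" "verts N = {0, 3} \<times> {1..n} \<union> {1, 2} \<times> {Suc k..n}"
  shows "planar (posn n) (elims (concat (map (\<lambda>j. [(1, j), (2, j)]) [Suc k..<Suc n])) (verticals 1 2 [Suc k..<Suc n] + N))"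
  using assms
proof (induction k arbitrary: N rule: inc_induct)
  case (step k)
  let ?x = "(1, Suc k)" and ?y = "(2, Suc k)"
  let ?N = "elims [?x, ?y] (add_mset ({?x, ?y}, 0) N)"
  have k: "Suc k < Suc n" using step by simp
  have "elims [?x, ?y] (verticals 1 2 [Suc k..<Suc n] + N)
     = elims [?x, ?y] (add_mset ({?x, ?y}, 0) N + verticals 1 2 [Suc (Suc k)..<Suc n])"
    by (simp add: upt_conv_Cons[OF k] add.commute del: fold.simps)
  also have "\<dots> = verticals 1 2 [Suc (Suc k)..<Suc n] + ?N"
    by (subst elims_add_untouched) (auto simp: verts_verticals)
  finally have 1: "elims [?x, ?y] (verticals 1 2 [Suc k..<Suc n] + N) = verticals 1 2 [Suc (Suc k)..<Suc n] + ?N" .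
  have "planar (posn n) ?N"
  proof (rule planar_contract[OF step.prems(1)])
    fix z assume "z \<in> verts N"
    then show "posn n z \<le> posn n ?x \<or> posn n ?y \<le> posn n z"
      using k by (cases z) (auto simp: step.prems(2) posn_def)
  qed (use k in \<open>auto simp: step.prems(2) posn_def\<close>)
  moreover have "verts ?N = {0, 3} \<times> {1..n} \<union> {1, 2} \<times> {Suc (Suc k)..n}"
    using k by (auto simp: verts_elims step.prems(2) simp del: fold.simps)
  ultimately have "planar (posn n) (elims (concat (map (\<lambda>j. [(1, j), (2, j)]) [Suc (Suc k)..<Suc n]))
      (verticals 1 2 [Suc (Suc k)..<Suc n] + ?N))"
    by (rule step.IH)
  then have "planar (posn n) (elims ([?x, ?y] @ concat (map (\<lambda>j. [(1, j), (2, j)]) [Suc (Suc k)..<Suc n]))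
      (verticals 1 2 [Suc k..<Suc n] + N))"
    by (simp only: 1 fold_append o_def)
  then show ?case by (simp add: upt_conv_Cons[OF k])
qed (simp add: upt_Suc)

lemma diagrams_iff:
  "d \<in> diagrams n \<longleftrightarrow> matching n d \<and> noncrossing n (edges d) \<and>
    (\<forall>e\<in>edges d. dec d e > 0 \<longrightarrow> left_exposed n (edges d) e) \<and>
    (cups d = {} \<longrightarrow> (\<forall>e\<in>edges d. dec d e = 0) \<and> (\<forall>k\<in>#loops d. k = 0))"
proof -
  have "card (cups d) = 0 \<longleftrightarrow> cups d = {}" if "matching n d"
    using matchingD(1)[OF that] by (auto simp: cups_def)
  then show ?thesis unfolding diagrams_def matching_def by auto
qed

lemma diagrams_matching: "d \<in> diagrams n \<Longrightarrow> matching n d"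
  by (simp add: diagrams_iff)

lemma pos_inj: "x \<in> nodes n \<Longrightarrow> y \<in> nodes n \<Longrightarrow> pos n x = pos n y \<Longrightarrow> x = y"
  by (cases x; cases y) (auto simp: nodes_def)

text \<open>Only the order of the positions matters, so one criterion serves the two factors and
  their product inside the common numbering \<open>posn\<close>.\<close>

lemma planar_net_iff:
  assumes P: "\<And>x y. x \<in> nodes n \<Longrightarrow> y \<in> nodes n \<Longrightarrow> P (vtx r s x) < P (vtx r s y) \<longleftrightarrow> pos n x < pos n y"
    and rs: "r \<noteq> s" and d: "matching n d"
  shows "planar P (net r s d) \<longleftrightarrow> noncrossing n (edges d) \<and> (\<forall>e\<in>edges d. dec d e > 0 \<longrightarrow> left_exposed n (edges d) e)"
proof -
  have fin: "finite (edges d)" using d matchingD by blast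
  have mem: "p \<in># net r s d \<longleftrightarrow> (\<exists>e\<in>edges d. p = (vtx r s ` e, dec d e)) \<or> (\<exists>k\<in>#loops d. p = ({}, k))" for p
    using fin by (auto simp: net_def edge_net_def loop_net_def)
  have Pinj: "P (vtx r s x) = P (vtx r s y) \<Longrightarrow> x = y" if "x \<in> nodes n" "y \<in> nodes n" for x y
    using P[OF that] P[OF that(2,1)] pos_inj[OF that] by (metis less_irrefl linorder_less_linear)
  have 1: "inj_on P (verts (net r s d))"
    unfolding verts_net[OF d] vtx_nodes[symmetric] by (rule inj_onI) (use Pinj in blast)
  have 2: "\<forall>v\<in>verts (net r s d). once v (net r s d)"
    using once_net[OF d rs] by (simp add: verts_net[OF d])
  have 3: "\<forall>p\<in>#net r s d. fst p = {} \<or> card (fst p) = 2"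
    using matchingD(5)[OF d] inj_on_subset[OF inj_vtx[OF rs]] by (auto simp: mem card_image)
  have nod: "x \<in> e \<Longrightarrow> e \<in> edges d \<Longrightarrow> x \<in> nodes n" for x e using matchingD(4)[OF d] by auto
  have 4: "(\<forall>p\<in>#net r s d. \<forall>q\<in>#net r s d. \<forall>a\<in>fst p. \<forall>b\<in>fst p. \<forall>c\<in>fst q. \<forall>d\<in>fst q.
      {a, b} \<inter> {c, d} = {} \<longrightarrow> \<not> crosses (P a) (P b) (P c) (P d)) \<longleftrightarrow> noncrossing n (edges d)" (is "?L = ?R")
  proof
    assume L: ?L
    show ?R unfolding noncrossing_def
    proof (intro ballI notI)
      fix e f a b c g assume *: "e \<in> edges d" "f \<in> edges d" "a \<in> e" "b \<in> e" "c \<in> f" "g \<in> f"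
        "pos n a < pos n c \<and> pos n c < pos n b \<and> pos n b < pos n g"
      have ne: "a \<noteq> c" "a \<noteq> g" "b \<noteq> c" "b \<noteq> g" using * by auto
      let ?v = "vtx r s"
      have m: "(?v ` e, dec d e) \<in># net r s d" "(?v ` f, dec d f) \<in># net r s d" using * by (auto simp: mem)
      have "{?v a, ?v b} \<inter> {?v c, ?v g} = {}" using ne inj_vtx[OF rs] by (auto dest: injD)
      then have "\<not> crosses (P (?v a)) (P (?v b)) (P (?v c)) (P (?v g))"
        using L[rule_format, OF m, of "?v a" "?v b" "?v c" "?v g"] * by auto
      moreover have "P (?v a) < P (?v c)" "P (?v c) < P (?v b)" "P (?v b) < P (?v g)"
        using P nod * by auto
      ultimately show False by (auto simp: crosses_def)
    qed
  next
    assume R: ?R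
    show ?L
    proof (intro ballI impI notI)
      fix p q a b c g assume *: "p \<in># net r s d" "q \<in># net r s d" "a \<in> fst p" "b \<in> fst p" "c \<in> fst q" "g \<in> fst q"
         "{a, b} \<inter> {c, g} = {}" "crosses (P a) (P b) (P c) (P g)"
      obtain e where e: "e \<in> edges d" "fst p = vtx r s ` e" using * by (auto simp: mem)
      obtain f where f: "f \<in> edges d" "fst q = vtx r s ` f" using * by (auto simp: mem)
      obtain a' b' c' g' where v: "a = vtx r s a'" "b = vtx r s b'" "c = vtx r s c'" "g = vtx r s g'"
         "a' \<in> e" "b' \<in> e" "c' \<in> f" "g' \<in> f" using * e f by auto
      note nn = nod[OF v(5) e(1)] nod[OF v(6) e(1)] nod[OF v(7) f(1)] nod[OF v(8) f(1)]
      have ne: "a' \<noteq> c'" "a' \<noteq> g'" "b' \<noteq> c'" "b' \<noteq> g'" using * v by auto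
      then have pne: "pos n a' \<noteq> pos n c'" "pos n a' \<noteq> pos n g'" "pos n b' \<noteq> pos n c'" "pos n b' \<noteq> pos n g'"
        using pos_inj nn by blast+
      have nc1: "\<not> (pos n x < pos n z \<and> pos n z < pos n y \<and> pos n y < pos n u)" if "x \<in> e" "y \<in> e" "z \<in> f" "u \<in> f" for x y z u
        using R e f that unfolding noncrossing_def by blast
      have nc2: "\<not> (pos n z < pos n x \<and> pos n x < pos n u \<and> pos n u < pos n y)" if "x \<in> e" "y \<in> e" "z \<in> f" "u \<in> f" for x y z u
        using R e f that unfolding noncrossing_def by blast
      have "crosses (pos n a') (pos n b') (pos n c') (pos n g')"
      proof -
        have "(min (P (vtx r s x)) (P (vtx r s y)) < P (vtx r s z) \<and> P (vtx r s z) < max (P (vtx r s x)) (P (vtx r s y)))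
           \<longleftrightarrow> (min (pos n x) (pos n y) < pos n z \<and> pos n z < max (pos n x) (pos n y))"
          if "x \<in> nodes n" "y \<in> nodes n" "z \<in> nodes n" for x y z
          using P that by (simp add: min_less_iff_disj less_max_iff_disj)
        then show ?thesis using *(8) nn unfolding crosses_def v by blast
      qed
      \<comment> \<open>Crossing does not say which end of an arc is the left one; the eight
        instances cover all namings.\<close>
      then show False
        using nc1[OF v(5,6,7,8)] nc1[OF v(6,5,7,8)] nc1[OF v(5,6,8,7)] nc1[OF v(6,5,8,7)]
          nc2[OF v(5,6,7,8)] nc2[OF v(6,5,7,8)] nc2[OF v(5,6,8,7)] nc2[OF v(6,5,8,7)] pne
        unfolding crosses_def min_def max_def by (auto split: if_splits)
    qed
  qed
  have 5: "(\<forall>p\<in>#net r s d. \<forall>q\<in>#net r s d. \<forall>c\<in>fst q. \<forall>g\<in>fst q. fst p \<noteq> {} \<and> snd p > 0 \<longrightarrow>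
      \<not> (\<forall>x\<in>fst p. P c < P x \<and> P x < P g)) \<longleftrightarrow> (\<forall>e\<in>edges d. dec d e > 0 \<longrightarrow> left_exposed n (edges d) e)" (is "?L = ?R")
  proof -
    have iff: "(\<forall>x\<in>vtx r s ` e. P (vtx r s c) < P x \<and> P x < P (vtx r s g)) \<longleftrightarrow> (\<forall>x\<in>e. pos n c < pos n x \<and> pos n x < pos n g)"
      if "e \<in> edges d" "f \<in> edges d" "c \<in> f" "g \<in> f" for e f c g
      using P nod that by auto
    have ne: "e \<in> edges d \<Longrightarrow> e \<noteq> {}" for e using matchingD(2)[OF d] by auto
    show ?thesis
    proof
      assume L: ?L
      show ?R unfolding left_exposed_def
      proof (intro ballI impI notI)
        fix e assume e: "e \<in> edges d" "0 < dec d e" "\<exists>f\<in>edges d. \<exists>c\<in>f. \<exists>g\<in>f. \<forall>x\<in>e. pos n c < pos n x \<and> pos n x < pos n g"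
        then obtain f c g where f: "f \<in> edges d" "c \<in> f" "g \<in> f" "\<forall>x\<in>e. pos n c < pos n x \<and> pos n x < pos n g" by blast
        have "\<forall>x\<in>vtx r s ` e. P (vtx r s c) < P x \<and> P x < P (vtx r s g)" using f iff[OF e(1) f(1-3)] by blast
        then show False
          using L[rule_format, of "(vtx r s ` e, dec d e)" "(vtx r s ` f, dec d f)" "vtx r s c" "vtx r s g"] e f ne
          by (auto simp: mem)
      qed
    next
      assume R: ?R
      show ?L
      proof (intro ballI impI notI)
        fix p q c g assume *: "p \<in># net r s d" "q \<in># net r s d" "c \<in> fst q" "g \<in> fst q" "fst p \<noteq> {} \<and> 0 < snd p"
          "\<forall>x\<in>fst p. P c < P x \<and> P x < P g"
        obtain e where e: "e \<in> edges d" "p = (vtx r s ` e, dec d e)" using *(1,5) by (auto simp: mem)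
        obtain f where f: "f \<in> edges d" "fst q = vtx r s ` f" using *(2,3) by (auto simp: mem)
        obtain c' g' where v: "c = vtx r s c'" "g = vtx r s g'" "c' \<in> f" "g' \<in> f" using * f by auto
        have "\<forall>x\<in>e. pos n c' < pos n x \<and> pos n x < pos n g'" using *(6) iff[OF e(1) f(1) v(3,4)] e(2) v(1,2) by simp
        moreover have "left_exposed n (edges d) e" using R e *(5) by simp
        ultimately show False using f(1) v(3,4) unfolding left_exposed_def by blast
      qed
    qed
  qed
  show ?thesis unfolding planar_def 4 5 using 1 2 3 by simp
qed

text \<open>Two nets placed side by side: arcs over disjoint intervals neither cross nor cover each
  other.\<close>

lemma planar_add_disjoint:
  assumes "planar P A" "planar P B" "\<And>x y. x \<in> verts A \<Longrightarrow> y \<in> verts B \<Longrightarrow> P x < P y"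
  shows "planar P (A + B)"
proof -
  have dis: "verts A \<inter> verts B = {}" using assms(3) by fastforce
  have onceA: "once v (A + B)" if "v \<in> verts A" for v
  proof -
    have "v \<notin> verts B" using that dis by blast
    then have "{#p \<in># B. v \<in> fst p#} = {#}" by (auto simp: verts_def)
    then show ?thesis using assms(1) that by (simp add: once_def planar_def)
  qed
  have onceB: "once v (A + B)" if "v \<in> verts B" for v
  proof -
    have "v \<notin> verts A" using that dis by blast
    then have "{#p \<in># A. v \<in> fst p#} = {#}" by (auto simp: verts_def)
    then show ?thesis using assms(2) that by (simp add: once_def planar_def)
  qed
  have vA: "x \<in> fst p \<Longrightarrow> p \<in># A \<Longrightarrow> x \<in> verts A" and vB: "x \<in> fst p \<Longrightarrow> p \<in># B \<Longrightarrow> x \<in> verts B" for x p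
    by (auto simp: verts_def)
  show ?thesis unfolding planar_def
  proof (intro conjI)
    have "P x \<noteq> P y" if "x \<in> verts A" "y \<in> verts B" for x y using assms(3)[OF that] by simp
    then show "inj_on P (verts (A + B))"
      using assms(1,2) unfolding planar_def inj_on_def verts_simps by (metis UnE)
    show "\<forall>v\<in>verts (A + B). once v (A + B)" using onceA onceB by auto
    show "\<forall>p\<in>#A + B. fst p = {} \<or> card (fst p) = 2" using assms(1,2) unfolding planar_def by auto
    show "\<forall>p\<in>#A + B. \<forall>q\<in>#A + B. \<forall>a\<in>fst p. \<forall>b\<in>fst p. \<forall>c\<in>fst q. \<forall>d\<in>fst q.
         {a, b} \<inter> {c, d} = {} \<longrightarrow> \<not> crosses (P a) (P b) (P c) (P d)"
    proof (intro ballI impI)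
      fix p q a b c d assume *: "p \<in># A + B" "q \<in># A + B" "a \<in> fst p" "b \<in> fst p" "c \<in> fst q" "d \<in> fst q" "{a, b} \<inter> {c, d} = {}"
      consider "p \<in># A" "q \<in># A" | "p \<in># B" "q \<in># B" | "p \<in># A" "q \<in># B" | "p \<in># B" "q \<in># A" using * by auto
      then show "\<not> crosses (P a) (P b) (P c) (P d)"
      proof cases
        case 1 then show ?thesis using * assms(1) unfolding planar_def by blast
      next
        case 2 then show ?thesis using * assms(2) unfolding planar_def by blast
      next
        case 3
        then have "P a < P c" "P a < P d" "P b < P c" "P b < P d" using * vA vB assms(3) by blast+
        then show ?thesis by (auto simp: crosses_def)
      next
        case 4
        then have "P c < P a" "P d < P a" "P c < P b" "P d < P b" using * vA vB assms(3) by blast+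
        then show ?thesis by (auto simp: crosses_def)
      qed
    qed
    show "\<forall>p\<in>#A + B. \<forall>q\<in>#A + B. \<forall>c\<in>fst q. \<forall>d\<in>fst q. fst p \<noteq> {} \<and> 0 < snd p \<longrightarrow>
       \<not> (\<forall>x\<in>fst p. P c < P x \<and> P x < P d)"
    proof (intro ballI impI notI)
      fix p q c d assume *: "p \<in># A + B" "q \<in># A + B" "c \<in> fst q" "d \<in> fst q" "fst p \<noteq> {} \<and> 0 < snd p"
         "\<forall>x\<in>fst p. P c < P x \<and> P x < P d"
      obtain x where x: "x \<in> fst p" using * by auto
      consider "p \<in># A" "q \<in># A" | "p \<in># B" "q \<in># B" | "p \<in># A" "q \<in># B" | "p \<in># B" "q \<in># A" using * by auto
      then show False
      proof cases
        case 1 then show ?thesis using * assms(1) unfolding planar_def by blast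
      next
        case 2 then show ?thesis using * assms(2) unfolding planar_def by blast
      next
        case 3
        then have "P x < P c" using x * vA vB assms(3) by blast
        then show ?thesis using x * by fastforce
      next
        case 4
        then have "P d < P x" using x * vA vB assms(3) by blast
        then show ?thesis using x * by fastforce
      qed
    qed
  qed
qed

lemma net_mem_iff:
  assumes "finite (edges d)" "r \<noteq> s" "e \<noteq> {}"
  shows "(vtx r s ` e, w) \<in># net r s d \<longleftrightarrow> e \<in> edges d \<and> dec d e = w"
proof -
  have *: "vtx r s ` e = vtx r s ` f \<longleftrightarrow> e = f" for f using inj_vtx[OF assms(2)] by (simp add: inj_image_eq_iff)
  show ?thesis using assms(1,3) by (auto simp: net_def edge_net_def loop_net_def *)
qed

lemma net_mem_elims:
  assumes "p \<in># N" "fst p \<inter> set xs = {}"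
  shows "p \<in># elims xs N"
proof -
  obtain N' where N: "N = N' + {#p#}" using assms(1) by (metis add_mset_add_single mset_add)
  have "elims xs N = elims xs N' + {#p#}" unfolding N using assms(2) by (intro elims_add_untouched) auto
  then show ?thesis by simp
qed

lemma vtx_north: "e \<subseteq> range North \<Longrightarrow> vtx r s ` e = vtx r t ` e"
  by (intro image_cong) auto

text \<open>An edge inside the top row meets no eliminated vertex, so it survives together with its
  decorations.\<close>

lemma edges_stack_north:
  assumes "matching n a" "matching n b" "e \<in> edges a" "e \<subseteq> range North"
  shows "e \<in> edges (stack a b)" "dec (stack a b) e = dec a e"
proof -
  have ne: "e \<noteq> {}" using matchingD(2)[OF assms(1)] assms(3) by auto
  have "(vtx 0 1 ` e, dec a e) \<in># net 0 1 a"
    using net_mem_iff[of a 0 1 e "dec a e"] ne assms matchingD(1) by simp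
  then have "(vtx 0 2 ` e, dec a e) \<in># net 0 1 a + net 1 2 b"
    using vtx_north[OF assms(4), of 0 1 2] by simp
  then have "(vtx 0 2 ` e, dec a e) \<in># elims (row 1 n) (net 0 1 a + net 1 2 b)"
    using assms(4) by (intro net_mem_elims) auto
  then have "(vtx 0 2 ` e, dec a e) \<in># net 0 2 (stack a b)"
    using net_stack[OF assms(1,2), of 0 1 2] by simp
  moreover have "finite (edges (stack a b))"
    using proper_stack assms matchingD(1) unfolding proper_def by metis
  ultimately show "e \<in> edges (stack a b)" "dec (stack a b) e = dec a e"
    using net_mem_iff[of "stack a b" 0 2 e "dec a e"] ne by simp_all
qed

lemma edges_stack_south:
  assumes "matching n a" "matching n b" "e \<in> edges b" "e \<subseteq> range South"
  shows "e \<in> edges (stack a b)" "dec (stack a b) e = dec b e"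
proof -
  have "flip_node ` e \<in> edges (flip b)" using assms by (simp add: edges_flip)
  moreover have "flip_node ` e \<subseteq> range North" using assms(4) by auto
  ultimately have "flip_node ` e \<in> edges (stack (flip b) (flip a))"
    "dec (stack (flip b) (flip a)) (flip_node ` e) = dec (flip b) (flip_node ` e)"
    using edges_stack_north[OF matching_flip matching_flip, OF assms(2,1)] by blast+
  then show "e \<in> edges (stack a b)" "dec (stack a b) e = dec b e"
    by (simp_all add: flip_stack[OF assms(1,2), symmetric] edges_flip)
qed

lemma planar_stack:
  assumes "a \<in> diagrams n" "b \<in> diagrams n"
  shows "planar (posn n) (net 0 3 (stack a b))" "verts (net 0 3 (stack a b)) = {0, 3} \<times> {1..n}"
proof -
  have ma: "matching n a" and mb: "matching n b" using assms diagrams_matching by auto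
  let ?N = "net 0 1 a + net 2 3 b"
  have pa: "planar (posn n) (net 0 1 a)"
  proof (subst planar_net_iff[of n])
    show "posn n (vtx 0 1 x) < posn n (vtx 0 1 y) \<longleftrightarrow> pos n x < pos n y" if "x \<in> nodes n" "y \<in> nodes n" for x y
      using that by (cases x; cases y) (auto simp: posn_def nodes_def)
  qed (use assms ma in \<open>auto simp: diagrams_iff\<close>)
  have pb: "planar (posn n) (net 2 3 b)"
  proof (subst planar_net_iff[of n])
    show "posn n (vtx 2 3 x) < posn n (vtx 2 3 y) \<longleftrightarrow> pos n x < pos n y" if "x \<in> nodes n" "y \<in> nodes n" for x y
      using that by (cases x; cases y) (auto simp: posn_def nodes_def)
  qed (use assms mb in \<open>auto simp: diagrams_iff\<close>)
  have plN: "planar (posn n) ?N"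
    using ma mb by (intro planar_add_disjoint pa pb) (auto simp: verts_net posn_def)
  have vN: "verts ?N = {0, 3} \<times> {1..n} \<union> {1, 2} \<times> {Suc 0..n}" using ma mb by (auto simp: verts_net)
  let ?L = "concat (map (\<lambda>j. [(1, j), (2, j)]) [Suc 0..<Suc n])" and ?D = "verticals 1 2 [1..<Suc n] + ?N"
  have "elims (row 1 n) (net 0 1 a + net 1 2 (id_diag n)) = net 0 2 (stack a (id_diag n))"
    using ma matching_id by (intro net_stack[symmetric]) auto
  then have r: "elims (row 1 n) (net 0 1 a + net 1 2 (id_diag n)) = net 0 2 a" by (simp only: stack_id_right[OF ma])
  \<comment> \<open>Column by column is the order that preserves planarity; row by row is the order
    in which the net is recognised as that of the product.\<close>
  have "elims ?L ?D = elims (row 1 n @ row 2 n) ?D"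
  proof (rule elims_cong)
    show "distinct (concat (map (\<lambda>j. [(1::nat, j), (2, j)]) [Suc 0..<Suc n]))"
      by (rule distinct_concat) (auto simp: distinct_map inj_on_def)
    show "distinct (row 1 n @ row 2 n)" by (auto simp: distinct_map inj_on_def)
  qed auto
  also have "\<dots> = elims (row 2 n) (elims (row 1 n) ((net 0 1 a + net 1 2 (id_diag n)) + net 2 3 b))"
    by (simp add: net_id ac_simps)
  also have "elims (row 1 n) ((net 0 1 a + net 1 2 (id_diag n)) + net 2 3 b) = net 0 2 a + net 2 3 b"
    unfolding r[symmetric] using mb by (intro elims_add_untouched) (auto simp: verts_net)
  also have "elims (row 2 n) (net 0 2 a + net 2 3 b) = net 0 3 (stack a b)"
    using ma mb by (intro net_stack[symmetric]) auto
  finally have eq: "elims ?L ?D = net 0 3 (stack a b)" .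
  show "planar (posn n) (net 0 3 (stack a b))"
    unfolding eq[symmetric] using planar_pairs[OF _ plN vN] by simp
  show "verts (net 0 3 (stack a b)) = {0, 3} \<times> {1..n}"
    unfolding eq[symmetric] verts_elims by (simp add: verts_verticals verts_net[OF ma] verts_net[OF mb]) auto
qed

text \<open>That edges of a product have two nodes and are disjoint is read off from
  \<open>planar\<close>, whose clauses on \<open>card\<close> and \<open>once\<close> say this for
  the net.\<close>

lemma matching_stack:
  assumes "a \<in> diagrams n" "b \<in> diagrams n"
  shows "matching n (stack a b)"
proof -
  let ?D = "stack a b" and ?v = "vtx 0 3"
  have pr: "proper ?D" using assms matchingD(1) diagrams_matching by (intro proper_stack) blast+
  note pl = planar_stack[OF assms]
  have inj: "inj ?v" by (rule inj_vtx) simp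
  have fin: "finite (edges ?D)" using pr by (simp add: proper_def)
  have mem: "(?v ` e, dec ?D e) \<in># net 0 3 ?D" "e \<noteq> {}" if "e \<in> edges ?D" for e
    using that pr net_mem_iff[OF fin, of 0 3 e "dec ?D e"] by (auto simp: proper_def)
  have "?v ` \<Union>(edges ?D) = ?v ` nodes n"
    using pl(2) verts_edge_net[OF fin, of 0 3] by (simp add: net_def vtx_nodes)
  then have un: "\<Union>(edges ?D) = nodes n" using inj by (simp add: inj_image_eq_iff)
  have card: "card e = 2" if "e \<in> edges ?D" for e
  proof -
    have "?v ` e = {} \<or> card (?v ` e) = 2" using pl(1) mem[OF that] unfolding planar_def by force
    then show ?thesis using mem[OF that] inj by (auto simp: card_image inj_on_subset)
  qed
  have "e = f" if "e \<in> edges ?D" "f \<in> edges ?D" "x \<in> e" "x \<in> f" for e f x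
  proof (rule ccontr)
    assume ne: "e \<noteq> f"
    have "?v x \<in> verts (net 0 3 ?D)" using that mem[of e] by (force simp: verts_def)
    then have "once (?v x) (net 0 3 ?D)" using pl(1) by (simp add: planar_def)
    then have 1: "size {#p \<in># edge_net 0 3 ?D. ?v x \<in> fst p#} = 1" 
    proof -
      have "{#p \<in># loop_net (loops ?D). ?v x \<in> fst p#} = {#}" by (auto simp: loop_net_def)
      then show ?thesis using \<open>once _ _\<close> unfolding once_def net_def filter_union_mset by (metis add.right_neutral)
    qed
    have "size {#p \<in># edge_net 0 3 ?D. ?v x \<in> fst p#} = card {g \<in> edges ?D. ?v x \<in> ?v ` g}"
      using fin by (simp add: edge_net_def filter_mset_image_mset o_def)
    moreover have "card {e, f} \<le> card {g \<in> edges ?D. ?v x \<in> ?v ` g}"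
      using fin that by (intro card_mono) auto
    ultimately show False using ne 1 by simp
  qed
  then show ?thesis using un card pr unfolding matching_def partition_on_def disjoint_def proper_def by blast
qed

text \<open>Both sides eliminate rows 1 and 2 from the same net on four rows, in opposite
  orders.\<close>

lemma stack_assoc:
  assumes "a \<in> diagrams n" "b \<in> diagrams n" "c \<in> diagrams n"
  shows "stack (stack a b) c = stack a (stack b c)"
proof -
  have m: "matching n a" "matching n b" "matching n c" "matching n (stack a b)" "matching n (stack b c)"
    using assms by (auto intro: matching_stack diagrams_matching)
  have "net 0 3 (stack (stack a b) c) = elims (row 2 n) (net 0 2 (stack a b) + net 2 3 c)"
    using m by (intro net_stack) auto
  also have "net 0 2 (stack a b) = elims (row 1 n) (net 0 1 a + net 1 2 b)"
    using m by (intro net_stack) auto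
  also have "\<dots> + net 2 3 c = elims (row 1 n) (net 0 1 a + net 1 2 b + net 2 3 c)"
    using m by (intro elims_add_untouched[symmetric]) (auto simp: verts_net)
  finally have 1: "net 0 3 (stack (stack a b) c) = elims (row 1 n @ row 2 n) (net 0 1 a + net 1 2 b + net 2 3 c)"
    by simp
  have "net 0 3 (stack a (stack b c)) = elims (row 1 n) (net 0 1 a + net 1 3 (stack b c))"
    using m by (intro net_stack) auto
  also have "net 1 3 (stack b c) = elims (row 2 n) (net 1 2 b + net 2 3 c)"
    using m by (intro net_stack) auto
  also have "net 0 1 a + \<dots> = elims (row 2 n) (net 1 2 b + net 2 3 c + net 0 1 a)"
    using m by (subst elims_add_untouched[of _ "net 0 1 a"]) (auto simp: verts_net add.commute)
  also have "net 1 2 b + net 2 3 c + net 0 1 a = net 0 1 a + net 1 2 b + net 2 3 c" by (simp add: ac_simps)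
  finally have "net 0 3 (stack a (stack b c)) = elims (row 2 n @ row 1 n) (net 0 1 a + net 1 2 b + net 2 3 c)"
    by simp
  also have "\<dots> = elims (row 1 n @ row 2 n) (net 0 1 a + net 1 2 b + net 2 3 c)"
    by (rule elims_perm) simp
  finally have "net 0 3 (stack (stack a b) c) = net 0 3 (stack a (stack b c))" using 1 by simp
  moreover have "proper (stack (stack a b) c)" "proper (stack a (stack b c))"
    using m matchingD(1) by (blast intro: proper_stack)+
  ultimately show ?thesis by (intro net_inj[of _ _ 0 3]) auto
qed

section \<open>Propagating edges; closure of diagrams under stacking and inversion\<close>

section \<open>Propagating edges\<close>

lemma diagramsI:
  assumes "matching n d" "noncrossing n (edges d)"
    "\<And>e. e \<in> edges d \<Longrightarrow> 0 < dec d e \<Longrightarrow> left_exposed n (edges d) e"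
    "cups d = {} \<Longrightarrow> (\<forall>e\<in>edges d. dec d e = 0) \<and> (\<forall>k\<in>#loops d. k = 0)"
  shows "d \<in> diagrams n"
  using assms unfolding diagrams_iff by blast

lemma diagramsD:
  assumes "d \<in> diagrams n"
  shows "matching n d" "noncrossing n (edges d)"
    "\<And>e. e \<in> edges d \<Longrightarrow> 0 < dec d e \<Longrightarrow> left_exposed n (edges d) e"
    "\<And>e. cups d = {} \<Longrightarrow> e \<in> edges d \<Longrightarrow> dec d e = 0"
    "\<And>k. cups d = {} \<Longrightarrow> k \<in># loops d \<Longrightarrow> k = 0"
  using assms unfolding diagrams_iff by blast+

lemma map_sorted_list_of_set:
  assumes "finite A" "strict_mono_on A (f :: nat \<Rightarrow> nat)"
  shows "map f (sorted_list_of_set A) = sorted_list_of_set (f ` A)"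
proof -
  have "sorted_wrt (<) (map f (sorted_list_of_set A))"
    unfolding sorted_wrt_map
    by (rule sorted_wrt_mono_rel[of _ "(<)"]) (use assms strict_sorted_list_of_set in \<open>auto simp: strict_mono_on_def\<close>)
  moreover have "set (map f (sorted_list_of_set A)) = f ` A" using assms(1) by simp
  ultimately show ?thesis
    using assms(1) by (metis finite_imageI sorted_list_of_set.idem_if_sorted_distinct strict_sorted_iff)
qed

lemma noncrossingD:
  assumes "noncrossing n E" "e \<in> E" "f \<in> E" "a \<in> e" "b \<in> e" "c \<in> f" "d \<in> f"
    "pos n a < pos n c" "pos n c < pos n b"
  shows "\<not> pos n b < pos n d"
  using assms unfolding noncrossing_def by blast

lemma edge_cases:
  assumes "matching n d" "e \<in> edges d"
  obtains (cup) i j where "e = {North i, North j}" "i < j" "i \<in> {1..n}" "j \<in> {1..n}"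
  | (cap) i j where "e = {South i, South j}" "i < j" "i \<in> {1..n}" "j \<in> {1..n}"
  | (thru) i j where "e = {North i, South j}" "i \<in> {1..n}" "j \<in> {1..n}"
proof -
  obtain x y where e: "e = {x, y}" "x \<noteq> y" using matchingD(5)[OF assms] by (auto simp: card_2_iff)
  have "x \<in> nodes n" "y \<in> nodes n" using matchingD(4)[OF assms] e by auto
  then consider i j where "x = North i" "y = North j" "i \<in> {1..n}" "j \<in> {1..n}" 
    | i j where "x = South i" "y = South j" "i \<in> {1..n}" "j \<in> {1..n}"
    | i j where "x = North i" "y = South j" "i \<in> {1..n}" "j \<in> {1..n}"
    | i j where "x = South i" "y = North j" "i \<in> {1..n}" "j \<in> {1..n}"
    by (auto simp: nodes_def)
  then show ?thesis
  proof cases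
    case (1 i j)
    then show ?thesis using e cup[of i j] cup[of j i] by (cases "i < j") (auto simp: insert_commute)
  next
    case (2 i j)
    then show ?thesis using e cap[of i j] cap[of j i] by (cases "i < j") (auto simp: insert_commute)
  next
    case 3 then show ?thesis using e thru by blast
  next
    case 4 then show ?thesis using e thru by (metis insert_commute)
  qed
qed

definition partner :: "diag \<Rightarrow> nat \<Rightarrow> nat"
  where "partner d i = (THE j. {North i, South j} \<in> edges d)"

definition props :: "diag \<Rightarrow> nat set"
  where "props d = {i. \<exists>j. {North i, South j} \<in> edges d}"

lemma partner_eq:
  assumes "matching n d" "{North i, South j} \<in> edges d"
  shows "partner d i = j"
  unfolding partner_def
proof (rule the_equality)
  fix k assume "{North i, South k} \<in> edges d"
  then show "k = j" using matchingD(7)[OF assms(1) assms(2), of "{North i, South k}"] by (auto simp: doubleton_eq_iff)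
qed (rule assms(2))

text \<open>Propagating edges whose lower ends came in the opposite order would cross.\<close>

lemma partner_mono:
  assumes "d \<in> diagrams n"
  shows "strict_mono_on (props d) (partner d)"
proof (rule strict_mono_onI)
  fix i i' assume "i \<in> props d" "i' \<in> props d" and less: "i < i'"
  then obtain j j' where e: "{North i, South j} \<in> edges d" "{North i', South j'} \<in> edges d" by (auto simp: props_def)
  have m: "matching n d" using assms diagrams_matching by auto
  have nod: "{North i, South j, North i', South j'} \<subseteq> nodes n" using matchingD(4)[OF m] e by auto
  have "j \<noteq> j'" using matchingD(7)[OF m e] less by (auto simp: doubleton_eq_iff)
  moreover have "\<not> (pos n (North i) < pos n (North i') \<and> pos n (North i') < pos n (South j) \<and> pos n (South j) < pos n (South j'))"
    using noncrossingD[OF _ e, of n "North i" "South j" "North i'" "South j'"] assms by (auto simp: diagrams_iff)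
  ultimately have "j < j'" using less nod by (auto simp: nodes_def)
  then show "partner d i < partner d i'" using partner_eq[OF m] e by simp
qed

lemma partner_edge: "matching n d \<Longrightarrow> i \<in> props d \<Longrightarrow> {North i, South (partner d i)} \<in> edges d"
  using partner_eq by (fastforce simp: props_def)

text \<open>Without cups all upper nodes propagate, and an increasing map of \<open>{1..n}\<close>
  into itself is the identity.\<close>

lemma no_cups_id:
  assumes d: "d \<in> diagrams n" and "cups d = {}"
  shows "edges d = edges (id_diag n)"
proof -
  have m: "matching n d" using d diagrams_matching by auto
  have p: "props d = {1..n}"
  proof -
    have "i \<in> props d" if "i \<in> {1..n}" for i
    proof -
      have "North i \<in> nodes n" using that by (auto simp: nodes_def)
      then obtain e where e: "e \<in> edges d" "North i \<in> e" using matchingD(6)[OF m] by auto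
      have nocup: "{North k, North l} \<notin> edges d" for k l
      proof
        assume "{North k, North l} \<in> edges d"
        then have "{North k, North l} \<in> cups d" by (simp add: cups_def)
        then show False using assms(2) by blast
      qed
      from m e(1) show ?thesis
      proof (cases rule: edge_cases)
        case (cup k l) then show ?thesis using e nocup by blast
      next
        case (cap k l) then show ?thesis using e by auto
      next
        case (thru k l) then show ?thesis using e by (auto simp: props_def)
      qed
    qed
    moreover have "i \<in> {1..n}" if "i \<in> props d" for i
      using matchingD(4)[OF m partner_edge[OF m that]] by (auto simp: nodes_def)
    ultimately show ?thesis by blast
  qed
  have sub: "partner d ` {1..n} \<subseteq> {1..n}"
  proof
    fix j assume "j \<in> partner d ` {1..n}"
    then obtain i where "i \<in> props d" "j = partner d i" using p by auto
    then show "j \<in> {1..n}" using matchingD(4)[OF m partner_edge[OF m, of i]] by (auto simp: nodes_def)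
  qed
  have mono: "strict_mono_on {1..n} (partner d)" using partner_mono[OF d] p by simp
  then have "card (partner d ` {1..n}) = card {1..n}" using card_image strict_mono_on_imp_inj_on by blast
  then have "partner d ` {1..n} = {1..n}" using sub by (simp add: card_subset_eq)
  then have "map (partner d) (sorted_list_of_set {1..n}) = map id (sorted_list_of_set {1..n})"
    using map_sorted_list_of_set[OF _ mono] by simp
  then have id: "partner d i = i" if "i \<in> {1..n}" for i
    using that unfolding map_eq_conv by simp
  have sub': "edges (id_diag n) \<subseteq> edges d"
    using partner_edge[OF m] id p by (auto simp: id_diag_def)
  moreover have "e \<in> edges (id_diag n)" if e: "e \<in> edges d" for e
  proof -
    obtain x where x: "x \<in> e" using matchingD(2)[OF m] e by fastforce
    then have "x \<in> \<Union>(edges (id_diag n))" using matchingD(4)[OF m e] matchingD(6)[OF matching_id] by auto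
    then obtain f where "f \<in> edges (id_diag n)" "x \<in> f" by auto
    then show ?thesis using matchingD(7)[OF m e, of f] sub' x by blast
  qed
  ultimately show ?thesis by blast
qed

text \<open>Diagrams without cups have this form and affect a product only through their loops.
  Needed for the condition that diagrams without cups be undecorated.\<close>

lemma stack_id_loops:
  assumes b: "matching n b"
  shows "stack (Diag (edges (id_diag n)) (\<lambda>_. 0) L) b = Diag (edges b) (dec b) (L + loops b)"
proof -
  let ?a = "Diag (edges (id_diag n)) (\<lambda>_. 0) L"
  have a: "matching n ?a" using matching_id[of n] by (simp add: matching_def id_diag_def)
  have na: "net 0 1 ?a = net 0 1 (id_diag n) + loop_net L"
  proof -
    have "edge_net 0 1 ?a = edge_net 0 1 (id_diag n)" "loops (id_diag n) = {#}"
      by (simp_all add: edge_net_def id_diag_def)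
    then show ?thesis by (simp add: net_def loop_net_def del: One_nat_def)
  qed
  have "net 0 2 (stack ?a b) = elims (row 1 n) (net 0 1 ?a + net 1 2 b)"
    using a b by (intro net_stack) auto
  also have "net 0 1 ?a + net 1 2 b = (net 0 1 (id_diag n) + net 1 2 b) + loop_net L"
    unfolding na by (simp only: ac_simps)
  also have "elims (row 1 n) \<dots> = net 0 2 b + loop_net L"
  proof -
    have "elims (row 1 n) (net 0 1 (id_diag n) + net 1 2 b) = net 0 2 b" using b by (intro elims_id) auto
    then show ?thesis by (simp only: elims_add_untouched verts_loop_net Int_empty_right)
  qed
  also have "\<dots> = net 0 2 (Diag (edges b) (dec b) (L + loops b))"
    by (simp add: net_def edge_net_def loop_net_def)
  finally show ?thesis
    using proper_stack[of ?a b] matchingD(1)[OF a] matchingD(1)[OF b] matching_proper[OF b]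
    by (intro net_inj[of _ _ 0 2]) (auto simp: proper_def)
qed

lemma diag_eq_iff: "a = b \<longleftrightarrow> edges a = edges b \<and> dec a = dec b \<and> loops a = loops b"
  by (cases a; cases b) auto

lemma diagrams_stack:
  assumes a: "a \<in> diagrams n" and b: "b \<in> diagrams n"
  shows "stack a b \<in> diagrams n"
proof -
  have m: "matching n (stack a b)" by (rule matching_stack[OF assms])
  have ma: "matching n a" and mb: "matching n b" using assms diagrams_matching by auto
  have "noncrossing n (edges (stack a b)) \<and> (\<forall>e\<in>edges (stack a b). 0 < dec (stack a b) e \<longrightarrow> left_exposed n (edges (stack a b)) e)"
  proof (subst planar_net_iff[symmetric, of n "posn n" 0 3])
    show "posn n (vtx 0 3 x) < posn n (vtx 0 3 y) \<longleftrightarrow> pos n x < pos n y" if "x \<in> nodes n" "y \<in> nodes n" for x y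
      using that by (cases x; cases y) (auto simp: posn_def nodes_def)
  qed (use m planar_stack[OF assms] in auto)
  \<comment> \<open>Cups of \<open>a\<close> survive in the product. So \<open>a\<close> has none
    and is an identity with loops, which leaves \<open>b\<close> unchanged up to loops; then
    \<open>b\<close> has no cups either, and nothing is decorated.\<close>
  moreover have "(\<forall>e\<in>edges (stack a b). dec (stack a b) e = 0) \<and> (\<forall>k\<in>#loops (stack a b). k = 0)"
    if "cups (stack a b) = {}"
  proof -
    have "cups a = {}" 
    proof (rule equals0I)
      fix e assume "e \<in> cups a"
      then have "e \<in> edges (stack a b)" "e \<subseteq> range North"
        using edges_stack_north(1)[OF ma mb, of e] by (simp_all add: cups_def)
      then have "e \<in> cups (stack a b)" by (simp add: cups_def)
      then show False using that by simp
    qed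
    moreover have "cups a = {} \<longrightarrow> (\<forall>e\<in>edges a. dec a e = 0) \<and> (\<forall>k\<in>#loops a. k = 0)"
      using a unfolding diagrams_iff by (elim conjE)
    ultimately have ea: "edges a = edges (id_diag n)" and da: "\<forall>e\<in>edges a. dec a e = 0" and la: "\<forall>k\<in>#loops a. k = 0"
      using no_cups_id[OF a] by simp_all
    have "dec a = (\<lambda>_. 0)" using matchingD(3)[OF ma] da by (intro ext) metis
    then have "a = Diag (edges (id_diag n)) (\<lambda>_. 0) (loops a)"
      using ea by (simp add: diag_eq_iff)
    then have s: "stack a b = Diag (edges b) (dec b) (loops a + loops b)"
      using stack_id_loops[OF mb, of "loops a"] by simp
    then have "cups b = {}" using that by (simp add: cups_def)
    moreover have "cups b = {} \<longrightarrow> (\<forall>e\<in>edges b. dec b e = 0) \<and> (\<forall>k\<in>#loops b. k = 0)"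
      using b unfolding diagrams_iff by (elim conjE)
    ultimately show ?thesis using la by (auto simp: s)
  qed
  ultimately show ?thesis using m by (intro diagramsI) blast+
qed

lemma diagrams_id: "id_diag n \<in> diagrams n"
  unfolding diagrams_iff by (auto simp: matching_id noncrossing_def) (auto simp: id_diag_def)

lemma left_exposed_flip:
  assumes "\<Union>E \<subseteq> nodes n" "e \<in> E" "left_exposed n E e" "E' = (`) flip_node ` E"
  shows "left_exposed n E' (flip_node ` e)"
  unfolding left_exposed_def
proof
  assume "\<exists>f\<in>E'. \<exists>c\<in>f. \<exists>d\<in>f. \<forall>x\<in>flip_node ` e. pos n c < pos n x \<and> pos n x < pos n d"
  then obtain f c d where f: "f \<in> E" "c \<in> f" "d \<in> f"
    "\<forall>x\<in>e. pos n (flip_node c) < pos n (flip_node x) \<and> pos n (flip_node x) < pos n (flip_node d)"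
    using assms(4) by auto
  have "pos n (flip_node x) < pos n (flip_node y) \<longleftrightarrow> pos n y < pos n x" if "x \<in> nodes n" "y \<in> nodes n" for x y
    using that by (cases x; cases y) (auto simp: nodes_def)
  then have "\<forall>x\<in>e. pos n d < pos n x \<and> pos n x < pos n c" using f assms(1,2) by blast
  then show False using f assms(3) unfolding left_exposed_def by blast
qed

text \<open>Each upper node lies on a cup or on a propagating edge. This turns statements about the
  number of propagating edges into counting cups.\<close>

lemma card_cups:
  assumes "matching n d"
  shows "n = 2 * card (cups d) + card (props d)"
proof -
  note d = matchingD[OF assms]
  have fin: "finite (cups d)" using d(1) by (simp add: cups_def)
  have "card (\<Union>(cups d)) = (\<Sum>e\<in>cups d. card e)"
  proof (rule card_Union_disjoint)
    show "pairwise disjnt (cups d)"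
      unfolding pairwise_def disjnt_def cups_def using d(7) by blast
    show "finite e" if "e \<in> cups d" for e
      using that d(5)[of e] by (intro card_ge_0_finite) (auto simp: cups_def)
  qed
  also have "\<dots> = (\<Sum>e\<in>cups d. 2)" using d(5) by (intro sum.cong) (auto simp: cups_def)
  finally have 1: "card (\<Union>(cups d)) = 2 * card (cups d)" by simp
  have 2: "North ` {1..n} = \<Union>(cups d) \<union> North ` props d"
  proof (intro equalityI subsetI)
    fix x assume "x \<in> North ` {1..n}"
    then have x: "x \<in> range North" "x \<in> nodes n" by (auto simp: nodes_def)
    then obtain e where e: "e \<in> edges d" "x \<in> e" using d(6) by blast
    from assms e(1) show "x \<in> \<Union>(cups d) \<union> North ` props d"
    proof (cases rule: edge_cases)
      case (cup k l)
      then have "e \<in> cups d" using e(1) by (auto simp: cups_def)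
      then show ?thesis using e(2) by blast
    next
      case (cap k l) then show ?thesis using e x by auto
    next
      case (thru k l)
      then have "k \<in> props d" using e(1) by (auto simp: props_def)
      then show ?thesis using thru e(2) x(1) by auto
    qed
  next
    fix x assume "x \<in> \<Union>(cups d) \<union> North ` props d"
    then have "x \<in> range North" "x \<in> \<Union>(edges d)" by (auto simp: cups_def props_def)
    then show "x \<in> North ` {1..n}" unfolding d(6) by (auto simp: nodes_def)
  qed
  have 3: "\<Union>(cups d) \<inter> North ` props d = {}"
  proof (rule ccontr)
    assume "\<Union>(cups d) \<inter> North ` props d \<noteq> {}"
    then obtain e i where e: "e \<in> cups d" "i \<in> props d" "North i \<in> e" by blast
    then have "e = {North i, South (partner d i)}"
      using d(7)[of e "{North i, South (partner d i)}"] partner_edge[OF assms e(2)] by (auto simp: cups_def)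
    then show False using e(1) by (auto simp: cups_def)
  qed
  have fin': "finite (\<Union>(cups d) \<union> North ` props d)" unfolding 2[symmetric] by simp
  have "card (North ` {1..n}) = card (\<Union>(cups d)) + card (North ` props d)"
    unfolding 2 using fin' 3 by (intro card_Un_disjoint) auto
  then show ?thesis by (simp add: 1 card_image inj_on_def)
qed

lemma partner_inj: "matching n d \<Longrightarrow> inj_on (partner d) (props d)"
proof (rule inj_onI)
  fix i j assume m: "matching n d" and *: "i \<in> props d" "j \<in> props d" "partner d i = partner d j"
  have "{North i, South (partner d i)} = {North j, South (partner d j)}"
    using * by (intro matchingD(7)[OF m] partner_edge[OF m]) auto
  then show "i = j" by (auto simp: doubleton_eq_iff)
qed

lemma props_flip:
  assumes "matching n d"
  shows "props (flip d) = partner d ` props d"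
proof -
  have "{North j, South i} \<in> edges (flip d) \<longleftrightarrow> {North i, South j} \<in> edges d" for i j
    by (simp add: edges_flip insert_commute)
  then have "props (flip d) = {j. \<exists>i. {North i, South j} \<in> edges d}" by (simp add: props_def)
  also have "\<dots> = partner d ` props d"
  proof (intro equalityI subsetI)
    fix j assume "j \<in> {j. \<exists>i. {North i, South j} \<in> edges d}"
    then obtain i where "{North i, South j} \<in> edges d" by blast
    then have "i \<in> props d" "partner d i = j" using partner_eq[OF assms] by (auto simp: props_def)
    then show "j \<in> partner d ` props d" by blast
  next
    fix j assume "j \<in> partner d ` props d"
    then show "j \<in> {j. \<exists>i. {North i, South j} \<in> edges d}" using partner_edge[OF assms] by blast
  qed
  finally show ?thesis .
qed

lemma card_props_flip: "matching n d \<Longrightarrow> card (props (flip d)) = card (props d)"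
  using card_image[OF partner_inj] props_flip by metis

text \<open>Inversion keeps the number of propagating edges, so there are as many caps as
  cups.\<close>

lemma cups_flip_empty: "matching n d \<Longrightarrow> cups (flip d) = {} \<longleftrightarrow> cups d = {}"
proof -
  assume m: "matching n d"
  have "card (cups (flip d)) = card (cups d)"
    using card_cups[OF m] card_cups[OF matching_flip[OF m]] card_props_flip[OF m] by simp
  moreover have "finite (cups d)" "finite (cups (flip d))"
    using matchingD(1)[OF m] matchingD(1)[OF matching_flip[OF m]] by (simp_all add: cups_def)
  ultimately show ?thesis by (metis card_0_eq card.empty)
qed

text \<open>Inversion reverses the order of the nodes along the boundary; planarity and exposure are
  symmetric under this reversal.\<close>

lemma pos_flip:
  assumes "x \<in> nodes n" "y \<in> nodes n"
  shows "pos n (flip_node x) < pos n (flip_node y) \<longleftrightarrow> pos n y < pos n x"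
  using assms by (cases x; cases y) (auto simp: nodes_def)

lemma diagrams_flip:
  assumes d: "d \<in> diagrams n"
  shows "flip d \<in> diagrams n"
proof -
  have m: "matching n d" using d diagrams_matching by auto
  have mf: "matching n (flip d)" by (rule matching_flip[OF m])
  have e: "edges (flip d) = (`) flip_node ` edges d" by (simp add: flip_def)
  have nc: "noncrossing n (edges d)" and le: "\<And>e. e \<in> edges d \<Longrightarrow> 0 < dec d e \<Longrightarrow> left_exposed n (edges d) e"
    and cu: "cups d = {} \<Longrightarrow> (\<forall>e\<in>edges d. dec d e = 0) \<and> (\<forall>k\<in>#loops d. k = 0)"
    using diagramsD[OF d] by blast+
  have A: "noncrossing n (edges (flip d))"
    unfolding noncrossing_def
  proof (intro ballI notI)
    fix e f a b c g
    assume ef: "e \<in> edges (flip d)" "f \<in> edges (flip d)" and abcg: "a \<in> e" "b \<in> e" "c \<in> f" "g \<in> f"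
      and ps: "pos n a < pos n c \<and> pos n c < pos n b \<and> pos n b < pos n g"
    have N: "a \<in> nodes n" "b \<in> nodes n" "c \<in> nodes n" "g \<in> nodes n"
      using matchingD(4)[OF mf] ef abcg by blast+
    have "\<not> pos n (flip_node c) < pos n (flip_node a)"
    proof (rule noncrossingD[OF nc])
      show "flip_node ` f \<in> edges d" "flip_node ` e \<in> edges d" using ef unfolding edges_flip by auto
      show "pos n (flip_node g) < pos n (flip_node b)" "pos n (flip_node b) < pos n (flip_node c)"
        using ps pos_flip N by auto
    qed (use abcg in auto)
    then show False using pos_flip[OF N(3,1)] ps by simp
  qed
  have B: "left_exposed n (edges (flip d)) f" if "f \<in> edges (flip d)" "0 < dec (flip d) f" for f
  proof -
    have f: "flip_node ` f \<in> edges d" "0 < dec d (flip_node ` f)" using that by (simp_all add: edges_flip)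
    have "left_exposed n (edges (flip d)) (flip_node ` flip_node ` f)"
      using matchingD(6)[OF m] by (intro left_exposed_flip[OF _ f(1) le[OF f] e]) simp
    then show ?thesis by simp
  qed
  have C: "(\<forall>e\<in>edges (flip d). dec (flip d) e = 0) \<and> (\<forall>k\<in>#loops (flip d). k = 0)" if "cups (flip d) = {}"
    using cu that cups_flip_empty[OF m] by (simp add: edges_flip)
  show ?thesis by (intro diagramsI mf A B C)
qed

section \<open>Type II diagrams as pairs of half-diagrams\<close>

section \<open>Type II diagrams and half-diagrams\<close>

text \<open>What remains of a diagram with even loops after cancelling decorations in pairs and
  removing loops; the power of \<delta> for the loops is kept separately in
  \<open>val\<close>.\<close>

definition nf :: "diag \<Rightarrow> diag"
  where "nf d = Diag (edges d) (\<lambda>e. dec d e mod 2) {#}"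

definition odd_loop :: "diag \<Rightarrow> bool"
  where "odd_loop d \<longleftrightarrow> (\<exists>k\<in>#loops d. odd k)"

lemma nf_simps [simp]: "edges (nf d) = edges d" "dec (nf d) e = dec d e mod 2" "loops (nf d) = {#}"
  by (simp_all add: nf_def)

lemma cups_cong: "edges a = edges b \<Longrightarrow> cups a = cups b"
  by (simp add: cups_def)

text \<open>Without loops, \<open>cancel_edge\<close> is the only relation that can apply.\<close>

lemma type_II_iff:
  "d \<in> type_II n \<longleftrightarrow> d \<in> diagrams n \<and> loops d = {#} \<and> (\<forall>e. dec d e \<le> 1) \<and> even (total_dec d)"
proof -
  have "(\<nexists>c d'. local_step d c d') \<longleftrightarrow> (\<forall>e. dec d e \<le> 1)" if "d \<in> diagrams n" "loops d = {#}"
  proof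
    assume no: "\<nexists>c d'. local_step d c d'"
    show "\<forall>e. dec d e \<le> 1"
    proof (rule allI, rule ccontr)
      fix e assume e: "\<not> dec d e \<le> 1"
      then have "e \<in> edges d" using matchingD(3)[OF diagramsD(1)[OF that(1)], of e] by force
      moreover have "dec d e = (dec d e - 2) + 2" using e by simp
      ultimately have "local_step (Diag (edges d) (dec d) (loops d)) 1
          (Diag (edges d) ((dec d)(e := dec d e - 2)) (loops d))" by (rule cancel_edge)
      then show False using no by simp
    qed
  next
    assume le: "\<forall>e. dec d e \<le> 1"
    show "\<nexists>c d'. local_step d c d'"
    proof (intro notI, elim exE)
      fix c d' assume "local_step d c d'"
      then show False
      proof cases
        case (cancel_edge e E w k L)
        then show False using le[rule_format, of e] by simp
      qed (use that(2) in auto)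
    qed
  qed
  then show ?thesis by (auto simp: type_II_def)
qed

lemma nf_type_II [simp]: "d \<in> type_II n \<Longrightarrow> nf d = d"
  unfolding type_II_iff by (simp add: diag_eq_iff fun_eq_iff le_Suc_eq) (metis less_2_cases_iff less_Suc_eq mod_less numeral_2_eq_2)

lemma nf_diagrams: "d \<in> diagrams n \<Longrightarrow> nf d \<in> diagrams n"
proof (rule diagramsI)
  assume d: "d \<in> diagrams n"
  note D = diagramsD[OF d]
  show "matching n (nf d)" using D(1) by (simp add: matching_def)
  show "noncrossing n (edges (nf d))" using D(2) by simp
  show "left_exposed n (edges (nf d)) e" if "e \<in> edges (nf d)" "0 < dec (nf d) e" for e
    using D(3)[of e] that by (cases "dec d e = 0") auto
  show "(\<forall>e\<in>edges (nf d). dec (nf d) e = 0) \<and> (\<forall>k\<in>#loops (nf d). k = 0)" if "cups (nf d) = {}"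
    using D(4) that cups_cong[of "nf d" d] by simp
qed

lemma total_dec_nf: "even (total_dec (nf d)) \<longleftrightarrow> even (\<Sum>e\<in>edges d. dec d e)"
proof -
  have "even (\<Sum>e\<in>E. f e mod 2) \<longleftrightarrow> even (\<Sum>e\<in>E. f e)" for E and f :: "node set \<Rightarrow> nat"
    by (simp add: even_iff_mod_2_eq_zero mod_sum_eq)
  then show ?thesis by (simp add: total_dec_def)
qed

lemma even_loops_sum: "\<not> odd_loop d \<Longrightarrow> even (sum_mset (loops d))"
proof -
  have "\<forall>k\<in>#L. even k \<Longrightarrow> even (sum_mset L)" for L :: "nat multiset" by (induction L) auto
  then show "\<not> odd_loop d \<Longrightarrow> even (sum_mset (loops d))" by (auto simp: odd_loop_def)
qed

lemma nf_in_type_II: "d \<in> diagrams n \<Longrightarrow> even (total_dec d) \<Longrightarrow> \<not> odd_loop d \<Longrightarrow> nf d \<in> type_II n"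
  using even_loops_sum[of d] total_dec_nf[of d] nf_diagrams[of d n]
  by (auto simp: type_II_iff total_dec_def[of d])

text \<open>The components of a product depend on the edges only, and \<open>nf\<close> keeps these.
  So the parities of decorations agree, and the loops of the factors are simply added.\<close>

lemma stack_nf:
  fixes a b
  defines "s \<equiv> stack a b" and "s' \<equiv> stack (nf a) (nf b)"
  assumes "finite (edges a)" "finite (edges b)"
  shows "nf s = nf s'" "odd_loop s \<longleftrightarrow> odd_loop a \<or> odd_loop b \<or> odd_loop s'"
    "size (loops s) = size (loops a) + size (loops b) + size (loops s')"
proof -
  let ?C = "chains a b"
  define w where "w = (\<lambda>K. \<Sum>p\<in>K. piece_dec a b p)"
  define w' where "w' = (\<lambda>K. \<Sum>p\<in>K. piece_dec (nf a) (nf b) p)"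
  have g: "glue (nf a) (nf b) = glue a b" by (simp add: glue_def)
  then have C: "chains (nf a) (nf b) = ?C" by (simp add: chains_def)
  have pd: "piece_dec (nf a) (nf b) p = piece_dec a b p mod 2" for p by (cases p) simp_all
  have w: "w' K mod 2 = w K mod 2" for K by (simp add: w_def w'_def pd mod_sum_eq)
  have s: "s = Diag {ends K | K. K \<in> ?C \<and> ends K \<noteq> {}} (\<lambda>e. if e = {} then 0 else \<Sum>K\<in>{K \<in> ?C. ends K = e}. w K)
      (loops a + loops b + image_mset w (mset_set {K \<in> ?C. ends K = {}}))"
    unfolding s_def stack_def Let_def w_def by (rule refl)
  have s': "s' = Diag {ends K | K. K \<in> ?C \<and> ends K \<noteq> {}} (\<lambda>e. if e = {} then 0 else \<Sum>K\<in>{K \<in> ?C. ends K = e}. w' K)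
      (image_mset w' (mset_set {K \<in> ?C. ends K = {}}))"
    unfolding s'_def stack_def Let_def w'_def C by simp
  have sw: "(\<Sum>K\<in>Z. w K) mod 2 = (\<Sum>K\<in>Z. w' K) mod 2" for Z
    using w mod_sum_eq[of w 2 Z] mod_sum_eq[of w' 2 Z] by simp
  show "nf s = nf s'" unfolding nf_def s s' using sw by (simp add: fun_eq_iff)
  have "odd (w K) \<longleftrightarrow> odd (w' K)" for K using w[of K] by (simp add: odd_iff_mod_2_eq_one)
  then show "odd_loop s \<longleftrightarrow> odd_loop a \<or> odd_loop b \<or> odd_loop s'"
    unfolding odd_loop_def s s' by auto
  show "size (loops s) = size (loops a) + size (loops b) + size (loops s')"
    unfolding s s' by simp
qed

lemma flip_type_II: "d \<in> type_II n \<Longrightarrow> flip d \<in> type_II n"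
  by (simp add: type_II_iff diagrams_flip total_dec_net[of _ 0 1] net_flip)
    (metis total_dec_net)

lemma lower_flip: "lower d = upper (flip d)" and upper_flip: "upper d = lower (flip d)"
proof -
  have *: "flip_node ` North ` e = South ` e" "flip_node ` South ` e = North ` e" for e by (simp_all add: image_image)
  show "lower d = upper (flip d)" "upper d = lower (flip d)"
    by (simp_all add: lower_def upper_def edges_flip * del: image_flip_flip)
qed

lemma half_diagrams_upper: "half_diagrams n = upper ` type_II n"
  unfolding half_diagrams_def using flip_type_II lower_flip by blast

lemma half_diagrams_lower: "half_diagrams n = lower ` type_II n"
  unfolding half_diagrams_def using flip_type_II upper_flip by blast

lemma hedges_simps [simp]: "hedges (upper d) = {e. North ` e \<in> edges d}" "hedges (lower d) = {e. South ` e \<in> edges d}"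
  "hdec (upper d) e = dec d (North ` e)" "hdec (lower d) e = dec d (South ` e)"
  by (simp_all add: upper_def lower_def)

lemma inj_North: "inj North" and inj_South: "inj South"
  by (auto intro: injI)

lemma north_image: "e \<subseteq> range North \<Longrightarrow> North ` (North -` e) = e"
  and south_image: "e \<subseteq> range South \<Longrightarrow> South ` (South -` e) = e"
  by auto

lemma cups_upper: "cups d = (`) North ` hedges (upper d)"
proof (intro equalityI subsetI)
  fix e assume "e \<in> cups d"
  then have "North -` e \<in> hedges (upper d)" "e = North ` (North -` e)"
    using north_image[of e] by (simp_all add: cups_def)
  then show "e \<in> (`) North ` hedges (upper d)" by blast
qed (auto simp: cups_def)

lemma card_hedges_upper: "card (hedges (upper d)) = card (cups d)"
  unfolding cups_upper by (rule card_image[symmetric]) (metis inj_North inj_image_eq_iff inj_onI)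

lemma finite_hedges: "matching n d \<Longrightarrow> finite (hedges (upper d))" "matching n d \<Longrightarrow> finite (hedges (lower d))"
proof -
  have *: "finite (hedges (upper d))" if "matching n d" for d
  proof -
    have "finite (cups d)" using matchingD(1)[OF that] by (simp add: cups_def)
    then show ?thesis unfolding cups_upper by (rule finite_imageD) (metis inj_North inj_image_eq_iff inj_onI)
  qed
  show "matching n d \<Longrightarrow> finite (hedges (upper d))" by (rule *)
  show "matching n d \<Longrightarrow> finite (hedges (lower d))" unfolding lower_flip by (intro * matching_flip)
qed

lemma half_prop_upper: "matching n d \<Longrightarrow> half_prop n (upper d) = card (props d)"
  using card_cups[of n d] by (simp add: half_prop_def card_hedges_upper del: hedges_simps)

lemma half_prop_lower: "matching n d \<Longrightarrow> half_prop n (lower d) = card (props d)"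
  using half_prop_upper[OF matching_flip, of n d] card_props_flip[of n d] by (simp add: lower_flip)

lemma props_subset: "matching n d \<Longrightarrow> props d \<subseteq> {1..n}"
proof
  fix i assume "matching n d" "i \<in> props d"
  then have "{North i, South (partner d i)} \<subseteq> nodes n" using matchingD(4) partner_edge by blast
  then show "i \<in> {1..n}" by (auto simp: nodes_def)
qed

lemma finite_props: "matching n d \<Longrightarrow> finite (props d)"
  using props_subset finite_subset by blast

lemma free_upper:
  assumes "matching n d"
  shows "{1..n} - \<Union>(hedges (upper d)) = props d"
proof (intro equalityI subsetI)
  fix i assume i: "i \<in> {1..n} - \<Union>(hedges (upper d))"
  then have "North i \<in> \<Union>(edges d)" unfolding matchingD(6)[OF assms] by (auto simp: nodes_def)
  then obtain e where e: "e \<in> edges d" "North i \<in> e" by blast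
  have no: "e \<noteq> North ` {k, l}" for k l
  proof
    assume "e = North ` {k, l}"
    then have "{k, l} \<in> hedges (upper d)" "i \<in> {k, l}" using e by auto
    then show False using i by blast
  qed
  from assms e(1) show "i \<in> props d"
  proof (cases rule: edge_cases)
    case (cup k l) then show ?thesis using no[of k l] by simp
  next
    case (cap k l) then show ?thesis using e by auto
  next
    case (thru k l) then show ?thesis using e by (auto simp: props_def)
  qed
next
  fix i assume i: "i \<in> props d"
  have "i \<notin> \<Union>(hedges (upper d))"
  proof
    assume "i \<in> \<Union>(hedges (upper d))"
    then obtain e where e: "North ` e \<in> edges d" "i \<in> e" by auto
    have "North ` e = {North i, South (partner d i)}"
      using e by (intro matchingD(7)[OF assms e(1) partner_edge[OF assms i]]) auto
    then have "South (partner d i) \<in> North ` e" by blast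
    then show False by auto
  qed
  then show "i \<in> {1..n} - \<Union>(hedges (upper d))" using props_subset[OF assms] i by blast
qed

lemma free_nodes_upper: "matching n d \<Longrightarrow> free_nodes n (upper d) = sorted_list_of_set (props d)"
  unfolding free_nodes_def by (simp only: free_upper)

lemma free_nodes_lower: "matching n d \<Longrightarrow> free_nodes n (lower d) = sorted_list_of_set (partner d ` props d)"
  by (simp add: lower_flip free_nodes_upper matching_flip props_flip)

lemma edges_decompose:
  assumes "matching n d"
  shows "edges d = (`) North ` hedges (upper d) \<union> (`) South ` hedges (lower d)
      \<union> (\<lambda>i. {North i, South (partner d i)}) ` props d"
proof (intro equalityI subsetI)
  fix e assume e: "e \<in> edges d"
  from assms e show "e \<in> (`) North ` hedges (upper d) \<union> (`) South ` hedges (lower d)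
      \<union> (\<lambda>i. {North i, South (partner d i)}) ` props d"
  proof (cases rule: edge_cases)
    case (cup i j)
    then have "e = North ` {i, j}" by simp
    moreover then have "{i, j} \<in> hedges (upper d)" using e by simp
    ultimately show ?thesis by blast
  next
    case (cap i j)
    then have "e = South ` {i, j}" by simp
    moreover then have "{i, j} \<in> hedges (lower d)" using e by simp
    ultimately show ?thesis by blast
  next
    case (thru i j)
    then have "partner d i = j" "i \<in> props d" using e partner_eq[OF assms] by (auto simp: props_def)
    then show ?thesis using thru by blast
  qed
qed (use partner_edge[OF assms] in auto)

lemma sum_edges:
  fixes g :: "node set \<Rightarrow> 'a :: comm_monoid_add"
  assumes "matching n d"
  shows "sum g (edges d) = (\<Sum>h\<in>hedges (upper d). g (North ` h)) + (\<Sum>h\<in>hedges (lower d). g (South ` h))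
    + (\<Sum>i\<in>props d. g {North i, South (partner d i)})"
proof -
  let ?A = "(`) North ` hedges (upper d)" and ?B = "(`) South ` hedges (lower d)"
    and ?C = "(\<lambda>i. {North i, South (partner d i)}) ` props d"
  have ne: "{} \<notin> edges d" using matchingD(2)[OF assms] .
  have fin: "finite ?A" "finite ?B" "finite ?C" using finite_hedges[OF assms] finite_props[OF assms] by auto
  have 1: "?A \<inter> ?B = {}"
  proof (rule equals0I)
    fix e assume "e \<in> ?A \<inter> ?B"
    then have "e \<subseteq> range North" "e \<subseteq> range South" "e \<in> edges d" by auto
    then show False using ne by (cases "e = {}") auto
  qed
  have 2: "(?A \<union> ?B) \<inter> ?C = {}" by (auto simp: doubleton_eq_iff set_eq_iff image_iff)
  have "sum g (edges d) = sum g ?A + sum g ?B + sum g ?C"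
    unfolding edges_decompose[OF assms] using fin 1 2 by (simp add: sum.union_disjoint)
  also have "sum g ?A = (\<Sum>h\<in>hedges (upper d). g (North ` h))"
    by (subst sum.reindex) (auto simp: inj_on_def inj_image_eq_iff[OF inj_North])
  also have "sum g ?B = (\<Sum>h\<in>hedges (lower d). g (South ` h))"
    by (subst sum.reindex) (auto simp: inj_on_def inj_image_eq_iff[OF inj_South])
  also have "sum g ?C = (\<Sum>i\<in>props d. g {North i, South (partner d i)})"
    by (subst sum.reindex) (auto simp: inj_on_def doubleton_eq_iff)
  finally show ?thesis .
qed

lemma total_dec_decompose:
  assumes "matching n d" "loops d = {#}"
  shows "total_dec d = half_total (upper d) + half_total (lower d) + (\<Sum>i\<in>props d. dec d {North i, South (partner d i)})"
  using assms(2) sum_edges[OF assms(1), of "dec d"] by (simp add: total_dec_def half_total_def)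

text \<open>A propagating edge further to the left covers both ends of this one, so this one is not
  exposed to the left wall.\<close>

lemma dec_thru:
  assumes d: "d \<in> diagrams n" and i: "i \<in> props d" "k \<in> props d" "k < i"
  shows "dec d {North i, South (partner d i)} = 0"
proof (rule ccontr)
  assume "\<not> ?thesis"
  then have "left_exposed n (edges d) {North i, South (partner d i)}"
    using diagramsD(3)[OF d] partner_edge[OF diagramsD(1)[OF d] i(1)] by simp
  moreover have "{North k, South (partner d k)} \<in> edges d" by (rule partner_edge[OF diagramsD(1)[OF d] i(2)])
  moreover have "partner d k < partner d i" using partner_mono[OF d] i by (auto dest: strict_mono_onD)
  moreover have "{North i, South (partner d i)} \<subseteq> nodes n"
    by (intro matchingD(4)[OF diagramsD(1)[OF d]] partner_edge[OF diagramsD(1)[OF d]] i)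
  then have "i \<in> {1..n}" "partner d i \<in> {1..n}" by (auto simp: nodes_def)
  ultimately show False using i(3) unfolding left_exposed_def
    by (auto dest!: bspec[of _ _ "{North k, South (partner d k)}"])
qed

text \<open>Pairing two sorted lists of equal length is an increasing bijection; this turns the list
  \<open>prop_edges\<close> into a function on the free nodes.\<close>

lemma zip_mono:
  fixes A B :: "nat set"
  assumes "finite A" "finite B" "card A = card B"
  obtains f where "strict_mono_on A f" "f ` A = B" "zip (sorted_list_of_set A) (sorted_list_of_set B)
     = map (\<lambda>i. (i, f i)) (sorted_list_of_set A)"
proof -
  let ?xs = "sorted_list_of_set A" and ?ys = "sorted_list_of_set B"
  have len: "length ?xs = length ?ys" using assms by simp
  have dx: "distinct ?xs" and sx: "sorted_wrt (<) ?xs" "sorted_wrt (<) ?ys" by auto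
  define f where "f i = the (map_of (zip ?xs ?ys) i)" for i
  have f: "f (?xs ! k) = ?ys ! k" if "k < length ?xs" for k
    using that len dx by (simp add: f_def map_of_zip_nth)
  have z: "zip ?xs ?ys = map (\<lambda>i. (i, f i)) ?xs"
    using len f by (intro nth_equalityI) auto
  have "f ` A = set (map snd (zip ?xs ?ys))" unfolding z using assms(1) by (auto simp: image_iff)
  moreover have "map snd (zip ?xs ?ys) = ?ys" using len by simp
  ultimately have im: "f ` A = B" using assms(2) by (metis set_sorted_list_of_set)
  have "strict_mono_on A f"
  proof (rule strict_mono_onI)
    fix i j assume ij: "i \<in> A" "j \<in> A" "i < j"
    then obtain k l where kl: "k < length ?xs" "l < length ?xs" "?xs ! k = i" "?xs ! l = j"
      using assms(1) by (metis in_set_conv_nth set_sorted_list_of_set)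
    have "k < l"
    proof (rule ccontr)
      assume "\<not> k < l"
      then have "l < k \<or> l = k" by auto
      then show False using ij kl sorted_wrt_nth_less[OF sx(1), of l k] by auto
    qed
    then have "?ys ! k < ?ys ! l" using sorted_wrt_nth_less[OF sx(2)] kl len by auto
    then show "f i < f j" using f kl by metis
  qed
  then show ?thesis using that im z by blast
qed

text \<open>The two halves determine the diagram: propagating edges join the free nodes in
  increasing order, only the leftmost may be decorated, and since the total is even its decoration
  is the parity of the halves.\<close>

lemma circ_upper_lower:
  assumes d: "d \<in> type_II n"
  shows "circ n (upper d) (lower d) = d"
proof -
  have dd: "d \<in> diagrams n" and l: "loops d = {#}" and le: "\<And>e. dec d e \<le> 1" and ev: "even (total_dec d)"
    using d by (auto simp: type_II_iff)
  note m = diagramsD(1)[OF dd]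
  let ?xs = "sorted_list_of_set (props d)" and ?t = "\<lambda>i. {North i, South (partner d i)}"
  have fin: "finite (props d)" by (rule finite_props[OF m])
  have "free_nodes n (lower d) = map (partner d) ?xs"
    unfolding free_nodes_lower[OF m] by (rule map_sorted_list_of_set[OF fin partner_mono[OF dd], symmetric])
  then have pe: "prop_edges n (upper d) (lower d) = map ?t ?xs"
    by (simp add: prop_edges_def free_nodes_upper[OF m] zip_map2 map_zip_map2 zip_same_conv_map o_def)
  have E: "edges (circ n (upper d) (lower d)) = edges d"
    unfolding edges_decompose[OF m] by (simp only: circ_def diag.sel pe set_map set_sorted_list_of_set[OF fin])
  have "dec (circ n (upper d) (lower d)) e = dec d e" for e
  proof -
    have im: "North ` (North -` e) = e" if "e \<in> (`) North ` hedges (upper d)"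
      using that by (intro north_image) auto
    have sm: "South ` (South -` e) = e" if "e \<in> (`) South ` hedges (lower d)"
      using that by (intro south_image) auto
    show ?thesis
    proof (cases "e \<in> (`) North ` hedges (upper d) \<or> e \<in> (`) South ` hedges (lower d)")
      case True
      then show ?thesis
      proof (cases "e \<in> (`) North ` hedges (upper d)")
        case True
        then have "dec (circ n (upper d) (lower d)) e = dec d (North ` (North -` e))" by (simp add: circ_def del: hedges_simps(1,2))
        then show ?thesis using im[OF True] by (simp only:)
      next
        case False
        then have s: "e \<in> (`) South ` hedges (lower d)" using True by blast
        then have "dec (circ n (upper d) (lower d)) e = dec d (South ` (South -` e))"
          using False by (simp add: circ_def del: hedges_simps(1,2))
        then show ?thesis using sm[OF s] by (simp only:)
      qed
    next
      case False
      have c: "dec (circ n (upper d) (lower d)) e = (if ?xs \<noteq> [] \<and> e = ?t (hd ?xs)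
          then (half_total (upper d) + half_total (lower d)) mod 2 else 0)"
        using False by (simp add: circ_def pe hd_map del: hedges_simps cong: conj_cong)
      show ?thesis
      proof (cases "e \<in> ?t ` props d")
        case True
        then obtain i where i: "i \<in> props d" "e = ?t i" by blast
        have ne: "props d \<noteq> {}" using i by auto
        then have xs: "?xs \<noteq> []" using fin by simp
        have hd: "hd ?xs = Min (props d)" using sorted_list_of_set_nonempty[OF fin ne] by simp
        show ?thesis
        proof (cases "i = Min (props d)")
          case True
          have "(\<Sum>j\<in>props d. dec d (?t j)) = dec d (?t i) + (\<Sum>j\<in>props d - {i}. dec d (?t j))"
            by (rule sum.remove[OF fin i(1)])
          also have "(\<Sum>j\<in>props d - {i}. dec d (?t j)) = 0"
          proof (intro sum.neutral ballI)
            fix j assume j: "j \<in> props d - {i}"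
            then have "i < j" using True fin by (metis DiffE Min_le insertI1 le_neq_implies_less)
            moreover have "j \<in> props d" using j by simp
            ultimately show "dec d (?t j) = 0" by (intro dec_thru[OF dd _ i(1)])
          qed
          finally have "even (half_total (upper d) + half_total (lower d) + dec d e)"
            using ev total_dec_decompose[OF m l] i(2) by simp
          then have "dec d e = (half_total (upper d) + half_total (lower d)) mod 2"
            using le[of e] by presburger
          then show ?thesis using c xs hd True i(2) by simp
        next
          case False
          have "Min (props d) < i" using False i(1) fin by (metis Min_le le_neq_implies_less)
          then have "dec d e = 0" unfolding i(2) by (rule dec_thru[OF dd i(1) Min_in[OF fin ne]])
          moreover have "e \<noteq> ?t (hd ?xs)" using hd False i(2) by (auto simp: doubleton_eq_iff)
          ultimately show ?thesis using c by simp
        qed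
      next
        case nt: False
        then have "e \<notin> edges d" unfolding edges_decompose[OF m] using False by blast
        then have "dec d e = 0" by (rule matchingD(3)[OF m])
        moreover have "e \<noteq> ?t (hd ?xs)" if "?xs \<noteq> []"
        proof
          assume "e = ?t (hd ?xs)"
          moreover have "hd ?xs \<in> props d" using hd_in_set[OF that] fin by simp
          ultimately show False using nt by blast
        qed
        ultimately show ?thesis using c by auto
      qed
    qed
  qed
  then show ?thesis using E l by (simp add: diag_eq_iff fun_eq_iff) (simp add: circ_def)
qed

lemma Union_hedges_upper:
  assumes "matching n d"
  shows "\<Union>(hedges (upper d)) = {1..n} - props d"
proof -
  have "\<Union>(hedges (upper d)) \<subseteq> {1..n}"
  proof
    fix i assume "i \<in> \<Union>(hedges (upper d))"
    then obtain e where "North ` e \<in> edges d" "i \<in> e" by auto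
    then have "North i \<in> nodes n" using matchingD(4)[OF assms] by blast
    then show "i \<in> {1..n}" by (auto simp: nodes_def)
  qed
  then show ?thesis using free_upper[OF assms] by blast
qed

lemma Union_hedges_lower:
  "matching n d \<Longrightarrow> \<Union>(hedges (lower d)) = {1..n} - partner d ` props d"
  using Union_hedges_upper[OF matching_flip, of n d] by (simp add: lower_flip props_flip del: hedges_simps)

lemma pos_North: "North i \<in> nodes n \<Longrightarrow> pos n (North i) = i \<and> 1 \<le> i \<and> i \<le> n"
  by (auto simp: nodes_def)

lemma pos_South: "South i \<in> nodes n \<Longrightarrow> pos n (South i) = 2 * n + 1 - i \<and> n < pos n (South i)"
  by (auto simp: nodes_def)

text \<open>Planarity and exposure are checked inside \<open>d1\<close> or \<open>d2\<close>: a new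
  strand shares its upper end with a strand of \<open>d1\<close> and its lower end with one of
  \<open>d2\<close>, and these replace it in comparisons with cups and caps respectively. Without
  strands no edge could absorb an odd parity, hence the hypothesis \<open>par\<close>.\<close>

lemma circ_type_II:
  assumes d1: "d1 \<in> type_II n" and d2: "d2 \<in> type_II n" and cA: "card (props d1) = card (props d2)"
    and par: "props d1 = {} \<Longrightarrow> even (half_total (upper d1) + half_total (lower d2))"
  defines "D \<equiv> circ n (upper d1) (lower d2)"
  shows "D \<in> type_II n" "upper D = upper d1" "lower D = lower d2"
proof -
  have dd: "d1 \<in> diagrams n" "d2 \<in> diagrams n" and le: "\<And>e. dec d1 e \<le> 1" "\<And>e. dec d2 e \<le> 1"
    using d1 d2 by (auto simp: type_II_iff)
  note m1 = diagramsD(1)[OF dd(1)] and m2 = diagramsD(1)[OF dd(2)]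
  define A where "A = props d1"
  define B where "B = partner d2 ` props d2"
  have fA: "finite A" "finite B" using finite_props m1 m2 by (auto simp: A_def B_def)
  have "card B = card (props d2)" unfolding B_def by (rule card_image[OF partner_inj[OF m2]])
  then have "card A = card B" using cA A_def by simp
  from zip_mono[OF fA this] obtain f where f: "strict_mono_on A f" "f ` A = B"
    and z: "zip (sorted_list_of_set A) (sorted_list_of_set B) = map (\<lambda>i. (i, f i)) (sorted_list_of_set A)" by blast
  define t where "t i = {North i, South (f i)}" for i
  define NU where "NU = (`) North ` hedges (upper d1)"
  define SL where "SL = (`) South ` hedges (lower d2)"
  define par' where "par' = (half_total (upper d1) + half_total (lower d2)) mod 2"
  have "prop_edges n (upper d1) (lower d2) = map (\<lambda>(i, j). {North i, South j}) (zip (sorted_list_of_set A) (sorted_list_of_set B))"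
    unfolding prop_edges_def free_nodes_upper[OF m1] free_nodes_lower[OF m2] A_def B_def by simp
  then have pe: "prop_edges n (upper d1) (lower d2) = map t (sorted_list_of_set A)"
    unfolding z by (simp add: t_def o_def)
  have ED: "edges D = NU \<union> SL \<union> t ` A"
    unfolding D_def circ_def diag.sel pe set_map set_sorted_list_of_set[OF fA(1)] NU_def SL_def ..
  have LD: "loops D = {#}" by (simp add: D_def circ_def)
  have NU: "e \<in> NU \<longleftrightarrow> e \<in> edges d1 \<and> e \<subseteq> range North" for e
    using cups_upper[of d1] unfolding NU_def cups_def by blast
  have "SL = (`) flip_node ` cups (flip d2)"
    unfolding cups_upper lower_flip SL_def image_image by simp
  then have SL: "e \<in> SL \<longleftrightarrow> e \<in> edges d2 \<and> e \<subseteq> range South" for e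
  proof -
    have "e \<in> SL \<Longrightarrow> e \<in> edges d2 \<and> e \<subseteq> range South" unfolding SL_def by auto
    moreover have "e \<in> SL" if "e \<in> edges d2" "e \<subseteq> range South"
    proof -
      have "South -` e \<in> hedges (lower d2)" "e = South ` (South -` e)" using that south_image[of e] by simp_all
      then show ?thesis unfolding SL_def by blast
    qed
    ultimately show ?thesis by blast
  qed
  have NUx: "\<exists>i. x = North i \<and> North i \<in> nodes n \<and> i \<notin> A" if ex: "e \<in> NU" "x \<in> e" for e x
  proof -
    obtain h where h: "e = North ` h" "h \<in> hedges (upper d1)" using ex(1) unfolding NU_def by blast
    then obtain i where i: "x = North i" "i \<in> h" using ex(2) by blast
    then have "i \<in> {1..n} - A" using h(2) Union_hedges_upper[OF m1] unfolding A_def by blast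
    then show ?thesis using i by (auto simp: nodes_def)
  qed
  have SLx: "\<exists>i. x = South i \<and> South i \<in> nodes n \<and> i \<notin> B" if ex: "e \<in> SL" "x \<in> e" for e x
  proof -
    obtain h where h: "e = South ` h" "h \<in> hedges (lower d2)" using ex(1) unfolding SL_def by blast
    then obtain i where i: "x = South i" "i \<in> h" using ex(2) by blast
    then have "i \<in> {1..n} - B" using h(2) Union_hedges_lower[OF m2] unfolding B_def by blast
    then show ?thesis using i by (auto simp: nodes_def)
  qed
  have An: "A \<subseteq> {1..n}" using props_subset[OF m1] by (simp add: A_def)
  have Bn: "B \<subseteq> {1..n}" using props_subset[OF matching_flip[OF m2]] props_flip[OF m2] by (simp add: B_def)
  have tn: "North i \<in> nodes n" "South (f i) \<in> nodes n" if "i \<in> A" for i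
    using that An Bn f(2) by (auto simp: nodes_def)
  have A1: "\<exists>j. {North i, South j} \<in> edges d1 \<and> South j \<in> nodes n" if "i \<in> A" for i
    using partner_edge[OF m1, of i] matchingD(4)[OF m1, of "{North i, South (partner d1 i)}"] that
    by (auto simp: A_def)
  have A2: "\<exists>k. {North k, South (f i)} \<in> edges d2 \<and> North k \<in> nodes n" if iA: "i \<in> A" for i
  proof -
    obtain k where k: "k \<in> props d2" "f i = partner d2 k" using f(2) iA unfolding B_def by blast
    then show ?thesis using partner_edge[OF m2 k(1)] matchingD(4)[OF m2 partner_edge[OF m2 k(1)]] by auto
  qed
  have ne: "e \<noteq> {}" if "e \<in> edges D" for e
    using that matchingD(2)[OF m1] matchingD(2)[OF m2] NU SL by (auto simp: ED t_def)
  have dis: "NU \<inter> SL = {}" "t i \<notin> NU" "t i \<notin> SL" for i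
  proof -
    show "NU \<inter> SL = {}"
    proof (rule equals0I)
      fix e assume e: "e \<in> NU \<inter> SL"
      then obtain x where "x \<in> e" using ne[of e] by (auto simp: ED)
      then show False using e NUx[of e x] SLx[of e x] by auto
    qed
    show "t i \<notin> NU" using NUx[of "t i" "South (f i)"] by (auto simp: t_def)
    show "t i \<notin> SL" using SLx[of "t i" "North i"] by (auto simp: t_def)
  qed
  have hd: "hd (map t (sorted_list_of_set A)) = t (Min A)" "map t (sorted_list_of_set A) \<noteq> []" if "A \<noteq> {}"
    using sorted_list_of_set_nonempty[OF fA(1) that] by simp_all
  have decNU: "dec D e = dec d1 e" if "e \<in> NU" for e
  proof -
    have "dec D e = dec d1 (North ` (North -` e))" using that by (simp add: D_def circ_def NU_def del: hedges_simps(1,2))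
    then show ?thesis using that NU north_image[of e] by (simp only:)
  qed
  have decSL: "dec D e = dec d2 e" if "e \<in> SL" for e
  proof -
    have "e \<notin> NU" using dis that by blast
    then have "dec D e = dec d2 (South ` (South -` e))"
      using that by (simp add: D_def circ_def NU_def SL_def del: hedges_simps(1,2))
    then show ?thesis using that SL south_image[of e] by (simp only:)
  qed
  have dec0: "dec D e = (if map t (sorted_list_of_set A) \<noteq> [] \<and> e = hd (map t (sorted_list_of_set A)) then par' else 0)"
    if "e \<notin> NU" "e \<notin> SL" for e
    using that by (simp add: D_def circ_def pe NU_def SL_def par'_def del: hedges_simps(1,2) cong: conj_cong)
  have dect: "dec D (t i) = (if i = Min A then par' else 0)" if "i \<in> A" for i
  proof -
    have "A \<noteq> {}" using that by auto
    moreover have "t i = t (Min A) \<longleftrightarrow> i = Min A" by (auto simp: t_def doubleton_eq_iff)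
    ultimately show ?thesis using dec0[OF dis(2,3)] hd by simp
  qed
  have decoff: "dec D e = 0" if "e \<notin> edges D" for e
  proof -
    have "e \<noteq> hd (map t (sorted_list_of_set A))" if "map t (sorted_list_of_set A) \<noteq> []"
    proof -
      have "A \<noteq> {}" using that by auto
      then show ?thesis using hd(1) Min_in[OF fA(1)] \<open>e \<notin> edges D\<close> by (auto simp: ED)
    qed
    then show ?thesis using dec0[of e] that by (auto simp: ED)
  qed
  have cases: "e \<in> NU \<or> e \<in> SL \<or> (\<exists>i\<in>A. e = t i)" if "e \<in> edges D" for e using that by (auto simp: ED)
  have mD: "matching n D"
    unfolding matching_def partition_on_def
  proof (intro conjI)
    have "\<Union>NU = North ` ({1..n} - A)"
      unfolding NU_def using Union_hedges_upper[OF m1] by (simp add: image_Union[symmetric] A_def del: hedges_simps)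
    moreover have "\<Union>SL = South ` ({1..n} - B)"
      unfolding SL_def using Union_hedges_lower[OF m2] by (simp add: image_Union[symmetric] B_def del: hedges_simps)
    moreover have "\<Union>(t ` A) = North ` A \<union> South ` B" unfolding t_def f(2)[symmetric] by blast
    ultimately show "\<Union>(edges D) = nodes n" unfolding ED nodes_def using An Bn by auto
    show "{} \<notin> edges D" using ne by blast
    show "\<forall>e\<in>edges D. card e = 2"
      using matchingD(5)[OF m1] matchingD(5)[OF m2] NU SL by (auto simp: ED t_def)
    show "\<forall>e. e \<notin> edges D \<longrightarrow> dec D e = 0" using decoff by blast
    show "disjoint (edges D)"
    proof (rule disjointI)
      fix e g assume e: "e \<in> edges D" and g: "g \<in> edges D" and neq: "e \<noteq> g"
      show "e \<inter> g = {}"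
      proof (rule equals0I)
        fix x assume x: "x \<in> e \<inter> g"
        consider "e \<in> NU" "g \<in> NU" | "e \<in> SL" "g \<in> SL" | "e \<in> NU" "g \<in> SL" | "e \<in> SL" "g \<in> NU"
          | i where "i \<in> A" "e = t i" "g \<in> NU" | i where "i \<in> A" "e = t i" "g \<in> SL"
          | i where "i \<in> A" "g = t i" "e \<in> NU" | i where "i \<in> A" "g = t i" "e \<in> SL"
          | i j where "i \<in> A" "j \<in> A" "e = t i" "g = t j" using cases[OF e] cases[OF g] by blast
        then show False
        proof cases
          case 1 then show False using matchingD(7)[OF m1, of e g] NU neq x by blast
        next
          case 2 then show False using matchingD(7)[OF m2, of e g] SL neq x by blast
        next
          case 3 then show False using NUx[of e x] SLx[of g x] x by auto
        next
          case 4 then show False using NUx[of g x] SLx[of e x] x by auto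
        next
          case (5 i) then show False using NUx[of g x] x by (auto simp: t_def)
        next
          case (6 i) then show False using SLx[of g x] x f(2) by (auto simp: t_def)
        next
          case (7 i) then show False using NUx[of e x] x by (auto simp: t_def)
        next
          case (8 i) then show False using SLx[of e x] x f(2) by (auto simp: t_def)
        next
          case (9 i j)
          then have "i \<noteq> j" "f i \<noteq> f j" using neq strict_mono_on_imp_inj_on[OF f(1)] by (auto dest: inj_onD)
          then show False using x 9 by (auto simp: t_def)
        qed
      qed
    qed
  qed
  have nc: "noncrossing n (edges D)"
    unfolding noncrossing_def
  proof (intro ballI notI)
    fix e g a b c h
    assume e: "e \<in> edges D" and g: "g \<in> edges D" and abch: "a \<in> e" "b \<in> e" "c \<in> g" "h \<in> g"
      and ps: "pos n a < pos n c \<and> pos n c < pos n b \<and> pos n b < pos n h"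
    have pU: "pos n x \<le> n" if "k \<in> NU" "x \<in> k" for k x using NUx[OF that] pos_North by auto
    have pL: "n < pos n x" if "k \<in> SL" "x \<in> k" for k x using SLx[OF that] pos_South by auto
    have pt: "x = North i \<and> pos n x \<le> n \<or> x = South (f i) \<and> n < pos n x" if "i \<in> A" "x \<in> t i" for i x
      using that tn[OF that(1)] pos_North[of i n] pos_South[of "f i" n] by (auto simp: t_def)
    consider "e \<in> NU" "g \<in> NU" | "e \<in> SL" "g \<in> SL" | "e \<in> NU" "g \<in> SL" | "e \<in> SL" "g \<in> NU"
      | i where "i \<in> A" "e = t i" "g \<in> NU" | i where "i \<in> A" "e = t i" "g \<in> SL"
      | i where "i \<in> A" "g = t i" "e \<in> NU" | i where "i \<in> A" "g = t i" "e \<in> SL"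
      | i j where "i \<in> A" "j \<in> A" "e = t i" "g = t j" using cases[OF e] cases[OF g] by blast
    then show False
    proof cases
      case 1 then show False using noncrossingD[OF diagramsD(2)[OF dd(1)], of e g a b c h] NU abch ps by blast
    next
      case 2 then show False using noncrossingD[OF diagramsD(2)[OF dd(2)], of e g a b c h] SL abch ps by blast
    next
      case 3 then show False using pU[of e b] pL[of g c] abch ps by simp
    next
      case 4 then show False using pU[of g h] pL[of e a] abch ps by simp
    next
      case (5 i) then show False using pU[of g h] pt[of i a] pt[of i b] abch ps by auto
    next
      \<comment> \<open>Replace the new strand by the strand of \<open>d2\<close> with the same
        lower end; its upper end still comes before all caps in the boundary order.\<close>
      case (6 i)
      have "b = South (f i)" using pL[of g c] pt[of i b] abch ps 6 by auto
      moreover obtain k where k: "{North k, South (f i)} \<in> edges d2" "North k \<in> nodes n" using A2[OF 6(1)] by blast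
      moreover have "pos n (North k) < pos n c" using pL[of g c] pos_North[OF k(2)] abch 6 by simp
      ultimately show False
        using noncrossingD[OF diagramsD(2)[OF dd(2)] k(1), of g "North k" b c h] 6 SL abch ps by blast
    next
      \<comment> \<open>Symmetric, with the strand of \<open>d1\<close> that has the same upper
        end.\<close>
      case (7 i)
      have "c = North i" using pU[of e b] pt[of i c] abch ps 7 by auto
      moreover obtain j where j: "{North i, South j} \<in> edges d1" "South j \<in> nodes n" using A1[OF 7(1)] by blast
      moreover have "pos n b < pos n (South j)" using pU[of e b] pos_South[OF j(2)] abch 7 by simp
      ultimately show False
        using noncrossingD[OF diagramsD(2)[OF dd(1)] _ j(1), of e a b c "South j"] 7 NU abch ps by blast
    next
      case (8 i) then show False using pL[of e a] pL[of e b] pt[of i c] pt[of i h] abch ps by auto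
    next
      case (9 i j)
      have "a = North i" "b = South (f i)" using pt[OF 9(1), of a] pt[OF 9(1), of b] abch ps 9 by auto
      moreover have "c = North j" "h = South (f j)" using pt[OF 9(2), of c] pt[OF 9(2), of h] abch ps 9 by auto
      ultimately have *: "i < j" "pos n (South (f i)) < pos n (South (f j))" using ps by auto
      then have "f i < f j" using f(1) 9 by (auto dest: strict_mono_onD)
      then show False using * by auto
    qed
  qed
  have ex: "left_exposed n (edges D) e" if e: "e \<in> edges D" and pos: "0 < dec D e" for e
    unfolding left_exposed_def
  proof (intro notI, elim bexE)
    fix g c h assume g: "g \<in> edges D" and ch: "c \<in> g" "h \<in> g" and cov: "\<forall>x\<in>e. pos n c < pos n x \<and> pos n x < pos n h"
    have pU: "pos n x \<le> n" if "k \<in> NU" "x \<in> k" for k x using NUx[OF that] pos_North by auto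
    have pL: "n < pos n x" if "k \<in> SL" "x \<in> k" for k x using SLx[OF that] pos_South by auto
    have pt: "x = North i \<and> pos n x \<le> n \<or> x = South (f i) \<and> n < pos n x" if "i \<in> A" "x \<in> t i" for i x
      using that tn[OF that(1)] pos_North[of i n] pos_South[of "f i" n] by (auto simp: t_def)
    obtain x where x: "x \<in> e" using ne[OF e] by blast
    consider "e \<in> NU" | "e \<in> SL" | i where "i \<in> A" "e = t i" using cases[OF e] by blast
    then show False
    proof cases
      case 1
      have le1: "left_exposed n (edges d1) e" using diagramsD(3)[OF dd(1)] 1 NU decNU[OF 1] pos by simp
      consider "g \<in> NU" | "g \<in> SL" | i where "i \<in> A" "g = t i" using cases[OF g] by blast
      then show False
      proof cases
        case 1 then show False using le1 NU ch cov unfolding left_exposed_def by blast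
      next
        case 2 then show False using pL[of g c] pU[OF \<open>e \<in> NU\<close> x] ch cov x by force
      next
        case (3 i)
        have "c = North i" using pt[OF 3(1), of c] ch 3 cov x pU[OF \<open>e \<in> NU\<close> x] by force
        moreover obtain j where j: "{North i, South j} \<in> edges d1" "South j \<in> nodes n" using A1[OF 3(1)] by blast
        moreover have "pos n y < pos n (South j)" if "y \<in> e" for y using pU[OF \<open>e \<in> NU\<close> that] pos_South[OF j(2)] by simp
        ultimately show False using le1 cov unfolding left_exposed_def by blast
      qed
    next
      case 2
      have le2: "left_exposed n (edges d2) e" using diagramsD(3)[OF dd(2)] 2 SL decSL[OF 2] pos by simp
      consider "g \<in> NU" | "g \<in> SL" | i where "i \<in> A" "g = t i" using cases[OF g] by blast
      then show False
      proof cases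
        case 1 then show False using pU[of g h] pL[OF \<open>e \<in> SL\<close> x] ch cov x by force
      next
        case 2 then show False using le2 SL ch cov unfolding left_exposed_def by blast
      next
        case (3 i)
        have "h = South (f i)" using pt[OF 3(1), of h] ch 3 cov x pL[OF \<open>e \<in> SL\<close> x] by force
        moreover obtain k where k: "{North k, South (f i)} \<in> edges d2" "North k \<in> nodes n" using A2[OF 3(1)] by blast
        moreover have "pos n (North k) < pos n y" if "y \<in> e" for y using pL[OF \<open>e \<in> SL\<close> that] pos_North[OF k(2)] by simp
        ultimately show False using le2 cov unfolding left_exposed_def by blast
      qed
    next
      case (3 i)
      \<comment> \<open>A decorated strand is the leftmost one, and an arc covering it would have to
        be a strand further to the left.\<close>
      then have i: "i = Min A" using dect pos by (auto split: if_splits)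
      have "North i \<in> e" "South (f i) \<in> e" using 3 by (auto simp: t_def)
      then have c: "pos n c < pos n (North i)" "pos n (South (f i)) < pos n h" using cov by auto
      have ci: "pos n c < i" "n < pos n h" "i \<le> n"
        using c pos_North[OF tn(1)[OF 3(1)]] pos_South[OF tn(2)[OF 3(1)]] by linarith+
      consider "g \<in> NU" | "g \<in> SL" | j where "j \<in> A" "g = t j" using cases[OF g] by blast
      then show False
      proof cases
        case 1 then show False using pU[of g h] ch ci by simp
      next
        case 2 then show False using pL[of g c] ch ci by simp
      next
        case (3 j)
        then have "c = North j" using pt[OF 3(1), of c] ch ci by auto
        then have "j < i" using ci by simp
        then show False using i 3 fA(1) by (simp add: leD)
      qed
    qed
  qed
  \<comment> \<open>Without cups all n upper nodes propagate, in \<open>d2\<close> as well, so there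
    are no caps and the parity \<open>par'\<close> vanishes.\<close>
  have cup: "(\<forall>e\<in>edges D. dec D e = 0) \<and> (\<forall>k\<in>#loops D. k = 0)" if "cups D = {}"
  proof -
    have "NU \<subseteq> cups D" using NU by (auto simp: cups_def ED)
    then have N0: "NU = {}" using that by blast
    then have H1: "hedges (upper d1) = {}" unfolding NU_def by blast
    then have "cups d1 = {}" by (simp only: cups_upper image_empty)
    then have "card (props d1) = n" using card_cups[OF m1] by simp
    then have "card (cups d2) = 0" using card_cups[OF m2] cA by simp
    moreover have "finite (cups d2)" using matchingD(1)[OF m2] by (simp add: cups_def)
    ultimately have "cups (flip d2) = {}" using cups_flip_empty[OF m2] by simp
    then have H2: "hedges (lower d2) = {}" unfolding lower_flip cups_upper by blast
    have S0: "SL = {}" unfolding SL_def H2 by simp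
    have "par' = 0" unfolding par'_def half_total_def H1 H2 by simp
    then show ?thesis using N0 S0 dect LD by (auto simp: ED)
  qed
  have DD: "D \<in> diagrams n" by (intro diagramsI mD nc ex cup)
  have north_ne: "North ` e \<notin> SL" "North ` e \<noteq> t i" if eD: "North ` e \<in> edges D" for e i
  proof -
    obtain x where "x \<in> North ` e" using ne[OF eD] by blast
    then show "North ` e \<notin> SL" using SLx[of "North ` e" x] by auto
    show "North ` e \<noteq> t i" by (auto simp: t_def)
  qed
  have south_ne: "South ` e \<notin> NU" "South ` e \<noteq> t i" if eD: "South ` e \<in> edges D" for e i
  proof -
    obtain x where "x \<in> South ` e" using ne[OF eD] by blast
    then show "South ` e \<notin> NU" using NUx[of "South ` e" x] by auto
    show "South ` e \<noteq> t i" by (auto simp: t_def)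
  qed
  have U: "North ` e \<in> edges D \<longleftrightarrow> North ` e \<in> edges d1" for e
  proof
    assume e: "North ` e \<in> edges D"
    from cases[OF e] north_ne[OF e] have "North ` e \<in> NU" by blast
    then show "North ` e \<in> edges d1" by (simp add: NU)
  next
    assume "North ` e \<in> edges d1"
    then have "North ` e \<in> NU" by (simp add: NU image_mono)
    then show "North ` e \<in> edges D" by (simp add: ED)
  qed
  have L: "South ` e \<in> edges D \<longleftrightarrow> South ` e \<in> edges d2" for e
  proof
    assume e: "South ` e \<in> edges D"
    from cases[OF e] south_ne[OF e] have "South ` e \<in> SL" by blast
    then show "South ` e \<in> edges d2" by (simp add: SL)
  next
    assume "South ` e \<in> edges d2"
    then have "South ` e \<in> SL" by (simp add: SL image_mono)
    then show "South ` e \<in> edges D" by (simp add: ED)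
  qed
  have Ud: "dec D (North ` e) = dec d1 (North ` e)" for e
  proof (cases "North ` e \<in> edges D")
    case True
    from cases[OF True] north_ne[OF True] have "North ` e \<in> NU" by blast
    then show ?thesis by (rule decNU)
  next
    case False
    then show ?thesis using U[of e] decoff matchingD(3)[OF m1] by simp
  qed
  have Ld: "dec D (South ` e) = dec d2 (South ` e)" for e
  proof (cases "South ` e \<in> edges D")
    case True
    from cases[OF True] south_ne[OF True] have "South ` e \<in> SL" by blast
    then show ?thesis by (rule decSL)
  next
    case False
    then show ?thesis using L[of e] decoff matchingD(3)[OF m2] by simp
  qed
  show up: "upper D = upper d1" by (simp add: upper_def U Ud)
  show lo: "lower D = lower d2" by (simp add: lower_def L Ld)
  have edge_t: "{North i, South j} \<in> edges D \<longleftrightarrow> i \<in> A \<and> j = f i" for i j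
  proof
    assume "{North i, South j} \<in> edges D"
    from cases[OF this] show "i \<in> A \<and> j = f i"
    proof (elim disjE bexE)
      assume "{North i, South j} \<in> NU" then show ?thesis using NUx[of _ "South j"] by blast
    next
      assume "{North i, South j} \<in> SL" then show ?thesis using SLx[of _ "North i"] by blast
    next
      fix k assume "k \<in> A" "{North i, South j} = t k" then show ?thesis by (auto simp: t_def doubleton_eq_iff)
    qed
  next
    assume "i \<in> A \<and> j = f i"
    then show "{North i, South j} \<in> edges D" by (auto simp: ED t_def)
  qed
  have pD: "props D = A" by (auto simp: props_def edge_t)
  have paD: "partner D i = f i" if "i \<in> A" for i by (rule partner_eq[OF mD]) (simp add: edge_t that)
  have "(\<Sum>i\<in>props D. dec D {North i, South (partner D i)}) = (\<Sum>i\<in>A. dec D (t i))"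
    unfolding pD by (intro sum.cong) (simp_all add: paD t_def)
  also have "\<dots> = (\<Sum>i\<in>A. if i = Min A then par' else 0)" by (intro sum.cong refl dect)
  also have "\<dots> = (if A = {} then 0 else par')" using fA(1) Min_in[OF fA(1)] by simp
  finally have "total_dec D = half_total (upper d1) + half_total (lower d2) + (if A = {} then 0 else par')"
    using total_dec_decompose[OF mD LD] up lo by simp
  then have ev: "even (total_dec D)" using par by (auto simp: par'_def A_def)
  have "dec D e \<le> 1" for e
  proof (cases "e \<in> edges D")
    case True
    have "par' \<le> 1" by (simp add: par'_def)
    then show ?thesis using cases[OF True] decNU decSL dect le by (auto split: if_splits)
  qed (simp add: decoff)
  then show "D \<in> type_II n" using DD LD ev by (simp add: type_II_iff)
qed

section \<open>Halves and propagating edges of a product\<close>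

section \<open>Halves of products\<close>

lemma cups_stack:
  assumes a: "a \<in> diagrams n" and b: "b \<in> diagrams n"
  shows "cups a \<subseteq> cups (stack a b)"
proof
  fix e assume "e \<in> cups a"
  then have "e \<in> edges (stack a b)" "e \<subseteq> range North"
    using edges_stack_north(1)[OF diagramsD(1)[OF a] diagramsD(1)[OF b], of e] by (simp_all add: cups_def)
  then show "e \<in> cups (stack a b)" by (simp add: cups_def)
qed

lemma finite_cups: "matching n d \<Longrightarrow> finite (cups d)"
  using matchingD(1) by (simp add: cups_def)

text \<open>Cups of the upper factor survive, and more cups mean fewer propagating edges. Equality
  leaves no room for a new cup, so the upper half is unchanged.\<close>

lemma props_stack_left:
  assumes a: "a \<in> diagrams n" and b: "b \<in> diagrams n"
  shows "card (props (stack a b)) \<le> card (props a)"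
    "card (props (stack a b)) = card (props a) \<Longrightarrow> upper (stack a b) = upper a"
proof -
  let ?s = "stack a b"
  note ma = diagramsD(1)[OF a] and mb = diagramsD(1)[OF b] and ms = matching_stack[OF a b]
  have n: "n = 2 * card (cups a) + card (props a)" "n = 2 * card (cups ?s) + card (props ?s)"
    using card_cups ma ms by blast+
  have "card (cups a) \<le> card (cups ?s)" by (rule card_mono[OF finite_cups[OF ms] cups_stack[OF a b]])
  then show "card (props ?s) \<le> card (props a)" using n by simp
  assume "card (props ?s) = card (props a)"
  then have "card (cups a) = card (cups ?s)" using n by simp
  then have eq: "cups ?s = cups a" using card_subset_eq[OF finite_cups[OF ms] cups_stack[OF a b]] by simp
  have iff: "North ` e \<in> edges d \<longleftrightarrow> North ` e \<in> cups d" for e d by (auto simp: cups_def)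
  have E: "North ` e \<in> edges ?s \<longleftrightarrow> North ` e \<in> edges a" for e
    unfolding iff eq ..
  have "dec ?s (North ` e) = dec a (North ` e)" for e
  proof (cases "North ` e \<in> edges a")
    case True
    then show ?thesis by (intro edges_stack_north(2)[OF ma mb]) auto
  next
    case False
    then show ?thesis using E[of e] matchingD(3)[OF ma] matchingD(3)[OF ms] by simp
  qed
  then show "upper ?s = upper a" by (simp add: upper_def E)
qed

lemma props_stack_right:
  assumes a: "a \<in> diagrams n" and b: "b \<in> diagrams n"
  shows "card (props (stack a b)) \<le> card (props b)"
    "card (props (stack a b)) = card (props b) \<Longrightarrow> lower (stack a b) = lower b"
proof -
  note ma = diagramsD(1)[OF a] and mb = diagramsD(1)[OF b] and ms = matching_stack[OF a b]
  have f: "flip (stack a b) = stack (flip b) (flip a)" by (rule flip_stack[OF ma mb])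
  have c: "card (props (flip (stack a b))) = card (props (stack a b))" "card (props (flip b)) = card (props b)"
    using card_props_flip ms mb by blast+
  note P = props_stack_left[OF diagrams_flip[OF b] diagrams_flip[OF a], folded f, unfolded c]
  show "card (props (stack a b)) \<le> card (props b)" by (rule P(1))
  show "card (props (stack a b)) = card (props b) \<Longrightarrow> lower (stack a b) = lower b"
    unfolding lower_flip by (rule P(2))
qed

lemma upper_nf_cong: "upper a = upper b \<Longrightarrow> upper (nf a) = upper (nf b)"
  unfolding upper_def half.inject fun_eq_iff by (simp add: set_eq_iff)

lemma lower_nf_cong: "lower a = lower b \<Longrightarrow> lower (nf a) = lower (nf b)"
  unfolding lower_def half.inject fun_eq_iff by (simp add: set_eq_iff)

lemma props_nf [simp]: "props (nf d) = props d"
  by (simp add: props_def)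

lemma image_mset_sum: "finite A \<Longrightarrow> image_mset f (mset_set A) = (\<Sum>a\<in>A. {#f a#})"
  by (induction A rule: finite_induct) auto

lemma edge_net_sum:
  assumes "matching n d"
  shows "edge_net r s d = (\<Sum>h\<in>hedges (upper d). {#(Pair r ` h, hdec (upper d) h)#})
    + (\<Sum>h\<in>hedges (lower d). {#(Pair s ` h, hdec (lower d) h)#})
    + (\<Sum>i\<in>props d. {#({(r, i), (s, partner d i)}, dec d {North i, South (partner d i)})#})"
proof -
  have "edge_net r s d = (\<Sum>e\<in>edges d. {#(vtx r s ` e, dec d e)#})"
    unfolding edge_net_def by (rule image_mset_sum[OF matchingD(1)[OF assms]])
  also have "\<dots> = (\<Sum>h\<in>hedges (upper d). {#(vtx r s ` North ` h, dec d (North ` h))#})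
    + (\<Sum>h\<in>hedges (lower d). {#(vtx r s ` South ` h, dec d (South ` h))#})
    + (\<Sum>i\<in>props d. {#(vtx r s ` {North i, South (partner d i)}, dec d {North i, South (partner d i)})#})"
    by (rule sum_edges[OF assms])
  finally show ?thesis by (simp only: hedges_simps image_insert image_empty vtx.simps image_image)
qed

lemma loop_net_filter:
  assumes "proper d"
  shows "loop_net (loops d) = {#p \<in># net r s d. fst p = {}#}"
proof -
  have "\<forall>p\<in>#edge_net r s d. fst p \<noteq> {}" using assms by (auto simp: edge_net_def proper_def)
  then have "{#p \<in># edge_net r s d. fst p = {}#} = {#}" by simp
  moreover have "{#p \<in># loop_net (loops d). fst p = {}#} = (loop_net (loops d) :: (nat \<times> nat) net)"
    by (auto simp: filter_mset_eq_conv loop_net_def)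
  ultimately show ?thesis by (simp add: net_def)
qed

lemma filter_mset_sum: "finite A \<Longrightarrow> {#p \<in># (\<Sum>a\<in>A. f a). P p#} = (\<Sum>a\<in>A. {#p \<in># f a. P p#})"
  by (induction A rule: finite_induct) auto

lemma image_mset_sum': "finite A \<Longrightarrow> image_mset g (\<Sum>a\<in>A. f a) = (\<Sum>a\<in>A. image_mset g (f a))"
  by (induction A rule: finite_induct) auto

lemma verts_sum: "finite A \<Longrightarrow> verts (\<Sum>a\<in>A. f a) = (\<Union>a\<in>A. verts (f a))"
  by (induction A rule: finite_induct) auto

lemma hedge_pair:
  assumes "matching n d" "h \<in> hedges (upper d)"
  obtains i j where "h = {i, j}" "i \<noteq> j" "i \<in> {1..n}" "j \<in> {1..n}"
proof -
  have h: "North ` h \<in> edges d" using assms by simp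
  then have "card h = 2" using matchingD(5)[OF assms(1) h] by (simp add: card_image inj_on_def)
  then obtain i j where ij: "h = {i, j}" "i \<noteq> j" unfolding card_2_iff by blast
  have "North i \<in> nodes n" "North j \<in> nodes n" using matchingD(4)[OF assms(1) h] ij by auto
  then show ?thesis using that ij by (auto simp: nodes_def)
qed

text \<open>Each middle edge meets its mirror image and closes to a loop with twice its decorations,
  and each strand continues in a strand of the other factor. So no loop is odd, and the product of S
  \<circ> T and T \<circ> T' reduces to S \<circ> T' times one \<delta> for each edge of T.\<close>

lemma stack_matched:
  assumes d1: "d1 \<in> type_II n" and d2: "d2 \<in> type_II n" and lu: "lower d1 = upper d2"
  shows "\<not> odd_loop (stack d1 d2)" "size (loops (stack d1 d2)) = card (hedges (lower d1))"
    "nf (stack d1 d2) = circ n (upper d1) (lower d2)"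
proof -
  have D: "d1 \<in> diagrams n" "d2 \<in> diagrams n" and l: "loops d1 = {#}" "loops d2 = {#}"
    and ev: "even (total_dec d1)" "even (total_dec d2)"
    using d1 d2 by (auto simp: type_II_iff)
  note m1 = diagramsD(1)[OF D(1)] and m2 = diagramsD(1)[OF D(2)]
  let ?s = "stack d1 d2" and ?p = "partner d1" and ?q = "partner d2" and ?P = "props d1"
  define H where "H = hedges (upper d2)"
  have pr: "props d2 = ?p ` ?P"
  proof -
    have "{1..n} - ?p ` ?P = {1..n} - props d2"
      using Union_hedges_lower[OF m1] Union_hedges_upper[OF m2] lu by simp
    moreover have "?p ` ?P \<subseteq> {1..n}" using props_subset[OF matching_flip[OF m1]] props_flip[OF m1] by simp
    ultimately show ?thesis using props_subset[OF m2] by blast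
  qed
  have fin: "finite ?P" "finite H" "finite (hedges (upper d1))" "finite (hedges (lower d2))"
    using finite_props[OF m1] finite_hedges[OF m1] finite_hedges[OF m2] unfolding H_def by blast+
  have Pn: "?P \<subseteq> {1..n}" "?p ` ?P \<subseteq> {1..n}" using props_subset[OF m1] props_subset[OF m2] pr by auto
  define U where "U = (\<Sum>h\<in>hedges (upper d1). {#(Pair (0::nat) ` h, hdec (upper d1) h)#})"
  define L where "L = (\<Sum>h\<in>hedges (lower d2). {#(Pair (2::nat) ` h, hdec (lower d2) h)#})"
  define w where "w h = hdec (upper d2) h" for h
  define A where "A h = {#(Pair (1::nat) ` h, w h), (Pair 1 ` h, w h)#}" for h
  define u where "u i = dec d1 {North i, South (?p i)}" for i
  define v where "v i = dec d2 {North (?p i), South (?q (?p i))}" for i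
  define B where "B i = {#({(0::nat, i), (1, ?p i)}, u i), ({(1, ?p i), (2, ?q (?p i))}, v i)#}" for i
  have "net 0 1 d1 = U + (\<Sum>h\<in>H. {#(Pair 1 ` h, w h)#}) + (\<Sum>i\<in>?P. {#({(0, i), (1, ?p i)}, u i)#})"
    unfolding net_def edge_net_sum[OF m1] l U_def H_def w_def u_def lu by (simp add: loop_net_def del: hedges_simps)
  moreover have "net 1 2 d2 = (\<Sum>h\<in>H. {#(Pair 1 ` h, w h)#}) + L + (\<Sum>i\<in>?P. {#({(1, ?p i), (2, ?q (?p i))}, v i)#})"
    unfolding net_def edge_net_sum[OF m2] l L_def H_def w_def v_def pr sum.reindex[OF partner_inj[OF m1]]
    by (simp add: loop_net_def o_def del: hedges_simps)
  \<comment> \<open>Regroup the net into the outer edges, the mirror pairs \<open>A h\<close> that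
    close to loops, and the strands \<open>B i\<close>.\<close>
  ultimately have N: "net 0 1 d1 + net 1 2 d2 = (U + L) + ((\<Sum>h\<in>H. A h) + (\<Sum>i\<in>?P. B i))"
  proof -
    have "(\<Sum>h\<in>H. A h) = (\<Sum>h\<in>H. {#(Pair 1 ` h, w h)#}) + (\<Sum>h\<in>H. {#(Pair 1 ` h, w h)#})"
      unfolding A_def by (simp add: sum.distrib[symmetric])
    moreover have "(\<Sum>i\<in>?P. B i) = (\<Sum>i\<in>?P. {#({(0, i), (1, ?p i)}, u i)#}) + (\<Sum>i\<in>?P. {#({(1, ?p i), (2, ?q (?p i))}, v i)#})"
      unfolding B_def by (simp add: sum.distrib[symmetric] add_mset_commute)
    ultimately show ?thesis using \<open>net 0 1 d1 = _\<close> \<open>net 1 2 d2 = _\<close> by (simp only: ac_simps)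
  qed
  have hp: "\<exists>i j. h = {i, j} \<and> i \<noteq> j \<and> i \<in> {1..n} \<and> j \<in> {1..n}" if "h \<in> H" for h
    using hedge_pair[OF m2 that[unfolded H_def]] by metis
  have Hfree: "h \<inter> ?p ` ?P = {}" if "h \<in> H" for h
    using that Union_hedges_upper[OF m2] pr unfolding H_def by blast
  have vA: "verts (A h) = Pair 1 ` h" for h by (simp add: A_def)
  have vB: "verts (B i) = {(0, i), (1, ?p i), (2, ?q (?p i))}" for i by (auto simp: B_def)
  have Hdis: "h \<inter> h' = {}" if "h \<in> H" "h' \<in> H" "h \<noteq> h'" for h h'
  proof (rule ccontr)
    assume "h \<inter> h' \<noteq> {}"
    then have "North ` h \<inter> North ` h' \<noteq> {}" by blast
    then have "North ` h = North ` h'" using that matchingD(7)[OF m2, of "North ` h" "North ` h'"] by (simp add: H_def)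
    then show False using that(3) by (simp add: inj_image_eq_iff[OF inj_North])
  qed
  have elA: "elims (row 1 n) (A h) = {#({}, 2 * w h)#}" if "h \<in> H" for h
  proof -
    obtain i j where ij: "h = {i, j}" "i \<noteq> j" "i \<in> {1..n}" "j \<in> {1..n}" using hp[OF \<open>h \<in> H\<close>] by blast
    have "elims (row 1 n) (A h) = elims [(1, i), (1, j)] (A h)"
      using ij by (intro elims_cong) (auto simp: vA distinct_map inj_on_def)
    also have "\<dots> = elim (1, j) (elim (1, i) (A h + {#}))" by simp
    also have "elim (1, i) (A h + {#}) = {#({(1, j)}, 2 * w h)#} + {#}"
      using ij by (subst elim_touched) (auto simp: A_def)
    also have "elim (1, j) ({#({(1, j)}, 2 * w h)#} + {#}) = {#({}, 2 * w h)#}"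
      by (subst elim_touched) auto
    finally show ?thesis .
  qed
  have elB: "elims (row 1 n) (B i) = {#({(0, i), (2, ?q (?p i))}, u i + v i)#}" if "i \<in> ?P" for i
  proof -
    have "elims (row 1 n) (B i) = elims [(1, ?p i)] (B i)"
      using that Pn by (intro elims_cong) (auto simp: vB distinct_map inj_on_def)
    also have "\<dots> = elim (1, ?p i) (B i + {#})" by simp
    also have "\<dots> = {#({(0, i), (2, ?q (?p i))}, u i + v i)#}"
      by (subst elim_touched) (auto simp: B_def)
    finally show ?thesis .
  qed
  have vU: "verts U \<subseteq> {0} \<times> UNIV" "verts L \<subseteq> {2} \<times> UNIV"
    unfolding U_def L_def using fin by (auto simp: verts_sum simp del: hedges_simps)
  have "net 0 2 ?s = elims (row 1 n) (net 0 1 d1 + net 1 2 d2)"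
    using m1 m2 by (intro net_stack) auto
  also have "\<dots> = elims (row 1 n) (((\<Sum>h\<in>H. A h) + (\<Sum>i\<in>?P. B i)) + (U + L))"
    unfolding N by (simp only: add.commute)
  also have "\<dots> = elims (row 1 n) ((\<Sum>h\<in>H. A h) + (\<Sum>i\<in>?P. B i)) + (U + L)"
    using vU by (intro elims_add_untouched) auto
  also have "elims (row 1 n) ((\<Sum>h\<in>H. A h) + (\<Sum>i\<in>?P. B i)) = elims (row 1 n) (\<Sum>h\<in>H. A h) + elims (row 1 n) (\<Sum>i\<in>?P. B i)"
    using fin Hfree by (intro elims_add) (auto simp: verts_sum vA vB)
  also have "elims (row 1 n) (\<Sum>h\<in>H. A h) = (\<Sum>h\<in>H. {#({}, 2 * w h)#})"
  proof -
    have "elims (row 1 n) (\<Sum>h\<in>H. A h) = (\<Sum>h\<in>H. elims (row 1 n) (A h))"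
      using fin Hdis by (intro elims_sum) (auto simp: vA)
    then show ?thesis by (simp only: elA cong: sum.cong)
  qed
  also have "elims (row 1 n) (\<Sum>i\<in>?P. B i) = (\<Sum>i\<in>?P. {#({(0, i), (2, ?q (?p i))}, u i + v i)#})"
  proof -
    have "elims (row 1 n) (\<Sum>i\<in>?P. B i) = (\<Sum>i\<in>?P. elims (row 1 n) (B i))"
      using fin partner_inj[OF m1] by (intro elims_sum) (auto simp: vB dest: inj_onD)
    then show ?thesis by (simp only: elB cong: sum.cong)
  qed
  finally have net: "net 0 2 ?s = (\<Sum>h\<in>H. {#({}, 2 * w h)#})
      + (\<Sum>i\<in>?P. {#({(0, i), (2, ?q (?p i))}, u i + v i)#}) + (U + L)" .
  have prs: "proper ?s" by (rule matching_proper[OF matching_stack[OF D]])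
  have ne: "h \<noteq> {}" if "h \<in> hedges (upper d1) \<or> h \<in> hedges (lower d2)" for h
    using that matchingD(2)[OF m1] matchingD(2)[OF m2] by auto
  have "loop_net (loops ?s) = {#p \<in># net 0 2 ?s. fst p = {}#}" by (rule loop_net_filter[OF prs])
  also have "\<dots> = (\<Sum>h\<in>H. {#({}, 2 * w h)#})"
  proof -
    have "{#p \<in># U. fst p = {}#} = {#}" "{#p \<in># L. fst p = {}#} = {#}"
      unfolding U_def L_def using ne by (simp_all add: filter_mset_sum[OF fin(3)] filter_mset_sum[OF fin(4)] del: hedges_simps)
    then show ?thesis unfolding net by (simp add: filter_mset_sum[OF fin(2)] filter_mset_sum[OF fin(1)])
  qed
  finally have "image_mset snd (loop_net (loops ?s) :: (nat \<times> nat) net) = image_mset snd (\<Sum>h\<in>H. {#({} :: (nat \<times> nat) set, 2 * w h)#})" by simp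
  then have loops: "loops ?s = (\<Sum>h\<in>H. {#2 * w h#})"
    by (simp add: loop_net_def multiset.map_comp o_def image_mset_sum'[OF fin(2)])
  have "odd_loop ?s \<longleftrightarrow> False"
    unfolding odd_loop_def loops image_mset_sum[OF fin(2), symmetric] by (auto simp: fin(2))
  then show no: "\<not> odd_loop ?s" by simp
  show "size (loops ?s) = card (hedges (lower d1))"
    unfolding loops image_mset_sum[OF fin(2), symmetric] lu H_def by simp
  have "?P \<subseteq> props ?s"
  proof
    fix i assume i: "i \<in> ?P"
    have "({(0 :: nat, i), (2 :: nat, ?q (?p i))}, u i + v i) \<in># (\<Sum>i\<in>?P. {#({(0, i), (2, ?q (?p i))}, u i + v i)#})"
      unfolding image_mset_sum[OF fin(1), symmetric] using fin(1) i by auto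
    then have "(vtx 0 2 ` {North i, South (?q (?p i))}, u i + v i) \<in># net 0 2 ?s"
      by (simp only: net union_iff image_insert image_empty vtx.simps simp_thms)
    moreover have "finite (edges ?s)" using prs by (simp add: proper_def)
    ultimately have "{North i, South (?q (?p i))} \<in> edges ?s"
      by (simp add: net_mem_iff del: image_insert)
    then show "i \<in> props ?s" by (auto simp: props_def)
  qed
  then have "card ?P \<le> card (props ?s)" by (intro card_mono finite_props[OF matching_stack[OF D]])
  then have c1: "card (props ?s) = card ?P" using props_stack_left(1)[OF D] by simp
  moreover have "card (props d2) = card ?P" unfolding pr by (rule card_image[OF partner_inj[OF m1]])
  ultimately have u: "upper ?s = upper d1" and lo: "lower ?s = lower d2"
    using props_stack_left(2)[OF D] props_stack_right(2)[OF D] by simp_all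
  \<comment> \<open>A type II diagram is determined by its halves, so the decorations on the strands
    need not be traced; evenness takes care of them.\<close>
  have "even (total_dec ?s)" using total_dec_stack[OF m1 m2] ev by simp
  then have "nf ?s \<in> type_II n" using nf_in_type_II[OF diagrams_stack[OF D]] no by simp
  then have "nf ?s = circ n (upper (nf ?s)) (lower (nf ?s))" using circ_upper_lower by metis
  then show "nf ?s = circ n (upper d1) (lower d2)"
    using upper_nf_cong[OF u] lower_nf_cong[OF lo] d1 d2 by simp
qed

section \<open>Quotients and subalgebras of unital algebras\<close>

section \<open>Algebras, quotients, subalgebras\<close>

text \<open>The laws pass to the image of a map that preserves the operations, which spares checking
  them on cosets one by one.\<close>

lemma unital_algebra_image:
  fixes R (structure) and A (structure) and Q (structure)
  assumes "unital_algebra R A"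
    and car: "carrier Q = h ` carrier A"
    and add: "\<And>x y. x \<in> carrier A \<Longrightarrow> y \<in> carrier A \<Longrightarrow> h (x \<oplus>\<^bsub>A\<^esub> y) = h x \<oplus>\<^bsub>Q\<^esub> h y"
    and mult: "\<And>x y. x \<in> carrier A \<Longrightarrow> y \<in> carrier A \<Longrightarrow> h (x \<otimes>\<^bsub>A\<^esub> y) = h x \<otimes>\<^bsub>Q\<^esub> h y"
    and smult: "\<And>c x. c \<in> carrier R \<Longrightarrow> x \<in> carrier A \<Longrightarrow> h (c \<odot>\<^bsub>A\<^esub> x) = c \<odot>\<^bsub>Q\<^esub> h x"
    and one: "h \<one>\<^bsub>A\<^esub> = \<one>\<^bsub>Q\<^esub>" and zero: "h \<zero>\<^bsub>A\<^esub> = \<zero>\<^bsub>Q\<^esub>"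
  shows "unital_algebra R Q"
proof -
  interpret A: unital_algebra R A by fact
  have grp: "abelian_group Q"
  proof (rule abelian_groupI)
    show "x \<oplus>\<^bsub>Q\<^esub> y \<in> carrier Q" if "x \<in> carrier Q" "y \<in> carrier Q" for x y
      using that unfolding car by (auto simp: add[symmetric])
    show "\<zero>\<^bsub>Q\<^esub> \<in> carrier Q" unfolding car zero[symmetric] by simp
    show "x \<oplus>\<^bsub>Q\<^esub> y \<oplus>\<^bsub>Q\<^esub> z = x \<oplus>\<^bsub>Q\<^esub> (y \<oplus>\<^bsub>Q\<^esub> z)" if "x \<in> carrier Q" "y \<in> carrier Q" "z \<in> carrier Q" for x y z
      using that unfolding car by (auto simp: add[symmetric] A.a_assoc)
    show "x \<oplus>\<^bsub>Q\<^esub> y = y \<oplus>\<^bsub>Q\<^esub> x" if "x \<in> carrier Q" "y \<in> carrier Q" for x y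
      using that unfolding car by (auto simp: add[symmetric] A.a_comm)
    show "\<zero>\<^bsub>Q\<^esub> \<oplus>\<^bsub>Q\<^esub> x = x" if "x \<in> carrier Q" for x
      using that unfolding car by (auto simp: add[symmetric] zero[symmetric])
    show "\<exists>y\<in>carrier Q. y \<oplus>\<^bsub>Q\<^esub> x = \<zero>\<^bsub>Q\<^esub>" if "x \<in> carrier Q" for x
    proof -
      obtain a where a: "a \<in> carrier A" "x = h a" using \<open>x \<in> carrier Q\<close> unfolding car by blast
      have "h (\<ominus>\<^bsub>A\<^esub> a) \<oplus>\<^bsub>Q\<^esub> x = \<zero>\<^bsub>Q\<^esub>" using a by (simp add: add[symmetric] zero[symmetric] A.l_neg)
      then show ?thesis using a unfolding car by blast
    qed
  qed
  have mon: "Group.monoid Q"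
    by (rule monoidI) (auto simp: car mult[symmetric] one[symmetric] A.m_assoc)
  have ring: "ring Q"
    by (rule ringI[OF grp mon]) (auto simp: car mult[symmetric] add[symmetric] A.l_distr A.r_distr)
  have "module R Q"
    unfolding module_def module_axioms_def
  proof (intro conjI allI impI grp)
    show "cring R" by (rule A.R.is_cring)
  qed (auto simp: car mult[symmetric] add[symmetric] smult[symmetric] A.smult_l_distr A.smult_r_distr A.smult_assoc1)
  then show ?thesis
    unfolding unital_algebra_def unital_algebra_axioms_def using ring
    by (auto simp: car mult[symmetric] smult[symmetric] A.smult_mult_left A.smult_mult_right)
qed

lemma quot_algebra_sel:
  "carrier (quot_algebra A I) = a_rcosets\<^bsub>A\<^esub> I"
  "x \<otimes>\<^bsub>quot_algebra A I\<^esub> y = rcoset_mult A I x y"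
  "x \<oplus>\<^bsub>quot_algebra A I\<^esub> y = set_add A x y"
  "\<one>\<^bsub>quot_algebra A I\<^esub> = I +>\<^bsub>A\<^esub> \<one>\<^bsub>A\<^esub>"
  "\<zero>\<^bsub>quot_algebra A I\<^esub> = I"
  "c \<odot>\<^bsub>quot_algebra A I\<^esub> K = (\<Union>x\<in>K. I +>\<^bsub>A\<^esub> (c \<odot>\<^bsub>A\<^esub> x))"
  by (simp_all add: quot_algebra_def ring.defs module.defs FactRing_def)

lemma quot_algebra:
  fixes R (structure) and A (structure)
  assumes A: "unital_algebra R A" and I: "ideal I A"
  defines "h \<equiv> \<lambda>x. I +>\<^bsub>A\<^esub> x" and "Q \<equiv> quot_algebra A I"
  shows "unital_algebra R Q" "carrier Q = h ` carrier A"
    "\<And>x y. x \<in> carrier A \<Longrightarrow> y \<in> carrier A \<Longrightarrow> h (x \<oplus>\<^bsub>A\<^esub> y) = h x \<oplus>\<^bsub>Q\<^esub> h y"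
    "\<And>x y. x \<in> carrier A \<Longrightarrow> y \<in> carrier A \<Longrightarrow> h (x \<otimes>\<^bsub>A\<^esub> y) = h x \<otimes>\<^bsub>Q\<^esub> h y"
    "\<And>c x. c \<in> carrier R \<Longrightarrow> x \<in> carrier A \<Longrightarrow> h (c \<odot>\<^bsub>A\<^esub> x) = c \<odot>\<^bsub>Q\<^esub> h x"
    "h \<one>\<^bsub>A\<^esub> = \<one>\<^bsub>Q\<^esub>" "h \<zero>\<^bsub>A\<^esub> = \<zero>\<^bsub>Q\<^esub>"
    "\<And>x y. x \<in> carrier A \<Longrightarrow> y \<in> carrier A \<Longrightarrow> h x = h y \<longleftrightarrow> x \<ominus>\<^bsub>A\<^esub> y \<in> I"
proof -
  interpret A: unital_algebra R A by fact
  interpret I: ideal I A by fact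
  have Icar: "i \<in> carrier A" if "i \<in> I" for i using that I.a_subset by blast
  show eq: "h x = h y \<longleftrightarrow> x \<ominus>\<^bsub>A\<^esub> y \<in> I" if "x \<in> carrier A" "y \<in> carrier A" for x y
    using A.quotient_eq_iff_same_a_r_cos[OF I that] unfolding h_def by blast
  show car: "carrier Q = h ` carrier A"
    unfolding Q_def quot_algebra_sel h_def by (auto simp: A_RCOSETS_def' )
  show add: "h (x \<oplus>\<^bsub>A\<^esub> y) = h x \<oplus>\<^bsub>Q\<^esub> h y" if "x \<in> carrier A" "y \<in> carrier A" for x y
    unfolding Q_def quot_algebra_sel h_def using I.a_rcos_sum that by simp
  show mult: "h (x \<otimes>\<^bsub>A\<^esub> y) = h x \<otimes>\<^bsub>Q\<^esub> h y" if "x \<in> carrier A" "y \<in> carrier A" for x y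
    unfolding Q_def quot_algebra_sel h_def using I.rcoset_mult_add that by simp
  show one: "h \<one>\<^bsub>A\<^esub> = \<one>\<^bsub>Q\<^esub>" unfolding Q_def quot_algebra_sel h_def ..
  show zero: "h \<zero>\<^bsub>A\<^esub> = \<zero>\<^bsub>Q\<^esub>"
    unfolding Q_def quot_algebra_sel h_def by (rule A.a_coset_add_zero[OF I.a_subset])
  show smult: "h (c \<odot>\<^bsub>A\<^esub> x) = c \<odot>\<^bsub>Q\<^esub> h x" if "c \<in> carrier R" "x \<in> carrier A" for c x
  proof -
    have "h (c \<odot>\<^bsub>A\<^esub> z) = h (c \<odot>\<^bsub>A\<^esub> x)" if z: "z \<in> h x" for z
    proof -
      obtain i where i: "i \<in> I" "z = i \<oplus>\<^bsub>A\<^esub> x" using z unfolding h_def a_r_coset_def' by blast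
      \<comment> \<open>An ideal is closed under scalars, because a scalar acts as multiplication by
        that multiple of the unit. Hence the union that defines the scalar action is a union of
        equal cosets.\<close>
      have "c \<odot>\<^bsub>A\<^esub> i = (c \<odot>\<^bsub>A\<^esub> \<one>\<^bsub>A\<^esub>) \<otimes>\<^bsub>A\<^esub> i"
        using A.smult_mult_left[OF \<open>c \<in> carrier R\<close>, of "\<one>\<^bsub>A\<^esub>" i] Icar[OF i(1)] by simp
      then have ci: "c \<odot>\<^bsub>A\<^esub> i \<in> I" using I.I_l_closed[OF i(1), of "c \<odot>\<^bsub>A\<^esub> \<one>\<^bsub>A\<^esub>"] \<open>c \<in> carrier R\<close> by simp
      have "c \<odot>\<^bsub>A\<^esub> z = c \<odot>\<^bsub>A\<^esub> i \<oplus>\<^bsub>A\<^esub> c \<odot>\<^bsub>A\<^esub> x"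
        unfolding i(2) using \<open>c \<in> carrier R\<close> \<open>x \<in> carrier A\<close> Icar[OF i(1)] by (simp add: A.smult_r_distr)
      then have "c \<odot>\<^bsub>A\<^esub> z \<ominus>\<^bsub>A\<^esub> c \<odot>\<^bsub>A\<^esub> x = c \<odot>\<^bsub>A\<^esub> i"
        using \<open>c \<in> carrier R\<close> \<open>x \<in> carrier A\<close> Icar[OF i(1)] by (simp add: A.minus_eq A.a_assoc A.r_neg)
      then show ?thesis using eq ci \<open>c \<in> carrier R\<close> \<open>x \<in> carrier A\<close> Icar[OF i(1)] i(2) by simp
    qed
    moreover have "x \<in> h x" unfolding h_def by (rule I.a_rcos_self[OF \<open>x \<in> carrier A\<close>])
    ultimately have "(\<Union>z\<in>h x. h (c \<odot>\<^bsub>A\<^esub> z)) = h (c \<odot>\<^bsub>A\<^esub> x)" by blast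
    then show ?thesis unfolding Q_def quot_algebra_sel(6) h_def[symmetric] by simp
  qed
  show "unital_algebra R Q" by (rule unital_algebra_image[OF A car add mult smult one zero])
qed

lemma subalgebra_unital:
  fixes R (structure) and A (structure)
  assumes A: "unital_algebra R A" and "subring H A" "submodule H R A"
  shows "unital_algebra R (A\<lparr>carrier := H\<rparr>)"
proof -
  interpret A: unital_algebra R A by fact
  have ring: "ring (A\<lparr>carrier := H\<rparr>)" by (rule A.subring_is_ring[OF assms(2)])
  have sub: "x \<in> H \<Longrightarrow> x \<in> carrier A" for x using subringE(1)[OF assms(2)] by blast
  have sm: "c \<in> carrier R \<Longrightarrow> x \<in> H \<Longrightarrow> c \<odot>\<^bsub>A\<^esub> x \<in> H" for c x by (rule submodule.smult_closed[OF assms(3)])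
  have "module R (A\<lparr>carrier := H\<rparr>)"
    unfolding module_def module_axioms_def
    using ring.is_abelian_group[OF ring] A.R.is_cring sm sub
    by (simp add: A.smult_l_distr A.smult_r_distr A.smult_assoc1)
  then show ?thesis
    unfolding unital_algebra_def unital_algebra_axioms_def using ring sub
    by (simp add: A.smult_mult_left A.smult_mult_right)
qed

lemma gen_subalgebra:
  fixes R (structure) and A (structure)
  assumes A: "unital_algebra R A" and S: "S \<subseteq> carrier A"
  shows "subring (gen_subalgebra R A S) A" "submodule (gen_subalgebra R A S) R A" "S \<subseteq> gen_subalgebra R A S"
    "\<And>H. subring H A \<Longrightarrow> submodule H R A \<Longrightarrow> S \<subseteq> H \<Longrightarrow> gen_subalgebra R A S \<subseteq> H"
proof -
  interpret A: unital_algebra R A by fact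
  let ?F = "{H. subring H A \<and> submodule H R A \<and> S \<subseteq> H}"
  have "subring (carrier A) A" by (intro A.subringI) auto
  moreover have "submodule (carrier A) R A" by (intro A.submoduleI) auto
  ultimately have ne: "carrier A \<in> ?F" using S by blast
  show sr: "subring (gen_subalgebra R A S) A"
    unfolding gen_subalgebra_def 
  proof (rule A.subring_Inter)
    show "?F \<noteq> {}" using ne by blast
  qed simp
  note E = subringE[OF sr]
  show "submodule (gen_subalgebra R A S) R A"
  proof (rule A.submoduleI)
    fix a x assume a: "a \<in> carrier R" and x: "x \<in> gen_subalgebra R A S"
    show "a \<odot>\<^bsub>A\<^esub> x \<in> gen_subalgebra R A S"
      unfolding gen_subalgebra_def
    proof (rule InterI)
      fix H assume H: "H \<in> ?F"
      then have "x \<in> H" using x unfolding gen_subalgebra_def by (rule InterD[rotated])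
      moreover have "submodule H R A" using H by simp
      ultimately show "a \<odot>\<^bsub>A\<^esub> x \<in> H" using submodule.smult_closed[of H R A a x] a by simp
    qed
  qed (use E(1,2,5,7) in blast)+
  show "S \<subseteq> gen_subalgebra R A S" unfolding gen_subalgebra_def by blast
  show "gen_subalgebra R A S \<subseteq> H" if "subring H A" "submodule H R A" "S \<subseteq> H" for H
    unfolding gen_subalgebra_def using that by blast
qed

section \<open>The algebra of formal combinations of diagrams\<close>

section \<open>Linear combinations of diagrams\<close>

type_synonym comb = "diag \<Rightarrow>\<^sub>0 int poly"

abbreviation keys :: "comb \<Rightarrow> diag set" where "keys \<equiv> Poly_Mapping.keys"
abbreviation lkp :: "comb \<Rightarrow> diag \<Rightarrow> int poly" where "lkp \<equiv> Poly_Mapping.lookup"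
abbreviation sgl :: "diag \<Rightarrow> int poly \<Rightarrow> comb" where "sgl \<equiv> Poly_Mapping.single"

definition scal :: "int poly \<Rightarrow> comb \<Rightarrow> comb"
  where "scal c x = Poly_Mapping.map ((*) c) x"

lemma lookup_scal [simp]: "lkp (scal c x) d = c * lkp x d"
  by (simp add: scal_def Poly_Mapping.map.rep_eq when_def)

lemma scal_simps [simp]: "scal 0 x = 0" "scal c 0 = 0" "scal 1 x = x" "scal c (sgl d e) = sgl d (c * e)"
  by (auto intro!: poly_mapping_eqI simp: lookup_single when_def)

lemma scal_add: "scal c (x + y) = scal c x + scal c y" "scal (c + e) x = scal c x + scal e x"
  by (auto intro!: poly_mapping_eqI simp: lookup_add algebra_simps)

lemma scal_scal [simp]: "scal c (scal e x) = scal (c * e) x"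
  by (auto intro!: poly_mapping_eqI simp: algebra_simps)

lemma scal_minus: "scal c (x - y) = scal c x - scal c y"
  by (rule poly_mapping_eqI) (simp add: lookup_minus right_diff_distrib)

lemma scal_sum: "scal c (\<Sum>i\<in>I. f i) = (\<Sum>i\<in>I. scal c (f i))"
  by (induction I rule: infinite_finite_induct) (auto simp: scal_add)

lemma keys_scal: "keys (scal c x) \<subseteq> keys x"
  by (auto simp: in_keys_iff)

text \<open>Integer polynomials have no zero divisors; used to cancel powers of \<delta>.\<close>

lemma scal_cancel: "c \<noteq> 0 \<Longrightarrow> scal c x = scal c y \<longleftrightarrow> x = y"
proof
  assume c: "c \<noteq> 0" and eq: "scal c x = scal c y"
  have "c * lkp x d = c * lkp y d" for d using arg_cong[OF eq, of "\<lambda>z. lkp z d"] by simp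
  then show "x = y" using c by (intro poly_mapping_eqI) simp
qed simp

text \<open>Linear extension of a map on diagrams. Reduction, inversion and both arguments of the
  product are instances.\<close>

definition lin :: "(diag \<Rightarrow> comb) \<Rightarrow> comb \<Rightarrow> comb"
  where "lin f x = (\<Sum>d\<in>keys x. scal (lkp x d) (f d))"

lemma lin_superset: "finite S \<Longrightarrow> keys x \<subseteq> S \<Longrightarrow> lin f x = (\<Sum>d\<in>S. scal (lkp x d) (f d))"
  unfolding lin_def by (rule sum.mono_neutral_left) (auto simp: in_keys_iff)

lemma lin_add: "lin f (x + y) = lin f x + lin f y"
proof -
  let ?S = "keys x \<union> keys y"
  have "keys (x + y) \<subseteq> ?S" by (rule keys_add)
  then show ?thesis
    using lin_superset[of ?S "x + y" f] lin_superset[of ?S x f] lin_superset[of ?S y f]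
    by (simp add: lookup_add scal_add sum.distrib)
qed

lemma lin_scal: "lin f (scal c x) = scal c (lin f x)"
  using lin_superset[of "keys x" "scal c x" f] keys_scal[of c x] by (simp add: lin_def scal_sum)

lemma lin_single [simp]: "lin f (sgl d c) = scal c (f d)"
  using lin_superset[of "{d}" "sgl d c" f] by simp

lemma lin_0 [simp]: "lin f 0 = 0"
  by (simp add: lin_def)

lemma lin_minus: "lin f (x - y) = lin f x - lin f y"
  using lin_add[of f "x - y" y] by simp

lemma lin_sum: "lin f (\<Sum>i\<in>I. g i) = (\<Sum>i\<in>I. lin f (g i))"
  by (induction I rule: infinite_finite_induct) (auto simp: lin_add)

text \<open>A statement stable under addition need only be checked on multiples of single diagrams
  in \<open>D\<close>.\<close>

lemma comb_induct [consumes 1, case_names zero single add]: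
  assumes "keys x \<subseteq> D"
    and "P 0" and single: "\<And>d c. d \<in> D \<Longrightarrow> P (sgl d c)"
    and add: "\<And>x y. keys x \<subseteq> D \<Longrightarrow> keys y \<subseteq> D \<Longrightarrow> P x \<Longrightarrow> P y \<Longrightarrow> P (x + y)"
  shows "P x"
proof -
  have *: "P (\<Sum>d\<in>S. sgl d (lkp x d)) \<and> keys (\<Sum>d\<in>S. sgl d (lkp x d)) \<subseteq> D" if "finite S" "S \<subseteq> D" for S
    using that
  proof (induction S rule: finite_induct)
    case (insert d S)
    have "keys (sgl d (lkp x d)) \<subseteq> D" using insert by simp
    moreover have "keys (sgl d (lkp x d) + (\<Sum>d\<in>S. sgl d (lkp x d)))
        \<subseteq> keys (sgl d (lkp x d)) \<union> keys (\<Sum>d\<in>S. sgl d (lkp x d))" by (rule keys_add)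
    ultimately show ?case using insert add single by auto
  qed (use assms(2) in simp)
  have "x = lin (\<lambda>d. sgl d 1) x"
  proof (rule poly_mapping_eqI)
    fix k
    have "lkp (lin (\<lambda>d. sgl d 1) x) k = (\<Sum>d\<in>keys x. if d = k then lkp x d else 0)"
      unfolding lin_def lookup_sum by (intro sum.cong) (auto simp: lookup_single when_def)
    then show "lkp x k = lkp (lin (\<lambda>d. sgl d 1) x) k" by (simp add: in_keys_iff)
  qed
  then have "x = (\<Sum>d\<in>keys x. sgl d (lkp x d))" by (simp add: lin_def)
  then show ?thesis using *[of "keys x"] assms(1) by (metis finite_keys)
qed

lemma keys_lin:
  assumes "keys x \<subseteq> D" "\<And>d. d \<in> D \<Longrightarrow> keys (f d) \<subseteq> E"
  shows "keys (lin f x) \<subseteq> E"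
  using assms(1)
proof (induction rule: comb_induct)
  case (single d c)
  then show ?case using assms(2)[of d] keys_scal[of c "f d"] by auto
next
  case (add x y)
  then show ?case using keys_add[of "lin f x" "lin f y"] by (auto simp: lin_add)
qed simp

definition pmul :: "comb \<Rightarrow> comb \<Rightarrow> comb"
  where "pmul x y = (\<Sum>a\<in>keys x. \<Sum>b\<in>keys y. sgl (stack a b) (lkp x a * lkp y b))"

lemma pmul_lin: "pmul x y = lin (\<lambda>a. lin (\<lambda>b. sgl (stack a b) 1) y) x"
  by (simp add: pmul_def lin_def scal_sum)

text \<open>Exchanging the sums makes linearity in the right argument an instance of the laws of
  \<open>lin\<close>.\<close>

lemma pmul_lin_right: "pmul x y = lin (\<lambda>b. lin (\<lambda>a. sgl (stack a b) 1) x) y"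
  unfolding pmul_def lin_def scal_sum by (subst sum.swap) (simp add: mult.commute)

lemma pmul_simps [simp]: "pmul 0 y = 0" "pmul x 0 = 0" "pmul (sgl a c) (sgl b e) = sgl (stack a b) (c * e)"
  by (simp_all add: pmul_lin) (simp add: lin_def)

lemma pmul_add: "pmul (x + y) z = pmul x z + pmul y z" "pmul x (y + z) = pmul x y + pmul x z"
  by (simp add: pmul_lin lin_add) (simp add: pmul_lin_right lin_add)

lemma pmul_scal: "pmul (scal c x) y = scal c (pmul x y)" "pmul x (scal c y) = scal c (pmul x y)"
  by (simp add: pmul_lin lin_scal) (simp add: pmul_lin_right lin_scal)

lemma keys_pmul: "keys x \<subseteq> D \<Longrightarrow> keys y \<subseteq> D' \<Longrightarrow> (\<And>a b. a \<in> D \<Longrightarrow> b \<in> D' \<Longrightarrow> stack a b \<in> E) \<Longrightarrow> keys (pmul x y) \<subseteq> E"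
  unfolding pmul_lin by (rule keys_lin, assumption, rule keys_lin, assumption) auto

lemma pmul_assoc:
  assumes "keys x \<subseteq> diagrams n" "keys y \<subseteq> diagrams n" "keys z \<subseteq> diagrams n"
  shows "pmul (pmul x y) z = pmul x (pmul y z)"
  using assms(1)
proof (induction rule: comb_induct)
  case (single a c)
  from assms(2) show ?case
  proof (induction rule: comb_induct)
    case (single b e)
    from assms(3) show ?case
    proof (induction rule: comb_induct)
      case (single d f)
      then show ?case using \<open>a \<in> _\<close> \<open>b \<in> _\<close> by (simp add: stack_assoc mult.assoc)
    qed (simp_all add: pmul_add)
  qed (simp_all add: pmul_add)
qed (simp_all add: pmul_add)

lemma pmul_id:
  assumes "keys x \<subseteq> diagrams n"
  shows "pmul (sgl (id_diag n) 1) x = x" "pmul x (sgl (id_diag n) 1) = x"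
  using assms
  by (induction rule: comb_induct) (simp_all add: pmul_add stack_id_left stack_id_right diagrams_matching)

lemma PL_sel: "carrier (PL n) = {x. keys x \<subseteq> diagrams n}" "x \<otimes>\<^bsub>PL n\<^esub> y = pmul x y" "x \<oplus>\<^bsub>PL n\<^esub> y = x + y"
  "\<one>\<^bsub>PL n\<^esub> = sgl (id_diag n) 1" "\<zero>\<^bsub>PL n\<^esub> = 0" "c \<odot>\<^bsub>PL n\<^esub> x = scal c x"
  by (simp_all add: PL_def pmul_def scal_def)

lemma Zd_sel: "carrier Z\<delta> = UNIV" "c \<otimes>\<^bsub>Z\<delta>\<^esub> e = c * e" "c \<oplus>\<^bsub>Z\<delta>\<^esub> e = c + e" "\<one>\<^bsub>Z\<delta>\<^esub> = 1" "\<zero>\<^bsub>Z\<delta>\<^esub> = 0"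
  by (simp_all add: ring_of_type_algebra_def)

lemma keys_uminus [simp]: "keys (- x :: comb) = keys x"
  by (auto simp: in_keys_iff)

lemma keys_minus_subset: "keys x \<subseteq> D \<Longrightarrow> keys y \<subseteq> D \<Longrightarrow> keys (x - y :: comb) \<subseteq> D"
proof
  fix d assume "keys x \<subseteq> D" "keys y \<subseteq> D" "d \<in> keys (x - y)"
  then show "d \<in> D" by (cases "lkp x d = 0") (auto simp: in_keys_iff lookup_minus)
qed

lemma keys_add_subset: "keys x \<subseteq> D \<Longrightarrow> keys y \<subseteq> D \<Longrightarrow> keys (x + y :: comb) \<subseteq> D"
  using keys_add[of x y] by blast

lemma unital_algebra_PL: "unital_algebra Z\<delta> (PL n)"
proof -
  have grp: "abelian_group (PL n)"
  proof (rule abelian_groupI)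
    show "\<exists>y\<in>carrier (PL n). y \<oplus>\<^bsub>PL n\<^esub> x = \<zero>\<^bsub>PL n\<^esub>" if "x \<in> carrier (PL n)" for x
      using that by (intro bexI[of _ "- x"]) (auto simp: PL_sel)
  qed (auto simp: PL_sel keys_add_subset add.assoc add.commute)
  have cl: "pmul x y \<in> {x. keys x \<subseteq> diagrams n}" if "keys x \<subseteq> diagrams n" "keys y \<subseteq> diagrams n" for x y
    using keys_pmul[OF that] diagrams_stack by blast
  have mon: "Group.monoid (PL n)"
    using cl by (intro monoidI) (auto simp: PL_sel pmul_assoc pmul_id diagrams_id)
  have ring: "ring (PL n)" by (rule ringI[OF grp mon]) (auto simp: PL_sel pmul_add)
  have kk: "keys (scal c x) \<subseteq> diagrams n" if "keys x \<subseteq> diagrams n" for c x using keys_scal that by blast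
  have "module Z\<delta> (PL n)"
    unfolding module_def module_axioms_def
  proof (intro conjI allI impI)
    show "cring Z\<delta>" by (rule cring_from_type_algebra)
    show "abelian_group (PL n)" by (rule grp)
  qed (simp_all add: PL_sel Zd_sel scal_add kk)
  then show ?thesis
    unfolding unital_algebra_def unital_algebra_axioms_def
    by (intro conjI allI impI ring) (simp_all add: PL_sel pmul_scal)
qed

section \<open>The reduction map and its compatibility with products\<close>

section \<open>Reduction to type II diagrams\<close>

text \<open>\<open>val d\<close> is the image of \<open>d\<close> after all local relations, with decorated loops set to \<open>0\<close>.\<close>

definition val :: "diag \<Rightarrow> comb"
  where "val d = (if odd_loop d then 0 else sgl (nf d) (\<delta> ^ size (loops d)))"

abbreviation "red \<equiv> lin val"

lemma odd_loop_nf [simp]: "\<not> odd_loop (nf d)"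
  by (simp add: odd_loop_def)

lemma nf_nf [simp]: "nf (nf d) = nf d"
  by (simp add: nf_def)

text \<open>The powers of \<delta> from the loops of one factor split off, so the value of a product
  depends on each factor only through the value of that factor.\<close>

lemma stack_nf_right:
  assumes "finite (edges a)" "finite (edges b)"
  shows "val (stack a b) = (if odd_loop b then 0 else scal (\<delta> ^ size (loops b)) (val (stack a (nf b))))"
    "val (stack a b) = (if odd_loop a then 0 else scal (\<delta> ^ size (loops a)) (val (stack (nf a) b)))"
proof -
  note S = stack_nf[OF assms]
  note R = stack_nf[of a "nf b"] and L = stack_nf[of "nf a" b]
  have f: "finite (edges (nf a))" "finite (edges (nf b))" using assms by simp_all
  show "val (stack a b) = (if odd_loop b then 0 else scal (\<delta> ^ size (loops b)) (val (stack a (nf b))))"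
    using S R[OF assms(1) f(2)] by (simp add: val_def power_add mult_ac)
  show "val (stack a b) = (if odd_loop a then 0 else scal (\<delta> ^ size (loops a)) (val (stack (nf a) b)))"
    using S L[OF f(1) assms(2)] by (simp add: val_def power_add mult_ac)
qed

text \<open>Makes the combinations that \<open>red\<close> sends to 0 a two-sided ideal, which is
  why \<open>red\<close> passes to the quotients.\<close>

lemma red_pmul:
  assumes "keys x \<subseteq> diagrams n" "keys y \<subseteq> diagrams n"
  shows "red (pmul x y) = red (pmul x (red y))" "red (pmul x y) = red (pmul (red x) y)"
proof -
  have fin: "a \<in> diagrams n \<Longrightarrow> finite (edges a)" for a using matchingD(1) diagrams_matching by blast
  show "red (pmul x y) = red (pmul x (red y))"
    using assms(1)
  proof (induction rule: comb_induct)
    case (single a c)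
    from assms(2) show ?case
    proof (induction rule: comb_induct)
      case (single b e)
      have "val (stack a b) = (if odd_loop b then 0 else scal (\<delta> ^ size (loops b)) (val (stack a (nf b))))"
        using single \<open>a \<in> _\<close> fin by (intro stack_nf_right)
      then show ?case by (simp add: val_def[of b] mult_ac)
    qed (simp_all add: pmul_add lin_add)
  qed (simp_all add: pmul_add lin_add)
  show "red (pmul x y) = red (pmul (red x) y)"
    using assms(1)
  proof (induction rule: comb_induct)
    case (single a c)
    from assms(2) show ?case
    proof (induction rule: comb_induct)
      case (single b e)
      have "val (stack a b) = (if odd_loop a then 0 else scal (\<delta> ^ size (loops a)) (val (stack (nf a) b)))"
        using single \<open>a \<in> _\<close> fin by (intro stack_nf_right)
      then show ?case by (simp add: val_def[of a] mult_ac)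
    qed (simp_all add: pmul_add lin_add)
  qed (simp_all add: pmul_add lin_add)
qed

lemma red_type_II: "keys x \<subseteq> type_II n \<Longrightarrow> red x = x"
proof (induction rule: comb_induct)
  case (single d c)
  have "nf d = d" "loops d = {#}" using single by (simp add: nf_type_II[OF single], simp add: type_II_iff)
  then show ?case by (simp add: val_def odd_loop_def)
qed (simp_all add: lin_add)

lemma keys_red:
  assumes "keys x \<subseteq> {d \<in> diagrams n. even (total_dec d)}"
  shows "keys (red x) \<subseteq> type_II n"
  using assms by (rule keys_lin) (auto simp: val_def intro: nf_in_type_II)

text \<open>Fewer decorations cannot violate exposure, and loops are constrained only in diagrams
  without cups.\<close>

lemma diagrams_weaken:
  assumes d: "Diag E w L \<in> diagrams n" and w: "\<And>e. w' e \<le> w e"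
    and L: "\<forall>k\<in>#L. k = 0 \<Longrightarrow> \<forall>k\<in>#L'. k = 0"
  shows "Diag E w' L' \<in> diagrams n"
proof (rule diagramsI)
  note D = diagramsD[OF d, unfolded diag.sel]
  have w0: "w' e = 0" if "w e = 0" for e using w[of e] that by simp
  show "matching n (Diag E w' L')" using D(1) w0 by (simp add: matching_def)
  show "noncrossing n (edges (Diag E w' L'))" using D(2) by simp
  show "left_exposed n (edges (Diag E w' L')) e" if "e \<in> edges (Diag E w' L')" "0 < dec (Diag E w' L') e" for e
    using D(3)[of e] that w[of e] by simp
  show "(\<forall>e\<in>edges (Diag E w' L'). dec (Diag E w' L') e = 0) \<and> (\<forall>k\<in>#loops (Diag E w' L'). k = 0)"
    if "cups (Diag E w' L') = {}"
  proof -
    have "cups (Diag E w L) = {}" using that by (simp add: cups_def)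
    then show ?thesis using D(4,5) w0 L by simp
  qed
qed

lemma local_step_diagrams:
  assumes "local_step d c d'" "d \<in> diagrams n"
  shows "d' \<in> diagrams n"
  using assms by cases (auto elim!: diagrams_weaken)

text \<open>Removing a loop and cancelling decorations preserve parities and account for the factor.
  In the absorption relations a loop with one decoration stays on both sides, so both values are
  0.\<close>

lemma val_local_step: "local_step d c d' \<Longrightarrow> val d = scal c (val d')"
proof (induction rule: local_step.induct)
  case (remove_loop E w L)
  then show ?case by (simp add: val_def odd_loop_def nf_def)
next
  case (cancel_edge e E w k L)
  then have "(\<lambda>f. (w(e := k)) f mod 2) = (\<lambda>f. w f mod 2)" by (auto simp: fun_eq_iff)
  then show ?case unfolding val_def odd_loop_def nf_def by (simp only: diag.sel scal_simps mult_1)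
next
  case (cancel_loop E w k L)
  then show ?case by (simp add: val_def odd_loop_def nf_def)
next
  case (absorb_edge e E w k L)
  then have "\<exists>k\<in>#L. odd k" by (intro bexI[of _ 1]) auto
  then show ?case by (simp add: val_def odd_loop_def)
next
  case (absorb_loop L E w k)
  then have "\<exists>k\<in>#L. odd k" by (intro bexI[of _ 1]) auto
  then show ?case by (simp add: val_def odd_loop_def)
qed

section \<open>The quotient by the local relations\<close>

section \<open>The quotient by the local relations\<close>

lemma PL_minus: "y \<in> carrier (PL n) \<Longrightarrow> x \<ominus>\<^bsub>PL n\<^esub> y = x - y"
proof -
  assume y: "y \<in> carrier (PL n)"
  interpret unital_algebra "Z\<delta>" "PL n" by (rule unital_algebra_PL)
  have "- y \<in> carrier (PL n)" using y by (simp add: PL_sel)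
  moreover have "- y \<oplus>\<^bsub>PL n\<^esub> y = \<zero>\<^bsub>PL n\<^esub>" by (simp add: PL_sel)
  ultimately have "\<ominus>\<^bsub>PL n\<^esub> y = - y" using minus_equality y by blast
  then show ?thesis by (simp add: a_minus_def PL_sel)
qed

text \<open>The kernel \<open>?K\<close> of \<open>red\<close> is an ideal and contains the
  generators by \<open>val_local_step\<close>, so it contains the whole local ideal.\<close>

lemma local_ideal: "ideal (local_ideal n) (PL n)"
  and local_ideal_step: "d \<in> diagrams n \<Longrightarrow> local_step d c d' \<Longrightarrow> sgl d 1 - sgl d' c \<in> local_ideal n"
  and local_ideal_red: "x \<in> local_ideal n \<Longrightarrow> keys x \<subseteq> diagrams n \<and> red x = 0"
proof -
  interpret unital_algebra "Z\<delta>" "PL n" by (rule unital_algebra_PL)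
  let ?S = "{sgl d 1 - sgl d' c | d c d'. d \<in> diagrams n \<and> local_step d c d'}"
  have Sc: "?S \<subseteq> carrier (PL n)"
  proof -
    have "keys (sgl d 1 - sgl d' c) \<subseteq> diagrams n" if "d \<in> diagrams n" "local_step d c d'" for d c d'
      using that local_step_diagrams[OF that(2,1)] by (intro keys_minus_subset) auto
    then show ?thesis by (auto simp: PL_sel)
  qed
  show I: "ideal (local_ideal n) (PL n)" unfolding local_ideal_def by (rule genideal_ideal[OF Sc])
  show "sgl d 1 - sgl d' c \<in> local_ideal n" if "d \<in> diagrams n" "local_step d c d'"
    unfolding local_ideal_def using genideal_self[OF Sc] that by blast
  let ?K = "{x. keys x \<subseteq> diagrams n \<and> red x = 0}"
  have "ideal ?K (PL n)"
  proof (rule idealI)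
    show "ring (PL n)" ..
    show "subgroup ?K (add_monoid (PL n))"
    proof (rule add.subgroupI)
      show "?K \<subseteq> carrier (PL n)" by (auto simp: PL_sel)
      show "?K \<noteq> {}" by (auto intro!: exI[of _ 0])
      show "\<ominus>\<^bsub>PL n\<^esub> a \<in> ?K" if "a \<in> ?K" for a
      proof -
        have "a \<in> carrier (PL n)" using that by (auto simp: PL_sel)
        then have "\<ominus>\<^bsub>PL n\<^esub> a = 0 - a" using PL_minus[of a n 0] minus_eq[of "\<zero>\<^bsub>PL n\<^esub>" a] by (simp add: PL_sel)
        then show ?thesis using that by (simp add: lin_minus[of val 0 a, simplified])
      qed
      show "a \<oplus>\<^bsub>PL n\<^esub> b \<in> ?K" if "a \<in> ?K" "b \<in> ?K" for a b
        using that by (auto simp: PL_sel lin_add intro: keys_add_subset[THEN subsetD])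
    qed
    fix a x assume a: "a \<in> ?K" and x: "x \<in> carrier (PL n)"
    then have k: "keys a \<subseteq> diagrams n" "keys x \<subseteq> diagrams n" "red a = 0" by (auto simp: PL_sel)
    have "keys (pmul x a) \<subseteq> diagrams n" "keys (pmul a x) \<subseteq> diagrams n"
      using keys_pmul k diagrams_stack by meson+
    then show "x \<otimes>\<^bsub>PL n\<^esub> a \<in> ?K" "a \<otimes>\<^bsub>PL n\<^esub> x \<in> ?K"
      using red_pmul(1)[OF k(2,1)] red_pmul(2)[OF k(1,2)] k(3) by (simp_all add: PL_sel)
  qed
  moreover have "?S \<subseteq> ?K"
    using Sc val_local_step by (auto simp: PL_sel lin_minus)
  ultimately have "local_ideal n \<subseteq> ?K" unfolding local_ideal_def by (rule genideal_minimal)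
  then show "keys x \<subseteq> diagrams n \<and> red x = 0" if "x \<in> local_ideal n" using that by blast
qed

definition prj :: "nat \<Rightarrow> comb \<Rightarrow> comb set"
  where "prj n x = local_ideal n +>\<^bsub>PL n\<^esub> x"

lemma prj_diag: "PL_hat_diag n d = prj n (sgl d 1)"
  by (simp add: PL_hat_diag_def prj_def)

lemmas PL_hat_quot = quot_algebra[OF unital_algebra_PL local_ideal, folded PL_hat_def prj_def]

lemma unital_algebra_PL_hat: "unital_algebra Z\<delta> (PL_hat n)"
  by (rule PL_hat_quot(1))

lemma prj_carrier: "carrier (PL_hat n) = prj n ` {x. keys x \<subseteq> diagrams n}"
  using PL_hat_quot(2) by (simp add: PL_sel)

lemma prj_ops:
  assumes "keys x \<subseteq> diagrams n" "keys y \<subseteq> diagrams n"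
  shows "prj n (x + y) = prj n x \<oplus>\<^bsub>PL_hat n\<^esub> prj n y" "prj n (pmul x y) = prj n x \<otimes>\<^bsub>PL_hat n\<^esub> prj n y"
    "prj n (scal c x) = c \<odot>\<^bsub>PL_hat n\<^esub> prj n x" "prj n x = prj n y \<longleftrightarrow> x - y \<in> local_ideal n"
  using assms PL_hat_quot(3)[of x n y] PL_hat_quot(4)[of x n y] PL_hat_quot(5)[of c x n] PL_hat_quot(8)[of x n y]
  by (simp_all add: PL_sel Zd_sel PL_minus)

lemma prj_const: "prj n 0 = \<zero>\<^bsub>PL_hat n\<^esub>" "prj n (sgl (id_diag n) 1) = \<one>\<^bsub>PL_hat n\<^esub>"
  using PL_hat_quot(6,7)[of n] by (simp_all add: PL_sel)

lemma prj_step: "d \<in> diagrams n \<Longrightarrow> local_step d c d' \<Longrightarrow> prj n (sgl d 1) = prj n (sgl d' c)"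
  using local_ideal_step[of d n c d'] local_step_diagrams[of d c d' n] by (subst prj_ops) simp_all

lemma prj_scal_single: "d \<in> diagrams n \<Longrightarrow> prj n (sgl d c) = c \<odot>\<^bsub>PL_hat n\<^esub> prj n (sgl d 1)"
  using prj_ops(3)[of "sgl d 1" n 0 c] by simp

text \<open>Every relation used lowers the number of decorations plus the number of loops, so the
  reduction ends, and in the absence of odd loops it ends at \<open>nf d\<close>.\<close>

lemma prj_reduce:
  assumes "d \<in> diagrams n" "\<not> odd_loop d"
  shows "prj n (sgl d 1) = prj n (sgl (nf d) (\<delta> ^ size (loops d)))"
  using assms
proof (induction "total_dec d + size (loops d)" arbitrary: d rule: less_induct)
  case less
  note d = less.prems(1)
  note m = diagramsD(1)[OF d]
  have step: ?case if st: "local_step d c d'" and m': "total_dec d' + size (loops d') < total_dec d + size (loops d)"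
     and nf: "nf d' = nf d" and odd: "odd_loop d' \<longleftrightarrow> odd_loop d" and pw: "c * \<delta> ^ size (loops d') = \<delta> ^ size (loops d)" for c d'
  proof -
    have d': "d' \<in> diagrams n" by (rule local_step_diagrams[OF st d])
    have "prj n (sgl d 1) = c \<odot>\<^bsub>PL_hat n\<^esub> prj n (sgl d' 1)"
      by (rule trans[OF prj_step[OF d st] prj_scal_single[OF d']])
    also have "prj n (sgl d' 1) = prj n (sgl (nf d') (\<delta> ^ size (loops d')))"
      using less.hyps[OF m' d'] less.prems(2) odd by simp
    also have "c \<odot>\<^bsub>PL_hat n\<^esub> \<dots> = prj n (scal c (sgl (nf d') (\<delta> ^ size (loops d'))))"
      using nf_diagrams[OF d'] by (intro prj_ops(3)[symmetric, of _ n 0]) auto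
    finally show ?thesis using nf pw by simp
  qed
  show ?case
  proof (cases "\<exists>e. 2 \<le> dec d e")
    case True
    then obtain e where e: "2 \<le> dec d e" by blast
    then have eE: "e \<in> edges d" using matchingD(3)[OF m, of e] by force
    define d' where "d' = Diag (edges d) ((dec d)(e := dec d e - 2)) (loops d)"
    have "local_step (Diag (edges d) (dec d) (loops d)) 1 d'"
      unfolding d'_def using eE e by (intro cancel_edge) auto
    then have st: "local_step d 1 d'" by simp
    have "(\<Sum>f\<in>edges d. dec d' f) < (\<Sum>f\<in>edges d. dec d f)"
      using eE e matchingD(1)[OF m] by (intro sum_strict_mono_ex1) (auto simp: d'_def)
    moreover have "nf d' = nf d" using e by (auto simp: nf_def d'_def fun_eq_iff le_mod_geq)
    ultimately show ?thesis by (intro step[OF st]) (auto simp: total_dec_def odd_loop_def d'_def)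
  next
    case no2: False
    show ?thesis
    proof (cases "loops d = {#}")
      case True
      have "dec d e \<le> 1" for e using no2 by (metis not_less_eq_eq numeral_2_eq_2 One_nat_def)
      then have "dec d e mod 2 = dec d e" for e using le_imp_less_Suc[of "dec d e" 1] by simp
      then have "nf d = d" using True by (simp add: diag_eq_iff fun_eq_iff)
      then show ?thesis using True by simp
    next
      case False
      then obtain k L where L: "loops d = add_mset k L" by (metis multiset_cases)
      then have dd: "d = Diag (edges d) (dec d) (add_mset k L)" by (simp add: diag_eq_iff)
      have ev: "even k" using less.prems(2) L by (simp add: odd_loop_def)
      show ?thesis
      proof (cases "k = 0")
        case True
        define d' where "d' = Diag (edges d) (dec d) L"
        have st: "local_step d \<delta> d'" using remove_loop[of "edges d" "dec d" L] dd True unfolding d'_def by simp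
        show ?thesis using True by (intro step[OF st]) (auto simp: total_dec_def odd_loop_def d'_def L nf_def)
      next
        case False
        then have k: "k = (k - 2) + 2" using ev by presburger
        define d' where "d' = Diag (edges d) (dec d) (add_mset (k - 2) L)"
        have st: "local_step d 1 d'" using cancel_loop[of "edges d" "dec d" "k - 2" L] dd k unfolding d'_def by simp
        have "even (k - 2)" using ev by simp
        then show ?thesis using False k ev
          by (intro step[OF st]) (auto simp: total_dec_def odd_loop_def d'_def L nf_def)
      qed
    qed
  qed
qed

text \<open>Pairs of decorations on an odd loop are cancelled until one is left, because the
  generators of \<open>decorated_loop_ideal\<close> have a loop with exactly one decoration.\<close>

lemma prj_odd_loop:
  assumes "d \<in> diagrams n" "odd_loop d"
  shows "\<exists>d'\<in>diagrams n. 1 \<in># loops d' \<and> prj n (sgl d 1) = prj n (sgl d' 1)"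
proof -
  have *: "\<exists>d'\<in>diagrams n. 1 \<in># loops d' \<and> prj n (sgl d 1) = prj n (sgl d' 1)"
    if "loops d = add_mset (2 * m + 1) L" "d \<in> diagrams n" for m L d
    using that
  proof (induction m arbitrary: d)
    case 0
    then show ?case by (intro bexI[of _ d]) simp_all
  next
    case (Suc m)
    define d' where "d' = Diag (edges d) (dec d) (add_mset (2 * m + 1) L)"
    have "d = Diag (edges d) (dec d) (add_mset ((2 * m + 1) + 2) L)" using Suc.prems by (simp add: diag_eq_iff)
    then have st: "local_step d 1 d'" using cancel_loop[of "edges d" "dec d" "2 * m + 1" L] unfolding d'_def by simp
    then have "d' \<in> diagrams n" using local_step_diagrams Suc.prems by blast
    then have "\<exists>d''\<in>diagrams n. 1 \<in># loops d'' \<and> prj n (sgl d' 1) = prj n (sgl d'' 1)"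
      by (intro Suc.IH) (simp add: d'_def)
    then show ?case using prj_step[OF Suc.prems(2) st] by simp
  qed
  obtain k where k: "k \<in># loops d" "odd k" using assms(2) by (auto simp: odd_loop_def)
  obtain L where L: "loops d = add_mset k L" using k(1) by (metis mset_add)
  obtain m where m: "k = 2 * m + 1" using k(2) by (rule oddE)
  show ?thesis by (rule *[OF L[unfolded m] assms(1)])
qed

section \<open>Type II diagrams are products of simple diagrams\<close>

section \<open>Generation by simple diagrams\<close>

text \<open>The case \<open>c = 0\<close> gives \<open>simple\<close>, and \<open>i = 1\<close>,
  \<open>c = 1\<close> gives \<open>simple_bar\<close>, so that one formula covers multiplication by
  both kinds.\<close>

definition gdiag :: "nat \<Rightarrow> nat \<Rightarrow> nat \<Rightarrow> diag"
  where "gdiag n i c = Diag (simple_edges n i)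
    (\<lambda>e. if e = {North i, North (i + 1)} \<or> e = {South i, South (i + 1)} then c else 0) {#}"

lemma simple_gdiag: "simple n i = gdiag n i 0"
  by (simp add: simple_def gdiag_def)

lemma simple_bar_gdiag: "simple_bar n = gdiag n 1 1"
  unfolding simple_bar_def gdiag_def one_add_one by (rule refl)

lemma matching_gdiag:
  assumes i: "1 \<le> i" "i < n"
  shows "matching n (gdiag n i c)"
proof -
  let ?V = "(\<lambda>j. {North j, South j}) ` ({1..n} - {i, i + 1})"
  have E: "simple_edges n i = insert {North i, North (i + 1)} (insert {South i, South (i + 1)} ?V)"
    by (auto simp: simple_edges_def)
  have "\<Union>(simple_edges n i) = nodes n" unfolding E nodes_def using i by auto
  moreover have "disjoint (simple_edges n i)"
    unfolding E disjoint_def by auto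
  moreover have "{} \<notin> simple_edges n i" "\<forall>e\<in>simple_edges n i. card e = 2" unfolding E by auto
  ultimately show ?thesis unfolding matching_def partition_on_def gdiag_def by (auto simp: E)
qed

lemma diagrams_gdiag:
  assumes i: "1 \<le> i" "i < n" and c: "c = 0 \<or> i = 1"
  shows "gdiag n i c \<in> diagrams n"
proof (rule diagramsI)
  show "matching n (gdiag n i c)" by (rule matching_gdiag[OF i])
  have cases: "e = {North i, North (i + 1)} \<or> e = {South i, South (i + 1)} \<or> (\<exists>j\<in>{1..n} - {i, i + 1}. e = {North j, South j})"
    if "e \<in> simple_edges n i" for e using that unfolding simple_edges_def by blast
  have E: "edges (gdiag n i c) = simple_edges n i" by (simp add: gdiag_def)
  \<comment> \<open>Cup and cap occupy consecutive positions, so nothing can end strictly between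
    their ends.\<close>
  have short: "pos n y \<le> pos n x + 1"
    if "e = {North i, North (i + 1)} \<or> e = {South i, South (i + 1)}" "x \<in> e" "y \<in> e" for e x y
    using that i by (elim disjE) auto
  have vert: "x = North j \<and> y = South j"
    if "e = {North j, South j}" "x \<in> e" "y \<in> e" "pos n x < pos n y" "j \<in> {1..n} - {i, i + 1}" for e x y j
    using that by auto
  show "noncrossing n (edges (gdiag n i c))"
    unfolding noncrossing_def E
  proof (intro ballI notI)
    fix e f x y z w assume *: "e \<in> simple_edges n i" "f \<in> simple_edges n i" "x \<in> e" "y \<in> e" "z \<in> f" "w \<in> f"
      and ps: "pos n x < pos n z \<and> pos n z < pos n y \<and> pos n y < pos n w"
    have "\<not> (e = {North i, North (i + 1)} \<or> e = {South i, South (i + 1)})" using short[of e x y] * ps by linarith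
    then obtain j where j: "j \<in> {1..n} - {i, i + 1}" "e = {North j, South j}" using cases[OF *(1)] by blast
    have "\<not> (f = {North i, North (i + 1)} \<or> f = {South i, South (i + 1)})" using short[of f z w] * ps by linarith
    then obtain k where k: "k \<in> {1..n} - {i, i + 1}" "f = {North k, South k}" using cases[OF *(2)] by blast
    have "x = North j \<and> y = South j" using vert[OF j(2) *(3,4) _ j(1)] ps by linarith
    moreover have "z = North k \<and> w = South k" using vert[OF k(2) *(5,6) _ k(1)] ps by linarith
    ultimately have "j < k" "2 * n + 1 - j < 2 * n + 1 - k" using ps by simp_all
    then show False by linarith
  qed
  have bound: "1 \<le> pos n x \<and> pos n x \<le> 2 * n" if "x \<in> nodes n" for x using that by (auto simp: nodes_def)
  show "left_exposed n (edges (gdiag n i c)) e" if "e \<in> edges (gdiag n i c)" "0 < dec (gdiag n i c) e" for e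
    unfolding left_exposed_def
  proof (intro notI, elim bexE)
    fix f z w assume f: "f \<in> edges (gdiag n i c)" "z \<in> f" "w \<in> f" and cov: "\<forall>x\<in>e. pos n z < pos n x \<and> pos n x < pos n w"
    \<comment> \<open>At \<open>i = 1\<close> the cup has positions 1 and 2 and the cap 2n - 1 and
      2n, the extreme ones, so neither can be covered.\<close>
    have i1: "i = 1" and e: "e = {North i, North (i + 1)} \<or> e = {South i, South (i + 1)}"
      using that(2) c by (auto simp: gdiag_def split: if_splits)
    have "1 \<le> pos n z" "pos n w \<le> 2 * n"
      using bound matchingD(4)[OF matching_gdiag[OF i] f(1)] f(2,3) by blast+
    then show False using e cov i1 by (elim disjE) auto
  qed
  have "{North i, North (i + 1)} \<in> cups (gdiag n i c)" by (simp add: cups_def E simple_edges_def)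
  then show "(\<forall>e\<in>edges (gdiag n i c). dec (gdiag n i c) e = 0) \<and> (\<forall>k\<in>#loops (gdiag n i c). k = 0)"
    if "cups (gdiag n i c) = {}" using that by blast
qed

lemma flip_gdiag: "flip (gdiag n i c) = gdiag n i c"
proof -
  have E: "simple_edges n i = {{North i, North (i + 1)}, {South i, South (i + 1)}} \<union> (\<lambda>j. {North j, South j}) ` ({1..n} - {i, i + 1})"
    by (auto simp: simple_edges_def)
  have "(`) flip_node ` simple_edges n i = simple_edges n i"
    unfolding E image_Un image_image by (simp add: insert_commute)
  moreover have "flip_node ` e = f \<longleftrightarrow> e = flip_node ` f" for e f by auto
  then have "flip_node ` e = {North i, North (i + 1)} \<longleftrightarrow> e = {South i, South (i + 1)}"
    "flip_node ` e = {South i, South (i + 1)} \<longleftrightarrow> e = {North i, North (i + 1)}" for e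
    by simp_all
  ultimately show ?thesis by (simp add: flip_def gdiag_def disj_commute)
qed

text \<open>If nodes i and i + 1 lie on different edges of \<open>d\<close>, the cap of the simple
  diagram fuses these edges and closes no loop. The vertical strands only rename vertices, which
  leaves two eliminations to compute.\<close>

lemma stack_gdiag:
  assumes d: "matching n d" and i: "1 \<le> i" "i < n"
    and U: "{North i, x} \<in> edges d" and Y: "{North (i + 1), y} \<in> edges d" and ne: "{North i, x} \<noteq> {North (i + 1), y}"
  defines "X1 \<equiv> {North i, x}" and "Y1 \<equiv> {North (i + 1), y}" and "C \<equiv> {North i, North (i + 1)}"
  shows "stack (gdiag n i c) d = Diag (insert C (insert {x, y} (edges d - {X1, Y1})))
    (\<lambda>e. if e = C then c else if e = {x, y} then dec d X1 + dec d Y1 + c else if e \<in> {X1, Y1} then 0 else dec d e)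
    (loops d)" (is "_ = ?t")
proof -
  let ?g = "gdiag n i c"
  have g: "matching n ?g" by (rule matching_gdiag[OF i])
  define J where "J = filter (\<lambda>j. j \<noteq> i \<and> j \<noteq> i + 1) [1..<Suc n]"
  have sJ: "set J = {1..n} - {i, i + 1}" by (auto simp: J_def)
  have dJ: "distinct J" by (simp add: J_def)
  have finE: "finite (edges d)" by (rule matchingD(1)[OF d])
  have XY: "X1 \<in> edges d" "Y1 \<in> edges d" "X1 \<inter> Y1 = {}"
    using U Y ne matchingD(7)[OF d U Y] by (auto simp: X1_def Y1_def)
  have c2: "card X1 = 2" "card Y1 = 2" using matchingD(5)[OF d] XY by auto
  have xy: "x \<noteq> North i" "x \<noteq> North (i + 1)" "y \<noteq> North i" "y \<noteq> North (i + 1)" "x \<noteq> y"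
    using c2 XY(3) by (auto simp: X1_def Y1_def)
  have nod: "x \<in> nodes n" "y \<in> nodes n" using matchingD(4)[OF d] XY by (auto simp: X1_def Y1_def)
  let ?R = "edges d - {X1, Y1}"
  have XYne: "X1 \<noteq> Y1" using ne by (simp add: X1_def Y1_def)
  have only: "North i \<notin> e" "North (i + 1) \<notin> e" "x \<notin> e" "y \<notin> e" if "e \<in> ?R" for e
    using that matchingD(7)[OF d, of e X1] matchingD(7)[OF d, of e Y1] XY by (auto simp: X1_def Y1_def)
  let ?n = "\<lambda>r s E. image_mset (\<lambda>e. (vtx r s ` e, dec d e)) (mset_set E)"
  have nd: "net 1 2 d = {#(vtx 1 2 ` X1, dec d X1), (vtx 1 2 ` Y1, dec d Y1)#} + ?n 1 2 ?R + loop_net (loops d)"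
  proof -
    have "mset_set (insert X1 (insert Y1 ?R)) = add_mset X1 (add_mset Y1 (mset_set ?R))"
      using finE XYne by (subst mset_set.insert, simp_all)+
    moreover have "insert X1 (insert Y1 ?R) = edges d" using XY(1,2) by blast
    ultimately show ?thesis by (simp add: net_def edge_net_def)
  qed
  have ng: "net 0 1 ?g = {#({(0, i), (0, i + 1)}, c), ({(1, i), (1, i + 1)}, c)#} + verticals 0 1 J"
  proof -
    have inj: "inj_on (\<lambda>j. {North j, South j}) (set J)" by (auto simp: inj_on_def doubleton_eq_iff)
    have "simple_edges n i = insert {North i, North (i + 1)} (insert {South i, South (i + 1)} ((\<lambda>j. {North j, South j}) ` set J))"
      unfolding sJ by (auto simp: simple_edges_def)
    then have "mset_set (simple_edges n i) = add_mset {North i, North (i + 1)} (add_mset {South i, South (i + 1)}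
        (mset_set ((\<lambda>j. {North j, South j}) ` set J)))"
      by (simp add: mset_set.insert doubleton_eq_iff image_iff)
    also have "mset_set ((\<lambda>j. {North j, South j}) ` set J) = image_mset (\<lambda>j. {North j, South j}) (mset J)"
      using image_mset_mset_set[OF inj] mset_set_set[OF dJ] by simp
    finally have "net 0 1 ?g = {#({(0, i), (0, i + 1)}, c), ({(1, i), (1, i + 1)}, c)#}
       + image_mset (\<lambda>j. (vtx 0 1 ` {North j, South j}, dec ?g {North j, South j})) (mset J)"
      by (simp add: net_def edge_net_def gdiag_def loop_net_def multiset.map_comp o_def)
    also have "image_mset (\<lambda>j. (vtx 0 1 ` {North j, South j}, dec ?g {North j, South j})) (mset J) = verticals 0 1 J"
      unfolding verticals_def mset_map by (intro image_mset_cong) (simp add: gdiag_def doubleton_eq_iff)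
    finally show ?thesis .
  qed
  let ?m = "move 0 1 (set J)"
  have mv: "?m (vtx 1 2 z) = vtx 0 2 z" if "z \<in> nodes n" "z \<noteq> North i" "z \<noteq> North (i + 1)" for z
    using that by (cases z) (auto simp: move_def sJ nodes_def)
  have mi: "?m (1, i) = (1, i)" "?m (1, i + 1) = (1, i + 1)" by (simp_all add: move_def sJ)
  define x' where "x' = vtx 0 2 x"
  define y' where "y' = vtx 0 2 y"
  have xy': "x' \<notin> {1} \<times> UNIV" "y' \<notin> {1} \<times> UNIV" "x' \<noteq> y'"
    using inj_vtx[of 0 2] xy unfolding x'_def y'_def by (cases x; cases y; auto dest: injD)+
  have rel: "relabel ?m (net 1 2 d) = {#({(1, i), x'}, dec d X1), ({(1, i + 1), y'}, dec d Y1)#} + ?n 0 2 ?R + loop_net (loops d)"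
  proof -
    have "relabel ?m (?n 1 2 ?R) = ?n 0 2 ?R"
      unfolding relabel_def multiset.map_comp
    proof (intro image_mset_cong)
      fix e assume "e \<in># mset_set ?R"
      then have e: "e \<in> ?R" using finE by simp
      have "?m ` vtx 1 2 ` e = vtx 0 2 ` e"
        unfolding image_image
      proof (rule image_cong[OF refl])
        fix z assume "z \<in> e"
        then show "?m (vtx 1 2 z) = vtx 0 2 z" using only(1,2)[OF e] matchingD(4)[OF d, of e] e by (intro mv) auto
      qed
      then show "((\<lambda>(U, w). (?m ` U, w)) \<circ> (\<lambda>e. (vtx 1 2 ` e, dec d e))) e = (vtx 0 2 ` e, dec d e)" by simp
    qed
    moreover have "relabel ?m (loop_net (loops d)) = loop_net (loops d)" by (simp add: relabel_def loop_net_def multiset.map_comp o_def)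
    moreover have "?m ` vtx 1 2 ` X1 = {(1, i), x'}" "?m ` vtx 1 2 ` Y1 = {(1, i + 1), y'}"
      using mi mv[OF nod(1) xy(1,2)] mv[OF nod(2) xy(3,4)] by (simp_all add: X1_def Y1_def x'_def y'_def)
    ultimately show ?thesis unfolding nd by simp
  qed
  let ?A = "{#({(0, i), (0, i + 1)}, c), ({(1, i), (1, i + 1)}, c)#} :: (nat \<times> nat) net"
  let ?L = "map (Pair 1) J @ [(1, i), (1, i + 1)]"
  have "net 0 2 (stack ?g d) = elims (row 1 n) (net 0 1 ?g + net 1 2 d)"
    using g d by (intro net_stack) auto
  \<comment> \<open>Arrange the middle row so that the columns of the vertical strands precede i and
    i + 1.\<close>
  also have "\<dots> = elims ?L (net 0 1 ?g + net 1 2 d)"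
    using dJ i by (intro elims_cong) (auto simp: distinct_map inj_on_def sJ)
  also have "\<dots> = elims [(1, i), (1, i + 1)] (elims (map (Pair 1) J) ((verticals 0 1 J + net 1 2 d) + ?A))"
    unfolding ng by (simp only: fold_append o_def ac_simps)
  also have "elims (map (Pair 1) J) ((verticals 0 1 J + net 1 2 d) + ?A) = elims (map (Pair 1) J) (verticals 0 1 J + net 1 2 d) + ?A"
    by (intro elims_add_untouched) (auto simp: sJ)
  also have "elims (map (Pair 1) J) (verticals 0 1 J + net 1 2 d) = relabel ?m (net 1 2 d)"
    using d by (intro elims_verticals dJ) (auto simp: verts_net sJ intro!: once_net)
  also have "relabel ?m (net 1 2 d) + ?A = {#({(1, i), (1, i + 1)}, c), ({(1, i), x'}, dec d X1), ({(1, i + 1), y'}, dec d Y1)#}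
      + ({#({(0, i), (0, i + 1)}, c)#} + ?n 0 2 ?R + loop_net (loops d))" (is "_ = ?B + ?K")
    unfolding rel by (simp add: ac_simps)
  also have "elims [(1, i), (1, i + 1)] (?B + ?K) = elims [(1, i), (1, i + 1)] ?B + ?K"
  proof (rule elims_add_untouched)
    have "(1, j) \<notin> vtx 0 2 ` e" for j e by (rule vtx_mem(3)) auto
    then show "set [(1, i), (1, i + 1)] \<inter> verts ?K = {}" using finE by (auto simp: verts_def loop_net_def)
  qed
  also have "elims [(1, i), (1, i + 1)] ?B = {#({x', y'}, c + dec d X1 + dec d Y1)#}"
  proof -
    have "elim (1, i) ({#({(1, i), (1, i + 1)}, c), ({(1, i), x'}, dec d X1)#} + {#({(1, i + 1), y'}, dec d Y1)#})
        = {#({(1, i + 1), x'}, c + dec d X1)#} + {#({(1, i + 1), y'}, dec d Y1)#}"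
      using xy' by (subst elim_touched) auto
    moreover have "elim (1, i + 1) ({#({(1, i + 1), x'}, c + dec d X1), ({(1, i + 1), y'}, dec d Y1)#} + {#})
        = {#({x', y'}, c + dec d X1 + dec d Y1)#}"
      using xy' by (subst elim_touched) auto
    ultimately show ?thesis by (simp add: add_mset_commute)
  qed
  finally have net: "net 0 2 (stack ?g d) = {#({x', y'}, c + dec d X1 + dec d Y1), ({(0, i), (0, i + 1)}, c)#}
    + ?n 0 2 ?R + loop_net (loops d)" by simp
  have nin: "C \<notin> insert {x, y} ?R" "{x, y} \<notin> ?R"
    using only(1)[of C] only(3)[of "{x, y}"] xy by (auto simp: C_def doubleton_eq_iff)
  have XYn: "X1 \<noteq> C" "Y1 \<noteq> C" "X1 \<noteq> {x, y}" "Y1 \<noteq> {x, y}"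
    using xy by (auto simp: X1_def Y1_def C_def doubleton_eq_iff)
  have "net 0 2 ?t = {#(vtx 0 2 ` C, c), (vtx 0 2 ` {x, y}, dec d X1 + dec d Y1 + c)#} + ?n 0 2 ?R + loop_net (loops d)"
  proof -
    have "mset_set (insert C (insert {x, y} ?R)) = add_mset C (add_mset {x, y} (mset_set ?R))"
      using nin finE by (simp add: mset_set.insert)
    moreover have "image_mset (\<lambda>e. (vtx 0 2 ` e, dec ?t e)) (mset_set ?R) = ?n 0 2 ?R"
      using nin finE by (intro image_mset_cong) auto
    moreover have "dec ?t C = c" "dec ?t {x, y} = dec d X1 + dec d Y1 + c" using nin by auto
    ultimately show ?thesis unfolding net_def edge_net_def diag.sel(1,3) by (simp del: diag.sel(2))
  qed
  then have "net 0 2 (stack ?g d) = net 0 2 ?t"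
    unfolding net by (simp add: C_def x'_def y'_def ac_simps)
  moreover have "proper ?t"
  proof -
    have "dec ?t e = 0" if "e \<notin> edges ?t" for e
      using that matchingD(3)[OF d, of e] by auto
    moreover have "{} \<notin> edges ?t" using matchingD(2)[OF d] by (auto simp: C_def)
    ultimately show ?thesis using finE by (simp add: proper_def)
  qed
  ultimately show ?thesis
    using proper_stack[OF matchingD(1)[OF g] finE] by (intro net_inj[of _ _ 0 2]) auto
qed

text \<open>The side condition of \<open>Gen_left\<close> excludes exactly the products that close a
  loop, so no member has loops and \<open>Gen_nf\<close> costs no factor \<delta>. The rule
  \<open>Gen_flip\<close> lets arguments about cups serve for caps.\<close>

inductive_set Gen :: "nat \<Rightarrow> diag set" for n :: nat where
  Gen_id: "id_diag n \<in> Gen n"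
| Gen_left: "\<lbrakk>d \<in> Gen n; 1 \<le> i; i < n; c = 0 \<or> i = 1 \<and> c = 1; {North i, North (i + 1)} \<notin> edges d\<rbrakk>
    \<Longrightarrow> stack (gdiag n i c) d \<in> Gen n"
| Gen_flip: "d \<in> Gen n \<Longrightarrow> flip d \<in> Gen n"
| Gen_nf: "d \<in> Gen n \<Longrightarrow> nf d \<in> Gen n"

lemma Gen_diagrams: "d \<in> Gen n \<Longrightarrow> d \<in> diagrams n"
proof (induction rule: Gen.induct)
  case (Gen_left d i c)
  then have "gdiag n i c \<in> diagrams n" by (intro diagrams_gdiag) blast+
  then show ?case using Gen_left by (intro diagrams_stack)
qed (blast intro: diagrams_id diagrams_flip nf_diagrams)+

lemma north_edge:
  assumes "matching n d" "1 \<le> i" "i \<le> n"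
  obtains x where "{North i, x} \<in> edges d"
proof -
  have "North i \<in> \<Union>(edges d)" unfolding matchingD(6)[OF assms(1)] using assms by (auto simp: nodes_def)
  then obtain e where e: "e \<in> edges d" "North i \<in> e" by blast
  then obtain a b where "e = {a, b}" using matchingD(5)[OF assms(1) e(1)] unfolding card_2_iff by blast
  then have "e = {North i, if a = North i then b else a}" using e(2) by auto
  then show ?thesis using that e(1) by metis
qed

lemma not_cup:
  assumes "matching n d" "{North i, x} \<in> edges d" "{North i, x} \<noteq> {North i, North j}"
  shows "{North i, North j} \<notin> edges d"
  using matchingD(7)[OF assms(1,2), of "{North i, North j}"] assms(3) by blast

text \<open>Multiplication by the simple diagram at i + 1 moves the short cup one step to the right,
  and the one at i moves it back, as in the relation \<open>d_i d_{i+1} d_i = d_i\<close>. A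
  decoration of the cup passes to the edge that now ends at node i, and for i = 1 the decorated
  simple diagram restores it.\<close>

lemma slide:
  assumes d: "d \<in> type_II n" and i: "1 \<le> i" "i + 2 \<le> n" and cup: "{North i, North (i + 1)} \<in> edges d"
    and dec: "dec d {North i, North (i + 1)} = 0 \<or> i = 1"
  defines "e \<equiv> nf (stack (gdiag n (i + 1) 0) d)"
  shows "e \<in> type_II n" "{North (i + 1), North (i + 2)} \<in> edges e" "dec e {North (i + 1), North (i + 2)} = 0"
    "\<And>f. f \<in> edges d \<Longrightarrow> f \<subseteq> range South \<Longrightarrow> f \<in> edges e \<and> dec e f = dec d f"
    "e \<in> Gen n \<Longrightarrow> d \<in> Gen n"
proof -
  have dd: "d \<in> diagrams n" and ld: "loops d = {#}" and le: "\<And>e. dec d e \<le> 1" and ev: "even (total_dec d)"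
    using d by (auto simp: type_II_iff)
  note m = diagramsD(1)[OF dd]
  define g where "g = gdiag n (i + 1) 0"
  define s where "s = stack g d"
  have gd: "g \<in> diagrams n" using i by (auto simp: g_def intro: diagrams_gdiag)
  note mg = diagramsD(1)[OF gd]
  have es: "e = nf s" by (simp add: e_def s_def g_def)
  obtain z where z: "{North (i + 2), z} \<in> edges d" using north_edge[OF m, of "i + 2"] i by auto
  define C1 where "C1 = {North i, North (i + 1)}"
  define Z where "Z = {North (i + 2), z}"
  define C2 where "C2 = {North (i + 1), North (i + 2)}"
  define W where "W = {North i, z}"
  define c where "c = dec d C1"
  have neq: "C1 \<noteq> Z" by (auto simp: C1_def Z_def doubleton_eq_iff)
  have C1d: "C1 \<in> edges d" and Zd: "Z \<in> edges d" using cup z by (auto simp: C1_def Z_def)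
  have dis: "C1 \<inter> Z = {}" using matchingD(7)[OF m C1d Zd] neq by blast
  have "z \<notin> C1" using dis by (auto simp: Z_def)
  moreover have "z \<noteq> North (i + 2)"
  proof
    assume "z = North (i + 2)"
    then have "card Z = 1" by (simp add: Z_def)
    then show False using matchingD(5)[OF m Zd] by simp
  qed
  ultimately have zn: "z \<noteq> North i" "z \<noteq> North (i + 1)" "z \<noteq> North (i + 2)" by (auto simp: C1_def)
  have i1: "1 \<le> i + 1" "i + 1 < n" "i < n" using i by simp_all
  have eqs: "{North (i + 1), North i} = C1" "{North (i + 1 + 1), z} = Z" "{North (i + 1), North (i + 1 + 1)} = C2" "{North i, z} = W"
    by (auto simp: C1_def Z_def C2_def W_def)
  have "s = Diag (insert C2 (insert W (edges d - {C1, Z})))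
    (\<lambda>e. if e = C2 then 0 else if e = W then dec d C1 + dec d Z + 0 else if e \<in> {C1, Z} then 0 else dec d e) (loops d)"
    unfolding s_def g_def by (rule stack_gdiag[OF m, of "i + 1" "North i" z 0, unfolded eqs, OF i1(1,2) C1d Zd neq])
  then have s: "s = Diag (insert C2 (insert W (edges d - {C1, Z})))
    (\<lambda>e. if e = C2 then 0 else if e = W then c + dec d Z else if e \<in> {C1, Z} then 0 else dec d e) {#}"
    by (simp add: c_def ld cong: if_cong)
  have sd: "s \<in> diagrams n" unfolding s_def by (rule diagrams_stack[OF gd dd])
  have "total_dec g = 0" by (simp add: total_dec_def g_def gdiag_def)
  then have evs: "even (total_dec s)" unfolding s_def using total_dec_stack[OF mg m] ev by simp
  show eII: "e \<in> type_II n" unfolding es by (rule nf_in_type_II[OF sd evs]) (simp add: s odd_loop_def)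
  show "{North (i + 1), North (i + 2)} \<in> edges e" "dec e {North (i + 1), North (i + 2)} = 0"
    by (simp_all add: es s C2_def)
  show "f \<in> edges e \<and> dec e f = dec d f" if "f \<in> edges d" "f \<subseteq> range South" for f
    using edges_stack_south[OF mg m that] le[of f] unfolding es nf_simps s_def[symmetric]
    by (simp add: le_Suc_eq) auto
  have ed: "e \<in> diagrams n" using eII by (simp add: type_II_iff)
  note me = diagramsD(1)[OF ed]
  have We: "W \<in> edges e" "C2 \<in> edges e" by (simp_all add: es s)
  have WC2: "W \<noteq> C2" using zn by (auto simp: W_def C2_def doubleton_eq_iff)
  have C1Z: "C1 \<noteq> C2" "Z \<noteq> C2" "C1 \<noteq> W" "Z \<noteq> W"
    using zn by (auto simp: W_def C2_def C1_def Z_def doubleton_eq_iff)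
  have decW: "dec e W = (c + dec d Z) mod 2" "dec e C2 = 0" using WC2 by (simp_all add: es s)
  have le0: "loops e = {#}" by (simp add: es)
  have eqs': "{North i, z} = W" "{North (i + 1), North (i + 2)} = C2" "{z, North (i + 2)} = Z" "{North i, North (i + 1)} = C1"
    by (auto simp: C1_def Z_def C2_def W_def)
  have "stack (gdiag n i c) e = Diag (insert C1 (insert Z (edges e - {W, C2})))
    (\<lambda>f. if f = C1 then c else if f = Z then dec e W + dec e C2 + c else if f \<in> {W, C2} then 0 else dec e f) (loops e)"
    by (rule stack_gdiag[OF me, of i z "North (i + 2)" c, unfolded eqs', OF i(1) i1(3) We WC2])
  then have st: "stack (gdiag n i c) e = Diag (insert C1 (insert Z (edges e - {W, C2})))
    (\<lambda>f. if f = C1 then c else if f = Z then (c + dec d Z) mod 2 + c else if f \<in> {W, C2} then 0 else dec e f) {#}"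
    using le0 by (simp only: decW add_0_right)
  have WCd: "W \<notin> edges d" "C2 \<notin> edges d"
    using matchingD(7)[OF m C1d, of W] matchingD(7)[OF m C1d, of C2] C1Z by (auto simp: C1_def W_def C2_def)
  have "edges (stack (gdiag n i c) e) = edges d"
    unfolding st diag.sel using C1d Zd WCd C1Z WC2 by (auto simp: es s)
  moreover have "dec (stack (gdiag n i c) e) f mod 2 = dec d f" for f
  proof -
    have 1: "c mod 2 = c" "dec d f mod 2 = dec d f" using le[of C1] le[of f] by (auto simp: c_def)
    \<comment> \<open>The decoration of the cup has been added to \<open>Z\<close> twice and
      cancels.\<close>
    have 2: "((c + dec d Z) mod 2 + c) mod 2 = dec d Z"
      using le[of C1] le[of Z] unfolding c_def by presburger
    consider "f = C1" | "f = Z" | "f \<in> {W, C2}" | "f \<notin> {C1, Z, W, C2}" by blast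
    then show ?thesis
    proof cases
      case 1
      then have "dec (stack (gdiag n i c) e) f = c" by (simp add: st)
      then show ?thesis using \<open>c mod 2 = c\<close> 1 by (simp add: c_def)
    next
      case 2 then show ?thesis using \<open>((c + dec d Z) mod 2 + c) mod 2 = dec d Z\<close> neq by (simp add: st)
    next
      case 3 then show ?thesis using matchingD(3)[OF m] WCd C1Z by (auto simp: st)
    next
      case 4
      then have "dec (stack (gdiag n i c) e) f = dec e f" by (simp add: st)
      moreover have "dec e f = dec d f mod 2" using 4 by (simp add: es s)
      ultimately show ?thesis using \<open>dec d f mod 2 = dec d f\<close> by simp
    qed
  qed
  ultimately have bk: "nf (stack (gdiag n i c) e) = d"
    by (simp add: diag_eq_iff ld fun_eq_iff)
  have "{North i, North (i + 1)} \<notin> edges e"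
    using not_cup[OF me, of i z "i + 1"] We(1) C1Z by (auto simp: W_def C1_def)
  moreover have "c = 0 \<or> i = 1 \<and> c = 1" using dec le[of C1] by (auto simp: c_def C1_def le_Suc_eq)
  ultimately have "stack (gdiag n i c) e \<in> Gen n" if "e \<in> Gen n"
    using that i by (intro Gen_left) auto
  then show "e \<in> Gen n \<Longrightarrow> d \<in> Gen n" using Gen_nf bk by metis
qed

text \<open>Slides act from above, so the undecorated caps in \<open>F\<close> survive them. A
  decorated cup at i = 1 loses its decoration in its first slide, and 3 \<le> n guarantees that
  there is one.\<close>

lemma slide_to_end:
  assumes H: "\<And>e. e \<in> type_II n \<Longrightarrow> {North (n - 1), North n} \<in> edges e \<Longrightarrow> dec e {North (n - 1), North n} = 0
      \<Longrightarrow> F \<subseteq> edges e \<Longrightarrow> \<forall>f\<in>F. dec e f = 0 \<Longrightarrow> e \<in> Gen n"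
    and F: "\<forall>f\<in>F. f \<subseteq> range South"
    and d: "d \<in> type_II n" and i: "1 \<le> i" "i + 1 \<le> n" and cup: "{North i, North (i + 1)} \<in> edges d"
    and dec: "dec d {North i, North (i + 1)} = 0 \<or> i = 1 \<and> 3 \<le> n"
    and Fd: "F \<subseteq> edges d" "\<forall>f\<in>F. dec d f = 0"
  shows "d \<in> Gen n"
  using d i cup dec Fd
proof (induction "n - i" arbitrary: i d rule: less_induct)
  case less
  show ?case
  proof (cases "i + 1 = n")
    case True
    then have "n - 1 = i" "dec d {North i, North n} = 0" using less.prems by auto
    then show ?thesis using less.prems(4) True by (intro H less.prems) auto
  next
    case False
    then have i2: "i + 2 \<le> n" using less.prems by simp
    have dec': "dec d {North i, North (i + 1)} = 0 \<or> i = 1" using less.prems by blast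
    note S = slide[OF less.prems(1,2) i2 less.prems(4) dec']
    have eq: "i + 1 + 1 = i + 2" by simp
    have Fe: "f \<in> edges (nf (stack (gdiag n (i + 1) 0) d)) \<and> dec (nf (stack (gdiag n (i + 1) 0) d)) f = 0" if "f \<in> F" for f
      using S(4)[of f] that F less.prems(6,7) by auto
    have "nf (stack (gdiag n (i + 1) 0) d) \<in> Gen n"
    proof (rule less.hyps[of "i + 1"])
      show "F \<subseteq> edges (nf (stack (gdiag n (i + 1) 0) d))" using Fe by blast
      show "\<forall>f\<in>F. dec (nf (stack (gdiag n (i + 1) 0) d)) f = 0" using Fe by blast
    qed (use S(1-3) i2 in \<open>simp_all only: eq\<close>, simp_all)
    then show ?thesis by (rule S(5))
  qed
qed

text \<open>The node after the left end of a longer cup is joined, by planarity, to another node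
  under that cup; this gives a shorter cup.\<close>

lemma inner_short_cup:
  assumes d: "d \<in> diagrams n" and ab: "{North a, North b} \<in> edges d" "a < b"
  shows "\<exists>i. a \<le> i \<and> i < b \<and> {North i, North (i + 1)} \<in> edges d"
  using ab
proof (induction "b - a" arbitrary: a b rule: less_induct)
  case less
  note m = diagramsD(1)[OF d]
  show ?case
  proof (cases "b = a + 1")
    case True
    then show ?thesis using less.prems by auto
  next
    case False
    then have b: "a + 1 < b" using less.prems by simp
    have ab: "{North a, North b} \<subseteq> nodes n" by (rule matchingD(4)[OF m less.prems(1)])
    then have n: "1 \<le> a" "b \<le> n" by (auto simp: nodes_def)
    then obtain x where x: "{North (a + 1), x} \<in> edges d" using north_edge[OF m, of "a + 1"] b by auto
    have dis: "{North (a + 1), x} \<inter> {North a, North b} = {}"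
    proof (rule ccontr)
      assume "{North (a + 1), x} \<inter> {North a, North b} \<noteq> {}"
      then have "{North (a + 1), x} = {North a, North b}" by (rule matchingD(7)[OF m x less.prems(1)])
      then show False using b by (auto simp: doubleton_eq_iff)
    qed
    have xn: "x \<in> nodes n" using matchingD(4)[OF m x] by simp
    have "\<not> pos n (North b) < pos n x"
      using noncrossingD[OF diagramsD(2)[OF d] less.prems(1) x, of "North a" "North b" "North (a + 1)" x] b by simp
    moreover have "x \<noteq> North (a + 1)" using matchingD(5)[OF m x] by auto
    ultimately obtain c where c: "x = North c" "c < b" "a + 1 < c \<or> c < a"
      using xn n dis by (auto simp: nodes_def) (metis linorder_neqE_nat Suc_lessI less_antisym)
    have "a + 1 < c"
    proof (rule ccontr)
      assume "\<not> a + 1 < c"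
      then have "c < a" using c(3) by blast
      then have "\<not> pos n (North (a + 1)) < pos n (North b)"
        using noncrossingD[OF diagramsD(2)[OF d] x less.prems(1), of "North c" "North (a + 1)" "North a" "North b"] c(1) by simp
      then show False using b by simp
    qed
    then have "\<exists>i. a + 1 \<le> i \<and> i < c \<and> {North i, North (i + 1)} \<in> edges d"
      using x c by (intro less.hyps) auto
    then show ?thesis using c by (meson Suc_leD add_leD1 less_trans)
  qed
qed

text \<open>A short cup at node 1 may be decorated. Any other is undecorated if the edge at node 1
  covers it; otherwise that edge is itself a cup, and a short cup inside it either starts at node 1
  or is covered.\<close>

lemma short_cup:
  assumes d: "d \<in> diagrams n" and ne: "cups d \<noteq> {}"
  obtains i where "1 \<le> i" "i + 1 \<le> n" "{North i, North (i + 1)} \<in> edges d"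
    "dec d {North i, North (i + 1)} = 0 \<or> i = 1"
proof -
  note m = diagramsD(1)[OF d]
  have range: "1 \<le> i \<and> i + 1 \<le> n" if "{North i, North (i + 1)} \<in> edges d" for i
    using matchingD(4)[OF m that] by (auto simp: nodes_def)
  have covered: "dec d {North i, North (i + 1)} = 0"
    if e: "{North i, North (i + 1)} \<in> edges d" and f: "{North 1, x} \<in> edges d" "1 < i" "i + 1 < pos n x" for i x
  proof (rule ccontr)
    assume "dec d {North i, North (i + 1)} \<noteq> 0"
    then have "left_exposed n (edges d) {North i, North (i + 1)}" using diagramsD(3)[OF d e] by simp
    moreover have "\<forall>y\<in>{North i, North (i + 1)}. pos n (North 1) < pos n y \<and> pos n y < pos n x" using f by simp
    ultimately show False using f(1) unfolding left_exposed_def by blast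
  qed
  obtain e where e: "e \<in> edges d" "e \<subseteq> range North" using ne by (auto simp: cups_def)
  then obtain a b where ab: "{North a, North b} \<in> edges d" "a < b"
    by (cases rule: edge_cases[OF m e(1)]) auto
  obtain i where i: "{North i, North (i + 1)} \<in> edges d" using inner_short_cup[OF d ab] by blast
  show ?thesis
  proof (cases "i = 1")
    case True
    then show ?thesis using that[of i] i range[OF i] by blast
  next
    case i1: False
    then have ig: "1 < i" "1 \<le> n" using range[OF i] by auto
    obtain x where x: "{North 1, x} \<in> edges d" using north_edge[OF m, of 1] ig by auto
    have xn: "x \<in> nodes n" using matchingD(4)[OF m x] by simp
    have dis: "{North 1, x} \<inter> {North i, North (i + 1)} = {}" 
    proof (rule ccontr)
      assume "{North 1, x} \<inter> {North i, North (i + 1)} \<noteq> {}"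
      then have "{North 1, x} = {North i, North (i + 1)}" by (rule matchingD(7)[OF m x i])
      then show False using ig by (auto simp: doubleton_eq_iff)
    qed
    show ?thesis
    proof (cases "i + 1 < pos n x")
      case True
      then show ?thesis using that[of i] covered[OF i x ig(1)] range[OF i] i by blast
    next
      case False
      have "x \<noteq> North 1" using matchingD(5)[OF m x] by auto
      moreover obtain j where "x = North j" "1 \<le> j" using False xn range[OF i] by (auto simp: nodes_def)
      ultimately have "x = North j" "1 < j" by auto
      then obtain j where j: "x = North j" "1 < j" by blast
      obtain k where k: "1 \<le> k" "k < j" "{North k, North (k + 1)} \<in> edges d"
        using inner_short_cup[OF d] x j by blast
      show ?thesis
      proof (cases "k = 1")
        case True
        then show ?thesis using that[of k] k range[OF k(3)] by blast
      next
        case k1: False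
        have "k + 1 \<noteq> j"
        proof
          assume kj: "k + 1 = j"
          then have "{North k, North (k + 1)} = {North 1, x}"
            using j by (intro matchingD(7)[OF m k(3) x]) auto
          then show False using k1 kj k j by (auto simp: doubleton_eq_iff)
        qed
        then have "k + 1 < pos n x" using k j by simp
        then have "dec d {North k, North (k + 1)} = 0" using k1 k by (intro covered[OF k(3) x]) auto
        then show ?thesis using that[of k] k range[OF k(3)] by blast
      qed
    qed
  qed
qed

section \<open>Passage from n to n + 2 strands\<close>

subsection \<open>Adding a cup and a cap on the right\<close>

text \<open>For a matching \<open>d\<close> the new cup and cap are undecorated, since
  \<open>dec d\<close> is 0 off the edges of \<open>d\<close>.\<close>

definition ext :: "nat \<Rightarrow> diag \<Rightarrow> diag"
  where "ext n d = Diag ({{North (n + 1), North (n + 2)}, {South (n + 1), South (n + 2)}} \<union> edges d) (dec d) (loops d)"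

lemma nodes_ext: "nodes (n + 2) = {North (n + 1), North (n + 2), South (n + 1), South (n + 2)} \<union> nodes n"
  by (auto simp: nodes_def image_iff)

lemma new_nodes: "North (n + 1) \<notin> nodes n" "North (n + 2) \<notin> nodes n" "South (n + 1) \<notin> nodes n" "South (n + 2) \<notin> nodes n"
  by (auto simp: nodes_def)

lemma matching_ext_iff:
  assumes "{{North (n + 1), North (n + 2)}, {South (n + 1), South (n + 2)}} \<inter> edges d = {}"
    "dec d {North (n + 1), North (n + 2)} = 0" "dec d {South (n + 1), South (n + 2)} = 0"
  shows "matching (n + 2) (ext n d) \<longleftrightarrow> matching n d"
proof -
  define A where "A = {North (n + 1), North (n + 2)}"
  define B where "B = {South (n + 1), South (n + 2)}"
  have E: "edges (ext n d) = insert A (insert B (edges d))" by (simp add: ext_def A_def B_def)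
  have D: "dec (ext n d) = dec d" by (simp add: ext_def)
  have nn: "nodes (n + 2) = A \<union> B \<union> nodes n" unfolding nodes_ext A_def B_def by blast
  have AB: "A \<inter> nodes n = {}" "B \<inter> nodes n = {}" "A \<inter> B = {}" using new_nodes[of n] by (auto simp: A_def B_def)
  have ne: "A \<noteq> {}" "B \<noteq> {}" and card: "card A = 2" "card B = 2" by (auto simp: A_def B_def)
  have out: "A \<notin> edges d" "B \<notin> edges d" "dec d A = 0" "dec d B = 0" using assms by (auto simp: A_def B_def)
  show ?thesis
  proof
    assume m: "matching (n + 2) (ext n d)"
    note M = matchingD[OF m, unfolded E D]
    have dj: "e \<inter> A = {}" "e \<inter> B = {}" if "e \<in> edges d" for e
    proof -
      have ie: "e \<in> insert A (insert B (edges d))" using that by simp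
      have "e \<noteq> A" "e \<noteq> B" using that out by auto
      then show "e \<inter> A = {}" "e \<inter> B = {}"
        using M(7)[OF ie, of A] M(7)[OF ie, of B] by auto
    qed
    have "\<Union>(edges d) = nodes n"
    proof (intro equalityI subsetI)
      fix v assume "v \<in> \<Union>(edges d)"
      then obtain e where e: "e \<in> edges d" "v \<in> e" by (rule UnionE)
      have "v \<in> \<Union>(insert A (insert B (edges d)))" using e by auto
      then have "v \<in> A \<union> B \<union> nodes n" unfolding M(6) nn .
      then show "v \<in> nodes n" using dj[OF e(1)] e(2) by auto
    next
      fix v assume v: "v \<in> nodes n"
      then have "v \<in> \<Union>(insert A (insert B (edges d)))" unfolding M(6) nn by simp
      then show "v \<in> \<Union>(edges d)" using AB(1,2) v by auto
    qed
    moreover have "disjoint (edges d)"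
    proof (rule disjointI)
      fix e f assume "e \<in> edges d" "f \<in> edges d" "e \<noteq> f"
      then show "e \<inter> f = {}" using M(7)[of e f] by auto
    qed
    moreover have "dec d e = 0" if "e \<notin> edges d" for e
      using M(3)[of e] out that by auto
    moreover have "finite (edges d)" "{} \<notin> edges d" "\<forall>e\<in>edges d. card e = 2" using M(1,2,5) by auto
    ultimately show "matching n d" unfolding matching_def partition_on_def by simp
  next
    assume m: "matching n d"
    note M = matchingD[OF m]
    have "\<Union>(edges (ext n d)) = nodes (n + 2)" unfolding E nn M(6)[symmetric] by auto
    moreover have "disjoint (edges (ext n d))"
      unfolding E
    proof (rule disjointI)
      have dj: "e \<inter> A = {} \<and> A \<inter> e = {} \<and> e \<inter> B = {} \<and> B \<inter> e = {}" if "e \<in> edges d" for e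
        using M(4)[OF that] AB(1,2) by blast
      fix e f assume "e \<in> insert A (insert B (edges d))" "f \<in> insert A (insert B (edges d))" "e \<noteq> f"
      then show "e \<inter> f = {}" using dj M(7)[of e f] AB(3) by (elim insertE) auto
    qed
    moreover have "{} \<notin> edges (ext n d)" "\<forall>e\<in>edges (ext n d). card e = 2" unfolding E using M(2,5) ne card by auto
    moreover have "\<forall>e. e \<notin> edges (ext n d) \<longrightarrow> dec (ext n d) e = 0" unfolding E D using M(3) by simp
    ultimately show "matching (n + 2) (ext n d)" unfolding matching_def partition_on_def by simp
  qed
qed

lemma matching_ext:
  assumes "matching n d"
  shows "matching (n + 2) (ext n d)"
proof -
  have "e \<notin> edges d" if "\<not> e \<subseteq> nodes n" for e using matchingD(4)[OF assms] that by blast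
  then have n: "{North (n + 1), North (n + 2)} \<notin> edges d" "{South (n + 1), South (n + 2)} \<notin> edges d"
    using new_nodes[of n] by blast+
  then show ?thesis using matching_ext_iff[of n d] matchingD(3)[OF assms] assms by simp
qed

lemma ext_id: "ext n (id_diag n) = gdiag (n + 2) (n + 1) 0"
proof -
  have V: "{1..n + 2} - {n + 1, n + 1 + 1} = {1..n}" by auto
  show ?thesis unfolding ext_def gdiag_def simple_edges_def V by (simp add: id_diag_def)
qed

text \<open>The identity goes to the simple diagram at n + 1, and \<open>ext\<close> commutes with
  the other rules because simple diagrams at i < n do not touch the new cup and cap.\<close>

lemma ext_Gen: "d \<in> Gen n \<Longrightarrow> ext n d \<in> Gen (n + 2)"
proof (induction rule: Gen.induct)
  case Gen_id
  have "{North (n + 1), North (n + 1 + 1)} \<notin> edges (id_diag (n + 2))" by (auto simp: id_diag_def doubleton_eq_iff)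
  then have "stack (gdiag (n + 2) (n + 1) 0) (id_diag (n + 2)) \<in> Gen (n + 2)"
    by (intro Gen.Gen_left Gen.Gen_id) auto
  then show ?case using stack_id_right[OF matching_gdiag[of "n + 1" "n + 2" 0]] by (simp add: ext_id)
next
  case (Gen_left d i c)
  let ?A = "{North (n + 1), North (n + 2)}" and ?B = "{South (n + 1), South (n + 2)}"
  note m = diagramsD(1)[OF Gen_diagrams[OF Gen_left(1)]]
  obtain x where x: "{North i, x} \<in> edges d" using north_edge[OF m] Gen_left by (metis less_imp_le)
  obtain y where y: "{North (i + 1), y} \<in> edges d" using north_edge[OF m, of "i + 1"] Gen_left by auto
  have ne: "{North i, x} \<noteq> {North (i + 1), y}"
  proof
    assume "{North i, x} = {North (i + 1), y}"
    then have "{North i, x} = {North i, North (i + 1)}" by (auto simp: doubleton_eq_iff)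
    then show False using x Gen_left(5) by simp
  qed
  have sub: "{North i, x} \<subseteq> nodes n" "{North (i + 1), y} \<subseteq> nodes n" using matchingD(4)[OF m] x y by blast+
  have AB: "?A \<noteq> e \<and> ?B \<noteq> e" if "e \<subseteq> nodes n" for e using that new_nodes[of n] by blast
  have sub': "{North i, North (i + 1)} \<subseteq> nodes n" "{x, y} \<subseteq> nodes n" using sub by auto
  have A0: "dec d ?A = 0" "dec d ?B = 0" using matchingD(3,4)[OF m] new_nodes[of n] by blast+
  have xe: "{North i, x} \<in> edges (ext n d)" "{North (i + 1), y} \<in> edges (ext n d)" using x y by (simp_all add: ext_def)
  have il: "1 \<le> i" "i < n + 2" using Gen_left.hyps(2,3) by (simp, simp)
  note s1 = stack_gdiag[OF m Gen_left.hyps(2,3) x y ne, of c]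
  note s2 = stack_gdiag[OF matching_ext[OF m] il xe ne, of c]
  have ES: "insert A (insert B (insert C (insert W (E - {X1, Y1})))) = insert C (insert W (insert A (insert B E) - {X1, Y1}))"
    if "A \<noteq> X1" "A \<noteq> Y1" "B \<noteq> X1" "B \<noteq> Y1" for A B C W X1 Y1 :: "node set" and E
    using that by auto
  note ne4 = AB[OF sub(1), THEN conjunct1] AB[OF sub(2), THEN conjunct1] AB[OF sub(1), THEN conjunct2] AB[OF sub(2), THEN conjunct2]
  have "ext n (stack (gdiag n i c) d) = stack (gdiag (n + 2) i c) (ext n d)"
    unfolding s1 s2 by (simp only: ext_def diag.sel Un_insert_left Un_empty_left ES[OF ne4])
  moreover have "{North i, North (i + 1)} \<notin> edges (ext n d)"
    unfolding ext_def diag.sel using Gen_left.hyps(5) AB[OF sub'(1)] by blast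
  then have "stack (gdiag (n + 2) i c) (ext n d) \<in> Gen (n + 2)"
    using Gen_left.hyps(4) by (intro Gen.Gen_left Gen_left.IH il) auto
  ultimately show ?case by (simp only:)
next
  case (Gen_flip d)
  have "ext n (flip d) = flip (ext n d)" by (auto simp: ext_def flip_def)
  then show ?case using Gen_flip Gen.Gen_flip by metis
next
  case (Gen_nf d)
  have "nf (ext n d) = ext n (nf d)" by (simp add: ext_def nf_def)
  then show ?case using Gen_nf Gen.Gen_nf by metis
qed

text \<open>New columns at the right end leave the upper positions alone and shift all lower
  positions by the same amount.\<close>

lemma pos_ext: "x \<in> nodes n \<Longrightarrow> y \<in> nodes n \<Longrightarrow> pos (n + 2) x < pos (n + 2) y \<longleftrightarrow> pos n x < pos n y"
  by (cases x; cases y) (auto simp: nodes_def)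

lemma unext:
  assumes e: "e \<in> type_II (n + 2)"
    and A: "{North (n + 1), North (n + 2)} \<in> edges e" "dec e {North (n + 1), North (n + 2)} = 0"
    and B: "{South (n + 1), South (n + 2)} \<in> edges e" "dec e {South (n + 1), South (n + 2)} = 0"
  obtains d where "d \<in> type_II n" "e = ext n d"
proof -
  let ?A = "{North (n + 1), North (n + 2)}" and ?B = "{South (n + 1), South (n + 2)}"
  define d where "d = Diag (edges e - {?A, ?B}) (dec e) {#}"
  have ee: "e \<in> diagrams (n + 2)" and l: "loops e = {#}" and le: "\<And>f. dec e f \<le> 1" and ev: "even (total_dec e)"
    using e by (auto simp: type_II_iff)
  note me = diagramsD(1)[OF ee]
  have eq: "e = ext n d" using A B l by (auto simp: diag_eq_iff ext_def d_def)
  have m: "matching n d"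
    using matching_ext_iff[of n d] me A(2) B(2) unfolding eq[symmetric] by (simp add: d_def)
  have sub: "edges d \<subseteq> edges e" by (auto simp: d_def)
  have dd: "dec d = dec e" by (simp add: d_def)
  have nod: "x \<in> nodes n" if "f \<in> edges d" "x \<in> f" for f x using matchingD(4)[OF m that(1)] that(2) by blast
  have nc: "noncrossing n (edges d)"
    unfolding noncrossing_def
  proof (intro ballI notI)
    fix f g a b c h assume f: "f \<in> edges d" and g: "g \<in> edges d" and v: "a \<in> f" "b \<in> f" "c \<in> g" "h \<in> g"
      and ps: "pos n a < pos n c \<and> pos n c < pos n b \<and> pos n b < pos n h"
    have fe: "f \<in> edges e" "g \<in> edges e" using f g sub by auto
    have "\<not> pos (n + 2) b < pos (n + 2) h"
      using ps pos_ext nod[OF f v(1)] nod[OF f v(2)] nod[OF g v(3)]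
      by (intro noncrossingD[OF diagramsD(2)[OF ee] fe v]) auto
    then show False using ps pos_ext nod[OF f v(2)] nod[OF g v(4)] by auto
  qed
  have ex: "left_exposed n (edges d) f" if f: "f \<in> edges d" "0 < dec d f" for f
    unfolding left_exposed_def
  proof (intro notI, elim bexE)
    fix g c h assume g: "g \<in> edges d" "c \<in> g" "h \<in> g" and cov: "\<forall>x\<in>f. pos n c < pos n x \<and> pos n x < pos n h"
    have "left_exposed (n + 2) (edges e) f" using diagramsD(3)[OF ee] f sub dd by auto
    moreover have "\<forall>x\<in>f. pos (n + 2) c < pos (n + 2) x \<and> pos (n + 2) x < pos (n + 2) h"
    proof
      fix x assume x: "x \<in> f"
      show "pos (n + 2) c < pos (n + 2) x \<and> pos (n + 2) x < pos (n + 2) h"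
        using cov x pos_ext[OF nod[OF g(1,2)] nod[OF f(1) x]] pos_ext[OF nod[OF f(1) x] nod[OF g(1,3)]] by blast
    qed
    ultimately show False using g sub unfolding left_exposed_def by blast
  qed
  \<comment> \<open>Only propagating edges remain. By \<open>dec_thru\<close> two of them cannot
    both be decorated, and a single decoration would make the total odd.\<close>
  have cup: "(\<forall>f\<in>edges d. dec d f = 0) \<and> (\<forall>k\<in>#loops d. k = 0)" if c0: "cups d = {}"
  proof -
    have "card (props d) = n" using card_cups[OF m] c0 by simp
    then have "cups (flip d) = {}" using cups_flip_empty[OF m] c0 by simp
    then have low: "hedges (lower d) = {}" unfolding lower_flip cups_upper by blast
    have up: "hedges (upper d) = {}" using c0 unfolding cups_upper by blast
    have pd: "props d \<subseteq> props e" using sub by (auto simp: props_def)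
    have pa: "partner d i = partner e i" if "i \<in> props d" for i
      by (rule partner_eq[OF me subsetD[OF sub partner_edge[OF m that]], symmetric])
    let ?t = "\<lambda>i. {North i, South (partner d i)}"
    have AB: "?A \<notin> edges d" "?B \<notin> edges d" "?A \<noteq> ?B" by (auto simp: d_def doubleton_eq_iff)
    have "total_dec e = (\<Sum>f\<in>insert ?A (insert ?B (edges d)). dec e f)"
      unfolding total_dec_def l using A B by (auto simp: d_def intro!: arg_cong[where f="sum (dec e)"])
    also have "\<dots> = (\<Sum>f\<in>edges d. dec d f)"
      using AB matchingD(1)[OF m] A(2) B(2) by (simp add: dd)
    also have "\<dots> = (\<Sum>i\<in>props d. dec d (?t i))" unfolding sum_edges[OF m] up low by simp
    finally have ev': "even (\<Sum>i\<in>props d. dec d (?t i))" using ev by simp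
    have fin: "finite (props d)" by (rule finite_props[OF m])
    have z: "dec d (?t i) = 0" if i: "i \<in> props d" for i
    proof (rule ccontr)
      assume nz: "dec d (?t i) \<noteq> 0"
      have other: "dec d (?t j) = 0" if j: "j \<in> props d" "j \<noteq> i" for j
      proof (rule ccontr)
        assume nz': "dec d (?t j) \<noteq> 0"
        have ie: "i \<in> props e" "j \<in> props e" using i j pd by auto
        have "dec e {North i, South (partner e i)} \<noteq> 0" "dec e {North j, South (partner e j)} \<noteq> 0"
          using nz nz' pa[OF i] pa[OF j(1)] dd by simp_all
        then show False using dec_thru[OF ee ie(1) ie(2)] dec_thru[OF ee ie(2) ie(1)] j(2) by linarith
      qed
      have "(\<Sum>j\<in>props d. dec d (?t j)) = dec d (?t i) + (\<Sum>j\<in>props d - {i}. dec d (?t j))"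
        by (rule sum.remove[OF fin i])
      also have "(\<Sum>j\<in>props d - {i}. dec d (?t j)) = 0" using other by (intro sum.neutral) auto
      finally have "even (dec d (?t i))" using ev' by simp
      then show False using nz le[of "?t i"] unfolding dd by presburger
    qed
    have "dec d f = 0" if "f \<in> edges d" for f
      using that z up low unfolding edges_decompose[OF m] by auto
    then show ?thesis by (simp add: d_def)
  qed
  have "total_dec d = total_dec e"
  proof -
    have AB: "?A \<notin> edges d" "?B \<notin> edges d" "?A \<noteq> ?B" by (auto simp: d_def doubleton_eq_iff)
    have "total_dec e = (\<Sum>f\<in>insert ?A (insert ?B (edges d)). dec e f)"
      unfolding total_dec_def l using A B by (auto simp: d_def intro!: arg_cong[where f="sum (dec e)"])
    also have "\<dots> = (\<Sum>f\<in>edges d. dec d f)"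
      using AB matchingD(1)[OF m] A(2) B(2) by (simp add: dd)
    finally show ?thesis by (simp add: total_dec_def d_def)
  qed
  then have "d \<in> type_II n" using diagramsI[OF m nc ex cup] ev le dd by (simp add: type_II_iff) (simp add: d_def)
  then show ?thesis using that eq by blast
qed

lemma type_II_no_cups: "d \<in> type_II n \<Longrightarrow> cups d = {} \<Longrightarrow> d = id_diag n"
proof -
  assume d: "d \<in> type_II n" and c: "cups d = {}"
  have dd: "d \<in> diagrams n" and l: "loops d = {#}" using d by (auto simp: type_II_iff)
  have "dec d f = 0" for f
    using diagramsD(4)[OF dd c] matchingD(3)[OF diagramsD(1)[OF dd]] by (cases "f \<in> edges d") auto
  then show ?thesis using no_cups_id[OF dd c] l by (simp add: diag_eq_iff fun_eq_iff) (simp add: id_diag_def)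
qed

text \<open>Two strands leave no room to slide a decorated cup. Evenness makes cup and cap equally
  decorated, so only simple diagrams remain.\<close>

lemma two_strands:
  assumes d: "d \<in> type_II 2" and cup: "{North 1, North 2} \<in> edges d"
  shows "d = gdiag 2 1 (dec d {North 1, North 2})"
proof -
  have dd: "d \<in> diagrams 2" and l: "loops d = {#}" and le: "\<And>f. dec d f \<le> 1" and ev: "even (total_dec d)"
    using d by (auto simp: type_II_iff)
  note m = diagramsD(1)[OF dd]
  have nodes: "nodes 2 = {North 1, North 2, South 1, South 2}" by (auto simp: nodes_def numeral_2_eq_2 atLeastAtMostSuc_conv)
  have "South 1 \<in> \<Union>(edges d)" unfolding matchingD(6)[OF m] nodes by simp
  then obtain f where f: "f \<in> edges d" "South 1 \<in> f" by blast
  have "f \<inter> {North 1, North 2} = {}"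
  proof (rule ccontr)
    assume "f \<inter> {North 1, North 2} \<noteq> {}"
    then have "f = {North 1, North 2}" by (rule matchingD(7)[OF m f(1) cup])
    then show False using f by auto
  qed
  then have "f \<subseteq> {South 1, South 2}" using matchingD(4)[OF m f(1)] nodes by auto
  moreover have "card f = 2" by (rule matchingD(5)[OF m f(1)])
  ultimately have fS: "f = {South 1, South 2}" by (intro card_subset_eq) auto
  have E: "edges d = {{North 1, North 2}, {South 1, South 2}}"
  proof
    show "edges d \<subseteq> {{North 1, North 2}, {South 1, South 2}}"
    proof
      fix g assume g: "g \<in> edges d"
      then obtain x where x: "x \<in> g" using matchingD(2)[OF m] by fastforce
      then have "x \<in> nodes 2" using matchingD(4)[OF m g] by blast
      then have "g \<inter> {North 1, North 2} \<noteq> {} \<or> g \<inter> f \<noteq> {}" using x nodes fS by auto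
      then show "g \<in> {{North 1, North 2}, {South 1, South 2}}"
        using matchingD(7)[OF m g cup] matchingD(7)[OF m g f(1)] fS by blast
    qed
  qed (use cup f fS in auto)
  have S: "simple_edges 2 1 = edges d" unfolding E simple_edges_def by (auto simp: numeral_2_eq_2)
  have "total_dec d = dec d {North 1, North 2} + dec d {South 1, South 2}"
    by (simp add: total_dec_def l E doubleton_eq_iff)
  then have eqd: "dec d {South 1, South 2} = dec d {North 1, North 2}"
    using ev le[of "{North 1, North 2}"] le[of "{South 1, South 2}"] by presburger
  have "dec d e = (if e = {North 1, North 2} \<or> e = {South 1, South 2} then dec d {North 1, North 2} else 0)" for e
    using eqd matchingD(3)[OF m, of e] E by auto
  then show ?thesis unfolding gdiag_def S by (simp add: diag_eq_iff l fun_eq_iff numeral_2_eq_2)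
qed

theorem type_II_Gen: "d \<in> type_II n \<Longrightarrow> d \<in> Gen n"
proof (induction n arbitrary: d rule: less_induct)
  case (less n)
  show ?case
  proof (cases "cups d = {}")
    case True
    then show ?thesis using type_II_no_cups[OF less.prems] Gen_id by simp
  next
    case False
    note tD = type_II_iff[THEN iffD1, THEN conjunct1]
    let ?A = "{North (n - 1), North n}" and ?B = "{South (n - 1), South n}"
    obtain i0 where "1 \<le> i0" "i0 + 1 \<le> n" using short_cup[OF tD[OF less.prems] False] by metis
    then have n2: "2 \<le> n" by simp
    define k where "k = n - 2"
    have nk: "n = k + 2" "n - 1 = k + 1" using n2 by (simp_all add: k_def)
    \<comment> \<open>With an undecorated cup and cap at the right end, cut both off and use the
      induction hypothesis for n - 2.\<close>
    have both: "e \<in> Gen n" if "e \<in> type_II n" "?A \<in> edges e" "dec e ?A = 0" "?B \<in> edges e" "dec e ?B = 0" for e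
    proof -
      have "e \<in> type_II (k + 2)" "{North (k + 1), North (k + 2)} \<in> edges e" "dec e {North (k + 1), North (k + 2)} = 0"
        "{South (k + 1), South (k + 2)} \<in> edges e" "dec e {South (k + 1), South (k + 2)} = 0"
        using that nk by simp_all
      then obtain d0 where "d0 \<in> type_II k" "e = ext k d0" by (rule unext)
      then show ?thesis using less.IH[of k d0] ext_Gen[of d0 k] nk by simp
    qed
    have one: "e \<in> Gen n" if e: "e \<in> type_II n" and n3: "3 \<le> n" and F: "\<forall>f\<in>F. f \<subseteq> range South" "F \<subseteq> edges e" "\<forall>f\<in>F. dec e f = 0"
      and c: "cups e \<noteq> {}"
      and H: "\<And>e. e \<in> type_II n \<Longrightarrow> ?A \<in> edges e \<Longrightarrow> dec e ?A = 0 \<Longrightarrow> F \<subseteq> edges e \<Longrightarrow> \<forall>f\<in>F. dec e f = 0 \<Longrightarrow> e \<in> Gen n"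
    for e F
    proof -
      obtain i where i: "1 \<le> i" "i + 1 \<le> n" "{North i, North (i + 1)} \<in> edges e" "dec e {North i, North (i + 1)} = 0 \<or> i = 1"
        using short_cup[OF tD[OF e] c] by metis
      have "dec e {North i, North (i + 1)} = 0 \<or> i = 1 \<and> 3 \<le> n" using i(4) n3 by blast
      then show ?thesis using slide_to_end[OF H F(1) e i(1,2,3) _ F(2,3)] by blast
    qed
    \<comment> \<open>Inversion turns the cup at the right end into a cap, which is protected as
      \<open>F\<close> while a cup on the other side is moved.\<close>
    have top: "e \<in> Gen n" if e: "e \<in> type_II n" "?A \<in> edges e" "dec e ?A = 0" and n3: "3 \<le> n" for e
    proof -
      note ed = tD[OF e(1)]
      have fe: "flip_node ` ?B = ?A" by simp
      have "cups e \<noteq> {}" using e(2) by (auto simp: cups_def)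
      then have "cups (flip e) \<noteq> {}" using cups_flip_empty[OF diagramsD(1)[OF ed]] by simp
      moreover have "?B \<in> edges (flip e)" "dec (flip e) ?B = 0" using e by (simp_all add: edges_flip)
      ultimately have "flip e \<in> Gen n"
        using both by (intro one[OF flip_type_II[OF e(1)] n3, of "{?B}"]) auto
      then show ?thesis using Gen_flip[of "flip e" n] by simp
    qed
    show ?thesis
    proof (cases "3 \<le> n")
      case True
      show ?thesis using top[OF _ _ _ True] False by (intro one[OF less.prems True, of "{}"]) auto
    next
      case False
      then have n: "n = 2" using n2 by simp
      obtain i where i: "1 \<le> i" "i + 1 \<le> n" "{North i, North (i + 1)} \<in> edges d"
        using short_cup[OF tD[OF less.prems] \<open>cups d \<noteq> {}\<close>] by metis
      then have "i = 1" using n by simp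
      then have cup: "{North 1, North 2} \<in> edges d" using i(3) by (simp add: numeral_2_eq_2)
      define c where "c = dec d {North 1, North 2}"
      have "c \<le> 1" using less.prems by (simp add: type_II_iff c_def)
      then have "stack (gdiag 2 1 c) (id_diag 2) \<in> Gen 2"
        by (intro Gen_left Gen_id) (auto simp: id_diag_def doubleton_eq_iff)
      then have "gdiag 2 1 c \<in> Gen 2" using stack_id_right[OF matching_gdiag[of 1 2 c]] by simp
      then show ?thesis using two_strands[of d] less.prems cup n by (simp add: c_def)
    qed
  qed
qed

section \<open>The algebra of simple diagrams and its quotient by decorated loops\<close>

section \<open>The algebra generated by the simple diagrams\<close>

context
  fixes n :: nat
  assumes n2: "2 \<le> n"
begin

definition H0 :: "comb set set"
  where "H0 = gen_subalgebra Z\<delta> (PL_hat n) (PL_hat_diag n ` insert (simple_bar n) (simple n ` {1..n - 1}))"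

text \<open>Defined by classes instead of explicit products of generators: what is used is closure
  under stacking and that the classes span \<open>H0\<close>. Evenness is carried along because
  \<open>keys_red\<close> needs it.\<close>

definition words :: "diag set"
  where "words = {d \<in> diagrams n. even (total_dec d) \<and> prj n (sgl d 1) \<in> H0}"

lemma DTL_H0: "DTL n = (PL_hat n)\<lparr>carrier := H0\<rparr>"
  by (simp add: DTL_def H0_def)

lemma simple_diagrams: "d \<in> insert (simple_bar n) (simple n ` {1..n - 1}) \<Longrightarrow> d \<in> diagrams n \<and> even (total_dec d)"
proof -
  assume d: "d \<in> insert (simple_bar n) (simple n ` {1..n - 1})"
  have "total_dec (gdiag n i 0) = 0" for i by (simp add: total_dec_def gdiag_def)
  moreover have "even (total_dec (gdiag n 1 1))"
  proof -
    have m: "matching n (gdiag n 1 1)" using n2 by (intro matching_gdiag) auto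
    have "(\<Sum>e\<in>edges (gdiag n 1 1). dec (gdiag n 1 1) e) = (\<Sum>e\<in>{{North 1, North 2}, {South 1, South 2}}. 1)"
      by (rule sum.mono_neutral_cong_right[OF matchingD(1)[OF m]]) (auto simp: gdiag_def simple_edges_def numeral_2_eq_2)
    then show ?thesis by (simp add: total_dec_def doubleton_eq_iff) (simp add: gdiag_def)
  qed
  ultimately show ?thesis
    using d n2 by (auto simp: simple_gdiag simple_bar_gdiag intro!: diagrams_gdiag)
qed

lemma gens_carrier: "PL_hat_diag n ` insert (simple_bar n) (simple n ` {1..n - 1}) \<subseteq> carrier (PL_hat n)"
proof
  fix y assume "y \<in> PL_hat_diag n ` insert (simple_bar n) (simple n ` {1..n - 1})"
  then obtain d where "d \<in> diagrams n" "y = prj n (sgl d 1)" using simple_diagrams prj_diag by blast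
  then show "y \<in> carrier (PL_hat n)" unfolding prj_carrier by (intro image_eqI[of _ _ "sgl d 1"]) auto
qed

lemmas H0_gen = gen_subalgebra[OF unital_algebra_PL_hat gens_carrier, folded H0_def]

lemma H0_closed:
  "\<one>\<^bsub>PL_hat n\<^esub> \<in> H0" "\<zero>\<^bsub>PL_hat n\<^esub> \<in> H0" "x \<in> H0 \<Longrightarrow> y \<in> H0 \<Longrightarrow> x \<otimes>\<^bsub>PL_hat n\<^esub> y \<in> H0"
  "x \<in> H0 \<Longrightarrow> y \<in> H0 \<Longrightarrow> x \<oplus>\<^bsub>PL_hat n\<^esub> y \<in> H0" "x \<in> H0 \<Longrightarrow> c \<odot>\<^bsub>PL_hat n\<^esub> x \<in> H0"
proof -
  note E = subringE[OF H0_gen(1)]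
  show "\<one>\<^bsub>PL_hat n\<^esub> \<in> H0" "\<zero>\<^bsub>PL_hat n\<^esub> \<in> H0" by (rule E(3), rule E(2))
  show "x \<in> H0 \<Longrightarrow> y \<in> H0 \<Longrightarrow> x \<otimes>\<^bsub>PL_hat n\<^esub> y \<in> H0" by (rule E(6))
  show "x \<in> H0 \<Longrightarrow> y \<in> H0 \<Longrightarrow> x \<oplus>\<^bsub>PL_hat n\<^esub> y \<in> H0" by (rule E(7))
  show "x \<in> H0 \<Longrightarrow> c \<odot>\<^bsub>PL_hat n\<^esub> x \<in> H0" by (rule submodule.smult_closed[OF H0_gen(2)]) (simp_all add: Zd_sel)
qed

lemma words_diagrams: "words \<subseteq> diagrams n" and words_even: "words \<subseteq> {d \<in> diagrams n. even (total_dec d)}"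
  by (auto simp: words_def)

lemma words_id: "id_diag n \<in> words"
  using diagrams_id H0_closed(1) prj_const(2)[of n] by (simp add: words_def) (simp add: total_dec_def id_diag_def)

lemma words_stack: "a \<in> words \<Longrightarrow> b \<in> words \<Longrightarrow> stack a b \<in> words"
proof -
  assume a: "a \<in> words" and b: "b \<in> words"
  then have d: "a \<in> diagrams n" "b \<in> diagrams n" by (simp_all add: words_def)
  have "prj n (pmul (sgl a 1) (sgl b 1)) = prj n (sgl a 1) \<otimes>\<^bsub>PL_hat n\<^esub> prj n (sgl b 1)"
    using d by (intro prj_ops(2)) auto
  then have "prj n (sgl (stack a b) 1) \<in> H0" using H0_closed(3) a b by (simp add: words_def)
  then show ?thesis
    using a b diagrams_stack[OF d] total_dec_stack[OF diagrams_matching[OF d(1)] diagrams_matching[OF d(2)]]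
    by (simp add: words_def)
qed

lemma words_simple: "1 \<le> i \<Longrightarrow> i < n \<Longrightarrow> c = 0 \<or> i = 1 \<and> c = 1 \<Longrightarrow> gdiag n i c \<in> words"
proof -
  assume "1 \<le> i" "i < n" "c = 0 \<or> i = 1 \<and> c = 1"
  then have g: "gdiag n i c \<in> insert (simple_bar n) (simple n ` {1..n - 1})"
    by (auto simp: simple_gdiag simple_bar_gdiag)
  then have "PL_hat_diag n (gdiag n i c) \<in> H0" using H0_gen(3) by blast
  then show ?thesis using simple_diagrams[OF g] by (simp add: words_def prj_diag)
qed

lemma prj_comb: "keys x \<subseteq> diagrams n \<Longrightarrow> prj n x \<in> carrier (PL_hat n)"
  unfolding prj_carrier by blast

lemma prj_words: "keys x \<subseteq> words \<Longrightarrow> prj n x \<in> H0"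
proof (induction rule: comb_induct)
  case zero
  then show ?case using H0_closed(2) prj_const(1) by simp
next
  case (single d c)
  then have "d \<in> diagrams n" "prj n (sgl d 1) \<in> H0" by (simp_all add: words_def)
  then show ?case using prj_scal_single[of d n c] H0_closed(5) by metis
next
  case (add x y)
  then have "prj n (x + y) = prj n x \<oplus>\<^bsub>PL_hat n\<^esub> prj n y" using words_diagrams by (intro prj_ops(1)) auto
  then show ?case using add H0_closed(4) by simp
qed

text \<open>The classes of combinations of words are closed under all operations and contain the
  generators.\<close>

lemma H0_words: "H0 = prj n ` {x. keys x \<subseteq> words}"
proof
  interpret P: unital_algebra "Z\<delta>" "PL_hat n" by (rule unital_algebra_PL_hat)
  let ?H = "prj n ` {x. keys x \<subseteq> words}"
  have dia: "keys x \<subseteq> diagrams n" if "keys x \<subseteq> words" for x using that words_diagrams by blast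
  have Hc: "?H \<subseteq> carrier (PL_hat n)" using prj_comb dia by blast
  have zero: "\<zero>\<^bsub>PL_hat n\<^esub> \<in> ?H" using prj_const(1)[of n] by (intro image_eqI[of _ _ 0]) auto
  have one: "\<one>\<^bsub>PL_hat n\<^esub> \<in> ?H" using prj_const(2)[of n] words_id by (intro image_eqI[of _ _ "sgl (id_diag n) 1"]) auto
  have inv: "\<ominus>\<^bsub>PL_hat n\<^esub> h \<in> ?H" if "h \<in> ?H" for h
  proof -
    obtain x where x: "keys x \<subseteq> words" "h = prj n x" using \<open>h \<in> ?H\<close> by blast
    have "prj n (- x + x) = prj n (- x) \<oplus>\<^bsub>PL_hat n\<^esub> prj n x" using dia[OF x(1)] by (intro prj_ops(1)) auto
    then have "prj n (- x) \<oplus>\<^bsub>PL_hat n\<^esub> h = \<zero>\<^bsub>PL_hat n\<^esub>" using prj_const(1) x by simp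
    moreover have "h \<in> carrier (PL_hat n)" "prj n (- x) \<in> carrier (PL_hat n)"
      unfolding x(2) using dia[OF x(1)] by (intro prj_comb; simp)+
    ultimately have "\<ominus>\<^bsub>PL_hat n\<^esub> h = prj n (- x)" by (rule P.minus_equality)
    then show ?thesis using x(1) by (intro image_eqI[of _ _ "- x"]) auto
  qed
  have add: "h \<oplus>\<^bsub>PL_hat n\<^esub> k \<in> ?H" if "h \<in> ?H" "k \<in> ?H" for h k
  proof -
    obtain x y where x: "keys x \<subseteq> words" "h = prj n x" "keys y \<subseteq> words" "k = prj n y" using \<open>h \<in> ?H\<close> \<open>k \<in> ?H\<close> by blast
    have "h \<oplus>\<^bsub>PL_hat n\<^esub> k = prj n (x + y)" unfolding x(2,4) using dia[OF x(1)] dia[OF x(3)] by (intro prj_ops(1)[symmetric])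
    moreover have "keys (x + y) \<subseteq> words" using x by (intro keys_add_subset)
    ultimately show ?thesis by blast
  qed
  have mult: "h \<otimes>\<^bsub>PL_hat n\<^esub> k \<in> ?H" if "h \<in> ?H" "k \<in> ?H" for h k
  proof -
    obtain x y where x: "keys x \<subseteq> words" "h = prj n x" "keys y \<subseteq> words" "k = prj n y" using \<open>h \<in> ?H\<close> \<open>k \<in> ?H\<close> by blast
    have "h \<otimes>\<^bsub>PL_hat n\<^esub> k = prj n (pmul x y)" unfolding x(2,4) using dia[OF x(1)] dia[OF x(3)] by (intro prj_ops(2)[symmetric])
    moreover have "keys (pmul x y) \<subseteq> words" by (rule keys_pmul[OF x(1,3) words_stack])
    ultimately show ?thesis by blast
  qed
  have smult: "c \<odot>\<^bsub>PL_hat n\<^esub> h \<in> ?H" if "h \<in> ?H" for c h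
  proof -
    obtain x where x: "keys x \<subseteq> words" "h = prj n x" using \<open>h \<in> ?H\<close> by blast
    have "c \<odot>\<^bsub>PL_hat n\<^esub> h = prj n (scal c x)" unfolding x(2) using dia[OF x(1)] by (intro prj_ops(3)[symmetric, of _ n 0]) auto
    moreover have "keys (scal c x) \<subseteq> words" using keys_scal x(1) by blast
    ultimately show ?thesis by blast
  qed
  have "subring ?H (PL_hat n)" by (rule P.subringI[OF Hc one inv mult add])
  moreover have "submodule ?H Z\<delta> (PL_hat n)" by (rule P.submoduleI[OF Hc zero inv add smult])
  moreover have "PL_hat_diag n ` insert (simple_bar n) (simple n ` {1..n - 1}) \<subseteq> ?H"
  proof
    fix y assume "y \<in> PL_hat_diag n ` insert (simple_bar n) (simple n ` {1..n - 1})"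
    then obtain d where d: "d \<in> insert (simple_bar n) (simple n ` {1..n - 1})" "y = PL_hat_diag n d" by blast
    have "y \<in> H0" using H0_gen(3) d by blast
    then have "d \<in> words" using simple_diagrams[OF d(1)] d(2) by (simp add: words_def prj_diag)
    then show "y \<in> ?H" unfolding d(2) prj_diag by (intro image_eqI[of _ _ "sgl d 1"]) auto
  qed
  ultimately show "H0 \<subseteq> ?H" by (rule H0_gen(4))
  show "?H \<subseteq> H0" using prj_words by blast
qed

lemma type_II_words: "type_II n \<subseteq> words"
proof
  fix d assume d: "d \<in> type_II n"
  \<comment> \<open>Including the inverted diagram lets the induction pass the rule
    \<open>Gen_flip\<close>; the absence of loops lets it pass \<open>Gen_nf\<close>, since
    \<open>nf\<close> then preserves the class.\<close>
  have "loops e = {#} \<and> e \<in> words \<and> flip e \<in> words" if "e \<in> Gen n" for e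
    using that
  proof (induction rule: Gen.induct)
    case Gen_id
    have "loops (id_diag n) = {#}" by (simp add: id_diag_def)
    then show ?case using words_id by (simp add: flip_id)
  next
    case (Gen_left e i c)
    note m = diagramsD(1)[OF Gen_diagrams[OF Gen_left(1)]]
    note g = words_simple[OF Gen_left(2,3,4)]
    obtain x where x: "{North i, x} \<in> edges e" using north_edge[OF m] Gen_left by (metis less_imp_le)
    obtain y where y: "{North (i + 1), y} \<in> edges e" using north_edge[OF m, of "i + 1"] Gen_left by auto
    have "{North i, x} \<noteq> {North (i + 1), y}"
    proof
      assume "{North i, x} = {North (i + 1), y}"
      then have "{North i, x} = {North i, North (i + 1)}" by (auto simp: doubleton_eq_iff)
      then show False using x Gen_left(5) by simp
    qed
    then have "loops (stack (gdiag n i c) e) = loops e"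
      using stack_gdiag[OF m Gen_left(2,3) x y] by simp
    moreover have "flip (stack (gdiag n i c) e) = stack (flip e) (gdiag n i c)"
      using flip_stack[OF matching_gdiag[OF Gen_left(2,3)] m] by (simp add: flip_gdiag)
    ultimately show ?case using Gen_left.IH words_stack g by simp
  next
    case (Gen_flip e)
    then show ?case by simp
  next
    case (Gen_nf e)
    have nfw: "nf f \<in> words" if f: "f \<in> words" "loops f = {#}" for f
    proof -
      have fd: "f \<in> diagrams n" using f by (simp add: words_def)
      have odd: "\<not> odd_loop f" using f(2) by (simp add: odd_loop_def)
      have "prj n (sgl f 1) = prj n (sgl (nf f) 1)" using prj_reduce[OF fd odd] f(2) by simp
      then show ?thesis
        using f nf_in_type_II[OF fd _ odd] by (auto simp: words_def type_II_iff)
    qed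
    have "flip (nf e) = nf (flip e)" by (simp add: flip_def nf_def)
    then show ?case using nfw[of e] nfw[of "flip e"] Gen_nf.IH by simp
  qed
  then show "d \<in> words" using type_II_Gen[OF d] by blast
qed

lemma unital_algebra_DTL: "unital_algebra Z\<delta> (DTL n)"
  unfolding DTL_H0 by (rule subalgebra_unital[OF unital_algebra_PL_hat H0_gen(1,2)])

lemma DTL_sel: "carrier (DTL n) = H0" "x \<otimes>\<^bsub>DTL n\<^esub> y = x \<otimes>\<^bsub>PL_hat n\<^esub> y" "x \<oplus>\<^bsub>DTL n\<^esub> y = x \<oplus>\<^bsub>PL_hat n\<^esub> y"
  "\<zero>\<^bsub>DTL n\<^esub> = \<zero>\<^bsub>PL_hat n\<^esub>" "\<one>\<^bsub>DTL n\<^esub> = \<one>\<^bsub>PL_hat n\<^esub>" "c \<odot>\<^bsub>DTL n\<^esub> x = c \<odot>\<^bsub>PL_hat n\<^esub> x"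
  by (simp_all add: DTL_H0)

lemma DTL_minus:
  assumes "keys x \<subseteq> words" "keys y \<subseteq> words"
  shows "prj n x \<ominus>\<^bsub>DTL n\<^esub> prj n y = prj n (x - y)"
proof -
  interpret D: unital_algebra "Z\<delta>" "DTL n" by (rule unital_algebra_DTL)
  have k: "keys x \<subseteq> diagrams n" "keys y \<subseteq> diagrams n" "keys (x - y) \<subseteq> diagrams n" "keys (x - y) \<subseteq> words"
    using assms words_diagrams keys_minus_subset[OF assms] by auto
  have c: "prj n x \<in> carrier (DTL n)" "prj n y \<in> carrier (DTL n)" "prj n (x - y) \<in> carrier (DTL n)"
    using assms k(4) prj_words by (simp_all add: DTL_sel)
  have "prj n (x - y) \<oplus>\<^bsub>DTL n\<^esub> prj n y = prj n x"
    using prj_ops(1)[OF k(3,2)] by (simp add: DTL_sel)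
  then have "prj n x \<ominus>\<^bsub>DTL n\<^esub> prj n y = (prj n (x - y) \<oplus>\<^bsub>DTL n\<^esub> prj n y) \<ominus>\<^bsub>DTL n\<^esub> prj n y" by simp
  also have "\<dots> = prj n (x - y)" using c by (simp add: D.minus_eq D.a_assoc D.r_neg)
  finally show ?thesis .
qed

text \<open>As with the local relations, the classes of combinations killed by \<open>red\<close>
  form an ideal that contains the generators.\<close>

lemma loop_ideal: "ideal (decorated_loop_ideal n) (DTL n)"
  and loop_ideal_mem: "d \<in> diagrams n \<Longrightarrow> 1 \<in># loops d \<Longrightarrow> prj n (sgl d 1) \<in> H0 \<Longrightarrow> prj n (sgl d 1) \<in> decorated_loop_ideal n"
  and loop_ideal_red: "y \<in> decorated_loop_ideal n \<Longrightarrow> \<exists>x. keys x \<subseteq> diagrams n \<and> red x = 0 \<and> y = prj n x"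
proof -
  interpret D: unital_algebra "Z\<delta>" "DTL n" by (rule unital_algebra_DTL)
  let ?S = "{PL_hat_diag n d | d. d \<in> diagrams n \<and> 1 \<in># loops d \<and> PL_hat_diag n d \<in> carrier (DTL n)}"
  have Sc: "?S \<subseteq> carrier (DTL n)" by blast
  show "ideal (decorated_loop_ideal n) (DTL n)" unfolding decorated_loop_ideal_def by (rule D.genideal_ideal[OF Sc])
  show "d \<in> diagrams n \<Longrightarrow> 1 \<in># loops d \<Longrightarrow> prj n (sgl d 1) \<in> H0 \<Longrightarrow> prj n (sgl d 1) \<in> decorated_loop_ideal n"
    unfolding decorated_loop_ideal_def by (rule subsetD[OF D.genideal_self[OF Sc]]) (auto simp: prj_diag DTL_sel)
  let ?K = "{prj n x | x. keys x \<subseteq> words \<and> red x = 0}"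
  have dia: "keys x \<subseteq> diagrams n" if "keys x \<subseteq> words" for x using that words_diagrams by blast
  have "ideal ?K (DTL n)"
  proof (rule idealI)
    show "ring (DTL n)" ..
    show "subgroup ?K (add_monoid (DTL n))"
    proof (rule D.add.subgroupI)
      show "?K \<subseteq> carrier (DTL n)" using prj_words by (auto simp: DTL_sel)
      have "prj n 0 \<in> ?K" by (intro CollectI exI[of _ 0]) auto
      then show "?K \<noteq> {}" by blast
      show "\<ominus>\<^bsub>DTL n\<^esub> a \<in> ?K" if "a \<in> ?K" for a
      proof -
        obtain x where x: "keys x \<subseteq> words" "red x = 0" "a = prj n x" using \<open>a \<in> ?K\<close> by blast
        have "a \<in> carrier (DTL n)" using x prj_words by (simp add: DTL_sel)
        then have "\<ominus>\<^bsub>DTL n\<^esub> a = \<zero>\<^bsub>DTL n\<^esub> \<ominus>\<^bsub>DTL n\<^esub> a" by (simp add: D.minus_eq)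
        also have "\<dots> = prj n (0 - x)" using DTL_minus[of 0 x] x by (simp add: DTL_sel prj_const)
        finally show ?thesis using x lin_minus[of val 0 x] by (intro CollectI exI[of _ "0 - x"]) auto
      qed
      show "a \<oplus>\<^bsub>DTL n\<^esub> b \<in> ?K" if "a \<in> ?K" "b \<in> ?K" for a b
      proof -
        obtain x y where x: "keys x \<subseteq> words" "red x = 0" "a = prj n x" "keys y \<subseteq> words" "red y = 0" "b = prj n y"
          using \<open>a \<in> ?K\<close> \<open>b \<in> ?K\<close> by blast
        have "a \<oplus>\<^bsub>DTL n\<^esub> b = prj n (x + y)" using prj_ops(1)[OF dia[OF x(1)] dia[OF x(4)]] x by (simp add: DTL_sel)
        then show ?thesis using x keys_add_subset[OF x(1,4)] by (intro CollectI exI[of _ "x + y"]) (simp add: lin_add)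
      qed
    qed
    fix a b assume "a \<in> ?K" "b \<in> carrier (DTL n)"
    then obtain x y where x: "keys x \<subseteq> words" "red x = 0" "a = prj n x" and y: "keys y \<subseteq> words" "b = prj n y"
      unfolding DTL_sel H0_words by blast
    note k = dia[OF x(1)] dia[OF y(1)]
    have "b \<otimes>\<^bsub>DTL n\<^esub> a = prj n (pmul y x)" "a \<otimes>\<^bsub>DTL n\<^esub> b = prj n (pmul x y)"
      using prj_ops(2)[OF k(2,1)] prj_ops(2)[OF k(1,2)] x y by (simp_all add: DTL_sel)
    moreover have "red (pmul y x) = 0" "red (pmul x y) = 0"
      using red_pmul(1)[OF k(2,1)] red_pmul(2)[OF k(1,2)] x(2) by simp_all
    moreover have "keys (pmul y x) \<subseteq> words" "keys (pmul x y) \<subseteq> words"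
      by (rule keys_pmul[OF y(1) x(1) words_stack], assumption, assumption, rule keys_pmul[OF x(1) y(1) words_stack])
    ultimately show "b \<otimes>\<^bsub>DTL n\<^esub> a \<in> ?K" "a \<otimes>\<^bsub>DTL n\<^esub> b \<in> ?K" by blast+
  qed
  moreover have "?S \<subseteq> ?K"
  proof
    fix s assume "s \<in> ?S"
    then obtain d where d: "d \<in> diagrams n" "1 \<in># loops d" "s = prj n (sgl d 1)" "s \<in> H0" by (auto simp: prj_diag DTL_sel)
    \<comment> \<open>The class of \<open>d\<close> lies in \<open>H0\<close>, so a combination
      \<open>x\<close> of words represents it too. The two differ by an element of the local ideal,
      hence \<open>red x = 0\<close>.\<close>
    then obtain x where x: "keys x \<subseteq> words" "s = prj n x" unfolding H0_words by blast
    have "odd_loop d" using d(2) unfolding odd_loop_def by (intro bexI[of _ 1]) auto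
    then have "red (sgl d 1) = 0" by (simp add: val_def)
    moreover have "sgl d 1 - x \<in> local_ideal n"
      using prj_ops(4)[of "sgl d 1" n x] d x dia by auto
    then have "red (sgl d 1 - x) = 0" using local_ideal_red by blast
    ultimately have "red x = 0" by (simp add: lin_minus)
    then show "s \<in> ?K" using x by blast
  qed
  ultimately have "decorated_loop_ideal n \<subseteq> ?K" unfolding decorated_loop_ideal_def by (rule D.genideal_minimal)
  then show "\<exists>x. keys x \<subseteq> diagrams n \<and> red x = 0 \<and> y = prj n x" if "y \<in> decorated_loop_ideal n"
    using that dia by blast
qed

text \<open>The class in \<open>DTL_hat n\<close> of a combination of words.\<close>

definition psi :: "comb \<Rightarrow> comb set set"
  where "psi x = decorated_loop_ideal n +>\<^bsub>DTL n\<^esub> prj n x"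

lemmas DTL_hat_quot = quot_algebra[OF unital_algebra_DTL loop_ideal, folded DTL_hat_def]

lemma psi_ops_words:
  assumes "keys x \<subseteq> words" "keys y \<subseteq> words"
  shows "psi (x + y) = psi x \<oplus>\<^bsub>DTL_hat n\<^esub> psi y" "psi (pmul x y) = psi x \<otimes>\<^bsub>DTL_hat n\<^esub> psi y"
    "psi (scal c x) = c \<odot>\<^bsub>DTL_hat n\<^esub> psi x" "psi x = psi y \<longleftrightarrow> prj n (x - y) \<in> decorated_loop_ideal n"
proof -
  have k: "keys x \<subseteq> diagrams n" "keys y \<subseteq> diagrams n" using assms words_diagrams by auto
  have c: "prj n x \<in> carrier (DTL n)" "prj n y \<in> carrier (DTL n)" using assms prj_words by (simp_all add: DTL_sel)
  note q = DTL_hat_quot(3,4)[OF c] DTL_hat_quot(5)[of c, OF _ c(1)] DTL_hat_quot(8)[OF c]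
  show "psi (x + y) = psi x \<oplus>\<^bsub>DTL_hat n\<^esub> psi y"
    unfolding psi_def using q(1) prj_ops(1)[OF k] by (simp add: DTL_sel)
  show "psi (pmul x y) = psi x \<otimes>\<^bsub>DTL_hat n\<^esub> psi y"
    unfolding psi_def using q(2) prj_ops(2)[OF k] by (simp add: DTL_sel)
  show "psi (scal c x) = c \<odot>\<^bsub>DTL_hat n\<^esub> psi x"
    unfolding psi_def using q(3) prj_ops(3)[OF k] by (simp add: DTL_sel Zd_sel)
  show "psi x = psi y \<longleftrightarrow> prj n (x - y) \<in> decorated_loop_ideal n"
    unfolding psi_def using q(4) DTL_minus[OF assms] by simp
qed

lemma psi_const: "psi 0 = \<zero>\<^bsub>DTL_hat n\<^esub>"
  unfolding psi_def prj_const using DTL_hat_quot(7) by (simp add: DTL_sel)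

text \<open>Diagrams with an odd loop vanish by the loop ideal, the others are reduced by the local
  relations.\<close>

lemma psi_red:
  assumes "keys x \<subseteq> words"
  shows "psi x = psi (red x)"
  using assms
proof (induction rule: comb_induct)
  case (single a c)
  then have a: "a \<in> diagrams n" "prj n (sgl a 1) \<in> H0" "even (total_dec a)" by (simp_all add: words_def)
  have kv: "keys (val a) \<subseteq> words"
    using nf_in_type_II[OF a(1,3)] type_II_words by (auto simp: val_def)
  have ka: "keys (sgl a 1) \<subseteq> words" using single by simp
  have "psi (sgl a 1) = psi (val a)"
  proof (cases "odd_loop a")
    case True
    then obtain d' where d': "d' \<in> diagrams n" "1 \<in># loops d'" "prj n (sgl a 1) = prj n (sgl d' 1)"
      using prj_odd_loop[OF a(1)] by blast
    then have "prj n (sgl a 1) \<in> decorated_loop_ideal n" using loop_ideal_mem[OF d'(1,2)] a(2) by simp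
    then have "psi (sgl a 1) = psi 0" using psi_ops_words(4)[OF ka, of 0] by simp
    then show ?thesis using True by (simp add: val_def)
  next
    case False
    then show ?thesis unfolding psi_def using prj_reduce[OF a(1) False] by (simp add: val_def)
  qed
  then have "psi (scal c (sgl a 1)) = psi (scal c (val a))"
    unfolding psi_ops_words(3)[OF ka ka] psi_ops_words(3)[OF kv kv] by (rule arg_cong)
  then show ?case by simp
next
  case (add x y)
  have k: "keys (red z) \<subseteq> words" if "keys z \<subseteq> words" for z
    using keys_red[of z n] that words_even type_II_words by blast
  show ?case using add psi_ops_words(1)[OF add(1,2)] psi_ops_words(1)[OF k[OF add(1)] k[OF add(2)]] by (simp add: lin_add)
qed simp

abbreviation vecs :: "comb set"
  where "vecs \<equiv> {x. keys x \<subseteq> type_II n}"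

lemma vecs_words: "x \<in> vecs \<Longrightarrow> keys x \<subseteq> words"
  using type_II_words by auto

lemma red_words: "keys x \<subseteq> words \<Longrightarrow> red x \<in> vecs"
  using keys_red[of x n] words_even by blast

lemma carrier_DTL_hat: "carrier (DTL_hat n) = psi ` vecs"
proof -
  have "carrier (DTL_hat n) = psi ` {x. keys x \<subseteq> words}"
    unfolding DTL_hat_quot(2) DTL_sel H0_words image_image psi_def ..
  also have "\<dots> = psi ` vecs"
  proof (intro equalityI image_subsetI)
    fix x assume "x \<in> {x. keys x \<subseteq> words}"
    then show "psi x \<in> psi ` vecs" using psi_red red_words by (intro image_eqI[of _ _ "red x"]) auto
  next
    fix x assume "x \<in> vecs"
    then show "psi x \<in> psi ` {x. keys x \<subseteq> words}" using vecs_words by blast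
  qed
  finally show ?thesis .
qed

text \<open>This is the linear independence of type II diagrams. An element of the loop ideal is the
  class of some \<open>z\<close> with \<open>red z = 0\<close>, and \<open>x - y - z\<close> lies in
  the local ideal; so \<open>red\<close> kills \<open>x - y\<close>, which it also fixes.\<close>

lemma psi_inj: "x \<in> vecs \<Longrightarrow> y \<in> vecs \<Longrightarrow> psi x = psi y \<longleftrightarrow> x = y"
proof
  assume x: "x \<in> vecs" and y: "y \<in> vecs" and eq: "psi x = psi y"
  have "prj n (x - y) \<in> decorated_loop_ideal n" using psi_ops_words(4)[OF vecs_words[OF x] vecs_words[OF y]] eq by simp
  then obtain z where z: "keys z \<subseteq> diagrams n" "red z = 0" "prj n (x - y) = prj n z" using loop_ideal_red by blast
  have v: "x - y \<in> vecs" using x y keys_minus_subset by auto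
  then have "keys (x - y) \<subseteq> diagrams n" using vecs_words words_diagrams by blast
  then have "x - y - z \<in> local_ideal n" using prj_ops(4)[of "x - y" n z] z by simp
  then have "red (x - y - z) = 0" using local_ideal_red by blast
  then have "red (x - y) = 0" using z(2) by (simp add: lin_minus)
  then show "x = y" using red_type_II[of "x - y" n] v by simp
qed simp

text \<open>Together with \<open>carrier_DTL_hat\<close> and \<open>psi_inj\<close> this identifies
  \<open>DTL_hat n\<close> with the combinations of type II diagrams under the product
  \<open>red (pmul x y)\<close>.\<close>

lemma psi_ops:
  assumes "x \<in> vecs" "y \<in> vecs"
  shows "psi (x + y) = psi x \<oplus>\<^bsub>DTL_hat n\<^esub> psi y" "psi (red (pmul x y)) = psi x \<otimes>\<^bsub>DTL_hat n\<^esub> psi y"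
    "psi (scal c x) = c \<odot>\<^bsub>DTL_hat n\<^esub> psi x"
proof -
  note w = vecs_words[OF assms(1)] vecs_words[OF assms(2)]
  show "psi (x + y) = psi x \<oplus>\<^bsub>DTL_hat n\<^esub> psi y" "psi (scal c x) = c \<odot>\<^bsub>DTL_hat n\<^esub> psi x"
    using psi_ops_words(1,3)[OF w] by blast+
  have "keys (pmul x y) \<subseteq> words" by (rule keys_pmul[OF w words_stack])
  then show "psi (red (pmul x y)) = psi x \<otimes>\<^bsub>DTL_hat n\<^esub> psi y" using psi_red psi_ops_words(2)[OF w] by simp
qed

lemma red_pmul_vecs: "x \<in> vecs \<Longrightarrow> y \<in> vecs \<Longrightarrow> red (pmul x y) \<in> vecs"
  by (intro red_words keys_pmul[OF vecs_words vecs_words words_stack]) auto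

lemma DTL_hat_diag_psi: "DTL_hat_diag n d = psi (sgl d 1)"
  by (simp add: DTL_hat_diag_def psi_def prj_diag)

lemma unital_algebra_DTL_hat: "unital_algebra Z\<delta> (DTL_hat n)"
  by (rule DTL_hat_quot(1))

end

section \<open>Labels of type II diagrams\<close>

section \<open>Cell labels\<close>

text \<open>The sign is read from the upper half; in a type II diagram without propagating edges the
  lower half has the same parity.\<close>

definition cell_label :: "diag \<Rightarrow> label"
  where "cell_label d = (if props d = {} then if even (half_total (upper d)) then Zero_plus else Zero_minus
    else Thru (card (props d)))"

lemma cell_label_abs: "matching n d \<Longrightarrow> label_abs (cell_label d) = card (props d)"
  by (simp add: cell_label_def)

lemma cell_label_type_II:
  assumes d: "d \<in> type_II n"
  shows "cell_label d \<in> cell_labels n" "upper d \<in> cell_halves n (cell_label d)" "lower d \<in> cell_halves n (cell_label d)"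
proof -
  have dd: "d \<in> diagrams n" and l: "loops d = {#}" and ev: "even (total_dec d)" using d by (auto simp: type_II_iff)
  note m = diagramsD(1)[OF dd]
  have nn: "n = 2 * card (cups d) + card (props d)" by (rule card_cups[OF m])
  have fin: "finite (props d)" by (rule finite_props[OF m])
  show "cell_label d \<in> cell_labels n"
  proof (cases "props d = {}")
    case True
    then have "even n" using nn by simp
    then show ?thesis using True by (simp add: cell_label_def cell_labels_def)
  next
    case False
    define k where "k = card (props d)"
    have "k \<noteq> 0" "k \<le> n" "even n \<longleftrightarrow> even k" using False fin nn by (simp_all add: k_def)
    moreover from this have "2 \<le> k" if "even k" using that by presburger
    ultimately have "Thru k \<in> cell_labels n" by (auto simp: cell_labels_def)
    then show ?thesis using False by (simp add: cell_label_def k_def)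
  qed
  have half: "upper d \<in> half_diagrams n" "lower d \<in> half_diagrams n" using d by (simp_all add: half_diagrams_def)
  have par: "even (half_total (lower d)) \<longleftrightarrow> even (half_total (upper d))" if "props d = {}"
    using total_dec_decompose[OF m l] ev that by simp
  show "upper d \<in> cell_halves n (cell_label d)" "lower d \<in> cell_halves n (cell_label d)"
    unfolding cell_halves_def using half half_prop_upper[OF m] half_prop_lower[OF m] par
    by (auto simp: cell_label_def split: if_splits)
qed

text \<open>With \<open>circ_upper_lower\<close> and \<open>cell_label_type_II\<close> this gives
  the bijection between type II diagrams and pairs of halves with a common label.\<close>

lemma circ_cell:
  assumes l: "l \<in> cell_labels n" and S: "S \<in> cell_halves n l" and T: "T \<in> cell_halves n l"
  shows "circ n S T \<in> type_II n" "upper (circ n S T) = S" "lower (circ n S T) = T" "cell_label (circ n S T) = l"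
    "card (props (circ n S T)) = label_abs l"
proof -
  obtain d1 where d1: "d1 \<in> type_II n" "S = upper d1" using S half_diagrams_upper unfolding cell_halves_def by blast
  obtain d2 where d2: "d2 \<in> type_II n" "T = lower d2" using T half_diagrams_lower unfolding cell_halves_def by blast
  have m1: "matching n d1" and m2: "matching n d2" using d1 d2 diagrams_matching by (auto simp: type_II_iff)
  have p1: "card (props d1) = label_abs l" using S half_prop_upper[OF m1] d1(2) by (simp add: cell_halves_def)
  have p2: "card (props d2) = label_abs l" using T half_prop_lower[OF m2] d2(2) by (simp add: cell_halves_def)
  \<comment> \<open>\<open>Thru 0\<close> is not a label, whatever the parity of n.\<close>
  have l0: "label_abs l = 0 \<Longrightarrow> l = Zero_plus \<or> l = Zero_minus"
    using l by (cases l) (auto simp: cell_labels_def split: if_splits)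
  have par: "even (half_total (upper d1) + half_total (lower d2))" if "props d1 = {}"
    using l0 p1 that S T unfolding d1(2) d2(2) cell_halves_def by auto
  have c: "card (props d1) = card (props d2)" using p1 p2 by simp
  note C = circ_type_II[OF d1(1) d2(1) c par, folded d1(2) d2(2)]
  show t: "circ n S T \<in> type_II n" and u: "upper (circ n S T) = S" and lo: "lower (circ n S T) = T" using C by blast+
  have m: "matching n (circ n S T)" using t diagrams_matching by (auto simp: type_II_iff)
  show cp: "card (props (circ n S T)) = label_abs l"
    using half_prop_upper[OF m] S unfolding u by (simp add: cell_halves_def)
  have fin: "finite (props (circ n S T))" by (rule finite_props[OF m])
  show "cell_label (circ n S T) = l"
  proof (cases "label_abs l = 0")
    case True
    then have "props (circ n S T) = {}" using cp fin by simp
    then show ?thesis using l0[OF True] S u by (auto simp: cell_label_def cell_halves_def)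
  next
    case False
    then have "props (circ n S T) \<noteq> {}" using cp by auto
    moreover have "l = Thru (label_abs l)" using False by (cases l) auto
    ultimately show ?thesis using cp by (simp add: cell_label_def)
  qed
qed

text \<open>Decorations are 0 or 1 and loops are absent, so the edges and the set of decorated edges
  determine the diagram.\<close>

lemma finite_type_II: "finite (type_II n)"
proof -
  have "type_II n \<subseteq> (\<lambda>(E, F). Diag E (\<lambda>e. if e \<in> F then 1 else 0) {#}) ` (Pow (Pow (nodes n)) \<times> Pow (Pow (nodes n)))"
  proof
    fix d assume d: "d \<in> type_II n"
    then have dd: "d \<in> diagrams n" and le: "\<And>e. dec d e \<le> 1" and l: "loops d = {#}" by (auto simp: type_II_iff)
    note m = diagramsD(1)[OF dd]
    let ?F = "{e \<in> edges d. dec d e = 1}"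
    have "dec d e = (if e \<in> ?F then 1 else 0)" for e
      using le[of e] matchingD(3)[OF m, of e] by (cases "dec d e = 0") auto
    then have "d = Diag (edges d) (\<lambda>e. if e \<in> ?F then 1 else 0) {#}" using l by (simp add: diag_eq_iff fun_eq_iff)
    moreover have "edges d \<in> Pow (Pow (nodes n))" "?F \<in> Pow (Pow (nodes n))" using matchingD(4)[OF m] by auto
    ultimately show "d \<in> (\<lambda>(E, F). Diag E (\<lambda>e. if e \<in> F then 1 else 0) {#}) ` (Pow (Pow (nodes n)) \<times> Pow (Pow (nodes n)))"
      by (intro image_eqI[of _ _ "(edges d, ?F)"]) simp_all
  qed
  then show ?thesis by (rule finite_subset) simp
qed

lemma poset_cell_order: "partial_order_on (cell_labels n) (cell_order n)"
  unfolding partial_order_on_def preorder_on_def refl_on_def trans_on_def antisym_on_def trans_def antisym_def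
  by (auto simp: cell_order_def)

section \<open>Left multiplication on the cells and independence of the lower half\<close>

section \<open>Multiplication and the cells\<close>

text \<open>The classes of these diagrams generate A(<l), see \<open>lower_cells\<close>.\<close>

definition low :: "nat \<Rightarrow> label \<Rightarrow> diag set"
  where "low n l = {d \<in> type_II n. card (props d) < label_abs l}"

lemma circ_flip:
  assumes l: "l \<in> cell_labels n" and S: "S \<in> cell_halves n l" and T: "T \<in> cell_halves n l"
  shows "flip (circ n S T) = circ n T S"
proof -
  note C = circ_cell[OF l S T]
  have f: "flip (circ n S T) \<in> type_II n" by (rule flip_type_II[OF C(1)])
  have "upper (flip (circ n S T)) = T" "lower (flip (circ n S T)) = S"
    using C(2,3) by (simp add: lower_flip[symmetric], simp add: lower_flip)
  then show ?thesis using circ_upper_lower[OF f] by simp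
qed

text \<open>If no propagating edge of S \<circ> T is lost, \<open>props_stack_right\<close> keeps
  the lower half \<open>T\<close>, and the upper half must then have the same label.\<close>

lemma val_stack_cell:
  assumes d: "d \<in> type_II n" and l: "l \<in> cell_labels n" and S: "S \<in> cell_halves n l" and T: "T \<in> cell_halves n l"
  defines "s \<equiv> stack d (circ n S T)"
  shows "odd_loop s \<or> nf s \<in> type_II n"
    "\<not> odd_loop s \<Longrightarrow> \<not> nf s \<in> low n l \<Longrightarrow> upper (nf s) \<in> cell_halves n l \<and> nf s = circ n (upper (nf s)) T"
proof -
  note C = circ_cell[OF l S T]
  have D: "d \<in> diagrams n" "circ n S T \<in> diagrams n" and ev: "even (total_dec d)" "even (total_dec (circ n S T))"
    using d C(1) by (auto simp: type_II_iff)
  have sd: "s \<in> diagrams n" unfolding s_def by (rule diagrams_stack[OF D])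
  have "even (total_dec s)"
    unfolding s_def using total_dec_stack[OF diagrams_matching[OF D(1)] diagrams_matching[OF D(2)]] ev by simp
  then have nf: "nf s \<in> type_II n" if "\<not> odd_loop s" using nf_in_type_II[OF sd _ that] by blast
  then show "odd_loop s \<or> nf s \<in> type_II n" by blast
  assume no: "\<not> odd_loop s" and nl: "\<not> nf s \<in> low n l"
  have ns: "nf s \<in> type_II n" by (rule nf[OF no])
  have "label_abs l \<le> card (props s)" using nl ns by (simp add: low_def)
  moreover have "card (props s) \<le> label_abs l" using props_stack_right(1)[OF D] C(5) by (simp add: s_def)
  ultimately have cp: "card (props s) = label_abs l" by simp
  then have "lower s = lower (circ n S T)" unfolding s_def using props_stack_right(2)[OF D] C(5) by simp
  then have lo: "lower (nf s) = T" using lower_nf_cong[of s "circ n S T"] C(1,3) by simp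
  have eq: "nf s = circ n (upper (nf s)) T" using circ_upper_lower[OF ns] lo by simp
  have "cell_label (nf s) = l"
  proof (cases "label_abs l = 0")
    case True
    have fin: "finite (props s)" by (rule finite_props[OF diagrams_matching[OF sd]])
    then have "props (nf s) = {}" using cp True by simp
    then have Z: "cell_label (nf s) = Zero_plus \<or> cell_label (nf s) = Zero_minus" by (simp add: cell_label_def)
    \<comment> \<open>The sign of a label is the parity of the lower half, and \<open>T\<close> is
      the lower half both before and after the multiplication.\<close>
    have "T \<in> cell_halves n (cell_label (nf s))" using cell_label_type_II(3)[OF ns] lo by simp
    moreover have "l = Zero_plus \<or> l = Zero_minus" using True l by (cases l) (auto simp: cell_labels_def split: if_splits)
    ultimately show ?thesis using Z T by (auto simp: cell_halves_def)
  next
    case False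
    then have "props s \<noteq> {}" using cp by auto
    moreover have "l = Thru (label_abs l)" using False by (cases l) auto
    ultimately show ?thesis using cp by (simp add: cell_label_def)
  qed
  then show "upper (nf s) \<in> cell_halves n l \<and> nf s = circ n (upper (nf s)) T"
    using eq cell_label_type_II(2)[OF ns] by simp
qed

text \<open>Multiplying \<open>d (S \<circ> T)\<close> by \<open>T \<circ> T'\<close> on the right gives \<open>\<delta>\<^sup>a d (S \<circ> T')\<close>; cancelling the power
  of \<open>\<delta>\<close> shows that the coefficients do not depend on \<open>T\<close>.\<close>

lemma val_stack_change:
  assumes d: "d \<in> type_II n" and l: "l \<in> cell_labels n" and S: "S \<in> cell_halves n l"
    and T: "T \<in> cell_halves n l" and T': "T' \<in> cell_halves n l"
  defines "s \<equiv> stack d (circ n S T)" and "s' \<equiv> stack d (circ n S T')"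
  shows "\<not> odd_loop s \<Longrightarrow> \<not> nf s \<in> low n l \<Longrightarrow> val s' = sgl (circ n (upper (nf s)) T') (\<delta> ^ size (loops s))"
    "odd_loop s \<or> nf s \<in> low n l \<Longrightarrow> odd_loop s' \<or> nf s' \<in> low n l"
proof -
  let ?c = "circ n S T" and ?u = "circ n T T'"
  note C = circ_cell[OF l S T] and U = circ_cell[OF l T T'] and C' = circ_cell[OF l S T']
  define a where "a = card (hedges T)"
  have D: "d \<in> diagrams n" "?c \<in> diagrams n" "?u \<in> diagrams n" "circ n S T' \<in> diagrams n"
    using d C(1) U(1) C'(1) by (auto simp: type_II_iff)
  have fin: "finite (edges x)" if "x \<in> diagrams n" for x using matchingD(1)[OF diagrams_matching[OF that]] .
  have sd: "s \<in> diagrams n" unfolding s_def by (rule diagrams_stack[OF D(1,2)])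
  let ?v = "stack ?c ?u"
  have "lower ?c = upper ?u" using C(3) U(2) by simp
  note V = stack_matched[OF C(1) U(1) this]
  have vd: "?v \<in> diagrams n" by (rule diagrams_stack[OF D(2,3)])
  have nv: "nf ?v = circ n S T'" using V(3) C(2) U(3) by simp
  have sv: "size (loops ?v) = a" using V(2) C(3) by (simp add: a_def del: hedges_simps)
  \<comment> \<open>Associativity moves T \<circ> T' onto S \<circ> T, where
    \<open>stack_matched\<close> evaluates the product.\<close>
  have key: "val (stack s ?u) = scal (\<delta> ^ a) (val s')"
    using stack_nf_right(1)[OF fin[OF D(1)] fin[OF vd]] V(1) nv sv stack_assoc[OF D(1,2,3)]
    by (simp add: s_def s'_def)
  have key2: "val (stack s ?u) = (if odd_loop s then 0 else scal (\<delta> ^ size (loops s)) (val (stack (nf s) ?u)))"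
    by (rule stack_nf_right(2)[OF fin[OF sd] fin[OF D(3)]])
  have nz: "\<delta> ^ k \<noteq> 0" for k by simp
  {
    assume no: "\<not> odd_loop s" and nl: "\<not> nf s \<in> low n l"
    have W: "upper (nf s) \<in> cell_halves n l" "nf s = circ n (upper (nf s)) T"
      using val_stack_cell(2)[OF d l S T] no nl unfolding s_def by blast+
    have ns: "nf s \<in> type_II n" using val_stack_cell(1)[OF d l S T] no unfolding s_def by blast
    have lo: "lower (nf s) = T" using circ_cell(3)[OF l W(1) T] W(2) by simp
    then have "lower (nf s) = upper ?u" using U(2) by simp
    note Y = stack_matched[OF ns U(1) this]
    have "val (stack (nf s) ?u) = sgl (circ n (upper (nf s)) T') (\<delta> ^ a)"
      using Y lo U(3) by (simp add: val_def a_def del: hedges_simps)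
    then have "scal (\<delta> ^ a) (val s') = scal (\<delta> ^ a) (sgl (circ n (upper (nf s)) T') (\<delta> ^ size (loops s)))"
      using key key2 no by (simp add: mult.commute)
    then show "val s' = sgl (circ n (upper (nf s)) T') (\<delta> ^ size (loops s))" by (simp only: scal_cancel[OF nz])
  next
    assume low: "odd_loop s \<or> nf s \<in> low n l"
    show "odd_loop s' \<or> nf s' \<in> low n l"
    \<comment> \<open>If \<open>s'\<close> stayed in the cell, its value would be nonzero, hence
      also the value of \<open>nf s\<close> times T \<circ> T'. But that product has no more
      propagating edges than \<open>nf s\<close>.\<close>
    proof (rule ccontr)
      assume "\<not> (odd_loop s' \<or> nf s' \<in> low n l)"
      then have no': "\<not> odd_loop s'" and nl': "nf s' \<notin> low n l" by auto
      have ns': "nf s' \<in> type_II n" using val_stack_cell(1)[OF d l S T'] no' unfolding s'_def by blast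
      have vs': "val s' = sgl (nf s') (\<delta> ^ size (loops s'))" using no' by (simp add: val_def)
      have "lkp (scal (\<delta> ^ a) (val s')) (nf s') = \<delta> ^ (a + size (loops s'))"
        unfolding vs' scal_simps(4) power_add by (simp add: lookup_single)
      then have nzs: "scal (\<delta> ^ a) (val s') \<noteq> 0" using nz[of "a + size (loops s')"] by (metis lookup_zero)
      have no: "\<not> odd_loop s"
      proof
        assume "odd_loop s"
        then have "val (stack s ?u) = 0" unfolding key2 by simp
        then show False using nzs by (simp only: key)
      qed
      have nz2: "val (stack (nf s) ?u) \<noteq> 0"
      proof
        assume v0: "val (stack (nf s) ?u) = 0"
        have "val (stack s ?u) = 0" unfolding key2 v0 by simp
        then show False using nzs by (simp only: key)
      qed
      have nl: "nf s \<in> low n l" using low no by blast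
      then have nsd: "nf s \<in> diagrams n" and cl: "card (props (nf s)) < label_abs l" by (auto simp: low_def type_II_iff)
      have "\<not> odd_loop (stack (nf s) ?u)" using nz2 by (auto simp: val_def)
      then have "scal (\<delta> ^ a) (sgl (nf s') (\<delta> ^ size (loops s')))
          = scal (\<delta> ^ size (loops s)) (sgl (nf (stack (nf s) ?u)) (\<delta> ^ size (loops (stack (nf s) ?u))))"
        using key key2 no vs' by (simp add: val_def)
      then have "keys (sgl (nf s') (\<delta> ^ a * \<delta> ^ size (loops s'))) = keys (sgl (nf (stack (nf s) ?u)) (\<delta> ^ size (loops s) * \<delta> ^ size (loops (stack (nf s) ?u))))"
        by simp
      then have "nf s' = nf (stack (nf s) ?u)" by simp
      then have "card (props (nf s')) \<le> card (props (nf s))"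
        using props_stack_left(1)[OF nsd D(3)] by simp
      then have "nf s' \<in> low n l" using cl ns' by (simp add: low_def)
      then show False using nl' by simp
    qed
  }
qed

text \<open>Read off from the sample S \<circ> S, so that no lower half enters;
  \<open>val_stack_change\<close> carries it over to every S \<circ> T.\<close>

definition coef :: "nat \<Rightarrow> label \<Rightarrow> diag \<Rightarrow> half \<Rightarrow> half \<Rightarrow> int poly"
  where "coef n l d S' S = (let s = stack d (circ n S S) in
    if odd_loop s \<or> nf s \<in> low n l \<or> upper (nf s) \<noteq> S' then 0 else \<delta> ^ size (loops s))"

lemma finite_cell_halves: "finite (cell_halves n l)"
proof -
  have "cell_halves n l \<subseteq> upper ` type_II n" unfolding cell_halves_def half_diagrams_upper by blast
  then show ?thesis using finite_type_II finite_subset by blast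
qed

lemma val_stack_coef:
  assumes d: "d \<in> type_II n" and l: "l \<in> cell_labels n" and S: "S \<in> cell_halves n l" and T: "T \<in> cell_halves n l"
  shows "keys (val (stack d (circ n S T)) - (\<Sum>S'\<in>cell_halves n l. sgl (circ n S' T) (coef n l d S' S))) \<subseteq> low n l"
proof -
  define s where "s = stack d (circ n S S)"
  define s' where "s' = stack d (circ n S T)"
  note ch = val_stack_change[OF d l S S T, folded s_def s'_def]
  show ?thesis
  proof (cases "odd_loop s \<or> nf s \<in> low n l")
    case True
    then have "coef n l d S' S = 0" for S' by (auto simp: coef_def s_def[symmetric] Let_def)
    then have z: "(\<Sum>S'\<in>cell_halves n l. sgl (circ n S' T) (coef n l d S' S)) = 0" by simp
    show ?thesis using ch(2)[OF True] unfolding z by (auto simp: s'_def[symmetric] val_def)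
  next
    case False
    then have v: "val s' = sgl (circ n (upper (nf s)) T) (\<delta> ^ size (loops s))" using ch(1) by blast
    have up: "upper (nf s) \<in> cell_halves n l" using val_stack_cell(2)[OF d l S S] False unfolding s_def by blast
    have "coef n l d S' S = (if S' = upper (nf s) then \<delta> ^ size (loops s) else 0)" for S'
      using False by (auto simp: coef_def s_def[symmetric] Let_def)
    then have "(\<Sum>S'\<in>cell_halves n l. sgl (circ n S' T) (coef n l d S' S))
       = (\<Sum>S'\<in>cell_halves n l. if S' = upper (nf s) then sgl (circ n S' T) (\<delta> ^ size (loops s)) else 0)"
      by (intro sum.cong) auto
    also have "\<dots> = val s'" unfolding v using up finite_cell_halves by simp
    finally show ?thesis by (simp add: s'_def)
  qed
qed

section \<open>Verification of the axioms of a cellular algebra\<close>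

section \<open>The cell datum\<close>

context
  fixes n :: nat
  assumes n2: "2 \<le> n"
begin

abbreviation "ps \<equiv> psi n"
abbreviation "vs \<equiv> {x. keys x \<subseteq> type_II n}"

lemmas ops = psi_ops[OF n2] and inj = psi_inj[OF n2] and car = carrier_DTL_hat[OF n2]
  and ps0 = psi_const[OF n2] and red_vs = red_pmul_vecs[OF n2] and diag_ps = DTL_hat_diag_psi[OF n2]

interpretation A: unital_algebra "Z\<delta>" "DTL_hat n"
  by (rule unital_algebra_DTL_hat[OF n2])

lemma ps_carrier: "x \<in> vs \<Longrightarrow> ps x \<in> carrier (DTL_hat n)"
  unfolding car by blast

lemma vs_closed: "0 \<in> vs" "x \<in> vs \<Longrightarrow> y \<in> vs \<Longrightarrow> x + y \<in> vs" "x \<in> vs \<Longrightarrow> scal c x \<in> vs" "x \<in> vs \<Longrightarrow> - x \<in> vs"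
  "x \<in> vs \<Longrightarrow> y \<in> vs \<Longrightarrow> x - y \<in> vs"
  using keys_scal[of c x] keys_add_subset[of x "type_II n" y] keys_minus_subset[of x "type_II n" y] by auto

lemma vs_sum: "(\<And>i. i \<in> I \<Longrightarrow> f i \<in> vs) \<Longrightarrow> (\<Sum>i\<in>I. f i) \<in> vs"
  by (induction I rule: infinite_finite_induct) (use vs_closed in \<open>simp_all\<close>)

lemma ps_uminus: "x \<in> vs \<Longrightarrow> \<ominus>\<^bsub>DTL_hat n\<^esub> ps x = ps (- x)"
proof -
  assume x: "x \<in> vs"
  have mx: "- x \<in> vs" by (rule vs_closed(4)[OF x])
  have "ps (- x + x) = ps (- x) \<oplus>\<^bsub>DTL_hat n\<^esub> ps x" by (rule ops(1)[OF mx x])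
  then have "ps (- x) \<oplus>\<^bsub>DTL_hat n\<^esub> ps x = \<zero>\<^bsub>DTL_hat n\<^esub>" by (simp add: ps0)
  then show ?thesis by (rule A.minus_equality[OF _ ps_carrier[OF x] ps_carrier[OF mx]])
qed

lemma ps_minus: "x \<in> vs \<Longrightarrow> y \<in> vs \<Longrightarrow> ps x \<ominus>\<^bsub>DTL_hat n\<^esub> ps y = ps (x - y)"
  unfolding A.minus_eq using ps_uminus[of y] ops(1)[of x "- y"] by simp

lemma ps_finsum:
  assumes "finite I" "\<And>i. i \<in> I \<Longrightarrow> f i \<in> vs"
  shows "(\<Oplus>\<^bsub>DTL_hat n\<^esub>i\<in>I. ps (f i)) = ps (\<Sum>i\<in>I. f i)"
  using assms
proof (induction I rule: finite_induct)
  case empty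
  then show ?case by (simp add: ps0)
next
  case (insert i I)
  have s: "(\<Sum>i\<in>I. f i) \<in> vs" using insert by (intro vs_sum) auto
  have "(\<Oplus>\<^bsub>DTL_hat n\<^esub>i\<in>insert i I. ps (f i)) = ps (f i) \<oplus>\<^bsub>DTL_hat n\<^esub> (\<Oplus>\<^bsub>DTL_hat n\<^esub>i\<in>I. ps (f i))"
    using insert ps_carrier by (intro A.finsum_insert) auto
  also have "\<dots> = ps (f i) \<oplus>\<^bsub>DTL_hat n\<^esub> ps (\<Sum>i\<in>I. f i)" using insert by simp
  also have "\<dots> = ps (f i + (\<Sum>i\<in>I. f i))" using insert.prems[of i] by (intro ops(1)[symmetric] s) auto
  finally show ?case using insert by simp
qed

text \<open>Applied to all type II diagrams for the basis property and to \<open>low n l\<close> for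
  A(<l).\<close>

lemma gen_submodule_ps:
  assumes Y: "Y \<subseteq> type_II n"
  shows "gen_submodule Z\<delta> (DTL_hat n) ((\<lambda>d. ps (sgl d 1)) ` Y) = ps ` {x. keys x \<subseteq> Y}"
proof
  let ?G = "(\<lambda>d. ps (sgl d 1)) ` Y" and ?M = "ps ` {x. keys x \<subseteq> Y}"
  have v: "x \<in> vs" if "keys x \<subseteq> Y" for x using that Y by auto
  have "submodule ?M Z\<delta> (DTL_hat n)"
  proof (rule A.submoduleI)
    show "?M \<subseteq> carrier (DTL_hat n)" using v ps_carrier by blast
    show "\<zero>\<^bsub>DTL_hat n\<^esub> \<in> ?M" using ps0 by (intro image_eqI[of _ _ 0]) auto
    show "\<ominus>\<^bsub>DTL_hat n\<^esub> a \<in> ?M" if "a \<in> ?M" for a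
    proof -
      obtain x where x: "keys x \<subseteq> Y" "a = ps x" using \<open>a \<in> ?M\<close> by blast
      then show ?thesis using ps_uminus[OF v[OF x(1)]] by (intro image_eqI[of _ _ "- x"]) auto
    qed
    show "a \<oplus>\<^bsub>DTL_hat n\<^esub> b \<in> ?M" if "a \<in> ?M" "b \<in> ?M" for a b
    proof -
      obtain x y where x: "keys x \<subseteq> Y" "a = ps x" "keys y \<subseteq> Y" "b = ps y" using \<open>a \<in> ?M\<close> \<open>b \<in> ?M\<close> by blast
      then show ?thesis using ops(1)[OF v[OF x(1)] v[OF x(3)]] keys_add_subset[OF x(1,3)]
        by (intro image_eqI[of _ _ "x + y"]) auto
    qed
    show "c \<odot>\<^bsub>DTL_hat n\<^esub> a \<in> ?M" if "a \<in> ?M" for c a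
    proof -
      obtain x where x: "keys x \<subseteq> Y" "a = ps x" using \<open>a \<in> ?M\<close> by blast
      have "keys (scal c x) \<subseteq> Y" using keys_scal[of c x] x(1) by blast
      then show ?thesis using ops(3)[OF v[OF x(1)] v[OF x(1)], of c] x by (intro image_eqI[of _ _ "scal c x"]) auto
    qed
  qed
  moreover have "?G \<subseteq> ?M"
  proof
    fix y assume "y \<in> ?G"
    then obtain d where "d \<in> Y" "y = ps (sgl d 1)" by blast
    then show "y \<in> ?M" by (intro image_eqI[of _ _ "sgl d 1"]) auto
  qed
  ultimately show "gen_submodule Z\<delta> (DTL_hat n) ?G \<subseteq> ?M" unfolding gen_submodule_def by blast
  show "?M \<subseteq> gen_submodule Z\<delta> (DTL_hat n) ?G"
    unfolding gen_submodule_def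
  proof (intro image_subsetI InterI)
    fix x H assume x: "x \<in> {x. keys x \<subseteq> Y}" and "H \<in> {H. submodule H Z\<delta> (DTL_hat n) \<and> ?G \<subseteq> H}"
    then have H: "submodule H Z\<delta> (DTL_hat n)" "?G \<subseteq> H" by auto
    interpret H: submodule H "Z\<delta>" "DTL_hat n" by fact
    have "keys x \<subseteq> Y" using x by simp
    then show "ps x \<in> H"
    proof (induction rule: comb_induct)
      case zero
      show ?case using H.one_closed by (simp add: ps0)
    next
      case (single d c)
      have g: "sgl d 1 \<in> vs" "ps (sgl d 1) \<in> H" using single Y H(2) by auto
      have "c \<odot>\<^bsub>DTL_hat n\<^esub> ps (sgl d 1) \<in> H" using H.smult_closed[of c] g by (simp add: Zd_sel)
      then show ?case using ops(3)[OF g(1) g(1), of c] by simp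
    next
      case (add x y)
      then show ?case using H.m_closed[of "ps x" "ps y"] ops(1)[OF v[OF add(1)] v[OF add(2)]] by simp
    qed
  qed
qed

lemma basis: "module_basis Z\<delta> (DTL_hat n) ((\<lambda>d. ps (sgl d 1)) ` type_II n)"
proof -
  let ?B = "(\<lambda>d. ps (sgl d 1)) ` type_II n"
  have "?B \<subseteq> carrier (DTL_hat n)" using ps_carrier by auto
  moreover have "gen_submodule Z\<delta> (DTL_hat n) ?B = carrier (DTL_hat n)" unfolding car by (rule gen_submodule_ps) simp
  moreover have "lin_indep Z\<delta> (DTL_hat n) ?B"
    unfolding lin_indep_def
  proof (intro allI impI ballI, elim conjE)
    fix F c b0 assume F: "finite F" "F \<subseteq> ?B" and z: "(\<Oplus>\<^bsub>DTL_hat n\<^esub>b\<in>F. c b \<odot>\<^bsub>DTL_hat n\<^esub> b) = \<zero>\<^bsub>DTL_hat n\<^esub>" and b0: "b0 \<in> F"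
    \<comment> \<open>The coefficients are indexed by classes, so a diagram is chosen for each
      class. Different classes have different diagrams, hence the coefficient at \<open>e b0\<close>
      is \<open>c b0\<close> alone.\<close>
    have "\<forall>b\<in>F. \<exists>d. d \<in> type_II n \<and> ps (sgl d 1) = b" using F(2) by blast
    from bchoice[OF this] obtain e where "\<forall>b\<in>F. e b \<in> type_II n \<and> ps (sgl (e b) 1) = b" ..
    then have e: "e b \<in> type_II n" "ps (sgl (e b) 1) = b" if "b \<in> F" for b using that by blast+
    have v: "sgl (e b) k \<in> vs" if "b \<in> F" for b k using e(1)[OF that] by simp
    have "(\<Oplus>\<^bsub>DTL_hat n\<^esub>b\<in>F. c b \<odot>\<^bsub>DTL_hat n\<^esub> b) = (\<Oplus>\<^bsub>DTL_hat n\<^esub>b\<in>F. ps (sgl (e b) (c b)))"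
    proof (rule A.finsum_cong')
      show "(\<lambda>b. ps (sgl (e b) (c b))) \<in> F \<rightarrow> carrier (DTL_hat n)" using v ps_carrier by blast
      show "c b \<odot>\<^bsub>DTL_hat n\<^esub> b = ps (sgl (e b) (c b))" if "b \<in> F" for b
        using ops(3)[OF v[OF that, of 1] v[OF that, of 1], of "c b"] e(2)[OF that] by simp
    qed simp
    also have "\<dots> = ps (\<Sum>b\<in>F. sgl (e b) (c b))" by (rule ps_finsum[OF F(1) v])
    finally have "ps (\<Sum>b\<in>F. sgl (e b) (c b)) = ps 0" using z by (simp add: ps0)
    moreover have "(\<Sum>b\<in>F. sgl (e b) (c b)) \<in> vs" by (rule vs_sum) (rule v)
    ultimately have "(\<Sum>b\<in>F. sgl (e b) (c b)) = 0" using inj[OF _ vs_closed(1)] by blast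
    then have "lkp (\<Sum>b\<in>F. sgl (e b) (c b)) (e b0) = 0" by simp
    moreover have "lkp (\<Sum>b\<in>F. sgl (e b) (c b)) (e b0) = (\<Sum>b\<in>F. if b = b0 then c b else 0)"
      unfolding lookup_sum
    proof (rule sum.cong[OF refl])
      fix b assume b: "b \<in> F"
      have "e b = e b0 \<longleftrightarrow> b = b0"
      proof
        assume eb: "e b = e b0"
        have "b = ps (sgl (e b) 1)" by (rule e(2)[OF b, symmetric])
        also have "\<dots> = ps (sgl (e b0) 1)" unfolding eb ..
        also have "\<dots> = b0" by (rule e(2)[OF b0])
        finally show "b = b0" .
      qed simp
      then show "lkp (sgl (e b) (c b)) (e b0) = (if b = b0 then c b else 0)" by (simp add: lookup_single when_def)
    qed
    ultimately show "c b0 = \<zero>\<^bsub>Z\<delta>\<^esub>" using F(1) b0 by (simp add: Zd_sel)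
  qed
  ultimately show ?thesis by (simp add: module_basis_def)
qed

definition flp :: "comb \<Rightarrow> comb"
  where "flp = lin (\<lambda>d. sgl (flip d) 1)"

lemma flp_simps [simp]: "flp (x + y) = flp x + flp y" "flp (scal c x) = scal c (flp x)" "flp (sgl d c) = sgl (flip d) c" "flp 0 = 0"
  by (simp_all add: flp_def lin_add lin_scal)

lemma flp_vs: "x \<in> vs \<Longrightarrow> flp x \<in> vs"
  using keys_lin[of x "type_II n" "\<lambda>d. sgl (flip d) 1" "type_II n"] flip_type_II by (simp add: flp_def)

lemma flp_flp: "x \<in> vs \<Longrightarrow> flp (flp x) = x"
proof -
  assume "x \<in> vs"
  then have "keys x \<subseteq> type_II n" by simp
  then show ?thesis by (induction rule: comb_induct) simp_all
qed

lemma val_flip: "val (flip d) = flp (val d)"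
proof -
  have "nf (flip d) = flip (nf d)" by (simp add: flip_def nf_def)
  then show ?thesis by (simp add: val_def odd_loop_def)
qed

lemma flp_red: "flp (red x) = red (flp x)" if "keys x \<subseteq> diagrams n"
  using that by (induction rule: comb_induct) (simp_all add: lin_add val_flip)

lemma flp_pmul:
  assumes "keys x \<subseteq> diagrams n" "keys y \<subseteq> diagrams n"
  shows "flp (pmul x y) = pmul (flp y) (flp x)"
  using assms(1)
proof (induction rule: comb_induct)
  case (single a c)
  note a = single
  from assms(2) show ?case
  proof (induction rule: comb_induct)
    case (single b e)
    then show ?case by (simp add: flip_stack[OF diagrams_matching[OF a] diagrams_matching[OF single]] mult.commute)
  qed (simp_all add: pmul_add)
qed (simp_all add: pmul_add)

lemma vs_diagrams: "x \<in> vs \<Longrightarrow> keys x \<subseteq> diagrams n"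
  using type_II_iff by auto

text \<open>\<open>inversion\<close> is a definite description. Existence comes from transporting
  \<open>flp\<close> along \<open>ps\<close>; uniqueness holds because type II diagrams span and
  \<open>extensional\<close> fixes the values off the carrier.\<close>

lemma inversion_ps: "x \<in> vs \<Longrightarrow> inversion n (ps x) = ps (flp x)"
  and inversion_linear: "linear_endo Z\<delta> (DTL_hat n) (inversion n)"
proof -
  define g where "g = the_inv_into vs ps"
  have inj': "inj_on ps vs" using inj by (intro inj_onI) blast
  have g: "g (ps x) = x" if "x \<in> vs" for x unfolding g_def by (rule the_inv_into_f_f[OF inj' that])
  define f0 where "f0 = restrict (\<lambda>y. ps (flp (g y))) (carrier (DTL_hat n))"
  have f0: "f0 (ps x) = ps (flp x)" if "x \<in> vs" for x using that g ps_carrier by (simp add: f0_def)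
  have lin0: "linear_endo Z\<delta> (DTL_hat n) f0"
    unfolding linear_endo_def
  proof (intro conjI ballI)
    show "f0 \<in> carrier (DTL_hat n) \<rightarrow> carrier (DTL_hat n)"
    proof
      fix y assume "y \<in> carrier (DTL_hat n)"
      then obtain x where "x \<in> vs" "y = ps x" unfolding car by blast
      then show "f0 y \<in> carrier (DTL_hat n)" using f0 ps_carrier[OF flp_vs] by simp
    qed
    fix y z assume "y \<in> carrier (DTL_hat n)" "z \<in> carrier (DTL_hat n)"
    then obtain x w where x: "x \<in> vs" "y = ps x" and w: "w \<in> vs" "z = ps w" unfolding car by blast
    show "f0 (y \<oplus>\<^bsub>DTL_hat n\<^esub> z) = f0 y \<oplus>\<^bsub>DTL_hat n\<^esub> f0 z"
      unfolding x(2) w(2) ops(1)[OF x(1) w(1), symmetric] f0[OF vs_closed(2)[OF x(1) w(1)]] f0[OF x(1)] f0[OF w(1)]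
      using ops(1)[OF flp_vs[OF x(1)] flp_vs[OF w(1)]] by simp
  next
    fix c y assume "y \<in> carrier (DTL_hat n)"
    then obtain x where x: "x \<in> vs" "y = ps x" unfolding car by blast
    show "f0 (c \<odot>\<^bsub>DTL_hat n\<^esub> y) = c \<odot>\<^bsub>DTL_hat n\<^esub> f0 y"
      unfolding x(2) ops(3)[OF x(1) x(1), symmetric] f0[OF vs_closed(3)[OF x(1)]] f0[OF x(1)]
      using ops(3)[OF flp_vs[OF x(1)] flp_vs[OF x(1)], of c] by simp
  qed
  have "inversion n = f0"
    unfolding inversion_def
  proof (rule the_equality)
    show "f0 \<in> extensional (carrier (DTL_hat n)) \<and> linear_endo Z\<delta> (DTL_hat n) f0 \<and>
      (\<forall>d\<in>type_II n. f0 (DTL_hat_diag n d) = DTL_hat_diag n (flip d))"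
    proof (intro conjI ballI)
      show "f0 \<in> extensional (carrier (DTL_hat n))" by (simp add: f0_def)
      show "f0 (DTL_hat_diag n d) = DTL_hat_diag n (flip d)" if "d \<in> type_II n" for d
        using f0[of "sgl d 1"] that by (simp add: diag_ps)
    qed (rule lin0)
  next
    fix f assume f: "f \<in> extensional (carrier (DTL_hat n)) \<and> linear_endo Z\<delta> (DTL_hat n) f \<and>
      (\<forall>d\<in>type_II n. f (DTL_hat_diag n d) = DTL_hat_diag n (flip d))"
    have fa: "f (y \<oplus>\<^bsub>DTL_hat n\<^esub> z) = f y \<oplus>\<^bsub>DTL_hat n\<^esub> f z" if "y \<in> carrier (DTL_hat n)" "z \<in> carrier (DTL_hat n)" for y z
      using f that unfolding linear_endo_def by blast
    have fs: "f (c \<odot>\<^bsub>DTL_hat n\<^esub> y) = c \<odot>\<^bsub>DTL_hat n\<^esub> f y" if "y \<in> carrier (DTL_hat n)" for c y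
      using f that unfolding linear_endo_def by (simp add: Zd_sel)
    have fps: "f (ps x) = ps (flp x)" if "x \<in> vs" for x
    proof -
      have "keys x \<subseteq> type_II n" using that by simp
      then show ?thesis
      proof (induction rule: comb_induct)
        case zero
        have "f (ps (scal 0 0)) = 0 \<odot>\<^bsub>DTL_hat n\<^esub> f (ps 0)"
          unfolding ops(3)[OF vs_closed(1) vs_closed(1)] by (rule fs[OF ps_carrier[OF vs_closed(1)]])
        moreover have "f (ps 0) \<in> carrier (DTL_hat n)"
          using f ps_carrier[OF vs_closed(1)] unfolding linear_endo_def by blast
        then have "0 \<odot>\<^bsub>DTL_hat n\<^esub> f (ps 0) = \<zero>\<^bsub>DTL_hat n\<^esub>" using A.smult_l_null by (simp add: Zd_sel)
        ultimately show ?case by (simp add: ps0)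
      next
        case (single d c)
        have v: "sgl d 1 \<in> vs" "sgl (flip d) 1 \<in> vs" using single flip_type_II by simp_all
        have "f (ps (scal c (sgl d 1))) = c \<odot>\<^bsub>DTL_hat n\<^esub> ps (sgl (flip d) 1)"
          using ops(3)[OF v(1) v(1), of c] fs[OF ps_carrier[OF v(1)], of c] f single by (simp add: diag_ps)
        also have "\<dots> = ps (scal c (sgl (flip d) 1))" by (rule ops(3)[OF v(2) v(2), symmetric])
        finally show ?case by simp
      next
        case (add x y)
        then have v: "x \<in> vs" "y \<in> vs" by simp_all
        show ?case
          using ops(1)[OF v] fa[OF ps_carrier[OF v(1)] ps_carrier[OF v(2)]] add ops(1)[OF flp_vs[OF v(1)] flp_vs[OF v(2)]]
          by simp
      qed
    qed
    show "f = f0"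
    proof
      fix y show "f y = f0 y"
      proof (cases "y \<in> carrier (DTL_hat n)")
        case True
        then obtain x where "x \<in> vs" "y = ps x" unfolding car by blast
        then show ?thesis using fps f0 by simp
      next
        case False
        then show ?thesis using f by (simp add: f0_def extensional_def)
      qed
    qed
  qed
  then show "x \<in> vs \<Longrightarrow> inversion n (ps x) = ps (flp x)" "linear_endo Z\<delta> (DTL_hat n) (inversion n)"
    using f0 lin0 by simp_all
qed

lemma cell_map_ps: "cell_map n l S T = ps (sgl (circ n S T) 1)"
  by (simp add: cell_map_def diag_ps)

lemma cell_image: "(\<lambda>(l, S, T). cell_map n l S T) ` (SIGMA l:cell_labels n. cell_halves n l \<times> cell_halves n l)
    = (\<lambda>d. ps (sgl d 1)) ` type_II n"
proof (intro equalityI subsetI)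
  fix y assume "y \<in> (\<lambda>(l, S, T). cell_map n l S T) ` (SIGMA l:cell_labels n. cell_halves n l \<times> cell_halves n l)"
  then obtain l S T where "l \<in> cell_labels n" "S \<in> cell_halves n l" "T \<in> cell_halves n l" "y = cell_map n l S T" by auto
  then show "y \<in> (\<lambda>d. ps (sgl d 1)) ` type_II n" using circ_cell(1) cell_map_ps by blast
next
  fix y assume "y \<in> (\<lambda>d. ps (sgl d 1)) ` type_II n"
  then obtain d where d: "d \<in> type_II n" "y = ps (sgl d 1)" by blast
  then have "y = cell_map n (cell_label d) (upper d) (lower d)" using circ_upper_lower by (simp add: cell_map_ps)
  then show "y \<in> (\<lambda>(l, S, T). cell_map n l S T) ` (SIGMA l:cell_labels n. cell_halves n l \<times> cell_halves n l)"
    using cell_label_type_II[OF d(1)] by (intro image_eqI[of _ _ "(cell_label d, upper d, lower d)"]) auto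
qed

lemma cell_inj: "inj_on (\<lambda>(l, S, T). cell_map n l S T) (SIGMA l:cell_labels n. cell_halves n l \<times> cell_halves n l)"
proof (rule inj_onI)
  fix x y
  assume x: "x \<in> (SIGMA l:cell_labels n. cell_halves n l \<times> cell_halves n l)"
    and y: "y \<in> (SIGMA l:cell_labels n. cell_halves n l \<times> cell_halves n l)"
    and eq: "(\<lambda>(l, S, T). cell_map n l S T) x = (\<lambda>(l, S, T). cell_map n l S T) y"
  obtain l S T where x': "x = (l, S, T)" by (cases x)
  obtain l' S' T' where y': "y = (l', S', T')" by (cases y)
  have 1: "l \<in> cell_labels n" "S \<in> cell_halves n l" "T \<in> cell_halves n l" using x unfolding x' by auto
  have 2: "l' \<in> cell_labels n" "S' \<in> cell_halves n l'" "T' \<in> cell_halves n l'" using y unfolding y' by auto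
  note C = circ_cell[OF 1] and C' = circ_cell[OF 2]
  have "sgl (circ n S T) (1 :: int poly) = sgl (circ n S' T') 1"
    using eq inj[of "sgl (circ n S T) 1" "sgl (circ n S' T') 1"] C(1) C'(1) by (simp add: cell_map_ps x' y')
  then have "keys (sgl (circ n S T) (1 :: int poly)) = keys (sgl (circ n S' T') 1)" by simp
  then have ceq: "circ n S T = circ n S' T'" by simp
  then have "l = l'" "S = S'" "T = T'" using C(2-4) C'(2-4) by simp_all
  then show "x = y" by (simp add: x' y')
qed

text \<open>Apart from equality the order compares only absolute values, and these count propagating
  edges.\<close>

lemma lower_cells:
  assumes "l \<in> cell_labels n"
  shows "{cell_map n k S T | k S T. k \<in> cell_labels n \<and> (k, l) \<in> cell_order n \<and> k \<noteq> l \<and> S \<in> cell_halves n k \<and> T \<in> cell_halves n k}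
    = (\<lambda>d. ps (sgl d 1)) ` low n l" (is "?L = _")
proof (intro equalityI subsetI)
  fix y assume "y \<in> ?L"
  then obtain k S T where k: "k \<in> cell_labels n" "(k, l) \<in> cell_order n" "k \<noteq> l" "S \<in> cell_halves n k" "T \<in> cell_halves n k"
    "y = cell_map n k S T" by blast
  then have "label_abs k < label_abs l" by (auto simp: cell_order_def)
  then have "circ n S T \<in> low n l" using circ_cell[OF k(1,4,5)] by (simp add: low_def)
  then show "y \<in> (\<lambda>d. ps (sgl d 1)) ` low n l" using k(6) cell_map_ps by blast
next
  fix y assume "y \<in> (\<lambda>d. ps (sgl d 1)) ` low n l"
  then obtain d where d: "d \<in> type_II n" "card (props d) < label_abs l" "y = ps (sgl d 1)" by (auto simp: low_def)
  have m: "matching n d" using d(1) diagrams_matching by (auto simp: type_II_iff)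
  have lt: "label_abs (cell_label d) < label_abs l" using d(2) cell_label_abs[OF m] by simp
  then have "(cell_label d, l) \<in> cell_order n" "cell_label d \<noteq> l"
    using cell_label_type_II(1)[OF d(1)] assms by (auto simp: cell_order_def)
  moreover have "y = cell_map n (cell_label d) (upper d) (lower d)" using circ_upper_lower[OF d(1)] d(3) by (simp add: cell_map_ps)
  ultimately show "y \<in> ?L" using cell_label_type_II[OF d(1)] by blast
qed

lemma single_sum_right: "sgl d (\<Sum>i\<in>I. f i) = (\<Sum>i\<in>I. sgl d (f i))"
  by (induction I rule: infinite_finite_induct) (simp_all add: single_add)

text \<open>Extends \<open>val_stack_coef\<close> linearly in the left factor.\<close>

lemma left_mult_coef:
  assumes l: "l \<in> cell_labels n" and x: "x \<in> vs" and S: "S \<in> cell_halves n l" and T: "T \<in> cell_halves n l"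
  shows "keys (red (pmul x (sgl (circ n S T) 1))
    - (\<Sum>S'\<in>cell_halves n l. sgl (circ n S' T) (\<Sum>d\<in>keys x. lkp x d * coef n l d S' S))) \<subseteq> low n l"
proof -
  let ?c = "circ n S T"
  have "red (pmul x (sgl ?c 1)) = (\<Sum>d\<in>keys x. scal (lkp x d) (val (stack d ?c)))"
    unfolding pmul_lin lin_def[of _ x] lin_sum lin_scal by simp
  moreover have "(\<Sum>S'\<in>cell_halves n l. sgl (circ n S' T) (\<Sum>d\<in>keys x. lkp x d * coef n l d S' S))
     = (\<Sum>d\<in>keys x. scal (lkp x d) (\<Sum>S'\<in>cell_halves n l. sgl (circ n S' T) (coef n l d S' S)))"
    unfolding scal_sum scal_simps single_sum_right by (rule sum.swap)
  ultimately have eq: "red (pmul x (sgl ?c 1)) - (\<Sum>S'\<in>cell_halves n l. sgl (circ n S' T) (\<Sum>d\<in>keys x. lkp x d * coef n l d S' S))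
     = (\<Sum>d\<in>keys x. scal (lkp x d) (val (stack d ?c) - (\<Sum>S'\<in>cell_halves n l. sgl (circ n S' T) (coef n l d S' S))))"
    by (simp add: sum_subtractf scal_minus)
  have "keys (\<Sum>d\<in>I. scal (lkp x d) (val (stack d ?c) - (\<Sum>S'\<in>cell_halves n l. sgl (circ n S' T) (coef n l d S' S)))) \<subseteq> low n l"
    if "finite I" "I \<subseteq> type_II n" for I
    using that
  proof (induction I rule: finite_induct)
    case (insert d I)
    have "keys (scal (lkp x d) (val (stack d ?c) - (\<Sum>S'\<in>cell_halves n l. sgl (circ n S' T) (coef n l d S' S)))) \<subseteq> low n l"
      using val_stack_coef[OF _ l S T, of d] keys_scal insert.prems by blast
    moreover have "keys (\<Sum>d\<in>I. scal (lkp x d) (val (stack d ?c) - (\<Sum>S'\<in>cell_halves n l. sgl (circ n S' T) (coef n l d S' S)))) \<subseteq> low n l"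
      using insert by simp
    ultimately show ?case unfolding sum.insert[OF insert(1,2)] by (rule keys_add_subset)
  qed simp
  then show ?thesis unfolding eq using x by simp
qed

lemma cellular: "cellular_algebra Z\<delta> (DTL_hat n) (cell_labels n) (cell_order n) (cell_halves n) (cell_map n) (inversion n)"
proof -
  have "cellular_algebra_axioms Z\<delta> (DTL_hat n) (cell_labels n) (cell_order n) (cell_halves n) (cell_map n) (inversion n)"
  proof
    show "partial_order_on (cell_labels n) (cell_order n)" by (rule poset_cell_order)
    show "finite (cell_halves n l)" for l by (rule finite_cell_halves)
    show "inj_on (\<lambda>(l, S, T). cell_map n l S T) (SIGMA l:cell_labels n. cell_halves n l \<times> cell_halves n l)" by (rule cell_inj)
    show "module_basis Z\<delta> (DTL_hat n) ((\<lambda>(l, S, T). cell_map n l S T) ` (SIGMA l:cell_labels n. cell_halves n l \<times> cell_halves n l))"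
      unfolding cell_image by (rule basis)
    show "linear_endo Z\<delta> (DTL_hat n) (inversion n)" by (rule inversion_linear)
    show "inversion n (inversion n y) = y" if y: "y \<in> carrier (DTL_hat n)" for y
    proof -
      obtain x where x: "x \<in> vs" "y = ps x" using y unfolding car by blast
      then show ?thesis using inversion_ps[OF x(1)] inversion_ps[OF flp_vs[OF x(1)]] flp_flp by simp
    qed
    show "inversion n (y \<otimes>\<^bsub>DTL_hat n\<^esub> z) = inversion n z \<otimes>\<^bsub>DTL_hat n\<^esub> inversion n y"
      if yz: "y \<in> carrier (DTL_hat n)" "z \<in> carrier (DTL_hat n)" for y z
    proof -
      obtain x w where x: "x \<in> vs" "y = ps x" and w: "w \<in> vs" "z = ps w" using yz unfolding car by blast
      have k: "keys (pmul x w) \<subseteq> diagrams n"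
        by (rule keys_pmul[OF vs_diagrams[OF x(1)] vs_diagrams[OF w(1)] diagrams_stack])
      have "inversion n (y \<otimes>\<^bsub>DTL_hat n\<^esub> z) = ps (flp (red (pmul x w)))"
        using ops(2)[OF x(1) w(1)] inversion_ps[OF red_vs[OF x(1) w(1)]] x w by simp
      also have "\<dots> = ps (red (pmul (flp w) (flp x)))"
        using flp_red[OF k] flp_pmul[OF vs_diagrams[OF x(1)] vs_diagrams[OF w(1)]] by simp
      also have "\<dots> = inversion n z \<otimes>\<^bsub>DTL_hat n\<^esub> inversion n y"
        using ops(2)[OF flp_vs[OF w(1)] flp_vs[OF x(1)]] inversion_ps[OF x(1)] inversion_ps[OF w(1)] x w by simp
      finally show ?thesis .
    qed
    show "inversion n (cell_map n l S T) = cell_map n l T S"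
      if "l \<in> cell_labels n" "S \<in> cell_halves n l" "T \<in> cell_halves n l" for l S T
      using inversion_ps[of "sgl (circ n S T) 1"] circ_cell(1)[OF that] circ_flip[OF that] by (simp add: cell_map_ps)
    fix l a assume l: "l \<in> cell_labels n" and "a \<in> carrier (DTL_hat n)"
    then obtain x where x: "x \<in> vs" "a = ps x" unfolding car by blast
    \<comment> \<open>No lower half occurs here, because \<open>coef\<close> does not mention one;
      this is the required independence.\<close>
    define r where "r S' S = (\<Sum>d\<in>keys x. lkp x d * coef n l d S' S)" for S' S
    show "\<exists>r\<in>cell_halves n l \<rightarrow> cell_halves n l \<rightarrow> carrier Z\<delta>. \<forall>S\<in>cell_halves n l. \<forall>T\<in>cell_halves n l.
      a \<otimes>\<^bsub>DTL_hat n\<^esub> cell_map n l S T \<ominus>\<^bsub>DTL_hat n\<^esub>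
        (\<Oplus>\<^bsub>DTL_hat n\<^esub>S'\<in>cell_halves n l. r S' S \<odot>\<^bsub>DTL_hat n\<^esub> cell_map n l S' T)
      \<in> gen_submodule Z\<delta> (DTL_hat n) {cell_map n k S'' T'' | k S'' T''. k \<in> cell_labels n \<and> (k, l) \<in> cell_order n \<and> k \<noteq> l
          \<and> S'' \<in> cell_halves n k \<and> T'' \<in> cell_halves n k}"
    proof (intro bexI[of _ r] ballI)
      show "r \<in> cell_halves n l \<rightarrow> cell_halves n l \<rightarrow> carrier Z\<delta>" by (simp add: Zd_sel)
      fix S T assume S: "S \<in> cell_halves n l" and T: "T \<in> cell_halves n l"
      have v: "sgl (circ n S' T) c \<in> vs" if "S' \<in> cell_halves n l" for S' c using circ_cell(1)[OF l that T] by simp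
      have "(\<Oplus>\<^bsub>DTL_hat n\<^esub>S'\<in>cell_halves n l. r S' S \<odot>\<^bsub>DTL_hat n\<^esub> cell_map n l S' T)
         = (\<Oplus>\<^bsub>DTL_hat n\<^esub>S'\<in>cell_halves n l. ps (sgl (circ n S' T) (r S' S)))"
      proof (rule A.finsum_cong')
        show "(\<lambda>S'. ps (sgl (circ n S' T) (r S' S))) \<in> cell_halves n l \<rightarrow> carrier (DTL_hat n)" using v ps_carrier by blast
        show "r S' S \<odot>\<^bsub>DTL_hat n\<^esub> cell_map n l S' T = ps (sgl (circ n S' T) (r S' S))" if "S' \<in> cell_halves n l" for S'
          using ops(3)[OF v[OF that, of 1] v[OF that, of 1], of "r S' S"] by (simp add: cell_map_ps)
      qed simp
      also have "\<dots> = ps (\<Sum>S'\<in>cell_halves n l. sgl (circ n S' T) (r S' S))" by (rule ps_finsum[OF finite_cell_halves v])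
      finally have sum: "(\<Oplus>\<^bsub>DTL_hat n\<^esub>S'\<in>cell_halves n l. r S' S \<odot>\<^bsub>DTL_hat n\<^esub> cell_map n l S' T)
         = ps (\<Sum>S'\<in>cell_halves n l. sgl (circ n S' T) (r S' S))" .
      have prod: "a \<otimes>\<^bsub>DTL_hat n\<^esub> cell_map n l S T = ps (red (pmul x (sgl (circ n S T) 1)))"
        unfolding x(2) cell_map_ps by (rule ops(2)[OF x(1) v[OF S], symmetric])
      have wv: "(\<Sum>S'\<in>cell_halves n l. sgl (circ n S' T) (r S' S)) \<in> vs" by (rule vs_sum) (rule v)
      have lowII: "low n l \<subseteq> type_II n" by (auto simp: low_def)
      show "a \<otimes>\<^bsub>DTL_hat n\<^esub> cell_map n l S T \<ominus>\<^bsub>DTL_hat n\<^esub>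
          (\<Oplus>\<^bsub>DTL_hat n\<^esub>S'\<in>cell_halves n l. r S' S \<odot>\<^bsub>DTL_hat n\<^esub> cell_map n l S' T)
        \<in> gen_submodule Z\<delta> (DTL_hat n) {cell_map n k S'' T'' | k S'' T''. k \<in> cell_labels n \<and> (k, l) \<in> cell_order n \<and> k \<noteq> l
          \<and> S'' \<in> cell_halves n k \<and> T'' \<in> cell_halves n k}"
        unfolding lower_cells[OF l] gen_submodule_ps[OF lowII] sum prod
          ps_minus[OF red_vs[OF x(1) v[OF S, of 1]] wv]
        using left_mult_coef[OF l x(1) S T] unfolding r_def by blast
    qed
  qed
  then show ?thesis unfolding cellular_algebra_def using A.unital_algebra_axioms by blast
qed

end

theorem theorem3p3p7:
  fixes n :: nat
  assumes "n \<ge> 4"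
  shows "cellular_algebra Z\<delta> (DTL_hat n) (cell_labels n) (cell_order n)
    (cell_halves n) (cell_map n) (inversion n)"
  using assms by (intro cellular) simp

end
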